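(* Let $(v,\xi)\in\mathbb{X}\times L^\infty(0,T)$ be an energy-variational solution (for data $v_0\in L^2_\sigma(\Omega)$, $f\in\mathbb{Z}$). Let $s<t$ in $(0,T)$ and assume that $\xi(\tau)=0$ for a.e. $\tau\in(s,t)$. Then $$\frac12\|v\|_{L^2(\Omega)}^2\Big|_q^r+\int_q^r\big(\nu\|\nabla v\|_{L^2(\Omega)}^2-\langle f,v\rangle\big)\,d\tau\le0\quad\text{for a.e. }q<r\in(s,t)$$ and $$\int_s^t\Big(\nu(\nabla v,\nabla\tilde v)-(v\otimes v;\nabla\tilde v)-(v,\partial_t\tilde v)-\langle f,\tilde v\rangle\Big)\,d\tau=0$$ for all $\tilde v\in\mathcal{C}^1_c((s,t);\mathcal{C}^\infty_{c,\sigma}(\Omega;\mathbb{R}^d))$.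
   Context: Setting. $\Omega\subset\mathbb{R}^d$, $d\ge2$, is a bounded Lipschitz domain, $T>0$, $\nu\ge0$. The equations are $\partial_t v+\nabla\cdot(v\otimes v)-\nu\Delta v+\nabla p=f$, $\nabla\cdot v=0$ in $\Omega\times(0,T)$, $v(0)=v_0$ in $\Omega$, with $v=0$ on $\partial\Omega$ if $\nu>0$ (Navier–Stokes) and $n\cdot v=0$ on $\partial\Omega$ if $\nu=0$ (Euler). Spaces. $\mathcal{C}^\infty_{c,\sigma}(\Omega;\mathbb{R}^d)$ is the space of smooth divergence-free compactly supported vector fields; $L^2_\sigma(\Omega)$ and $H^1_{0,\sigma}(\Omega)$ are its closures in $L^2(\Omega)$ and $H^1(\Omega)$. $(\cdot,\cdot)$ (also written $(\cdot;\cdot)$) is the $L^2(\Omega)$ inner product, $\langle\cdot,\cdot\rangle$ a duality pairing, $A_{\mathrm{sym}}=\frac12(A+A^T)$. For $\nu>0$: $\mathbb{X}=L^\infty(0,T;L^2_\sigma(\Omega))\cap L^2(0,T;H^1_{0,\sigma}(\Omega))$, $\mathbb{Y}=\mathbb{X}\cap L^2(0,T;H^2(\Omega))\cap L^1(0,T;W^{1,\infty}(\Omega))\cap H^1(0,T;(L^2_\sigma(\Omega))^* )$, $\mathbb{Z}=L^2(0,T;H^{-1}(\Omega))\oplus L^1(0,T;L^2(\Omega))$. For $\nu=0$: $\mathbb{X}=L^\infty(0,T;L^2_\sigma(\Omega))$, $\mathbb{Y}=\mathbb{X}\cap L^1(0,T;W^{1,\infty}(\Omega))\cap H^1(0,T;(L^2_\sigma(\Omega))^*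 )$, $\mathbb{Z}=L^1(0,T;L^2(\Omega))$. Terms with a factor $\nu$ are absent when $\nu=0$. Relative energy and system operator. $\mathcal{R}(v|\tilde v)=\frac12\|v-\tilde v\|_{L^2(\Omega)}^2$ and $\langle\mathcal{A}_\nu(\tilde v),\cdot\rangle=\langle\partial_t\tilde v+(\tilde v\cdot\nabla)\tilde v-\nu\Delta\tilde v-f,\cdot\rangle$ (understood weakly, at least in space). Admissible forms. Let $\mathcal{K}:L^2_\sigma(\Omega)\to[0,\infty]$ with domain $\mathcal{D}(\mathcal{K})=\{\tilde v\in\mathbb{X}:\mathcal{K}(\tilde v)\in L^1(0,T),\ \mathcal{K}(\tilde v)\ge0\}$. It is assumed that there is a fine enough topology on $\mathcal{D}(\mathcal{K})$ such that $\mathcal{K}$ is continuous (as a map into $L^1(0,T)$) and $\mathcal{C}^1([0,T];\mathcal{C}^\infty_{c,\sigma}(\Omega;\mathbb{R}^d))$ is dense in $\mathcal{D}(\mathcal{K})$, and that $\mathcal{K}(0)=0$. The relative form is for $\nu>0$: $\mathcal{W}_\nu(v|\tilde v)=\nu\|\nabla v-\nabla\tilde v\|_{L^2(\Omega)}^2-\int_\Omega((v-\tilde v)\cdot\nabla)(v-\tilde v)\cdot\tilde v\,dx+\mathcal{K}(\tilde v)\mathcal{R}(v|\tilde v)$; for $\nu=0$: $\mathcal{W}_0(v|\tilde v)=\int_\Omega(v-\tilde v)^T(\nabla\tilde v)_{\mathrm{sym}}(v-\tilde v)\,dx+\mathcal{K}(\tilde v)\mathcal{R}(v|\tilde v)$.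 $\mathcal{K}$ is called admissible if $\mathcal{W}_\nu(v|\tilde v)\ge0$ (as an $L^1(0,T)$ function) for all $v\in\mathbb{X}$ and all $\tilde v\in\mathbb{Y}\cap\mathcal{D}(\mathcal{K})$. Energy-variational solution (for data $v_0\in L^2_\sigma(\Omega)$, $f\in\mathbb{Z}$). A pair $(v,\xi)\in\mathbb{X}\times L^\infty(0,T)$ with $\xi(t)\ge0$ for all $t\in(0,T)$ such that for all admissible $\mathcal{K}$ the relative energy inequality $$\mathcal{R}(v(t+)|\tilde v(t))+\xi(t+)+\int_s^t\Big(\mathcal{W}_\nu(v|\tilde v)+\langle\mathcal{A}_\nu(\tilde v),v-\tilde v\rangle-\mathcal{K}(\tilde v)\big(\mathcal{R}(v|\tilde v)+\xi\big)\Big)d\tau\le\mathcal{R}(v(s-)|\tilde v(s))+\xi(s-)$$ holds for all $s\le t$ in $[0,T]$ and all $\tilde v\in\mathbb{Y}\cap\mathcal{D}(\mathcal{K})$, and the initial value $v(0)=v_0$ is attained in the weak sense. Here $\pm$ denotes right/left limits in time (one-sided limits at the end points). *)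

theory Defs
  imports "HOL-Analysis.Analysis"
begin

text \<open>
  Elements of function spaces over \<open>\<Omega>\<close> are represented by functions on all of \<open>real ^ 'n\<close>, and
  elements of Bochner spaces over \<open>(0,T)\<close> by functions on all of \<open>real\<close>; only their restrictions
  to \<open>\<Omega>\<close> and \<open>(0,T)\<close> matter, up to null sets.  The norms below are therefore seminorms on the
  representatives.
\<close>


section \<open>Domains and smooth functions\<close>

text \<open>Near each boundary point the set is, in suitable Cartesian coordinates with
  last axis \<open>e\<close>, the part of a ball above the graph of a Lipschitz function \<open>\<gamma>\<close> of the coordinates
  orthogonal to \<open>e\<close>.\<close>

definition bounded_lipschitz_domain :: "(real ^ 'n) set \<Rightarrow> bool" where
  "bounded_lipschitz_domain \<Omega> \<longleftrightarrow>
     open \<Omega> \<and> connected \<Omega> \<and> \<Omega> \<noteq> {} \<and> bounded \<Omega> \<and>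
     (\<forall>x\<in>frontier \<Omega>. \<exists>e r L \<gamma>. norm e = 1 \<and> r > 0 \<and> L-lipschitz_on {z. z \<bullet> e = 0} \<gamma> \<and>
        \<Omega> \<inter> ball x r = {y \<in> ball x r. (\<gamma> (y - (y \<bullet> e) *\<^sub>R e) :: real) < y \<bullet> e})"

definition partial_deriv :: "'n \<Rightarrow> (real ^ 'n \<Rightarrow> 'b::real_normed_vector) \<Rightarrow> real ^ 'n \<Rightarrow> 'b" where
  "partial_deriv j \<phi> x = frechet_derivative \<phi> (at x) (axis j 1)"

primrec iter_partial ::
  "'n list \<Rightarrow> (real ^ 'n \<Rightarrow> 'b::real_normed_vector) \<Rightarrow> real ^ 'n \<Rightarrow> 'b" where
  "iter_partial [] \<phi> = \<phi>"
| "iter_partial (j # js) \<phi> = partial_deriv j (iter_partial js \<phi>)"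

definition smooth_fun :: "(real ^ 'n \<Rightarrow> 'b::real_normed_vector) \<Rightarrow> bool" where
  "smooth_fun \<phi> \<longleftrightarrow> (\<forall>js x. iter_partial js \<phi> differentiable (at x))"

definition Cc_inf :: "(real ^ 'n) set \<Rightarrow> (real ^ 'n \<Rightarrow> 'b::real_normed_vector) set" where
  "Cc_inf \<Omega> = {\<phi>. smooth_fun \<phi> \<and> compact (closure {x. \<phi> x \<noteq> 0}) \<and> closure {x. \<phi> x \<noteq> 0} \<subseteq> \<Omega>}"

definition Cc_inf_sigma :: "(real ^ 'n) set \<Rightarrow> (real ^ 'n \<Rightarrow> real ^ 'n) set" where
  "Cc_inf_sigma \<Omega> = {\<phi> \<in> Cc_inf \<Omega>. \<forall>x. (\<Sum>j\<in>UNIV. partial_deriv j \<phi> x $ j) = 0}"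

text \<open>Row \<open>i\<close> of the gradient matrix is the gradient of the \<open>i\<close>-th component.\<close>

definition grad :: "(real ^ 'n \<Rightarrow> real ^ 'n) \<Rightarrow> real ^ 'n \<Rightarrow> real ^ 'n ^ 'n" where
  "grad \<phi> x = (\<chi> i j. partial_deriv j \<phi> x $ i)"

text \<open>Continuously differentiable curves in \<^term>\<open>Cc_inf_sigma \<Omega>\<close> with its usual (inductive limit)
  topology: the supports lie in one compact subset of \<open>\<Omega>\<close>, and \<open>\<phi>\<close> has a continuous derivative
  \<open>\<phi>'\<close>, where convergence means uniform convergence of all space derivatives.\<close>

definition C1_Cc_inf_sigma ::
  "real set \<Rightarrow> (real ^ 'n) set \<Rightarrow> (real \<Rightarrow> real ^ 'n \<Rightarrow> real ^ 'n) set" where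
  "C1_Cc_inf_sigma I \<Omega> = {\<phi>. \<exists>\<phi>' C. compact C \<and> C \<subseteq> \<Omega> \<and>
     (\<forall>t\<in>I. \<phi> t \<in> Cc_inf_sigma \<Omega> \<and> \<phi>' t \<in> Cc_inf_sigma \<Omega> \<and> (\<forall>x. x \<notin> C \<longrightarrow> \<phi> t x = 0 \<and> \<phi>' t x = 0)) \<and>
     (\<forall>t\<in>I. \<forall>js.
        uniform_limit UNIV (\<lambda>\<tau>. iter_partial js (\<lambda>x. (1 / (\<tau> - t)) *\<^sub>R (\<phi> \<tau> x - \<phi> t x)))
          (iter_partial js (\<phi>' t)) (at t within I) \<and>
        uniform_limit UNIV (\<lambda>\<tau>. iter_partial js (\<phi>' \<tau>)) (iter_partial js (\<phi>' t)) (at t within I))}"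

definition C1c_Cc_inf_sigma ::
  "real \<Rightarrow> real \<Rightarrow> (real ^ 'n) set \<Rightarrow> (real \<Rightarrow> real ^ 'n \<Rightarrow> real ^ 'n) set" where
  "C1c_Cc_inf_sigma s t \<Omega> = {\<phi> \<in> C1_Cc_inf_sigma {s<..<t} \<Omega>.
     \<exists>a b. s < a \<and> b < t \<and> (\<forall>\<tau>\<in>{s<..<t} - {a..b}. \<phi> \<tau> = (\<lambda>x. 0))}"

definition time_deriv :: "(real \<Rightarrow> real ^ 'n \<Rightarrow> real ^ 'n) \<Rightarrow> real \<Rightarrow> real ^ 'n \<Rightarrow> real ^ 'n" where
  "time_deriv \<phi> \<tau> x = vector_derivative (\<lambda>\<sigma>. \<phi> \<sigma> x) (at \<tau>)"


section \<open>Lebesgue and Sobolev spaces in space\<close>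

definition L2 :: "(real ^ 'n) set \<Rightarrow> (real ^ 'n \<Rightarrow> 'b::euclidean_space) set" where
  "L2 \<Omega> = {u. u \<in> borel_measurable (lebesgue_on \<Omega>) \<and>
              integrable (lebesgue_on \<Omega>) (\<lambda>x. (norm (u x))\<^sup>2)}"

definition L2_inner ::
  "(real ^ 'n) set \<Rightarrow> (real ^ 'n \<Rightarrow> 'b::euclidean_space) \<Rightarrow> (real ^ 'n \<Rightarrow> 'b) \<Rightarrow> real" where
  "L2_inner \<Omega> u w = (LINT x|lebesgue_on \<Omega>. u x \<bullet> w x)"

definition L2_norm :: "(real ^ 'n) set \<Rightarrow> (real ^ 'n \<Rightarrow> 'b::euclidean_space) \<Rightarrow> real" where
  "L2_norm \<Omega> u = sqrt (LINT x|lebesgue_on \<Omega>. (norm (u x))\<^sup>2)"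

definition Linf :: "(real ^ 'n) set \<Rightarrow> (real ^ 'n \<Rightarrow> 'b::euclidean_space) set" where
  "Linf \<Omega> = {u. u \<in> borel_measurable (lebesgue_on \<Omega>) \<and>
                (\<exists>C. AE x in lebesgue_on \<Omega>. norm (u x) \<le> C)}"

definition Linf_norm :: "(real ^ 'n) set \<Rightarrow> (real ^ 'n \<Rightarrow> 'b::euclidean_space) \<Rightarrow> real" where
  "Linf_norm \<Omega> u = Inf {C. 0 \<le> C \<and> (AE x in lebesgue_on \<Omega>. norm (u x) \<le> C)}"

definition loc_integrable :: "(real ^ 'n) set \<Rightarrow> (real ^ 'n \<Rightarrow> 'b::euclidean_space) \<Rightarrow> bool" where
  "loc_integrable \<Omega> u \<longleftrightarrow> (\<forall>C. compact C \<and> C \<subseteq> \<Omega> \<longrightarrow> integrable (lebesgue_on C) u)"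

definition weak_partial ::
  "(real ^ 'n) set \<Rightarrow> 'n \<Rightarrow> (real ^ 'n \<Rightarrow> 'b::euclidean_space) \<Rightarrow> (real ^ 'n \<Rightarrow> 'b) \<Rightarrow> bool" where
  "weak_partial \<Omega> j u g \<longleftrightarrow> loc_integrable \<Omega> u \<and> loc_integrable \<Omega> g \<and>
     (\<forall>\<phi>\<in>Cc_inf \<Omega>. (LINT x|lebesgue_on \<Omega>. (partial_deriv j \<phi> x :: real) *\<^sub>R u x) =
                   - (LINT x|lebesgue_on \<Omega>. \<phi> x *\<^sub>R g x))"

text \<open>A representative of the weak derivative, which is unique almost everywhere in \<open>\<Omega>\<close>.\<close>

definition wpartial ::
  "(real ^ 'n) set \<Rightarrow> 'n \<Rightarrow> (real ^ 'n \<Rightarrow> 'b::euclidean_space) \<Rightarrow> real ^ 'n \<Rightarrow> 'b" where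
  "wpartial \<Omega> j u = (SOME g. weak_partial \<Omega> j u g)"

definition wgrad ::
  "(real ^ 'n) set \<Rightarrow> (real ^ 'n \<Rightarrow> real ^ 'n) \<Rightarrow> real ^ 'n \<Rightarrow> real ^ 'n ^ 'n" where
  "wgrad \<Omega> u x = (\<chi> i j. wpartial \<Omega> j u x $ i)"

definition H1 :: "(real ^ 'n) set \<Rightarrow> (real ^ 'n \<Rightarrow> 'b::euclidean_space) set" where
  "H1 \<Omega> = {u \<in> L2 \<Omega>. \<forall>j. \<exists>g\<in>L2 \<Omega>. weak_partial \<Omega> j u g}"

definition H1_norm :: "(real ^ 'n) set \<Rightarrow> (real ^ 'n \<Rightarrow> 'b::euclidean_space) \<Rightarrow> real" where
  "H1_norm \<Omega> u = sqrt ((L2_norm \<Omega> u)\<^sup>2 + (\<Sum>j\<in>UNIV. (L2_norm \<Omega> (wpartial \<Omega> j u))\<^sup>2))"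

definition H2 :: "(real ^ 'n) set \<Rightarrow> (real ^ 'n \<Rightarrow> 'b::euclidean_space) set" where
  "H2 \<Omega> = {u \<in> H1 \<Omega>. \<forall>j. wpartial \<Omega> j u \<in> H1 \<Omega>}"

definition H2_norm :: "(real ^ 'n) set \<Rightarrow> (real ^ 'n \<Rightarrow> 'b::euclidean_space) \<Rightarrow> real" where
  "H2_norm \<Omega> u = sqrt ((L2_norm \<Omega> u)\<^sup>2 + (\<Sum>j\<in>UNIV. (H1_norm \<Omega> (wpartial \<Omega> j u))\<^sup>2))"

definition W1inf :: "(real ^ 'n) set \<Rightarrow> (real ^ 'n \<Rightarrow> 'b::euclidean_space) set" where
  "W1inf \<Omega> = {u \<in> Linf \<Omega>. \<forall>j. \<exists>g\<in>Linf \<Omega>. weak_partial \<Omega> j u g}"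

definition W1inf_norm :: "(real ^ 'n) set \<Rightarrow> (real ^ 'n \<Rightarrow> 'b::euclidean_space) \<Rightarrow> real" where
  "W1inf_norm \<Omega> u = Linf_norm \<Omega> u + (\<Sum>j\<in>UNIV. Linf_norm \<Omega> (wpartial \<Omega> j u))"

text \<open>Closure of a set \<open>A\<close> in the space \<open>X\<close> of functions with (semi)norm \<open>N\<close>.\<close>

definition closure_in ::
  "('p \<Rightarrow> 'b::real_normed_vector) set \<Rightarrow> (('p \<Rightarrow> 'b) \<Rightarrow> real) \<Rightarrow> ('p \<Rightarrow> 'b) set \<Rightarrow> ('p \<Rightarrow> 'b) set" where
  "closure_in X N A = {u \<in> X. \<forall>\<epsilon>>0. \<exists>\<phi>\<in>A. N (\<lambda>x. u x - \<phi> x) < \<epsilon>}"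

definition L2_sigma :: "(real ^ 'n) set \<Rightarrow> (real ^ 'n \<Rightarrow> real ^ 'n) set" where
  "L2_sigma \<Omega> = closure_in (L2 \<Omega>) (L2_norm \<Omega>) (Cc_inf_sigma \<Omega>)"

definition H10_sigma :: "(real ^ 'n) set \<Rightarrow> (real ^ 'n \<Rightarrow> real ^ 'n) set" where
  "H10_sigma \<Omega> = closure_in (H1 \<Omega>) (H1_norm \<Omega>) (Cc_inf_sigma \<Omega>)"

definition H10 :: "(real ^ 'n) set \<Rightarrow> (real ^ 'n \<Rightarrow> real ^ 'n) set" where
  "H10 \<Omega> = closure_in (H1 \<Omega>) (H1_norm \<Omega>) (Cc_inf \<Omega>)"

text \<open>Bounded linear functionals on the space \<open>X\<close> with (semi)norm \<open>N\<close>; their values outside \<open>X\<close>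
  are irrelevant.\<close>

definition dual ::
  "('p \<Rightarrow> 'b::real_normed_vector) set \<Rightarrow> (('p \<Rightarrow> 'b) \<Rightarrow> real) \<Rightarrow> (('p \<Rightarrow> 'b) \<Rightarrow> real) set" where
  "dual X N = {F. (\<forall>u\<in>X. \<forall>w\<in>X. F (\<lambda>x. u x + w x) = F u + F w) \<and>
                  (\<forall>c. \<forall>u\<in>X. F (\<lambda>x. c *\<^sub>R u x) = c * F u) \<and>
                  (\<exists>C. \<forall>u\<in>X. \<bar>F u\<bar> \<le> C * N u)}"

definition dual_norm ::
  "('p \<Rightarrow> 'b::real_normed_vector) set \<Rightarrow> (('p \<Rightarrow> 'b) \<Rightarrow> real) \<Rightarrow> (('p \<Rightarrow> 'b) \<Rightarrow> real) \<Rightarrow> real" where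
  "dual_norm X N F = Sup {\<bar>F u\<bar> | u. u \<in> X \<and> N u \<le> 1}"


section \<open>Bochner spaces in time\<close>

text \<open>Strong measurability: almost everywhere limit of simple functions with values in \<open>X\<close>.\<close>

definition bochner_measurable ::
  "real \<Rightarrow> ('p \<Rightarrow> 'b::real_normed_vector) set \<Rightarrow> (('p \<Rightarrow> 'b) \<Rightarrow> real) \<Rightarrow> (real \<Rightarrow> 'p \<Rightarrow> 'b) \<Rightarrow> bool" where
  "bochner_measurable T X N u \<longleftrightarrow> (AE t in lebesgue_on {0<..<T}. u t \<in> X) \<and>
     (\<exists>s. (\<forall>k::nat. simple_function (lebesgue_on {0<..<T}) (s k) \<and> (\<forall>t\<in>{0<..<T}. s k t \<in> X)) \<and>
          (AE t in lebesgue_on {0<..<T}. (\<lambda>k. N (\<lambda>x. s k t x - u t x)) \<longlonglongrightarrow> 0))"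

definition Lp_time ::
  "nat \<Rightarrow> real \<Rightarrow> ('p \<Rightarrow> 'b::real_normed_vector) set \<Rightarrow> (('p \<Rightarrow> 'b) \<Rightarrow> real) \<Rightarrow> (real \<Rightarrow> 'p \<Rightarrow> 'b) set" where
  "Lp_time p T X N =
     {u. bochner_measurable T X N u \<and> integrable (lebesgue_on {0<..<T}) (\<lambda>t. N (u t) ^ p)}"

definition Linf_time ::
  "real \<Rightarrow> ('p \<Rightarrow> 'b::real_normed_vector) set \<Rightarrow> (('p \<Rightarrow> 'b) \<Rightarrow> real) \<Rightarrow> (real \<Rightarrow> 'p \<Rightarrow> 'b) set" where
  "Linf_time T X N =
     {u. bochner_measurable T X N u \<and> (\<exists>C. AE t in lebesgue_on {0<..<T}. N (u t) \<le> C)}"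

definition Linf_scalar :: "real \<Rightarrow> (real \<Rightarrow> real) set" where
  "Linf_scalar T = {\<xi>. \<xi> \<in> borel_measurable (lebesgue_on {0<..<T}) \<and>
                       (\<exists>C. AE t in lebesgue_on {0<..<T}. \<bar>\<xi> t\<bar> \<le> C)}"

definition test_time :: "real \<Rightarrow> (real \<Rightarrow> real) set" where
  "test_time T = {\<psi>. (\<forall>k t. (deriv ^^ k) \<psi> differentiable (at t)) \<and>
     compact (closure {t. \<psi> t \<noteq> 0}) \<and> closure {t. \<psi> t \<noteq> 0} \<subseteq> {0<..<T}}"

text \<open>\<open>G\<close> is the weak time derivative of \<open>U\<close>, both with values in the dual of \<open>X\<close>; the identity of
  the two Bochner integrals in the dual space is tested with each \<open>w \<in> X\<close>.\<close>

definition weak_time_deriv ::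
  "real \<Rightarrow> ('p \<Rightarrow> 'b::real_normed_vector) set \<Rightarrow>
     (real \<Rightarrow> ('p \<Rightarrow> 'b) \<Rightarrow> real) \<Rightarrow> (real \<Rightarrow> ('p \<Rightarrow> 'b) \<Rightarrow> real) \<Rightarrow> bool" where
  "weak_time_deriv T X U G \<longleftrightarrow> (\<forall>\<psi>\<in>test_time T. \<forall>w\<in>X.
     (LINT t|lebesgue_on {0<..<T}. deriv \<psi> t * U t w) = - (LINT t|lebesgue_on {0<..<T}. \<psi> t * G t w))"

definition H1_time_dual ::
  "real \<Rightarrow> ('p \<Rightarrow> 'b::real_normed_vector) set \<Rightarrow> (('p \<Rightarrow> 'b) \<Rightarrow> real) \<Rightarrow>
     (real \<Rightarrow> ('p \<Rightarrow> 'b) \<Rightarrow> real) set" where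
  "H1_time_dual T X N = {U \<in> Lp_time 2 T (dual X N) (dual_norm X N).
     \<exists>G \<in> Lp_time 2 T (dual X N) (dual_norm X N). weak_time_deriv T X U G}"

text \<open>The time derivative in \<open>L\<^sup>2(0,T;(L\<^sup>2\<^sub>\<sigma>)\<^sup>*)\<close>; a field \<open>u\<close> is identified with the functional
  \<^term>\<open>L2_inner \<Omega> u\<close>.\<close>

definition dt ::
  "real \<Rightarrow> (real ^ 'n) set \<Rightarrow> (real \<Rightarrow> real ^ 'n \<Rightarrow> real ^ 'n) \<Rightarrow> real \<Rightarrow> (real ^ 'n \<Rightarrow> real ^ 'n) \<Rightarrow> real" where
  "dt T \<Omega> u = (SOME G. G \<in> Lp_time 2 T (dual (L2_sigma \<Omega>) (L2_norm \<Omega>)) (dual_norm (L2_sigma \<Omega>) (L2_norm \<Omega>)) \<and>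
                       weak_time_deriv T (L2_sigma \<Omega>) (\<lambda>t. L2_inner \<Omega> (u t)) G)"


section \<open>The spaces of solutions, test functions and forces\<close>

definition XX :: "real \<Rightarrow> real \<Rightarrow> (real ^ 'n) set \<Rightarrow> (real \<Rightarrow> real ^ 'n \<Rightarrow> real ^ 'n) set" where
  "XX \<nu> T \<Omega> = (if \<nu> > 0
     then Linf_time T (L2_sigma \<Omega>) (L2_norm \<Omega>) \<inter> Lp_time 2 T (H10_sigma \<Omega>) (H1_norm \<Omega>)
     else Linf_time T (L2_sigma \<Omega>) (L2_norm \<Omega>))"

definition YY :: "real \<Rightarrow> real \<Rightarrow> (real ^ 'n) set \<Rightarrow> (real \<Rightarrow> real ^ 'n \<Rightarrow> real ^ 'n) set" where
  "YY \<nu> T \<Omega> = {u \<in> XX \<nu> T \<Omega>.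
     (\<nu> > 0 \<longrightarrow> u \<in> Lp_time 2 T (H2 \<Omega>) (H2_norm \<Omega>)) \<and>
     u \<in> Lp_time 1 T (W1inf \<Omega>) (W1inf_norm \<Omega>) \<and>
     (\<lambda>t. L2_inner \<Omega> (u t)) \<in> H1_time_dual T (L2_sigma \<Omega>) (L2_norm \<Omega>)}"

text \<open>Forces are functional-valued: \<open>f t w\<close> is the pairing of \<open>f(t)\<close> with \<open>w\<close>.  An \<open>L\<^sup>2\<close> force
  \<open>g(t)\<close> acts by \<^term>\<open>L2_inner \<Omega> (g t)\<close>.\<close>

definition ZZ :: "real \<Rightarrow> real \<Rightarrow> (real ^ 'n) set \<Rightarrow> (real \<Rightarrow> (real ^ 'n \<Rightarrow> real ^ 'n) \<Rightarrow> real) set" where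
  "ZZ \<nu> T \<Omega> = (if \<nu> > 0
     then {f. \<exists>h \<in> Lp_time 2 T (dual (H10 \<Omega>) (H1_norm \<Omega>)) (dual_norm (H10 \<Omega>) (H1_norm \<Omega>)).
              \<exists>g \<in> Lp_time 1 T (L2 \<Omega>) (L2_norm \<Omega>).
                AE t in lebesgue_on {0<..<T}. \<forall>w\<in>H10 \<Omega>. f t w = h t w + L2_inner \<Omega> (g t) w}
     else {f. \<exists>g \<in> Lp_time 1 T (L2 \<Omega>) (L2_norm \<Omega>).
                AE t in lebesgue_on {0<..<T}. \<forall>w\<in>L2 \<Omega>. f t w = L2_inner \<Omega> (g t) w})"


section \<open>Relative energy, system operator and admissible forms\<close>

definition rel_energy ::
  "(real ^ 'n) set \<Rightarrow> (real ^ 'n \<Rightarrow> real ^ 'n) \<Rightarrow> (real ^ 'n \<Rightarrow> real ^ 'n) \<Rightarrow> real" where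
  "rel_energy \<Omega> u w = 1 / 2 * (L2_norm \<Omega> (\<lambda>x. u x - w x))\<^sup>2"

text \<open>The convective term \<open>(u \<cdot> \<nabla>) w\<close>.\<close>

definition conv ::
  "(real ^ 'n) set \<Rightarrow> (real ^ 'n \<Rightarrow> real ^ 'n) \<Rightarrow> (real ^ 'n \<Rightarrow> real ^ 'n) \<Rightarrow> real ^ 'n \<Rightarrow> real ^ 'n" where
  "conv \<Omega> u w x = wgrad \<Omega> w x *v u x"

definition sym_part :: "real ^ 'n ^ 'n \<Rightarrow> real ^ 'n ^ 'n" where
  "sym_part A = (1 / 2) *\<^sub>R (A + transpose A)"

definition outer :: "real ^ 'n \<Rightarrow> real ^ 'n \<Rightarrow> real ^ 'n ^ 'n" where
  "outer a b = (\<chi> i j. a $ i * b $ j)"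

text \<open>The pairing of the system operator at \<open>vt\<close> and time \<open>t\<close> with the field \<open>w\<close>; the Laplacian is
  understood weakly in space.\<close>

definition system_op ::
  "real \<Rightarrow> real \<Rightarrow> (real ^ 'n) set \<Rightarrow> (real \<Rightarrow> (real ^ 'n \<Rightarrow> real ^ 'n) \<Rightarrow> real) \<Rightarrow>
     (real \<Rightarrow> real ^ 'n \<Rightarrow> real ^ 'n) \<Rightarrow> real \<Rightarrow> (real ^ 'n \<Rightarrow> real ^ 'n) \<Rightarrow> real" where
  "system_op \<nu> T \<Omega> f vt t w =
     dt T \<Omega> vt t w + L2_inner \<Omega> (conv \<Omega> (vt t) (vt t)) w
     + \<nu> * L2_inner \<Omega> (wgrad \<Omega> (vt t)) (wgrad \<Omega> w) - f t w"

definition DK ::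
  "real \<Rightarrow> real \<Rightarrow> (real ^ 'n) set \<Rightarrow> ((real ^ 'n \<Rightarrow> real ^ 'n) \<Rightarrow> ennreal) \<Rightarrow>
     (real \<Rightarrow> real ^ 'n \<Rightarrow> real ^ 'n) set" where
  "DK \<nu> T \<Omega> K = {u \<in> XX \<nu> T \<Omega>. (\<lambda>t. K (u t)) \<in> borel_measurable (lebesgue_on {0<..<T}) \<and>
                              (\<integral>\<^sup>+ t. K (u t) \<partial>lebesgue_on {0<..<T}) < \<infinity>}"

text \<open>Standing assumptions on \<open>K\<close>: it is a function on \<open>L\<^sup>2\<^sub>\<sigma>\<close> (independent of representatives),
  vanishes at zero, and its domain carries a topology for which \<open>K\<close> is continuous into \<open>L\<^sup>1(0,T)\<close>
  and the smooth fields are dense.\<close>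

definition weight_form ::
  "real \<Rightarrow> real \<Rightarrow> (real ^ 'n) set \<Rightarrow> ((real ^ 'n \<Rightarrow> real ^ 'n) \<Rightarrow> ennreal) \<Rightarrow> bool" where
  "weight_form \<nu> T \<Omega> K \<longleftrightarrow>
     (\<forall>u\<in>L2_sigma \<Omega>. \<forall>w\<in>L2_sigma \<Omega>. (AE x in lebesgue_on \<Omega>. u x = w x) \<longrightarrow> K u = K w) \<and>
     K (\<lambda>x. 0) = 0 \<and>
     (\<exists>\<O>. topspace \<O> = DK \<nu> T \<Omega> K \<and>
        (\<forall>u\<in>topspace \<O>. \<forall>\<epsilon>>0. \<exists>V. openin \<O> V \<and> u \<in> V \<and>
           (\<forall>w\<in>V. (LINT t|lebesgue_on {0<..<T}. \<bar>enn2real (K (w t)) - enn2real (K (u t))\<bar>) < \<epsilon>)) \<and>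
        C1_Cc_inf_sigma {0..T} \<Omega> \<subseteq> topspace \<O> \<and>
        \<O> closure_of C1_Cc_inf_sigma {0..T} \<Omega> = topspace \<O>)"

definition rel_form ::
  "real \<Rightarrow> (real ^ 'n) set \<Rightarrow> ((real ^ 'n \<Rightarrow> real ^ 'n) \<Rightarrow> ennreal) \<Rightarrow>
     (real ^ 'n \<Rightarrow> real ^ 'n) \<Rightarrow> (real ^ 'n \<Rightarrow> real ^ 'n) \<Rightarrow> real" where
  "rel_form \<nu> \<Omega> K u w = (if \<nu> > 0
     then \<nu> * (L2_norm \<Omega> (\<lambda>x. wgrad \<Omega> u x - wgrad \<Omega> w x))\<^sup>2
          - L2_inner \<Omega> (conv \<Omega> (\<lambda>x. u x - w x) (\<lambda>x. u x - w x)) w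
          + enn2real (K w) * rel_energy \<Omega> u w
     else L2_inner \<Omega> (\<lambda>x. u x - w x) (\<lambda>x. sym_part (wgrad \<Omega> w x) *v (u x - w x))
          + enn2real (K w) * rel_energy \<Omega> u w)"

definition admissible ::
  "real \<Rightarrow> real \<Rightarrow> (real ^ 'n) set \<Rightarrow> ((real ^ 'n \<Rightarrow> real ^ 'n) \<Rightarrow> ennreal) \<Rightarrow> bool" where
  "admissible \<nu> T \<Omega> K \<longleftrightarrow> weight_form \<nu> T \<Omega> K \<and>
     (\<forall>v\<in>XX \<nu> T \<Omega>. \<forall>vt\<in>YY \<nu> T \<Omega> \<inter> DK \<nu> T \<Omega> K.
        AE t in lebesgue_on {0<..<T}. 0 \<le> rel_form \<nu> \<Omega> K (v t) (vt t))"


section \<open>Energy-variational solutions\<close>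

text \<open>Since elements of Bochner spaces are determined only almost everywhere in time, one-sided
  limits are essential limits, i.e. they disregard a null set.  At the end points of \<open>[0,T]\<close> both
  are the limit from inside the interval.\<close>

definition ess_tendsto_on :: "real set \<Rightarrow> (real \<Rightarrow> real) \<Rightarrow> real \<Rightarrow> real \<Rightarrow> bool" where
  "ess_tendsto_on I g t l \<longleftrightarrow> (\<exists>N\<in>null_sets lebesgue. (g \<longlongrightarrow> l) (at t within (I - N)))"

definition right_lim :: "real \<Rightarrow> (real \<Rightarrow> real) \<Rightarrow> real \<Rightarrow> real \<Rightarrow> bool" where
  "right_lim T g t l \<longleftrightarrow> (if t < T then ess_tendsto_on {t<..<T} g t l else ess_tendsto_on {0<..<T} g T l)"

definition left_lim :: "real \<Rightarrow> (real \<Rightarrow> real) \<Rightarrow> real \<Rightarrow> real \<Rightarrow> bool" where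
  "left_lim T g t l \<longleftrightarrow> (if 0 < t then ess_tendsto_on {0<..<t} g t l else ess_tendsto_on {0<..<T} g 0 l)"

text \<open>One-sided limits of fields are taken in the weak topology of \<open>L\<^sup>2\<^sub>\<sigma>\<close>.\<close>

definition weak_right_lim ::
  "real \<Rightarrow> (real ^ 'n) set \<Rightarrow> (real \<Rightarrow> real ^ 'n \<Rightarrow> real ^ 'n) \<Rightarrow> real \<Rightarrow> (real ^ 'n \<Rightarrow> real ^ 'n) \<Rightarrow> bool" where
  "weak_right_lim T \<Omega> v t w \<longleftrightarrow> w \<in> L2_sigma \<Omega> \<and>
     (\<forall>\<phi>\<in>L2_sigma \<Omega>. right_lim T (\<lambda>\<tau>. L2_inner \<Omega> (v \<tau>) \<phi>) t (L2_inner \<Omega> w \<phi>))"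

definition weak_left_lim ::
  "real \<Rightarrow> (real ^ 'n) set \<Rightarrow> (real \<Rightarrow> real ^ 'n \<Rightarrow> real ^ 'n) \<Rightarrow> real \<Rightarrow> (real ^ 'n \<Rightarrow> real ^ 'n) \<Rightarrow> bool" where
  "weak_left_lim T \<Omega> v t w \<longleftrightarrow> w \<in> L2_sigma \<Omega> \<and>
     (\<forall>\<phi>\<in>L2_sigma \<Omega>. left_lim T (\<lambda>\<tau>. L2_inner \<Omega> (v \<tau>) \<phi>) t (L2_inner \<Omega> w \<phi>))"

definition L2_sigma_continuous ::
  "real \<Rightarrow> (real ^ 'n) set \<Rightarrow> (real \<Rightarrow> real ^ 'n \<Rightarrow> real ^ 'n) \<Rightarrow> bool" where
  "L2_sigma_continuous T \<Omega> u \<longleftrightarrow> (\<forall>t\<in>{0..T}. u t \<in> L2_sigma \<Omega> \<and>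
     ((\<lambda>\<tau>. L2_norm \<Omega> (\<lambda>x. u \<tau> x - u t x)) \<longlongrightarrow> 0) (at t within {0..T}))"

text \<open>Test functions in \<^term>\<open>YY \<nu> T \<Omega>\<close> have a representative that is continuous in time with values
  in \<open>L\<^sup>2\<^sub>\<sigma>\<close>.  The point values \<open>vt s\<close> and \<open>vt t\<close> refer to it, whence the restriction to continuous
  representatives; all other terms are independent of the representative.\<close>

definition energy_variational_solution ::
  "real \<Rightarrow> real \<Rightarrow> (real ^ 'n) set \<Rightarrow> (real ^ 'n \<Rightarrow> real ^ 'n) \<Rightarrow>
     (real \<Rightarrow> (real ^ 'n \<Rightarrow> real ^ 'n) \<Rightarrow> real) \<Rightarrow>
     (real \<Rightarrow> real ^ 'n \<Rightarrow> real ^ 'n) \<Rightarrow> (real \<Rightarrow> real) \<Rightarrow> bool" where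
  "energy_variational_solution \<nu> T \<Omega> v0 f v \<xi> \<longleftrightarrow>
     v \<in> XX \<nu> T \<Omega> \<and> \<xi> \<in> Linf_scalar T \<and> (\<forall>t\<in>{0<..<T}. 0 \<le> \<xi> t) \<and>
     (\<exists>vp vm \<xi>p \<xi>m.
        (\<forall>t\<in>{0..T}. weak_right_lim T \<Omega> v t (vp t) \<and> weak_left_lim T \<Omega> v t (vm t) \<and>
                    right_lim T \<xi> t (\<xi>p t) \<and> left_lim T \<xi> t (\<xi>m t)) \<and>
        (\<forall>K. admissible \<nu> T \<Omega> K \<longrightarrow>
          (\<forall>vt \<in> YY \<nu> T \<Omega> \<inter> DK \<nu> T \<Omega> K. L2_sigma_continuous T \<Omega> vt \<longrightarrow>
            (\<forall>s t. 0 \<le> s \<and> s \<le> t \<and> t \<le> T \<longrightarrow>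
               rel_energy \<Omega> (vp t) (vt t) + \<xi>p t
               + (LINT \<tau>|lebesgue_on {s..t}.
                    rel_form \<nu> \<Omega> K (v \<tau>) (vt \<tau>)
                    + system_op \<nu> T \<Omega> f vt \<tau> (\<lambda>x. v \<tau> x - vt \<tau> x)
                    - enn2real (K (vt \<tau>)) * (rel_energy \<Omega> (v \<tau>) (vt \<tau>) + \<xi> \<tau>))
               \<le> rel_energy \<Omega> (vm s) (vt s) + \<xi>m s)))) \<and>
     weak_right_lim T \<Omega> v 0 v0"

end

theory Submission
  imports Defs
begin

text \<open>
  Where the defect \<open>\<xi>\<close> vanishes, the weight \<open>K\<close> drops out of the relative energy inequality: it enters through
  \<open>K R\<close> in the relative form and through \<open>- K (R + \<xi>)\<close>.  The remaining integrand is, by integration by parts,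
  \<open>e + l(\<phi>) - (\<phi>', \<phi>)\<close> for a test field \<open>\<phi>\<close>.  Here \<open>e\<close> is the dissipation minus the power of the force, and
  \<open>l(\<phi>)\<close> is the residual of the weak formulation, which is linear in \<open>\<phi>\<close>; all other terms that are quadratic in \<open>\<phi>\<close>
  cancel because a solenoidal field does no work on the field that it transports (\<open>convective_antisym\<close>,
  \<open>integrand_identity\<close>, \<open>energy_integrand_AE\<close>).  The time integral of \<open>(\<phi>', \<phi>)\<close> is the change of the
  kinetic energy of \<open>\<phi>\<close>.  Both claims are now immediate.  For \<open>\<phi> = 0\<close> the inequality is the energy inequality
  (\<open>zero_defect_energy_inequality\<close>).  If \<open>\<phi>\<close> has compact support in time, then for all real \<open>\<alpha>\<close> the inequality
  for \<open>\<alpha> \<phi>\<close> reads \<open>E + \<alpha> L \<le> 0\<close> with the integral \<open>L\<close> of \<open>l(\<phi>)\<close>, hence \<open>L = 0\<close>, which is the weak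
  formulation (\<open>zero_defect_weak_solution\<close>).

  For this, one admissible weight is needed whose domain contains the multiples of the test curves.  The weight
  \<open>smooth_weight\<close> is twice the \<open>W\<^sup>1\<^sup>,\<^sup>\<infinity>\<close> norm on test fields and infinite elsewhere.  On test fields the
  relative form is a nonnegative viscous term plus the stretching term \<open>((z \<cdot> \<nabla>) \<phi>, z)\<close> plus \<open>K R\<close>, and the weight
  dominates the stretching term (\<open>rel_form_smooth\<close>, \<open>stretching_bound\<close>).  The topological conditions on a weight
  are met by pulling back the \<open>L\<^sup>1\<close> distance of the weights, as functions of time (\<open>weight_form_smooth_weight\<close>).

  Two further points are of a measure theoretic nature.  The time derivative of a test curve enters as a chosen weak
  derivative in a dual space; by the fundamental lemma in time and the essential separability of strongly
  measurable functions it is the classical one along every measurable field (\<open>weak_time_deriv_unique\<close>,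
  \<open>C1_curve_dt\<close>).  And the inequality controls one-sided weak limits of the solution; for almost every time
  their norm is that of the solution itself (\<open>one_sided_limits_AE\<close>, \<open>weak_limits_AE\<close>).
\<close>

section \<open>Smooth functions of several variables\<close>

lemma partial_deriv_eq:
  "(f has_derivative f') (at x) \<Longrightarrow> partial_deriv j f x = f' (axis j 1)"
  unfolding partial_deriv_def by (simp add: frechet_derivative_at[symmetric])

text \<open>Smoothness is a greatest fixed point: every class of differentiable functions that is
  closed under partial derivatives consists of smooth functions. The closure properties below come
  from a suitable choice of the class.\<close>

lemma smooth_fun_coinduct:
  assumes "P f"
    and diff: "\<And>f x. P f \<Longrightarrow> f differentiable (at x)"
    and step: "\<And>f j. P f \<Longrightarrow> P (partial_deriv j f)"
  shows "smooth_fun f"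
proof -
  have "P (iter_partial js f)" for js
    by (induct js) (auto intro: assms)
  then show ?thesis
    unfolding smooth_fun_def using diff by blast
qed

lemma iter_partial_snoc: "iter_partial (js @ [j]) f = iter_partial js (partial_deriv j f)"
  by (induct js) auto

lemma smooth_fun_differentiable: "smooth_fun f \<Longrightarrow> f differentiable (at x)"
  unfolding smooth_fun_def by (metis iter_partial.simps(1))

lemma smooth_fun_partial: "smooth_fun f \<Longrightarrow> smooth_fun (partial_deriv j f)"
  unfolding smooth_fun_def by (metis iter_partial_snoc)

lemma smooth_fun_iter_partial: "smooth_fun f \<Longrightarrow> smooth_fun (iter_partial js f)"
  by (induct js) (auto intro: smooth_fun_partial)

lemma smooth_fun_has_derivative:
  "smooth_fun f \<Longrightarrow> (f has_derivative frechet_derivative f (at x)) (at x)"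
  using frechet_derivative_works smooth_fun_differentiable by blast

lemma smooth_fun_continuous: "smooth_fun f \<Longrightarrow> continuous_on S f"
  by (meson differentiable_imp_continuous_within continuous_at_imp_continuous_on
      smooth_fun_differentiable)

lemma partial_deriv_bilinear:
  assumes "bounded_bilinear prd" "f differentiable (at x)" "g differentiable (at x)"
  shows "partial_deriv j (\<lambda>x. prd (f x) (g x)) x
         = prd (partial_deriv j f x) (g x) + prd (f x) (partial_deriv j g x)"
proof -
  have "((\<lambda>x. prd (f x) (g x)) has_derivative
      (\<lambda>h. prd (f x) (frechet_derivative g (at x) h) + prd (frechet_derivative f (at x) h) (g x))) (at x)"
    using assms by (intro bounded_bilinear.FDERIV) (auto simp: frechet_derivative_works[symmetric])
  from partial_deriv_eq[OF this] show ?thesis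
    by (simp add: partial_deriv_def add.commute)
qed

lemma partial_deriv_linear:
  assumes "bounded_linear L" "f differentiable (at x)"
  shows "partial_deriv j (\<lambda>x. L (f x)) x = L (partial_deriv j f x)"
proof -
  have "(f has_derivative frechet_derivative f (at x)) (at x)"
    using assms(2) by (simp add: frechet_derivative_works)
  from bounded_linear.has_derivative[OF assms(1) this]
  have "((\<lambda>x. L (f x)) has_derivative (\<lambda>h. L (frechet_derivative f (at x) h))) (at x)" .
  from partial_deriv_eq[OF this] show ?thesis
    by (simp add: partial_deriv_def)
qed

lemma partial_deriv_add:
  assumes "f differentiable (at x)" "g differentiable (at x)"
  shows "partial_deriv j (\<lambda>x. f x + g x) x = partial_deriv j f x + partial_deriv j g x"
proof -
  have "((\<lambda>x. f x + g x) has_derivative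
      (\<lambda>h. frechet_derivative f (at x) h + frechet_derivative g (at x) h)) (at x)"
    using assms by (intro has_derivative_add) (auto simp: frechet_derivative_works[symmetric])
  from partial_deriv_eq[OF this] show ?thesis
    by (simp add: partial_deriv_def)
qed

lemma smooth_fun_const [simp]: "smooth_fun (\<lambda>x. c)"
proof (rule smooth_fun_coinduct[where P="\<lambda>f. \<exists>c. f = (\<lambda>x. c)"])
  fix f :: "real ^ 'a \<Rightarrow> 'b" and j assume "\<exists>c. f = (\<lambda>x. c)"
  then obtain c where f: "f = (\<lambda>x. c)" by blast
  have "partial_deriv j f = (\<lambda>x. 0)"
    unfolding f by (rule ext) (simp add: partial_deriv_def)
  then show "\<exists>c. partial_deriv j f = (\<lambda>x. c)" by blast
qed auto

text \<open>Products of smooth functions are not closed under partial derivatives, but finite sums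
  of products are, by the Leibniz rule. This is the class for coinduction.\<close>

inductive bilinear_span ::
  "('a::real_normed_vector \<Rightarrow> 'b::real_normed_vector \<Rightarrow> 'c::real_normed_vector) \<Rightarrow> (real ^ 'n \<Rightarrow> 'c) \<Rightarrow> bool"
  for prd where
  prd: "smooth_fun f \<Longrightarrow> smooth_fun g \<Longrightarrow> bilinear_span prd (\<lambda>x. prd (f x) (g x))"
| add: "bilinear_span prd a \<Longrightarrow> bilinear_span prd b \<Longrightarrow> bilinear_span prd (\<lambda>x. a x + b x)"

lemma smooth_fun_bilinear_span:
  assumes bb: "bounded_bilinear prd" and "bilinear_span prd h"
  shows "smooth_fun h"
proof (rule smooth_fun_coinduct[where P="bilinear_span prd", OF assms(2)])
  fix h :: "real ^ 'd \<Rightarrow> 'c" and x assume "bilinear_span prd h"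
  then show "h differentiable (at x)"
  proof induct
    case (prd f g)
    then show ?case
      using bounded_bilinear.FDERIV[OF bb smooth_fun_has_derivative smooth_fun_has_derivative]
      by (auto simp: differentiable_def)
  qed auto
next
  fix h :: "real ^ 'd \<Rightarrow> 'c" and j assume "bilinear_span prd h"
  then have "(\<forall>x. h differentiable (at x)) \<and> bilinear_span prd (partial_deriv j h)"
  proof induct
    case (prd f g)
    have "partial_deriv j (\<lambda>x. prd (f x) (g x)) =
       (\<lambda>x. prd (partial_deriv j f x) (g x) + prd (f x) (partial_deriv j g x))"
      using prd by (auto simp: partial_deriv_bilinear[OF bb] smooth_fun_differentiable)
    moreover have "bilinear_span prd \<dots>"
      using prd by (intro bilinear_span.intros smooth_fun_partial)
    ultimately show ?case
      using prd bounded_bilinear.FDERIV[OF bb smooth_fun_has_derivative smooth_fun_has_derivative]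
      by (auto simp: differentiable_def)
  next
    case (add a b)
    then have "partial_deriv j (\<lambda>x. a x + b x) = (\<lambda>x. partial_deriv j a x + partial_deriv j b x)"
      by (auto simp: partial_deriv_add)
    then show ?case using add by (auto intro: bilinear_span.intros)
  qed
  then show "bilinear_span prd (partial_deriv j h)" by blast
qed

lemma smooth_fun_bilinear:
  "bounded_bilinear prd \<Longrightarrow> smooth_fun f \<Longrightarrow> smooth_fun g \<Longrightarrow> smooth_fun (\<lambda>x. prd (f x) (g x))"
  by (rule smooth_fun_bilinear_span) (auto intro: bilinear_span.intros)

lemma smooth_fun_add:
  assumes "smooth_fun f" "smooth_fun g"
  shows "smooth_fun (\<lambda>x. f x + g x)"
proof -
  have "bilinear_span (\<lambda>r x. r *\<^sub>R x) (\<lambda>x. 1 *\<^sub>R f x + 1 *\<^sub>R g x)"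
    by (intro bilinear_span.intros assms smooth_fun_const)
  then show ?thesis
    using smooth_fun_bilinear_span[OF bounded_bilinear_scaleR] by simp
qed

lemma smooth_fun_scaleR_const: "smooth_fun f \<Longrightarrow> smooth_fun (\<lambda>x. c *\<^sub>R f x)"
  by (rule smooth_fun_bilinear[OF bounded_bilinear_scaleR smooth_fun_const])

lemma smooth_fun_diff: "smooth_fun f \<Longrightarrow> smooth_fun g \<Longrightarrow> smooth_fun (\<lambda>x. f x - g x)"
  using smooth_fun_add[of f "\<lambda>x. (-1) *\<^sub>R g x"] smooth_fun_scaleR_const[of g "-1"] by simp

lemma smooth_fun_linear:
  assumes L: "bounded_linear L" and f: "smooth_fun f"
  shows "smooth_fun (\<lambda>x. L (f x))"
proof -
  have "iter_partial js (\<lambda>x. L (f x)) = (\<lambda>x. L (iter_partial js f x))" for js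
    by (induct js)
      (simp_all add: partial_deriv_linear[OF L] smooth_fun_iter_partial smooth_fun_differentiable f)
  moreover have "(\<lambda>x. L (iter_partial js f x)) differentiable (at x)" for js x
  proof -
    have "(iter_partial js f has_derivative frechet_derivative (iter_partial js f) (at x)) (at x)"
      by (rule smooth_fun_has_derivative[OF smooth_fun_iter_partial[OF f]])
    from bounded_linear.has_derivative[OF L this] show ?thesis
      by (rule differentiableI)
  qed
  ultimately show ?thesis
    unfolding smooth_fun_def by simp
qed

lemma partial_deriv_diff:
  assumes "f differentiable (at x)" "g differentiable (at x)"
  shows "partial_deriv j (\<lambda>x. f x - g x) x = partial_deriv j f x - partial_deriv j g x"
proof -
  have "((\<lambda>x. f x - g x) has_derivative
      (\<lambda>h. frechet_derivative f (at x) h - frechet_derivative g (at x) h)) (at x)"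
    using assms by (intro has_derivative_diff) (auto simp: frechet_derivative_works[symmetric])
  from partial_deriv_eq[OF this] show ?thesis
    by (simp add: partial_deriv_def)
qed

lemma partial_deriv_scaleR:
  assumes "f differentiable (at x)"
  shows "partial_deriv j (\<lambda>x. c *\<^sub>R f x) x = c *\<^sub>R partial_deriv j f x"
  using partial_deriv_linear[OF bounded_linear_scaleR_right assms] .

lemma iter_partial_diff:
  "smooth_fun f \<Longrightarrow> smooth_fun g \<Longrightarrow>
    iter_partial js (\<lambda>x. f x - g x) = (\<lambda>x. iter_partial js f x - iter_partial js g x)"
  by (induct js)
    (auto simp: partial_deriv_diff smooth_fun_iter_partial smooth_fun_differentiable)

lemma iter_partial_scaleR:
  "smooth_fun f \<Longrightarrow> iter_partial js (\<lambda>x. c *\<^sub>R f x) = (\<lambda>x. c *\<^sub>R iter_partial js f x)"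
  by (induct js)
    (auto simp: partial_deriv_scaleR smooth_fun_iter_partial smooth_fun_differentiable)

lemma partial_deriv_zero [simp]: "partial_deriv j (\<lambda>x. 0) = (\<lambda>x. 0)"
  by (auto simp: partial_deriv_def)

lemma iter_partial_zero [simp]: "iter_partial js (\<lambda>x. 0) = (\<lambda>x. 0)"
  by (induct js) auto

lemma partial_deriv_eq_0_off_closed:
  assumes "closed C" "\<And>x. x \<notin> C \<Longrightarrow> f x = 0" "x \<notin> C"
  shows "partial_deriv j f x = 0"
proof -
  have "((\<lambda>x. 0) has_derivative (\<lambda>x. 0)) (at x)" by simp
  then have "(f has_derivative (\<lambda>x. 0)) (at x)"
    by (rule has_derivative_transform_within_open[where s="- C"]) (use assms in auto)
  then show ?thesis by (simp add: partial_deriv_eq)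
qed

lemma Cc_infI:
  assumes "smooth_fun \<phi>" "compact C" "C \<subseteq> \<Omega>" "\<And>x. x \<notin> C \<Longrightarrow> \<phi> x = 0"
  shows "\<phi> \<in> Cc_inf \<Omega>"
proof -
  have "closure {x. \<phi> x \<noteq> 0} \<subseteq> C"
    using assms by (intro closure_minimal) (auto simp: compact_imp_closed)
  moreover have "compact (closure {x. \<phi> x \<noteq> 0})"
    using compact_Int_closed[OF assms(2) closed_closure, of "{x. \<phi> x \<noteq> 0}"]
    by (metis Int_absorb1 calculation)
  ultimately show ?thesis
    using assms unfolding Cc_inf_def by auto
qed

lemma Cc_infE:
  assumes "\<phi> \<in> Cc_inf \<Omega>"
  obtains C where "smooth_fun \<phi>" "compact C" "C \<subseteq> \<Omega>" "\<And>x. x \<notin> C \<Longrightarrow> \<phi> x = 0"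
proof
  show "x \<notin> closure {x. \<phi> x \<noteq> 0} \<Longrightarrow> \<phi> x = 0" for x
    using closure_subset[of "{x. \<phi> x \<noteq> 0}"] by auto
qed (use assms in \<open>auto simp: Cc_inf_def\<close>)

lemma Cc_inf_partial: "\<phi> \<in> Cc_inf \<Omega> \<Longrightarrow> partial_deriv j \<phi> \<in> Cc_inf \<Omega>"
  by (erule Cc_infE, rule Cc_infI)
    (auto intro: smooth_fun_partial partial_deriv_eq_0_off_closed compact_imp_closed)

lemma Cc_inf_scaleR_const: "\<phi> \<in> Cc_inf \<Omega> \<Longrightarrow> (\<lambda>x. c *\<^sub>R \<phi> x) \<in> Cc_inf \<Omega>"
  by (erule Cc_infE, rule Cc_infI) (auto intro: smooth_fun_scaleR_const)

lemma Cc_inf_add: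
  assumes "\<phi> \<in> Cc_inf \<Omega>" "\<psi> \<in> Cc_inf \<Omega>"
  shows "(\<lambda>x. \<phi> x + \<psi> x) \<in> Cc_inf \<Omega>"
proof -
  obtain C D where C: "smooth_fun \<phi>" "compact C" "C \<subseteq> \<Omega>" "\<And>x. x \<notin> C \<Longrightarrow> \<phi> x = 0"
   and D: "smooth_fun \<psi>" "compact D" "D \<subseteq> \<Omega>" "\<And>x. x \<notin> D \<Longrightarrow> \<psi> x = 0"
    using assms by (meson Cc_infE)
  show ?thesis
    by (rule Cc_infI[where C="C \<union> D"]) (use C D in \<open>auto intro: smooth_fun_add\<close>)
qed

lemma Cc_inf_diff:
  "\<phi> \<in> Cc_inf \<Omega> \<Longrightarrow> \<psi> \<in> Cc_inf \<Omega> \<Longrightarrow> (\<lambda>x. \<phi> x - \<psi> x) \<in> Cc_inf \<Omega>"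
  using Cc_inf_add[of \<phi> \<Omega> "\<lambda>x. (-1) *\<^sub>R \<psi> x"] Cc_inf_scaleR_const[of \<psi> \<Omega> "-1"] by simp

lemma Cc_inf_linear: "bounded_linear L \<Longrightarrow> \<phi> \<in> Cc_inf \<Omega> \<Longrightarrow> (\<lambda>x. L (\<phi> x)) \<in> Cc_inf \<Omega>"
  by (erule Cc_infE, rule Cc_infI)
    (auto intro: smooth_fun_linear simp: linear_0 bounded_linear.linear)

lemma Cc_inf_bilinear:
  "bounded_bilinear prd \<Longrightarrow> \<phi> \<in> Cc_inf \<Omega> \<Longrightarrow> smooth_fun g \<Longrightarrow> (\<lambda>x. prd (\<phi> x) (g x)) \<in> Cc_inf \<Omega>"
  by (erule Cc_infE, rule Cc_infI) (auto intro: smooth_fun_bilinear simp: bounded_bilinear.zero_left)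

lemma Cc_inf_smooth: "\<phi> \<in> Cc_inf \<Omega> \<Longrightarrow> smooth_fun \<phi>"
  by (simp add: Cc_inf_def)

lemma Cc_inf_zero [simp]: "(\<lambda>x. 0) \<in> Cc_inf \<Omega>"
  by (rule Cc_infI[where C="{}"]) auto

lemma Cc_inf_bounded:
  fixes \<phi> :: "real ^ 'n \<Rightarrow> 'b::real_normed_vector"
  assumes "\<phi> \<in> Cc_inf \<Omega>"
  obtains B where "B > 0" "\<And>x. norm (\<phi> x) \<le> B"
proof -
  obtain C where C: "smooth_fun \<phi>" "compact C" "\<And>x. x \<notin> C \<Longrightarrow> \<phi> x = 0"
    using Cc_infE[OF assms] by metis
  have "compact (\<phi> ` C)"
    using C by (intro compact_continuous_image smooth_fun_continuous)
  then obtain B where "\<forall>y\<in>\<phi> ` C. norm y \<le> B"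
    using compact_imp_bounded bounded_iff by blast
  then have "norm (\<phi> x) \<le> max B 1" for x
    using C(3)[of x] by (cases "x \<in> C") (auto simp: le_max_iff_disj)
  then show ?thesis using that[of "max B 1"] by auto
qed

lemma Cc_inf_sigma_Cc_inf: "\<phi> \<in> Cc_inf_sigma \<Omega> \<Longrightarrow> \<phi> \<in> Cc_inf \<Omega>"
  by (simp add: Cc_inf_sigma_def)

lemma Cc_inf_sigma_zero [simp]: "(\<lambda>x. 0) \<in> Cc_inf_sigma \<Omega>"
  by (simp add: Cc_inf_sigma_def)

lemma Cc_inf_sigma_scaleR:
  "\<phi> \<in> Cc_inf_sigma \<Omega> \<Longrightarrow> (\<lambda>x. c *\<^sub>R \<phi> x) \<in> Cc_inf_sigma \<Omega>"
  unfolding Cc_inf_sigma_def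
  by (auto intro: Cc_inf_scaleR_const simp: partial_deriv_scaleR Cc_inf_smooth
      smooth_fun_differentiable sum_distrib_left[symmetric])

lemma Cc_inf_sigma_add:
  "\<phi> \<in> Cc_inf_sigma \<Omega> \<Longrightarrow> \<psi> \<in> Cc_inf_sigma \<Omega> \<Longrightarrow> (\<lambda>x. \<phi> x + \<psi> x) \<in> Cc_inf_sigma \<Omega>"
  unfolding Cc_inf_sigma_def
  by (auto intro: Cc_inf_add simp: partial_deriv_add Cc_inf_smooth
      smooth_fun_differentiable sum.distrib)

section \<open>Bump functions\<close>

text \<open>The class of these functions is closed under differentiation, and all of them are
  differentiable at the origin, because there the exponential beats the polynomial in
  \<open>1 / x\<close>.\<close>

definition flat :: "real poly \<Rightarrow> real \<Rightarrow> real" where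
  "flat p x = (if x > 0 then poly p (1 / x) * exp (- (1 / x)) else 0)"

lemma poly_div_exp_tendsto_0: "((\<lambda>y::real. poly p y / exp y) \<longlongrightarrow> 0) at_top"
proof -
  have "((\<lambda>y. \<Sum>i\<le>degree p. coeff p i * (y ^ i / exp y)) \<longlongrightarrow> (\<Sum>i\<le>degree p. coeff p i * 0)) at_top"
    by (intro tendsto_intros tendsto_power_div_exp_0)
  then show ?thesis
    by (simp add: poly_altdef sum_divide_distrib)
qed

lemma flat_has_derivative:
  "(flat p has_real_derivative flat ([:0, 0, 1:] * (p - pderiv p)) x) (at x)"
proof -
  consider "x > 0" | "x < 0" | "x = 0" by linarith
  then show ?thesis
  proof cases
    case 1
    have "((\<lambda>x. poly p (1 / x) * exp (- (1 / x))) has_real_derivative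
        flat ([:0, 0, 1:] * (p - pderiv p)) x) (at x)"
      using 1 by (auto intro!: derivative_eq_intros DERIV_chain2[OF poly_DERIV]
          simp: flat_def field_simps power2_eq_square)
    then show ?thesis
      by (rule DERIV_cong_ev[THEN iffD1, rotated -1])
        (use 1 in \<open>auto simp: flat_def eventually_nhds intro!: exI[of _ "{0<..}"]\<close>)
  next
    case 2
    have "((\<lambda>x. 0) has_real_derivative 0) (at x)" by simp
    then show ?thesis
      by (rule has_field_derivative_transform_within_open[where S="{..<0}", THEN DERIV_cong])
        (use 2 in \<open>auto simp: flat_def\<close>)
  next
    case 3
    have "((\<lambda>h. flat p h / h) \<longlongrightarrow> 0) (at_left 0)"
      by (rule tendsto_eventually) (auto simp: flat_def eventually_at_filter)
    moreover have "((\<lambda>h. flat p h / h) \<longlongrightarrow> 0) (at_right 0)"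
    proof -
      have "((\<lambda>h. poly ([:0,1:] * p) (inverse h) / exp (inverse h)) \<longlongrightarrow> 0) (at_right (0::real))"
        by (rule filterlim_compose[OF poly_div_exp_tendsto_0 filterlim_inverse_at_top_right])
      then show ?thesis
        by (rule Lim_transform_eventually)
          (auto simp: flat_def eventually_at_filter field_simps exp_minus)
    qed
    ultimately have "((\<lambda>h. flat p h / h) \<longlongrightarrow> 0) (at 0)"
      by (rule filterlim_split_at)
    then show ?thesis using 3
      by (simp add: DERIV_def flat_def)
  qed
qed

text \<open>Smoothness on the real line, in the form in which it occurs for test functions of time.\<close>

definition smooth1 :: "(real \<Rightarrow> real) \<Rightarrow> bool" where
  "smooth1 g \<longleftrightarrow> (\<forall>k t. (deriv ^^ k) g differentiable (at t))"

lemma smooth1_coinduct: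
  assumes "P f"
    and step: "\<And>f. P f \<Longrightarrow> \<exists>f'. P f' \<and> (\<forall>x. (f has_real_derivative f' x) (at x))"
  shows "smooth1 f"
proof -
  have P: "P (deriv f)" if Pf: "P f" for f
  proof -
    obtain f' where "P f'" "\<forall>x. (f has_real_derivative f' x) (at x)"
      using step[OF Pf] by blast
    then show ?thesis using DERIV_imp_deriv by (metis ext)
  qed
  have "P ((deriv ^^ k) f)" for k
    by (induct k) (auto intro: assms P)
  then show ?thesis
    unfolding smooth1_def using step by (metis real_differentiable_def)
qed

lemma smooth1_has_derivative:
  "smooth1 g \<Longrightarrow> (g has_real_derivative deriv g x) (at x)"
  unfolding smooth1_def
  by (metis DERIV_deriv_iff_real_differentiable funpow_0)

lemma smooth1_deriv: "smooth1 g \<Longrightarrow> smooth1 (deriv g)"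
  unfolding smooth1_def by (metis funpow_Suc_right o_apply)

lemma smooth1_flat_affine: "smooth1 (\<lambda>x. flat p (a * x + b))"
proof (rule smooth1_coinduct[where P="\<lambda>f. \<exists>c p. f = (\<lambda>x. c * flat p (a * x + b))"])
  show "\<exists>c q. (\<lambda>x. flat p (a * x + b)) = (\<lambda>x. c * flat q (a * x + b))"
    by (rule exI[of _ 1]) auto
next
  fix f assume "\<exists>c p. f = (\<lambda>x. c * flat p (a * x + b))"
  then obtain c p where f: "f = (\<lambda>x. c * flat p (a * x + b))" by blast
  have "(f has_real_derivative (c * a) * flat ([:0, 0, 1:] * (p - pderiv p)) (a * x + b)) (at x)" for x
    unfolding f by (auto intro!: derivative_eq_intros DERIV_chain2[OF flat_has_derivative])
  then show "\<exists>f'. (\<exists>c p. f' = (\<lambda>x. c * flat p (a * x + b))) \<and> (\<forall>x. (f has_real_derivative f' x) (at x))"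
    by (intro exI[of _ "\<lambda>x. (c * a) * flat ([:0, 0, 1:] * (p - pderiv p)) (a * x + b)"]) blast
qed

inductive prod_span :: "(real \<Rightarrow> real) \<Rightarrow> bool" where
  prd: "smooth1 f \<Longrightarrow> smooth1 g \<Longrightarrow> prod_span (\<lambda>x. f x * g x)"
| add: "prod_span a \<Longrightarrow> prod_span b \<Longrightarrow> prod_span (\<lambda>x. a x + b x)"

lemma smooth1_mult:
  assumes "smooth1 f" "smooth1 g"
  shows "smooth1 (\<lambda>x. f x * g x)"
proof (rule smooth1_coinduct[where P=prod_span])
  show "prod_span (\<lambda>x. f x * g x)" using assms by (rule prod_span.intros)
  fix h assume "prod_span h"
  then show "\<exists>h'. prod_span h' \<and> (\<forall>x. (h has_real_derivative h' x) (at x))"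
  proof induct
    case (prd f g)
    then show ?case
      by (intro exI[of _ "\<lambda>x. deriv f x * g x + f x * deriv g x"])
        (auto intro!: prod_span.intros smooth1_deriv derivative_eq_intros smooth1_has_derivative)
  next
    case (add a b)
    then obtain a' b' where "prod_span a'" "\<forall>x. (a has_real_derivative a' x) (at x)"
      "prod_span b'" "\<forall>x. (b has_real_derivative b' x) (at x)" by blast
    then show ?case
      by (intro exI[of _ "\<lambda>x. a' x + b' x"]) (auto intro!: prod_span.intros derivative_intros)
  qed
qed

text \<open>For every \<open>y > 0\<close> one has
  \<open>flat 1 (k * y) = exp (- 1 / (k * y))\<close>, which tends to 1 as \<open>k\<close> grows;
  thus the bumps are smooth approximations of the indicator of the open interval from
  \<open>a\<close> to \<open>b\<close>.\<close>

definition bump :: "nat \<Rightarrow> real \<Rightarrow> real \<Rightarrow> real \<Rightarrow> real" where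
  "bump k a b x = flat 1 (real k * (x - a)) * flat 1 (real k * (b - x))"

lemma smooth1_bump: "smooth1 (bump k a b)"
proof -
  have "smooth1 (\<lambda>x. flat 1 (real k * x + (- real k * a)) * flat 1 (- real k * x + real k * b))"
    by (intro smooth1_mult smooth1_flat_affine)
  moreover have "bump k a b = (\<lambda>x. flat 1 (real k * x + (- real k * a)) * flat 1 (- real k * x + real k * b))"
    by (auto simp: bump_def algebra_simps)
  ultimately show ?thesis by simp
qed

lemma bump_bounds: "0 \<le> bump k a b x" "bump k a b x \<le> 1"
proof -
  have *: "0 \<le> flat 1 y" "flat 1 y \<le> 1" for y by (auto simp: flat_def)
  then show "0 \<le> bump k a b x" "bump k a b x \<le> 1"
    unfolding bump_def by (auto intro: mult_le_one)
qed

lemma bump_eq_0: "x \<notin> {a<..<b} \<Longrightarrow> bump k a b x = 0"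
  by (auto simp: bump_def flat_def zero_less_mult_iff)

lemma bump_tendsto:
  "(\<lambda>k. bump k a b x) \<longlonglongrightarrow> indicator {a<..<b} x"
proof (cases "x \<in> {a<..<b}")
  case True
  have *: "(\<lambda>k. flat 1 (real k * y)) \<longlonglongrightarrow> 1" if "y > 0" for y
  proof -
    have "(\<lambda>k. (1 / y) * (1 / real k)) \<longlonglongrightarrow> (1 / y) * 0"
      by (intro tendsto_mult tendsto_const lim_1_over_n)
    then have lim: "(\<lambda>k. exp (- ((1 / y) * (1 / real k)))) \<longlonglongrightarrow> exp (- ((1 / y) * 0))"
      by (intro tendsto_exp tendsto_minus)
    have ev: "\<forall>\<^sub>F k in sequentially. exp (- ((1 / y) * (1 / real k))) = flat 1 (real k * y)"
      using eventually_gt_at_top[of 0] by eventually_elim (use that in \<open>auto simp: flat_def mult.commute\<close>)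
    show ?thesis
      using Lim_transform_eventually[OF lim ev] by simp
  qed
  have "(\<lambda>k. bump k a b x) \<longlonglongrightarrow> 1 * 1"
    unfolding bump_def using True by (intro tendsto_mult *) auto
  then show ?thesis using True by simp
qed (simp add: bump_eq_0)

lemma smooth_fun_component:
  assumes "smooth1 g"
  shows "smooth_fun (\<lambda>x :: real ^ 'n. g (x $ i))"
proof (rule smooth_fun_coinduct[where P="\<lambda>f. \<exists>c g. smooth1 g \<and> f = (\<lambda>x. c * g (x $ i))"])
  show "\<exists>c h. smooth1 h \<and> (\<lambda>x :: real ^ 'n. g (x $ i)) = (\<lambda>x. c * h (x $ i))"
    using assms by (intro exI[of _ 1] exI[of _ g]) auto
next
  have D: "((\<lambda>x. c * g (x $ i)) has_derivative (\<lambda>h. c * (h $ i * deriv g (x $ i)))) (at x)"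
    if "smooth1 g" for c g and x :: "real ^ 'n"
  proof -
    have "(g has_derivative (\<lambda>h. h * deriv g (x $ i))) (at (x $ i))"
      using smooth1_has_derivative[OF that, of "x $ i"]
      by (simp add: has_field_derivative_def mult.commute[of _ "deriv g (x $ i)"])
    moreover have "((\<lambda>x :: real ^ 'n. x $ i) has_derivative (\<lambda>h. h $ i)) (at x)"
      by (rule bounded_linear_imp_has_derivative[OF bounded_linear_vec_nth])
    ultimately have "((\<lambda>x. g (x $ i)) has_derivative (\<lambda>h. h $ i * deriv g (x $ i))) (at x)"
      by (rule has_derivative_compose[rotated])
    then show ?thesis by (rule has_derivative_mult_right)
  qed
  fix f :: "real ^ 'n \<Rightarrow> real"
  assume "\<exists>c g. smooth1 g \<and> f = (\<lambda>x. c * g (x $ i))"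
  then obtain c g where g: "smooth1 g" "f = (\<lambda>x. c * g (x $ i))" by (elim exE conjE)
  show "f differentiable (at x)" for x
    unfolding g(2) by (rule differentiableI[OF D[OF g(1)]])
  fix j
  have "partial_deriv j f = (\<lambda>x. (c * (axis j 1 $ i)) * deriv g (x $ i))"
    unfolding g(2) using partial_deriv_eq[OF D[OF g(1)], of j c] by (intro ext) (simp add: mult.assoc)
  then show "\<exists>c g. smooth1 g \<and> partial_deriv j f = (\<lambda>x. c * g (x $ i))"
    by (intro exI[of _ "c * (axis j 1 $ i)"] exI[of _ "deriv g"] conjI smooth1_deriv[OF g(1)])
qed

lemma smooth_fun_prod:
  "finite I \<Longrightarrow> (\<And>i. i \<in> I \<Longrightarrow> smooth_fun (f i)) \<Longrightarrow>
    smooth_fun (\<lambda>x. \<Prod>i\<in>I. (f i x :: real))"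
  by (induct I rule: finite_induct) (auto intro: smooth_fun_bilinear[OF bounded_bilinear_mult])

definition box_bump :: "nat \<Rightarrow> real ^ 'n \<Rightarrow> real ^ 'n \<Rightarrow> real ^ 'n \<Rightarrow> real" where
  "box_bump k a b x = (\<Prod>i\<in>UNIV. bump k (a $ i) (b $ i) (x $ i))"

lemma box_bump_eq_0:
  assumes "x \<notin> cbox a b"
  shows "box_bump k a b x = 0"
proof -
  have "\<exists>i. \<not> (a $ i \<le> x $ i \<and> x $ i \<le> b $ i)"
    using assms by (simp add: mem_box_cart)
  then obtain i where "\<not> (a $ i \<le> x $ i \<and> x $ i \<le> b $ i)" by blast
  then have "x $ i \<notin> {a $ i<..<b $ i}" by auto
  then show ?thesis
    unfolding box_bump_def by (intro prod_zero bexI[of _ i] bump_eq_0) simp_all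
qed

lemma box_bump_Cc_inf:
  assumes "cbox a b \<subseteq> \<Omega>"
  shows "box_bump k a b \<in> Cc_inf \<Omega>"
proof (rule Cc_infI[where C="cbox a b"])
  show "smooth_fun (box_bump k a b)"
    unfolding box_bump_def[abs_def]
    by (intro smooth_fun_prod smooth_fun_component smooth1_bump) auto
qed (use assms in \<open>auto simp: box_bump_eq_0\<close>)

lemma box_bump_bounds: "0 \<le> box_bump k a b x" "box_bump k a b x \<le> 1"
  unfolding box_bump_def by (auto intro!: prod_nonneg prod_le_1 simp: bump_bounds)

lemma box_bump_tendsto: "(\<lambda>k. box_bump k a b x) \<longlonglongrightarrow> indicator (box a b) x"
proof -
  have "(\<lambda>k. box_bump k a b x) \<longlonglongrightarrow> (\<Prod>i\<in>UNIV. indicator {a $ i<..<b $ i} (x $ i))"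
    unfolding box_bump_def by (rule tendsto_prod) (rule bump_tendsto)
  moreover have "(\<Prod>i\<in>UNIV. indicator {a $ i<..<b $ i} (x $ i)) = (indicator (box a b) x :: real)"
  proof (cases "x \<in> box a b")
    case False
    then obtain i where i: "x $ i \<notin> {a $ i<..<b $ i}" by (auto simp: mem_box_cart)
    then have "(\<Prod>i\<in>UNIV. indicator {a $ i<..<b $ i} (x $ i)) = (0 :: real)"
      by (intro prod_zero bexI[of _ i]) (simp_all only: indicator_simps finite UNIV_I not_False_eq_True)
    then show ?thesis using False by simp
  next
    case True
    then have "(\<Prod>i\<in>UNIV. indicator {a $ i<..<b $ i} (x $ i)) = (1 :: real)"
      by (intro prod.neutral) (auto simp: mem_box_cart)
    then show ?thesis using True by simp
  qed
  ultimately show ?thesis by metis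
qed


section \<open>Lebesgue measure on a subset\<close>

lemma complete_lebesgue_on: 
  assumes "S \<in> sets lebesgue"
  shows "complete_measure (lebesgue_on S)"
proof
  fix A B :: "'a set" assume "B \<subseteq> A" "A \<in> null_sets (lebesgue_on S)"
  then have "A \<in> null_sets lebesgue" "A \<subseteq> S" "B \<subseteq> A"
    using assms by (auto simp: null_sets_restrict_space)
  then have "B \<in> null_sets lebesgue"
    by (metis completion.complete2)
  then show "B \<in> sets (lebesgue_on S)"
    using \<open>A \<subseteq> S\<close> \<open>B \<subseteq> A\<close> assms by (auto simp: sets_restrict_space_iff null_sets_def)
qed

text \<open>Elements of the function spaces are representatives, so everything has to be stable
  under changes on null sets. For measurability this is the completeness of Lebesgue measure.\<close>

lemma measurable_AE_lebesgue_on: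
  assumes S: "S \<in> sets lebesgue" and f: "f \<in> measurable (lebesgue_on S) M"
    and ae: "AE x in lebesgue_on S. f x = g x" and g: "\<And>x. x \<in> S \<Longrightarrow> g x \<in> space M"
  shows "g \<in> measurable (lebesgue_on S) M"
proof (rule measurableI)
  fix A assume A: "A \<in> sets M"
  show "g -` A \<inter> space (lebesgue_on S) \<in> sets (lebesgue_on S)"
  proof (rule complete_measure.in_sets_AE[OF complete_lebesgue_on[OF S]])
    show "f -` A \<inter> space (lebesgue_on S) \<in> sets (lebesgue_on S)"
      using f A by (rule measurable_sets)
    show "AE x in lebesgue_on S. (x \<in> f -` A \<inter> space (lebesgue_on S)) = (x \<in> g -` A \<inter> space (lebesgue_on S))"
      using ae by eventually_elim auto
  qed auto
qed (use g in simp)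

lemma measurable_AE_cong_lebesgue_on:
  assumes "S \<in> sets lebesgue" "AE x in lebesgue_on S. f x = g x"
  shows "f \<in> borel_measurable (lebesgue_on S) \<longleftrightarrow> g \<in> borel_measurable (lebesgue_on S)"
proof -
  have "AE x in lebesgue_on S. g x = f x" using assms(2) by eventually_elim simp
  then show ?thesis
    using measurable_AE_lebesgue_on[OF assms(1) _ assms(2), of borel]
      measurable_AE_lebesgue_on[OF assms(1), of g borel f] by (metis UNIV_I space_borel)
qed

lemma integrable_AE_cong_lebesgue_on:
  assumes "S \<in> sets lebesgue" "AE x in lebesgue_on S. f x = g x"
  shows "integrable (lebesgue_on S) f \<longleftrightarrow> integrable (lebesgue_on S) g"
proof (cases "f \<in> borel_measurable (lebesgue_on S)")
  case True
  moreover from True have "g \<in> borel_measurable (lebesgue_on S)"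
    using measurable_AE_cong_lebesgue_on[OF assms] by blast
  ultimately show ?thesis
    using assms(2) by (rule integrable_cong_AE)
next
  case False
  then show ?thesis
    using measurable_AE_cong_lebesgue_on[OF assms] borel_measurable_integrable by blast
qed

text \<open>This holds for arbitrary functions: by completeness both are measurable or neither is,
  and in the latter case both integrals have the default value 0.\<close>

lemma integral_AE_cong_lebesgue_on:
  fixes f :: "'a::euclidean_space \<Rightarrow> 'b::{banach, second_countable_topology}"
  assumes "S \<in> sets lebesgue" "AE x in lebesgue_on S. f x = g x"
  shows "(LINT x|lebesgue_on S. f x) = (LINT x|lebesgue_on S. g x)"
proof (cases "f \<in> borel_measurable (lebesgue_on S)")
  case True
  moreover from True have "g \<in> borel_measurable (lebesgue_on S)"
    using measurable_AE_cong_lebesgue_on[OF assms] by blast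
  ultimately show ?thesis
    using assms(2) by (rule integral_cong_AE)
next
  case False
  then have "\<not> integrable (lebesgue_on S) f" "\<not> integrable (lebesgue_on S) g"
    using measurable_AE_cong_lebesgue_on[OF assms] borel_measurable_integrable by blast+
  then show ?thesis by (simp add: not_integrable_integral_eq)
qed

lemma measurable_AE_limit_lebesgue_on:
  fixes g :: "'a::euclidean_space \<Rightarrow> 'b::{banach, second_countable_topology}"
  assumes "S \<in> sets lebesgue" "\<And>k::nat. f k \<in> borel_measurable (lebesgue_on S)"
    "AE x in lebesgue_on S. (\<lambda>k. f k x) \<longlonglongrightarrow> g x"
  shows "g \<in> borel_measurable (lebesgue_on S)"
proof (rule measurable_AE_lebesgue_on)
  show "(\<lambda>x. lim (\<lambda>k. f k x)) \<in> borel_measurable (lebesgue_on S)"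
    using assms(2) by (rule borel_measurable_lim_metric)
  show "AE x in lebesgue_on S. lim (\<lambda>k. f k x) = g x"
    using assms(3) by eventually_elim (rule limI)
qed (use assms in auto)

lemma AE_lebesgue_on_iff:
  "S \<in> sets lebesgue \<Longrightarrow> (AE x in lebesgue_on S. P x) \<longleftrightarrow> (AE x in lebesgue. x \<in> S \<longrightarrow> P x)"
  by (rule AE_restrict_space_iff) simp

lemma AE_lebesgue_on_subset:
  assumes "AE x in lebesgue_on S. P x" "S' \<subseteq> S" "S \<in> sets lebesgue" "S' \<in> sets lebesgue"
  shows "AE x in lebesgue_on S'. P x"
  using assms by (auto simp: AE_lebesgue_on_iff elim: eventually_mono)

lemma lebesgue_on_supp:
  fixes f :: "'a::euclidean_space \<Rightarrow> 'b::{banach, second_countable_topology}"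
  assumes "S \<in> sets lebesgue" "S' \<in> sets lebesgue" "S' \<subseteq> S" "\<And>x. x \<in> S - S' \<Longrightarrow> f x = 0"
  shows "integrable (lebesgue_on S) f \<longleftrightarrow> integrable (lebesgue_on S') f"
    and "(LINT x|lebesgue_on S. f x) = (LINT x|lebesgue_on S'. f x)"
proof -
  have "(\<lambda>x. indicator S x *\<^sub>R f x) = (\<lambda>x. indicator S' x *\<^sub>R f x)"
    using assms by (intro ext) (auto simp: indicator_def)
  moreover have "S \<inter> space lebesgue \<in> sets lebesgue" "S' \<inter> space lebesgue \<in> sets lebesgue"
    using assms by auto
  ultimately show "integrable (lebesgue_on S) f \<longleftrightarrow> integrable (lebesgue_on S') f"
    "(LINT x|lebesgue_on S. f x) = (LINT x|lebesgue_on S'. f x)"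
    by (simp_all only: integrable_restrict_space integral_restrict_space)
qed

lemma integrable_lebesgue_on_subset:
  fixes f :: "'a::euclidean_space \<Rightarrow> 'b::{banach, second_countable_topology}"
  assumes "integrable (lebesgue_on S) f" "S \<in> sets lebesgue" "S' \<in> sets lebesgue" "S' \<subseteq> S"
  shows "integrable (lebesgue_on S') f"
proof -
  have "integrable lebesgue (\<lambda>x. indicator S x *\<^sub>R f x)"
    using assms(1,2) by (simp add: integrable_restrict_space)
  from integrable_mult_indicator[OF assms(3) this]
  have "integrable lebesgue (\<lambda>x. indicator S' x *\<^sub>R (indicator S x *\<^sub>R f x))" .
  moreover have "(\<lambda>x. indicator S' x *\<^sub>R (indicator S x *\<^sub>R f x)) = (\<lambda>x. indicator S' x *\<^sub>R f x)"
    using assms(4) by (intro ext) (auto simp: indicator_def)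
  ultimately have "integrable lebesgue (\<lambda>x. indicator S' x *\<^sub>R f x)"
    by (simp only:)
  then show ?thesis
    using assms(3) by (simp add: integrable_restrict_space)
qed

section \<open>The fundamental lemma of the calculus of variations\<close>

text \<open>The sets over which \<open>U\<close> has integral zero form a Dynkin system, and boxes
  are an intersection-stable generator of the Borel sets. Hence \<open>U\<close> has integral zero
  over every Borel set.\<close>

lemma AE_zero_if_box_integrals_zero:
  fixes U :: "'a::euclidean_space \<Rightarrow> real"
  assumes int: "integrable lebesgue U"
    and box0: "\<And>c d. (LINT x:box c d|lebesgue. U x) = 0"
    and total: "(LINT x|lebesgue. U x) = 0"
  shows "AE x in lebesgue. U x = 0"
proof -
  \<comment> \<open>Dynkin induction runs over Borel sets, so U is replaced by a Borel measurable representative.\<close>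
  obtain V where V[measurable]: "V \<in> borel_measurable lborel" and UV: "AE x in lborel. U x = V x"
    using completion_ex_borel_measurable_real[OF borel_measurable_integrable[OF int]] by auto
  have UV': "AE x in lebesgue. U x = V x" using UV by (rule AE_completion)
  have Vm: "V \<in> borel_measurable lebesgue" using V by (rule measurable_completion)
  have iV: "integrable lborel V"
    using int integrable_cong_AE[OF borel_measurable_integrable[OF int] Vm UV'] V
    by (simp add: integrable_completion)
  have eq: "(LINT x:A|lborel. V x) = (LINT x:A|lebesgue. U x)" if A: "A \<in> sets lborel" for A
  proof -
    have "(LINT x:A|lborel. V x) = (LINT x:A|lebesgue. V x)"
      unfolding set_lebesgue_integral_def
      by (rule integral_completion[symmetric]) (use A in measurable)
    also have "\<dots> = (LINT x:A|lebesgue. U x)"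
      unfolding set_lebesgue_integral_def
    proof (rule integral_cong_AE)
      show "(\<lambda>x. indicator A x *\<^sub>R V x) \<in> borel_measurable lebesgue"
        using A by (intro measurable_completion) simp
      show "(\<lambda>x. indicator A x *\<^sub>R U x) \<in> borel_measurable lebesgue"
        using A borel_measurable_integrable[OF int]
        by (intro borel_measurable_scaleR borel_measurable_indicator) auto
      show "AE x in lebesgue. indicator A x *\<^sub>R V x = indicator A x *\<^sub>R U x"
        using UV' by eventually_elim simp
    qed
    finally show ?thesis .
  qed
  have sU: "set_integrable lborel A V" if "A \<in> sets lborel" for A
    unfolding set_integrable_def using integrable_mult_indicator[OF that iV] .
  have tV: "(LINT x|lborel. V x) = 0"
    using eq[of UNIV] total by (simp add: set_lebesgue_integral_def)
  have main: "(LINT x:A|lborel. V x) = 0" if "A \<in> sets borel" for A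
  proof -
    have A: "A \<in> sigma_sets UNIV (range (\<lambda>(a, b). box a b :: 'a set))"
      using that unfolding borel_eq_box by simp
    show ?thesis
      using _ _ A
    proof (rule sigma_sets_induct_disjoint)
      show "Int_stable (range (\<lambda>(a, b). box a b :: 'a set))"
        by (auto simp: Int_stable_def box_Int_box)
      fix B assume "B \<in> range (\<lambda>(a, b). box a b :: 'a set)"
      then show "(LINT x:B|lborel. V x) = 0" using eq[of B] box0 by auto
    next
      fix B assume B: "B \<in> sigma_sets UNIV (range (\<lambda>(a, b). box a b :: 'a set))" "(LINT x:B|lborel. V x) = 0"
      then have Bb: "B \<in> sets borel" unfolding borel_eq_box by simp
      have "(LINT x:B \<union> (UNIV - B)|lborel. V x) = (LINT x:B|lborel. V x) + (LINT x:UNIV - B|lborel. V x)"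
        by (rule set_integral_Un) (use Bb sU in auto)
      then show "(LINT x:UNIV - B|lborel. V x) = 0"
        using B tV by (simp add: set_lebesgue_integral_def)
    next
      fix B :: "nat \<Rightarrow> 'a set"
      assume B: "disjoint_family B" "range B \<subseteq> sigma_sets UNIV (range (\<lambda>(a, b). box a b :: 'a set))"
        "\<And>i. (LINT x:B i|lborel. V x) = 0"
      then have Bb: "B i \<in> sets borel" for i unfolding borel_eq_box by auto
      have "(LINT x:(\<Union>i. B i)|lborel. V x) = (\<Sum>i. (LINT x:B i|lborel. V x))"
        by (rule lebesgue_integral_countable_add) (use Bb sU B in \<open>auto simp: disjoint_family_on_def\<close>)
      then show "(LINT x:(\<Union>i. B i)|lborel. V x) = 0" using B by simp
    qed (auto simp: set_lebesgue_integral_def)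
  qed
  have "AE x in lborel. V x = 0"
    by (rule density_unique_real[OF iV]) (use main in \<open>auto simp: set_lebesgue_integral_def\<close>)
  with UV have "AE x in lborel. U x = 0" by eventually_elim simp
  then show ?thesis by (rule AE_completion)
qed

text \<open>An open set is a countable union of closed boxes, so it suffices to treat the components
  of \<open>u\<close>, cut off outside one box.\<close>

lemma AE_zero_on_open:
  fixes u :: "'a::euclidean_space \<Rightarrow> 'b::euclidean_space"
  assumes "open \<Omega>"
    and int: "\<And>c d. cbox c d \<subseteq> \<Omega> \<Longrightarrow> integrable (lebesgue_on (cbox c d)) u"
    and zero: "\<And>c d. cbox c d \<subseteq> \<Omega> \<Longrightarrow> (LINT x|lebesgue_on (box c d). u x) = 0"
  shows "AE x in lebesgue_on \<Omega>. u x = 0"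
proof -
  have one: "AE x in lebesgue. x \<in> cbox a b \<longrightarrow> u x = 0" if ab: "cbox a b \<subseteq> \<Omega>" for a b
  proof -
    have "AE x in lebesgue. indicator (box a b) x * (u x \<bullet> e) = 0" if e: "e \<in> Basis" for e
    proof (rule AE_zero_if_box_integrals_zero)
      have iu: "integrable (lebesgue_on (box a b)) u"
        by (rule integrable_lebesgue_on_subset[OF int[OF ab]]) (auto simp: box_subset_cbox)
      then have iue: "integrable (lebesgue_on (box a b)) (\<lambda>x. u x \<bullet> e)" by auto
      then show I: "integrable lebesgue (\<lambda>x. indicator (box a b) x * (u x \<bullet> e))"
        by (simp add: integrable_restrict_space)
      have sub: "(LINT x|lebesgue_on (box c d). u x \<bullet> e) = 0" if "box c d \<subseteq> box a b" for c d
      proof (cases "box c d = {}")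
        case True then show ?thesis by simp
      next
        case False
        then have "cbox c d \<subseteq> cbox a b"
          using that by (metis box_subset_cbox closed_cbox closure_box closure_minimal dual_order.trans)
        then have "cbox c d \<subseteq> \<Omega>" using ab by blast
        then have "(LINT x|lebesgue_on (box c d). u x) = 0" by (rule zero)
        moreover have "(LINT x|lebesgue_on (box c d). u x \<bullet> e) = (LINT x|lebesgue_on (box c d). u x) \<bullet> e"
          by (rule integral_inner_left) (use integrable_lebesgue_on_subset[OF iu] that in auto)
        ultimately show ?thesis by simp
      qed
      show "(LINT x|lebesgue. indicator (box a b) x * (u x \<bullet> e)) = 0"
        using sub[of a b] by (simp add: integral_restrict_space)
      fix c d :: 'a
      obtain p q where pq: "box c d \<inter> box a b = box p q"
        by (rule that[OF box_Int_box])
      have "(LINT x:box c d|lebesgue. indicator (box a b) x * (u x \<bullet> e))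
          = (LINT x|lebesgue. indicator (box p q) x * (u x \<bullet> e))"
        unfolding set_lebesgue_integral_def pq[symmetric] by (simp add: indicator_inter_arith mult.assoc)
      also have "\<dots> = 0"
      proof -
        have "box p q \<subseteq> box a b" using pq by blast
        from sub[OF this] show ?thesis by (simp add: integral_restrict_space)
      qed
      finally show "(LINT x:box c d|lebesgue. indicator (box a b) x * (u x \<bullet> e)) = 0" .
    qed
    then have "AE x in lebesgue. \<forall>e\<in>Basis. indicator (box a b) x * (u x \<bullet> e) = 0"
      by (subst AE_ball_countable) (auto simp: countable_finite)
    moreover have "AE x in lebesgue. x \<notin> cbox a b - box a b"
      by (rule AE_not_in) (metis negligible_frontier_interval negligible_iff_null_sets)
    ultimately show ?thesis
    proof eventually_elim
      case (elim x)
      show ?case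
      proof
        assume "x \<in> cbox a b"
        then have "x \<in> box a b" using elim(2) by blast
        then have "\<forall>e\<in>Basis. u x \<bullet> e = 0" using elim(1) by simp
        then show "u x = 0" using euclidean_all_zero_iff by blast
      qed
    qed
  qed
  obtain \<D> where D: "countable \<D>" "\<D> \<subseteq> Pow \<Omega>" "\<And>X. X \<in> \<D> \<Longrightarrow> \<exists>a b. X = cbox a b" "\<Union>\<D> = \<Omega>"
    using open_countable_Union_open_cbox[OF assms(1)] by metis
  have "AE x in lebesgue. \<forall>X\<in>\<D>. x \<in> X \<longrightarrow> u x = 0"
  proof (subst AE_ball_countable[OF D(1)], intro ballI)
    fix X assume "X \<in> \<D>"
    then obtain a b where "X = cbox a b" "X \<subseteq> \<Omega>" using D by blast
    then show "AE x in lebesgue. x \<in> X \<longrightarrow> u x = 0" using one by simp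
  qed
  then have "AE x in lebesgue. x \<in> \<Omega> \<longrightarrow> u x = 0"
    by eventually_elim (use D(4) in blast)
  then show ?thesis
    using assms(1) by (simp add: AE_lebesgue_on_iff)
qed

lemma bump_integral_limit:
  fixes u :: "'a::euclidean_space \<Rightarrow> 'b::euclidean_space"
  assumes int: "integrable (lebesgue_on (cbox a b)) u"
    and \<phi>: "\<And>k::nat. \<phi> k \<in> borel_measurable (lebesgue_on (cbox a b))"
    "\<And>k x. \<bar>\<phi> k x\<bar> \<le> 1" "\<And>x. (\<lambda>k. \<phi> k x) \<longlonglongrightarrow> indicator (box a b) x"
    and zero: "\<And>k. (LINT x|lebesgue_on (cbox a b). (\<phi> k x :: real) *\<^sub>R u x) = 0"
  shows "(LINT x|lebesgue_on (box a b). u x) = 0"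
proof -
  have "(\<lambda>k. LINT x|lebesgue_on (cbox a b). \<phi> k x *\<^sub>R u x) \<longlonglongrightarrow>
      (LINT x|lebesgue_on (cbox a b). indicator (box a b) x *\<^sub>R u x)"
  proof (rule integral_dominated_convergence[where w="\<lambda>x. norm (u x)"])
    show "(\<lambda>x. \<phi> k x *\<^sub>R u x) \<in> borel_measurable (lebesgue_on (cbox a b))" for k
      using \<phi>(1) borel_measurable_integrable[OF int] by measurable
    show "(\<lambda>x. indicator (box a b) x *\<^sub>R u x) \<in> borel_measurable (lebesgue_on (cbox a b))"
    proof (rule borel_measurable_scaleR)
      show "indicator (box a b) \<in> borel_measurable (lebesgue_on (cbox a b))"
        by (intro measurable_restrict_space1 borel_measurable_indicator) auto
    qed (use borel_measurable_integrable[OF int] in simp)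
    show "AE x in lebesgue_on (cbox a b). norm (\<phi> k x *\<^sub>R u x) \<le> norm (u x)" for k
      using \<phi>(2) by (intro AE_I2) (simp add: mult_left_le_one_le)
    show "AE x in lebesgue_on (cbox a b). (\<lambda>k. \<phi> k x *\<^sub>R u x) \<longlonglongrightarrow> indicator (box a b) x *\<^sub>R u x"
      using \<phi>(3) by (intro AE_I2 tendsto_scaleR tendsto_const)
  qed (use int in auto)
  then have "(LINT x|lebesgue_on (cbox a b). indicator (box a b) x *\<^sub>R u x) = 0"
    using zero LIMSEQ_unique tendsto_const by (simp add: LIMSEQ_const_iff)
  also have "(LINT x|lebesgue_on (cbox a b). indicator (box a b) x *\<^sub>R u x)
      = (LINT x|lebesgue_on (box a b). indicator (box a b) x *\<^sub>R u x)"
    by (rule lebesgue_on_supp) (auto simp: box_subset_cbox)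
  also have "\<dots> = (LINT x|lebesgue_on (box a b). u x)"
    by (rule Bochner_Integration.integral_cong) auto
  finally show ?thesis .
qed

text \<open>The bumps of a closed box inside \<open>\<Omega>\<close> are test functions that
  converge boundedly to the indicator of its interior, so that the integral of \<open>u\<close> over
  every such box vanishes.\<close>

lemma fundamental_lemma:
  fixes u :: "real ^ 'n \<Rightarrow> 'b::euclidean_space"
  assumes "open \<Omega>" and li: "loc_integrable \<Omega> u"
    and zero: "\<And>\<phi>. \<phi> \<in> Cc_inf \<Omega> \<Longrightarrow> (LINT x|lebesgue_on \<Omega>. (\<phi> x :: real) *\<^sub>R u x) = 0"
  shows "AE x in lebesgue_on \<Omega>. u x = 0"
proof (rule AE_zero_on_open[OF assms(1)])
  fix c d :: "real ^ 'n" assume cd: "cbox c d \<subseteq> \<Omega>"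
  then show int: "integrable (lebesgue_on (cbox c d)) u"
    using li compact_cbox unfolding loc_integrable_def by blast
  show "(LINT x|lebesgue_on (box c d). u x) = 0"
  proof (rule bump_integral_limit[OF int, where \<phi>="\<lambda>k. box_bump k c d"])
    show "box_bump k c d \<in> borel_measurable (lebesgue_on (cbox c d))" for k
      by (rule continuous_imp_measurable_on_sets_lebesgue[OF smooth_fun_continuous[OF
            Cc_inf_smooth[OF box_bump_Cc_inf[OF cd]]]]) simp
    show "\<bar>box_bump k c d x\<bar> \<le> 1" for k x
      using box_bump_bounds[of k c d x] by simp
    show "(LINT x|lebesgue_on (cbox c d). box_bump k c d x *\<^sub>R u x) = 0" for k
    proof -
      have "(LINT x|lebesgue_on \<Omega>. box_bump k c d x *\<^sub>R u x) = (LINT x|lebesgue_on (cbox c d). box_bump k c d x *\<^sub>R u x)"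
      proof (rule lebesgue_on_supp)
        fix x assume "x \<in> \<Omega> - cbox c d"
        then show "box_bump k c d x *\<^sub>R u x = 0" by (simp add: box_bump_eq_0)
      qed (use cd assms(1) in auto)
      then show ?thesis by (rule trans[OF sym zero[OF box_bump_Cc_inf[OF cd]]])
    qed
  qed (rule box_bump_tendsto)
qed

lemma bump_test_time:
  assumes "{a..b} \<subseteq> {0<..<T}"
  shows "bump k a b \<in> test_time T"
proof -
  have "t \<in> {a..b}" if "bump k a b t \<noteq> 0" for t
  proof (rule ccontr)
    assume "t \<notin> {a..b}"
    then have "t \<notin> {a<..<b}" by auto
    with that show False by (simp add: bump_eq_0)
  qed
  then have sub: "closure {t. bump k a b t \<noteq> 0} \<subseteq> {a..b}"
    by (intro closure_minimal subsetI) simp_all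
  moreover have "compact (closure {t. bump k a b t \<noteq> 0})"
    using compact_Int_closed[OF compact_Icc closed_closure, of a b "{t. bump k a b t \<noteq> 0}"] sub
    by (metis Int_absorb1)
  ultimately show ?thesis
    using assms smooth1_bump unfolding test_time_def smooth1_def by auto
qed

lemma fundamental_lemma_time:
  fixes u :: "real \<Rightarrow> real"
  assumes int: "integrable (lebesgue_on {0<..<T}) u"
    and zero: "\<And>\<psi>. \<psi> \<in> test_time T \<Longrightarrow> (LINT t|lebesgue_on {0<..<T}. \<psi> t * u t) = 0"
  shows "AE t in lebesgue_on {0<..<T}. u t = 0"
proof (rule AE_zero_on_open)
  fix c d :: real assume cd: "cbox c d \<subseteq> {0<..<T}"
  then show int: "integrable (lebesgue_on (cbox c d)) u"
    by (intro integrable_lebesgue_on_subset[OF assms(1)]) auto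
  have t: "bump k c d \<in> test_time T" for k using bump_test_time cd by simp
  show "(LINT x|lebesgue_on (box c d). u x) = 0"
  proof (rule bump_integral_limit[OF int, where \<phi>="\<lambda>k. bump k c d"])
    show "bump k c d \<in> borel_measurable (lebesgue_on (cbox c d))" for k
    proof (rule continuous_imp_measurable_on_sets_lebesgue)
      show "continuous_on (cbox c d) (bump k c d)"
        using DERIV_isCont[OF smooth1_has_derivative[OF smooth1_bump]]
        by (simp add: continuous_at_imp_continuous_on)
    qed simp
    show "\<bar>bump k c d x\<bar> \<le> 1" for k x
      using bump_bounds[of k c d x] by simp
    show "(LINT x|lebesgue_on (cbox c d). bump k c d x *\<^sub>R u x) = 0" for k
    proof -
      have "(LINT x|lebesgue_on {0<..<T}. bump k c d x *\<^sub>R u x) = (LINT x|lebesgue_on (cbox c d). bump k c d x *\<^sub>R u x)"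
      proof (rule lebesgue_on_supp)
        fix x assume "x \<in> {0<..<T} - cbox c d"
        then show "bump k c d x *\<^sub>R u x = 0" by (auto intro!: bump_eq_0)
      qed (use cd in auto)
      then show ?thesis using zero[OF t] unfolding real_scaleR_def by (rule trans[OF sym])
    qed
    show "(\<lambda>k. bump k c d x) \<longlonglongrightarrow> indicator (box c d) x" for x
      using bump_tendsto by (simp add: box_real)
  qed
qed auto


section \<open>Square integrable functions\<close>

lemma L2_measurable: "u \<in> L2 \<Omega> \<Longrightarrow> u \<in> borel_measurable (lebesgue_on \<Omega>)"
  by (simp add: L2_def)

lemma L2_integrable_sq: "u \<in> L2 \<Omega> \<Longrightarrow> integrable (lebesgue_on \<Omega>) (\<lambda>x. (norm (u x))\<^sup>2)"
  by (simp add: L2_def)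

lemma L2_inner_integrable:
  assumes "u \<in> L2 \<Omega>" "w \<in> L2 \<Omega>"
  shows "integrable (lebesgue_on \<Omega>) (\<lambda>x. u x \<bullet> w x)"
proof (rule Bochner_Integration.integrable_bound)
  show "integrable (lebesgue_on \<Omega>) (\<lambda>x. (norm (u x))\<^sup>2 + (norm (w x))\<^sup>2)"
    using assms by (intro Bochner_Integration.integrable_add L2_integrable_sq)
  show "(\<lambda>x. u x \<bullet> w x) \<in> borel_measurable (lebesgue_on \<Omega>)"
    using assms by (intro borel_measurable_inner L2_measurable)
  have "\<bar>u x \<bullet> w x\<bar> \<le> (norm (u x))\<^sup>2 + (norm (w x))\<^sup>2" for x
  proof -
    have "\<bar>u x \<bullet> w x\<bar> \<le> norm (u x) * norm (w x)" by (rule Cauchy_Schwarz_ineq2)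
    also have "\<dots> \<le> (norm (u x))\<^sup>2 + (norm (w x))\<^sup>2"
      using sum_squares_bound[of "norm (u x)" "norm (w x)"] mult_nonneg_nonneg[OF norm_ge_zero[of "u x"] norm_ge_zero[of "w x"]]
      by linarith
    finally show ?thesis .
  qed
  then show "AE x in lebesgue_on \<Omega>. norm (u x \<bullet> w x) \<le> norm ((norm (u x))\<^sup>2 + (norm (w x))\<^sup>2)"
    by (intro AE_I2) simp
qed

lemma L2_zero [simp]: "(\<lambda>x. 0) \<in> L2 \<Omega>"
  by (simp add: L2_def)

lemma L2_scaleR: "u \<in> L2 \<Omega> \<Longrightarrow> (\<lambda>x. c *\<^sub>R u x) \<in> L2 \<Omega>"
  by (auto simp: L2_def power_mult_distrib intro!: borel_measurable_const_scaleR)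

lemma L2_add:
  assumes "u \<in> L2 \<Omega>" "w \<in> L2 \<Omega>"
  shows "(\<lambda>x. u x + w x) \<in> L2 \<Omega>"
  unfolding L2_def
proof (intro CollectI conjI)
  show "(\<lambda>x. u x + w x) \<in> borel_measurable (lebesgue_on \<Omega>)"
    using assms by (intro borel_measurable_add L2_measurable)
  have "integrable (lebesgue_on \<Omega>) (\<lambda>x. (norm (u x))\<^sup>2 + 2 * (u x \<bullet> w x) + (norm (w x))\<^sup>2)"
    using assms by (intro Bochner_Integration.integrable_add L2_integrable_sq
        integrable_mult_right L2_inner_integrable)
  moreover have "(norm (u x + w x))\<^sup>2 = (norm (u x))\<^sup>2 + 2 * (u x \<bullet> w x) + (norm (w x))\<^sup>2" for x
    by (simp add: power2_norm_eq_inner inner_add_left inner_add_right inner_commute)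
  ultimately show "integrable (lebesgue_on \<Omega>) (\<lambda>x. (norm (u x + w x))\<^sup>2)" by simp
qed

lemma L2_diff: "u \<in> L2 \<Omega> \<Longrightarrow> w \<in> L2 \<Omega> \<Longrightarrow> (\<lambda>x. u x - w x) \<in> L2 \<Omega>"
  using L2_add[of u \<Omega> "\<lambda>x. (-1) *\<^sub>R w x"] L2_scaleR[of w \<Omega> "-1"] by simp

lemma L2_sum: "(\<And>i. i \<in> I \<Longrightarrow> u i \<in> L2 \<Omega>) \<Longrightarrow> (\<lambda>x. \<Sum>i\<in>I. u i x) \<in> L2 \<Omega>"
  by (induct I rule: infinite_finite_induct) (simp_all add: L2_add)

lemma L2_bounded_linear:
  assumes L: "bounded_linear L" and u: "u \<in> L2 \<Omega>"
  shows "(\<lambda>x. L (u x)) \<in> L2 \<Omega>"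
proof -
  obtain K where K: "\<And>y. norm (L y) \<le> norm y * K" "K \<ge> 0"
    using bounded_linear.nonneg_bounded[OF L] by blast
  have m: "(\<lambda>x. L (u x)) \<in> borel_measurable (lebesgue_on \<Omega>)"
    using measurable_compose[OF L2_measurable[OF u] borel_measurable_continuous_onI[OF linear_continuous_on[OF L]]] .
  have "integrable (lebesgue_on \<Omega>) (\<lambda>x. (norm (L (u x)))\<^sup>2)"
  proof (rule Bochner_Integration.integrable_bound)
    show "integrable (lebesgue_on \<Omega>) (\<lambda>x. K\<^sup>2 * (norm (u x))\<^sup>2)"
      by (intro integrable_mult_right L2_integrable_sq u)
    show "(\<lambda>x. (norm (L (u x)))\<^sup>2) \<in> borel_measurable (lebesgue_on \<Omega>)"
      using m by simp
    have "(norm (L (u x)))\<^sup>2 \<le> K\<^sup>2 * (norm (u x))\<^sup>2" for x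
      using power_mono[OF K(1) norm_ge_zero, of "u x" 2] by (simp add: power_mult_distrib mult.commute)
    then show "AE x in lebesgue_on \<Omega>. norm ((norm (L (u x)))\<^sup>2) \<le> norm (K\<^sup>2 * (norm (u x))\<^sup>2)"
      by (intro AE_I2) simp
  qed
  with m show ?thesis by (simp add: L2_def)
qed

lemma L2_bounded_mult:
  fixes prd :: "'a::euclidean_space \<Rightarrow> 'b::euclidean_space \<Rightarrow> 'c::euclidean_space"
  assumes bb: "bounded_bilinear prd" and u: "u \<in> L2 \<Omega>"
    and m: "m \<in> borel_measurable (lebesgue_on \<Omega>)" and B: "AE x in lebesgue_on \<Omega>. norm (m x) \<le> B"
  shows "(\<lambda>x. prd (m x) (u x)) \<in> L2 \<Omega>"
proof -
  obtain K where K: "\<And>a b. norm (prd a b) \<le> norm a * norm b * K" "K \<ge> 0"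
    using bounded_bilinear.nonneg_bounded[OF bb] by blast
  have pm: "(\<lambda>x. prd (m x) (u x)) \<in> borel_measurable (lebesgue_on \<Omega>)"
  proof -
    have "continuous_on UNIV (\<lambda>p. prd (fst p) (snd p))"
      by (intro bounded_bilinear.continuous_on[OF bb] continuous_intros)
    from measurable_compose[OF borel_measurable_Pair[OF m L2_measurable[OF u]]
        borel_measurable_continuous_onI[OF this]]
    show ?thesis by simp
  qed
  have "integrable (lebesgue_on \<Omega>) (\<lambda>x. (norm (prd (m x) (u x)))\<^sup>2)"
  proof (rule Bochner_Integration.integrable_bound)
    show "integrable (lebesgue_on \<Omega>) (\<lambda>x. (B * K)\<^sup>2 * (norm (u x))\<^sup>2)"
      by (intro integrable_mult_right L2_integrable_sq u)
    show "(\<lambda>x. (norm (prd (m x) (u x)))\<^sup>2) \<in> borel_measurable (lebesgue_on \<Omega>)"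
      using pm by simp
    show "AE x in lebesgue_on \<Omega>. norm ((norm (prd (m x) (u x)))\<^sup>2) \<le> norm ((B * K)\<^sup>2 * (norm (u x))\<^sup>2)"
      using B
    proof eventually_elim
      case (elim x)
      have "norm (prd (m x) (u x)) \<le> norm (m x) * norm (u x) * K" by (rule K)
      also have "\<dots> \<le> B * norm (u x) * K"
        using elim K(2) by (intro mult_right_mono) auto
      finally have "norm (prd (m x) (u x)) \<le> (B * K) * norm (u x)" by (simp add: mult.commute mult.left_commute)
      from power_mono[OF this norm_ge_zero, of 2] show ?case
        by (simp add: power_mult_distrib)
    qed
  qed
  with pm show ?thesis by (simp add: L2_def)
qed

lemma L2_norm_nonneg [simp]: "0 \<le> L2_norm \<Omega> u"
  by (simp add: L2_norm_def)

lemma L2_norm_sq: "(L2_norm \<Omega> u)\<^sup>2 = (LINT x|lebesgue_on \<Omega>. (norm (u x))\<^sup>2)"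
  by (simp add: L2_norm_def)

lemma L2_inner_self: "L2_inner \<Omega> u u = (L2_norm \<Omega> u)\<^sup>2"
  by (simp add: L2_norm_sq L2_inner_def power2_norm_eq_inner)

lemma L2_norm_zero [simp]: "L2_norm \<Omega> (\<lambda>x. 0) = 0"
  by (simp add: L2_norm_def)

lemma L2_inner_zero [simp]: "L2_inner \<Omega> (\<lambda>x. 0) w = 0" "L2_inner \<Omega> w (\<lambda>x. 0) = 0"
  by (simp_all add: L2_inner_def)

lemma L2_norm_scaleR: "L2_norm \<Omega> (\<lambda>x. c *\<^sub>R u x) = \<bar>c\<bar> * L2_norm \<Omega> u"
  by (simp add: L2_norm_def power_mult_distrib real_sqrt_mult)

lemma L2_norm_minus_commute: "L2_norm \<Omega> (\<lambda>x. u x - w x) = L2_norm \<Omega> (\<lambda>x. w x - u x)"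
  by (simp add: L2_norm_def norm_minus_commute)

lemma L2_inner_commute: "L2_inner \<Omega> u w = L2_inner \<Omega> w u"
  by (simp add: L2_inner_def inner_commute)

lemma L2_inner_add_left:
  "u \<in> L2 \<Omega> \<Longrightarrow> w \<in> L2 \<Omega> \<Longrightarrow> z \<in> L2 \<Omega> \<Longrightarrow>
    L2_inner \<Omega> (\<lambda>x. u x + w x) z = L2_inner \<Omega> u z + L2_inner \<Omega> w z"
  unfolding L2_inner_def
  by (simp add: inner_add_left L2_inner_integrable)

lemma L2_inner_diff_left:
  "u \<in> L2 \<Omega> \<Longrightarrow> w \<in> L2 \<Omega> \<Longrightarrow> z \<in> L2 \<Omega> \<Longrightarrow>
    L2_inner \<Omega> (\<lambda>x. u x - w x) z = L2_inner \<Omega> u z - L2_inner \<Omega> w z"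
  unfolding L2_inner_def
  by (simp add: inner_diff_left L2_inner_integrable)

lemma L2_inner_add_right:
  "u \<in> L2 \<Omega> \<Longrightarrow> w \<in> L2 \<Omega> \<Longrightarrow> z \<in> L2 \<Omega> \<Longrightarrow>
    L2_inner \<Omega> z (\<lambda>x. u x + w x) = L2_inner \<Omega> z u + L2_inner \<Omega> z w"
  unfolding L2_inner_commute[of \<Omega> z "\<lambda>x. u x + w x"] L2_inner_commute[of \<Omega> z u]
    L2_inner_commute[of \<Omega> z w]
  by (rule L2_inner_add_left)

lemma L2_inner_diff_right:
  "u \<in> L2 \<Omega> \<Longrightarrow> w \<in> L2 \<Omega> \<Longrightarrow> z \<in> L2 \<Omega> \<Longrightarrow>
    L2_inner \<Omega> z (\<lambda>x. u x - w x) = L2_inner \<Omega> z u - L2_inner \<Omega> z w"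
  unfolding L2_inner_commute[of \<Omega> z "\<lambda>x. u x - w x"] L2_inner_commute[of \<Omega> z u]
    L2_inner_commute[of \<Omega> z w]
  by (rule L2_inner_diff_left)

lemma L2_inner_scaleR_left [simp]: "L2_inner \<Omega> (\<lambda>x. c *\<^sub>R u x) w = c * L2_inner \<Omega> u w"
  by (simp add: L2_inner_def)

lemma L2_inner_scaleR_right [simp]: "L2_inner \<Omega> u (\<lambda>x. c *\<^sub>R w x) = c * L2_inner \<Omega> u w"
  by (simp add: L2_inner_def)

lemma L2_norm_diff_sq:
  assumes "u \<in> L2 \<Omega>" "w \<in> L2 \<Omega>"
  shows "(L2_norm \<Omega> (\<lambda>x. u x - w x))\<^sup>2 = (L2_norm \<Omega> u)\<^sup>2 - 2 * L2_inner \<Omega> u w + (L2_norm \<Omega> w)\<^sup>2"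
  using assms L2_diff[OF assms]
  by (simp add: L2_inner_self[symmetric] L2_inner_diff_left L2_inner_diff_right L2_inner_commute[of \<Omega> w u])

lemma L2_norm_add_sq:
  assumes "u \<in> L2 \<Omega>" "w \<in> L2 \<Omega>"
  shows "(L2_norm \<Omega> (\<lambda>x. u x + w x))\<^sup>2 = (L2_norm \<Omega> u)\<^sup>2 + 2 * L2_inner \<Omega> u w + (L2_norm \<Omega> w)\<^sup>2"
  using assms L2_add[OF assms]
  by (simp add: L2_inner_self[symmetric] L2_inner_add_left L2_inner_add_right L2_inner_commute[of \<Omega> w u])

lemma L2_Cauchy_Schwarz:
  assumes "u \<in> L2 \<Omega>" "w \<in> L2 \<Omega>"
  shows "\<bar>L2_inner \<Omega> u w\<bar> \<le> L2_norm \<Omega> u * L2_norm \<Omega> w"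
proof -
  define a b c where "a = (L2_norm \<Omega> w)\<^sup>2" and "b = L2_inner \<Omega> u w" and "c = (L2_norm \<Omega> u)\<^sup>2"
  have q: "0 \<le> c - 2 * t * b + t\<^sup>2 * a" for t
    using L2_norm_diff_sq[OF assms(1) L2_scaleR[OF assms(2), of t]]
      zero_le_power2[of "L2_norm \<Omega> (\<lambda>x. u x - t *\<^sub>R w x)"]
    by (simp add: L2_norm_scaleR power_mult_distrib a_def b_def c_def)
  have "b\<^sup>2 \<le> c * a"
  proof (cases "a = 0")
    case True
    have "b = 0"
    proof (rule ccontr)
      assume "b \<noteq> 0"
      then have "0 \<le> - c - 2" using q[of "(c + 1) / b"] True by simp
      moreover have "0 \<le> c" by (simp add: c_def)
      ultimately show False by linarith
    qed
    then show ?thesis using True by simp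
  next
    case False
    then have "a > 0" by (simp add: a_def)
    then show ?thesis
      using q[of "b / a"] by (simp add: power2_eq_square field_simps)
  qed
  then have "\<bar>b\<bar>\<^sup>2 \<le> (L2_norm \<Omega> u * L2_norm \<Omega> w)\<^sup>2"
    by (simp add: a_def c_def power_mult_distrib)
  then show ?thesis
    unfolding b_def by (rule power2_le_imp_le) simp
qed

lemma L2_norm_triangle:
  assumes "u \<in> L2 \<Omega>" "w \<in> L2 \<Omega>"
  shows "L2_norm \<Omega> (\<lambda>x. u x + w x) \<le> L2_norm \<Omega> u + L2_norm \<Omega> w"
proof (rule power2_le_imp_le)
  show "(L2_norm \<Omega> (\<lambda>x. u x + w x))\<^sup>2 \<le> (L2_norm \<Omega> u + L2_norm \<Omega> w)\<^sup>2"
    using L2_norm_add_sq[OF assms] L2_Cauchy_Schwarz[OF assms]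
    by (simp add: power2_sum)
qed simp

lemma L2_norm_triangle_diff:
  assumes "u \<in> L2 \<Omega>" "w \<in> L2 \<Omega>"
  shows "\<bar>L2_norm \<Omega> u - L2_norm \<Omega> w\<bar> \<le> L2_norm \<Omega> (\<lambda>x. u x - w x)"
proof -
  have "L2_norm \<Omega> u \<le> L2_norm \<Omega> (\<lambda>x. u x - w x) + L2_norm \<Omega> w"
    using L2_norm_triangle[OF L2_diff[OF assms] assms(2)] by simp
  moreover have "L2_norm \<Omega> w \<le> L2_norm \<Omega> (\<lambda>x. w x - u x) + L2_norm \<Omega> u"
    using L2_norm_triangle[OF L2_diff[OF assms(2,1)] assms(1)] by simp
  ultimately show ?thesis
    using L2_norm_minus_commute[of \<Omega> u w] by linarith
qed

lemma L2_norm_tendsto: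
  assumes "\<forall>\<^sub>F k in F. y k \<in> L2 \<Omega>" "u \<in> L2 \<Omega>" "((\<lambda>k. L2_norm \<Omega> (\<lambda>x. y k x - u x)) \<longlongrightarrow> 0) F"
  shows "((\<lambda>k. L2_norm \<Omega> (y k)) \<longlongrightarrow> L2_norm \<Omega> u) F"
proof -
  have "((\<lambda>k. L2_norm \<Omega> (y k) - L2_norm \<Omega> u) \<longlongrightarrow> 0) F"
  proof (rule Lim_null_comparison[OF _ assms(3)])
    show "\<forall>\<^sub>F k in F. norm (L2_norm \<Omega> (y k) - L2_norm \<Omega> u) \<le> L2_norm \<Omega> (\<lambda>x. y k x - u x)"
      using assms(1)
    proof eventually_elim
      case (elim k)
      show ?case using L2_norm_triangle_diff[OF elim assms(2)] by simp
    qed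
  qed
  then show ?thesis by (simp add: LIM_zero_iff)
qed

lemma L2_inner_tendsto:
  assumes "\<forall>\<^sub>F k in F. y k \<in> L2 \<Omega>" "u \<in> L2 \<Omega>" "((\<lambda>k. L2_norm \<Omega> (\<lambda>x. y k x - u x)) \<longlongrightarrow> 0) F"
    and "\<forall>\<^sub>F k in F. z k \<in> L2 \<Omega>" "w \<in> L2 \<Omega>" "((\<lambda>k. L2_norm \<Omega> (\<lambda>x. z k x - w x)) \<longlongrightarrow> 0) F"
  shows "((\<lambda>k. L2_inner \<Omega> (y k) (z k)) \<longlongrightarrow> L2_inner \<Omega> u w) F"
proof -
  have "((\<lambda>k. L2_inner \<Omega> (y k) (z k) - L2_inner \<Omega> u w) \<longlongrightarrow> 0) F"
  proof (rule Lim_null_comparison)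
    show "\<forall>\<^sub>F k in F. norm (L2_inner \<Omega> (y k) (z k) - L2_inner \<Omega> u w) \<le>
       L2_norm \<Omega> (\<lambda>x. y k x - u x) * L2_norm \<Omega> (z k) + L2_norm \<Omega> u * L2_norm \<Omega> (\<lambda>x. z k x - w x)"
      using assms(1,4)
    proof eventually_elim
      case (elim k)
      have "L2_inner \<Omega> (y k) (z k) - L2_inner \<Omega> u w =
        L2_inner \<Omega> (\<lambda>x. y k x - u x) (z k) + L2_inner \<Omega> u (\<lambda>x. z k x - w x)"
        using assms(2,5) elim by (simp add: L2_inner_diff_left L2_inner_diff_right L2_diff)
      then show ?case
        using L2_Cauchy_Schwarz[OF L2_diff[OF elim(1) assms(2)] elim(2)]
          L2_Cauchy_Schwarz[OF assms(2) L2_diff[OF elim(2) assms(5)]]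
        by (simp only: real_norm_def)
    qed
    have "((\<lambda>k. L2_norm \<Omega> (\<lambda>x. y k x - u x) * L2_norm \<Omega> (z k) + L2_norm \<Omega> u * L2_norm \<Omega> (\<lambda>x. z k x - w x))
       \<longlongrightarrow> 0 * L2_norm \<Omega> w + L2_norm \<Omega> u * 0) F"
      by (intro tendsto_add tendsto_mult tendsto_const assms(3,6) L2_norm_tendsto[OF assms(4,5,6)])
    then show "((\<lambda>k. L2_norm \<Omega> (\<lambda>x. y k x - u x) * L2_norm \<Omega> (z k) + L2_norm \<Omega> u * L2_norm \<Omega> (\<lambda>x. z k x - w x))
       \<longlongrightarrow> 0) F" by simp
  qed
  then show ?thesis by (simp add: LIM_zero_iff)
qed

lemma L2_inner_tendsto_left:
  assumes "\<forall>\<^sub>F k in F. y k \<in> L2 \<Omega>" "u \<in> L2 \<Omega>" "((\<lambda>k. L2_norm \<Omega> (\<lambda>x. y k x - u x)) \<longlongrightarrow> 0) F" "w \<in> L2 \<Omega>"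
  shows "((\<lambda>k. L2_inner \<Omega> (y k) w) \<longlongrightarrow> L2_inner \<Omega> u w) F"
  using L2_inner_tendsto[OF assms(1,2,3), of "\<lambda>_. w" w] assms(4) by simp

section \<open>Function spaces over a bounded open set\<close>

text \<open>Openness makes test functions plentiful; boundedness makes bounded functions square
  integrable.\<close>

locale bounded_open =
  fixes \<Omega> :: "(real ^ 'n) set"
  assumes open_dom: "open \<Omega>" and bounded_dom: "bounded \<Omega>"
begin

lemma sets_dom [simp, intro]: "\<Omega> \<in> sets lebesgue"
  using open_dom by auto

lemma finite_measure_dom: "finite_measure (lebesgue_on \<Omega>)"
  using bounded_dom open_dom by (intro finite_measure_lebesgue_on bounded_set_imp_lmeasurable) auto

lemma L2_norm_cong_AE:
  assumes "AE x in lebesgue_on \<Omega>. u x = w x"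
  shows "L2_norm \<Omega> u = L2_norm \<Omega> w"
proof -
  have "AE x in lebesgue_on \<Omega>. (norm (u x))\<^sup>2 = (norm (w x))\<^sup>2"
    using assms by eventually_elim simp
  from integral_AE_cong_lebesgue_on[OF sets_dom this] show ?thesis
    by (simp only: L2_norm_def)
qed

lemma L2_inner_cong_AE:
  assumes "AE x in lebesgue_on \<Omega>. u x = u' x" "AE x in lebesgue_on \<Omega>. w x = w' x"
  shows "L2_inner \<Omega> u w = L2_inner \<Omega> u' w'"
proof -
  have "AE x in lebesgue_on \<Omega>. u x \<bullet> w x = u' x \<bullet> w' x"
    using assms by eventually_elim simp
  from integral_AE_cong_lebesgue_on[OF sets_dom this] show ?thesis
    by (simp only: L2_inner_def)
qed

lemma L2_cong_AE:
  assumes "AE x in lebesgue_on \<Omega>. u x = w x" "u \<in> L2 \<Omega>"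
  shows "w \<in> L2 \<Omega>"
proof -
  have "AE x in lebesgue_on \<Omega>. (norm (u x))\<^sup>2 = (norm (w x))\<^sup>2"
    using assms(1) by eventually_elim simp
  then show ?thesis
    using assms measurable_AE_cong_lebesgue_on[OF sets_dom assms(1)]
      integrable_AE_cong_lebesgue_on[OF sets_dom, of "\<lambda>x. (norm (u x))\<^sup>2" "\<lambda>x. (norm (w x))\<^sup>2"]
    by (simp add: L2_def)
qed

lemma L2_bounded:
  assumes "u \<in> borel_measurable (lebesgue_on \<Omega>)" "AE x in lebesgue_on \<Omega>. norm (u x) \<le> B"
  shows "u \<in> L2 \<Omega>"
proof -
  have "integrable (lebesgue_on \<Omega>) (\<lambda>x. (norm (u x))\<^sup>2)"
  proof (rule finite_measure.integrable_const_bound[OF finite_measure_dom])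
    show "AE x in lebesgue_on \<Omega>. norm ((norm (u x))\<^sup>2) \<le> B\<^sup>2"
      using assms(2) by eventually_elim (simp add: power_mono)
  qed (use assms in simp)
  with assms(1) show ?thesis by (simp add: L2_def)
qed

lemma L2_norm_le_bound:
  assumes "\<And>x. x \<in> \<Omega> \<Longrightarrow> norm (u x) \<le> B" "u \<in> borel_measurable (lebesgue_on \<Omega>)" "0 \<le> B"
  shows "L2_norm \<Omega> u \<le> B * sqrt (measure lebesgue \<Omega>)"
proof -
  have "u \<in> L2 \<Omega>" using assms by (intro L2_bounded AE_I2) auto
  have "(LINT x|lebesgue_on \<Omega>. (norm (u x))\<^sup>2) \<le> (LINT x|lebesgue_on \<Omega>. B\<^sup>2)"
  proof (rule integral_mono)
    show "integrable (lebesgue_on \<Omega>) (\<lambda>x. B\<^sup>2)"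
      by (rule finite_measure.integrable_const[OF finite_measure_dom])
    show "(norm (u x))\<^sup>2 \<le> B\<^sup>2" if "x \<in> space (lebesgue_on \<Omega>)" for x
      using that assms(1)[of x] by (simp add: power_mono)
  qed (rule L2_integrable_sq, fact)
  also have "\<dots> = B\<^sup>2 * measure lebesgue \<Omega>"
    by (simp add: measure_restrict_space)
  finally have "L2_norm \<Omega> u \<le> sqrt (B\<^sup>2 * measure lebesgue \<Omega>)"
    unfolding L2_norm_def by (rule real_sqrt_le_mono)
  then show ?thesis using assms(3) by (simp add: real_sqrt_mult)
qed

lemma L2_integrable:
  assumes "u \<in> L2 \<Omega>"
  shows "integrable (lebesgue_on \<Omega>) u"
proof (rule Bochner_Integration.integrable_bound)
  show "integrable (lebesgue_on \<Omega>) (\<lambda>x. 1 + (norm (u x))\<^sup>2)"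
    using finite_measure.integrable_const[OF finite_measure_dom]
    by (intro Bochner_Integration.integrable_add L2_integrable_sq assms)
  have "norm (u x) \<le> 1 + (norm (u x))\<^sup>2" for x
    using sum_squares_bound[of 1 "norm (u x)"] norm_ge_zero[of "u x"] by (simp, linarith)
  then show "AE x in lebesgue_on \<Omega>. norm (u x) \<le> norm (1 + (norm (u x))\<^sup>2)"
    by (intro AE_I2) simp
qed (rule L2_measurable[OF assms])

lemma smooth_measurable: 
  fixes \<phi> :: "real ^ 'n \<Rightarrow> 'b::euclidean_space"
  shows "smooth_fun \<phi> \<Longrightarrow> \<phi> \<in> borel_measurable (lebesgue_on \<Omega>)"
  by (rule continuous_imp_measurable_on_sets_lebesgue[OF smooth_fun_continuous]) auto

lemma Cc_inf_L2: 
  fixes \<phi> :: "real ^ 'n \<Rightarrow> 'b::euclidean_space"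
  assumes "\<phi> \<in> Cc_inf S"
  shows "\<phi> \<in> L2 \<Omega>"
proof -
  obtain B where "B > 0" "\<And>x. norm (\<phi> x) \<le> B" using Cc_inf_bounded[OF assms] by blast
  then show ?thesis
    using smooth_measurable[OF Cc_inf_smooth[OF assms]] by (intro L2_bounded[of \<phi> B] AE_I2)
qed

end


section \<open>Integration by parts and weak derivatives\<close>

lemma has_vector_derivative_iff_quotient:
  "(f has_vector_derivative D) (at t within S) \<longleftrightarrow>
    ((\<lambda>\<tau>. (1 / (\<tau> - t)) *\<^sub>R (f \<tau> - f t)) \<longlongrightarrow> D) (at t within S)"
proof -
  have "norm (f y - f t - (y - t) *\<^sub>R D) / norm (y - t) = norm ((1 / (y - t)) *\<^sub>R (f y - f t) - D)"
    if "y \<noteq> t" for y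
  proof -
    have "(1 / (y - t)) *\<^sub>R (f y - f t) - D = (1 / (y - t)) *\<^sub>R (f y - f t - (y - t) *\<^sub>R D)"
      using that by (simp add: scaleR_diff_right)
    then show ?thesis by (simp add: divide_inverse mult.commute)
  qed
  then have "\<forall>\<^sub>F y in at t within S. norm (f y - f t - (y - t) *\<^sub>R D) / norm (y - t)
      = norm ((1 / (y - t)) *\<^sub>R (f y - f t) - D)"
    by (simp add: eventually_at_filter)
  from tendsto_cong[OF this, of 0] show ?thesis
    by (simp add: has_vector_derivative_def has_derivative_iff_norm bounded_linear_scaleR_left
        tendsto_norm_zero_iff LIM_zero_iff)
qed

lemma smooth_line_derivative:
  assumes "smooth_fun F"
  shows "((\<lambda>s. F (x + s *\<^sub>R axis j 1)) has_vector_derivative partial_deriv j F (x + s *\<^sub>R axis j 1)) (at s)"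
proof -
  let ?D = "frechet_derivative F (at (x + s *\<^sub>R axis j 1))"
  have 1: "((\<lambda>s. x + s *\<^sub>R axis j 1) has_derivative (\<lambda>h. h *\<^sub>R axis j 1)) (at s)"
    by (auto intro!: derivative_eq_intros)
  have 2: "(F has_derivative ?D) (at (x + s *\<^sub>R axis j 1))"
    by (rule smooth_fun_has_derivative[OF assms])
  have "?D (h *\<^sub>R axis j 1) = h *\<^sub>R ?D (axis j 1)" for h
    using linear_frechet_derivative[OF smooth_fun_differentiable[OF assms]] by (simp add: linear_scale)
  with has_derivative_compose[OF 1 2] show ?thesis
    by (simp add: has_vector_derivative_def partial_deriv_def)
qed

lemma smooth_difference_bound:
  assumes "smooth_fun F" "\<And>x. norm (partial_deriv j F x) \<le> B"
  shows "norm (F (x + h *\<^sub>R axis j 1) - F x) \<le> B * \<bar>h\<bar>"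
proof -
  have "norm (F (x + h *\<^sub>R axis j 1) - F (x + 0 *\<^sub>R axis j 1)) \<le> B * norm (h - 0)"
  proof (rule differentiable_bound[of UNIV _ "\<lambda>s h. h *\<^sub>R partial_deriv j F (x + s *\<^sub>R axis j 1)"])
    show "((\<lambda>s. F (x + s *\<^sub>R axis j 1)) has_derivative (\<lambda>h. h *\<^sub>R partial_deriv j F (x + s *\<^sub>R axis j 1))) (at s)" for s
      using smooth_line_derivative[OF assms(1)] by (simp add: has_vector_derivative_def)
    show "onorm (\<lambda>h. h *\<^sub>R partial_deriv j F (x + s *\<^sub>R axis j 1)) \<le> B" for s
      using mult_right_mono[OF assms(2) abs_ge_zero] by (intro onorm_le) (simp add: mult.commute)
  qed auto
  then show ?thesis by simp
qed

lemma bounded_support_integrable: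
  fixes f :: "'a::euclidean_space \<Rightarrow> 'b::euclidean_space"
  assumes "f \<in> borel_measurable lborel" "\<And>x. norm (f x) \<le> B" "\<And>x. x \<notin> cball 0 R \<Longrightarrow> f x = 0"
  shows "integrable lborel f"
proof (rule Bochner_Integration.integrable_bound)
  show "integrable lborel (\<lambda>x. indicat_real (cball 0 R) x *\<^sub>R B)"
    by (intro integrable_scaleR_left integrable_real_indicator) (use emeasure_bounded_finite[OF bounded_cball] in simp_all)
  have "norm (f x) \<le> norm (indicat_real (cball 0 R) x *\<^sub>R B)" for x
    using assms(2,3)[of x] by (cases "x \<in> cball 0 R") (auto intro: order.trans[OF _ abs_ge_self])
  then show "AE x in lborel. norm (f x) \<le> norm (indicat_real (cball 0 R) x *\<^sub>R B)" by simp
qed (use assms in simp)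

lemma smooth_borel: 
  fixes F :: "real ^ 'n \<Rightarrow> 'b::euclidean_space"
  shows "smooth_fun F \<Longrightarrow> F \<in> borel_measurable borel"
  by (rule borel_measurable_continuous_onI[OF smooth_fun_continuous])

lemma Cc_inf_integrable_lborel:
  fixes F :: "real ^ 'n \<Rightarrow> 'b::euclidean_space"
  assumes "F \<in> Cc_inf S"
  shows "integrable lborel F"
proof -
  obtain B where "\<And>x. norm (F x) \<le> B" using Cc_inf_bounded[OF assms] by blast
  moreover obtain C where C: "compact C" "\<And>x. x \<notin> C \<Longrightarrow> F x = 0" using Cc_infE[OF assms] by metis
  moreover obtain R where "\<And>x. x \<in> C \<Longrightarrow> norm x \<le> R"
    using compact_imp_bounded[OF C(1)] unfolding bounded_iff by blast
  ultimately show ?thesis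
    using smooth_borel[OF Cc_inf_smooth[OF assms]]
    by (intro bounded_support_integrable[of F B R]) (auto simp: mem_cball_0)
qed

text \<open>A difference quotient of \<open>F\<close> has integral zero by translation invariance.
  With step size at most 1 the quotients are bounded and supported in one ball, so dominated
  convergence carries this over to the derivative.\<close>

lemma partial_deriv_integral_zero:
  fixes F :: "real ^ 'n \<Rightarrow> 'b::euclidean_space"
  assumes F: "F \<in> Cc_inf S"
  shows "(LINT x|lborel. partial_deriv j F x) = 0"
proof -
  have sm: "smooth_fun F" by (rule Cc_inf_smooth[OF F])
  obtain B where B: "\<And>x. norm (partial_deriv j F x) \<le> B"
    using Cc_inf_bounded[OF Cc_inf_partial[OF F]] by blast
  obtain C where C: "compact C" "\<And>x. x \<notin> C \<Longrightarrow> F x = 0" using Cc_infE[OF F] by metis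
  obtain R where R: "\<And>x. x \<in> C \<Longrightarrow> norm x \<le> R"
    using compact_imp_bounded[OF C(1)] unfolding bounded_iff by blast
  define h where "h k = 1 / real (Suc k)" for k
  have h: "0 < h k" "h k \<le> 1" for k by (simp_all add: h_def)
  define Q where "Q k x = (1 / h k) *\<^sub>R (F (x + h k *\<^sub>R axis j 1) - F x)" for k x
  have iF: "integrable lborel F" by (rule Cc_inf_integrable_lborel[OF F])
  have Fb: "F \<in> borel_measurable borel" by (rule smooth_borel[OF sm])
  have shift: "integrable lborel (\<lambda>x. F (c + x)) \<and> (LINT x|lborel. F (c + x)) = (LINT x|lborel. F x)" for c
  proof -
    have m: "(+) c \<in> measurable lborel borel" by simp
    show ?thesis
      using integrable_distr_eq[OF m Fb] integral_distr[OF m Fb] iF by (simp add: lborel_distr_plus)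
  qed
  have Q0: "(LINT x|lborel. Q k x) = 0" for k
    unfolding Q_def using shift[of "h k *\<^sub>R axis j 1"] iF by (simp add: add.commute)
  have "(\<lambda>k. LINT x|lborel. Q k x) \<longlonglongrightarrow> (LINT x|lborel. partial_deriv j F x)"
  proof (rule integral_dominated_convergence[where w="\<lambda>x. indicator (cball 0 (R + 1)) x *\<^sub>R B"])
    show "partial_deriv j F \<in> borel_measurable lborel"
      using smooth_borel[OF smooth_fun_partial[OF sm]] by simp
    show "Q k \<in> borel_measurable lborel" for k
      unfolding Q_def using shift[of "h k *\<^sub>R axis j 1"] iF
      by (intro borel_measurable_scaleR borel_measurable_diff borel_measurable_const borel_measurable_integrable)
        (simp_all add: add.commute)
    show "integrable lborel (\<lambda>x. indicat_real (cball 0 (R + 1)) x *\<^sub>R B)"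
      by (intro integrable_scaleR_left integrable_real_indicator) (use emeasure_bounded_finite[OF bounded_cball] in simp_all)
    show "AE x in lborel. (\<lambda>k. Q k x) \<longlonglongrightarrow> partial_deriv j F x"
    proof (rule AE_I2)
      fix x
      have "((\<lambda>s. (1 / (s - 0)) *\<^sub>R (F (x + s *\<^sub>R axis j 1) - F (x + 0 *\<^sub>R axis j 1)))
          \<longlongrightarrow> partial_deriv j F (x + 0 *\<^sub>R axis j 1)) (at 0)"
        using smooth_line_derivative[OF sm, of x j 0] unfolding has_vector_derivative_iff_quotient .
      then have lim: "((\<lambda>s. (1 / s) *\<^sub>R (F (x + s *\<^sub>R axis j 1) - F x)) \<longlongrightarrow> partial_deriv j F x) (at 0)"
        by simp
      have "h \<longlonglongrightarrow> 0" unfolding h_def using LIMSEQ_inverse_real_of_nat by (simp add: inverse_eq_divide)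
      moreover have "\<forall>\<^sub>F k in sequentially. h k \<noteq> 0" using h(1) by (simp add: less_imp_neq[symmetric])
      ultimately have "filterlim h (at 0) sequentially" by (simp add: filterlim_at)
      from filterlim_compose[OF lim this] show "(\<lambda>k. Q k x) \<longlonglongrightarrow> partial_deriv j F x"
        unfolding Q_def .
    qed
    show "AE x in lborel. norm (Q k x) \<le> indicat_real (cball 0 (R + 1)) x *\<^sub>R B" for k
    proof (rule AE_I2)
      fix x :: "real ^ 'n"
      show "norm (Q k x) \<le> indicat_real (cball 0 (R + 1)) x *\<^sub>R B"
      proof (cases "x \<in> cball 0 (R + 1)")
        case True
        have "norm (Q k x) = norm (F (x + h k *\<^sub>R axis j 1) - F x) / h k"
          unfolding Q_def using h(1)[of k] by simp
        also have "\<dots> \<le> (B * \<bar>h k\<bar>) / h k"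
          using smooth_difference_bound[OF sm B, of x "h k"] h(1)[of k] by (intro divide_right_mono) auto
        also have "\<dots> = B" using h(1)[of k] by simp
        finally show ?thesis using True by simp
      next
        case False
        have a: "norm (axis j 1 :: real ^ 'n) = 1" by simp
        have "norm x \<le> norm (x + h k *\<^sub>R axis j 1) + norm (h k *\<^sub>R axis j (1::real))"
          by (metis add_diff_cancel_right' norm_triangle_ineq4)
        then have "norm x \<le> norm (x + h k *\<^sub>R axis j 1) + 1"
          using a h(1)[of k] h(2)[of k] by simp
        then have "x + h k *\<^sub>R axis j 1 \<notin> cball 0 R" "x \<notin> cball 0 R" using False by auto
        then have "F (x + h k *\<^sub>R axis j 1) = 0" "F x = 0"
          using R C(2) by (meson mem_cball_0)+
        then show ?thesis using False by (simp add: Q_def)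
      qed
    qed
  qed
  then show ?thesis using Q0 by (simp add: LIMSEQ_const_iff)
qed

context bounded_open begin

lemma Cc_inf_integral_dom:
  fixes F :: "real ^ 'n \<Rightarrow> 'b::euclidean_space"
  assumes "F \<in> Cc_inf \<Omega>"
  shows "(LINT x|lebesgue_on \<Omega>. F x) = (LINT x|lborel. F x)"
proof -
  obtain C where C: "C \<subseteq> \<Omega>" "\<And>x. x \<notin> C \<Longrightarrow> F x = 0" using Cc_infE[OF assms] by metis
  have "(LINT x|lebesgue_on UNIV. F x) = (LINT x|lebesgue_on \<Omega>. F x)"
    by (rule lebesgue_on_supp) (use C in auto)
  moreover have "(LINT x|lebesgue. F x) = (LINT x|lborel. F x)"
    by (rule integral_completion) (use smooth_borel[OF Cc_inf_smooth[OF assms]] in simp)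
  ultimately show ?thesis by (simp add: lebesgue_on_UNIV_eq)
qed

lemma integrable_loc_integrable:
  fixes u :: "real ^ 'n \<Rightarrow> 'b::euclidean_space"
  assumes "integrable (lebesgue_on \<Omega>) u"
  shows "loc_integrable \<Omega> u"
  unfolding loc_integrable_def
proof (intro allI impI, elim conjE)
  fix C :: "(real ^ 'n) set" assume "compact C" "C \<subseteq> \<Omega>"
  then show "integrable (lebesgue_on C) u"
    by (intro integrable_lebesgue_on_subset[OF assms]) (auto simp: borel_compact)
qed

lemma L2_loc_integrable: "u \<in> L2 \<Omega> \<Longrightarrow> loc_integrable \<Omega> u"
  by (intro integrable_loc_integrable L2_integrable)

lemma loc_integrable_add:
  "loc_integrable \<Omega> u \<Longrightarrow> loc_integrable \<Omega> w \<Longrightarrow> loc_integrable \<Omega> (\<lambda>x. u x + w x)"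
  unfolding loc_integrable_def by simp

lemma loc_integrable_diff:
  "loc_integrable \<Omega> u \<Longrightarrow> loc_integrable \<Omega> w \<Longrightarrow> loc_integrable \<Omega> (\<lambda>x. u x - w x)"
  unfolding loc_integrable_def by simp

lemma loc_integrable_scaleR:
  "loc_integrable \<Omega> u \<Longrightarrow> loc_integrable \<Omega> (\<lambda>x. c *\<^sub>R u x)"
  unfolding loc_integrable_def by simp

lemma loc_integrable_cong_AE:
  assumes "AE x in lebesgue_on \<Omega>. u x = w x"
  shows "loc_integrable \<Omega> u = loc_integrable \<Omega> w"
proof -
  have "integrable (lebesgue_on C) u = integrable (lebesgue_on C) w" if "compact C" "C \<subseteq> \<Omega>" for C
  proof -
    have C: "C \<in> sets lebesgue" using that by (auto simp: borel_compact)
    show ?thesis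
      by (rule integrable_AE_cong_lebesgue_on[OF C AE_lebesgue_on_subset[OF assms that(2) sets_dom C]])
  qed
  then show ?thesis unfolding loc_integrable_def by auto
qed

lemma loc_integrable_mult_Cc_inf:
  fixes u :: "real ^ 'n \<Rightarrow> 'b::euclidean_space" and \<phi> :: "real ^ 'n \<Rightarrow> real"
  assumes u: "loc_integrable \<Omega> u" and \<phi>: "\<phi> \<in> Cc_inf \<Omega>"
  shows "integrable (lebesgue_on \<Omega>) (\<lambda>x. \<phi> x *\<^sub>R u x)"
proof -
  obtain C where C: "compact C" "C \<subseteq> \<Omega>" "\<And>x. x \<notin> C \<Longrightarrow> \<phi> x = 0" using Cc_infE[OF \<phi>] by metis
  obtain B where B: "\<And>x. norm (\<phi> x) \<le> B" using Cc_inf_bounded[OF \<phi>] by blast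
  have Cm: "C \<in> sets lebesgue" using C(1) by (auto simp: borel_compact)
  have iu: "integrable (lebesgue_on C) u" using u C unfolding loc_integrable_def by blast
  have "integrable (lebesgue_on C) (\<lambda>x. \<phi> x *\<^sub>R u x)"
  proof (rule Bochner_Integration.integrable_bound)
    show "integrable (lebesgue_on C) (\<lambda>x. B * norm (u x))" using iu by simp
    show "(\<lambda>x. \<phi> x *\<^sub>R u x) \<in> borel_measurable (lebesgue_on C)"
      by (intro borel_measurable_scaleR borel_measurable_integrable[OF iu]
          continuous_imp_measurable_on_sets_lebesgue[OF smooth_fun_continuous[OF Cc_inf_smooth[OF \<phi>]] Cm])
    have "norm (\<phi> x *\<^sub>R u x) \<le> norm (B * norm (u x))" for x
      using mult_right_mono[OF B norm_ge_zero[of "u x"], of x]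
      by (simp add: order.trans[OF _ abs_ge_self])
    then show "AE x in lebesgue_on C. norm (\<phi> x *\<^sub>R u x) \<le> norm (B * norm (u x))" by simp
  qed
  moreover have "integrable (lebesgue_on \<Omega>) (\<lambda>x. \<phi> x *\<^sub>R u x) = integrable (lebesgue_on C) (\<lambda>x. \<phi> x *\<^sub>R u x)"
    by (rule lebesgue_on_supp) (use C Cm in auto)
  ultimately show ?thesis by simp
qed

lemma weak_partial_loc_integrable:
  assumes "weak_partial \<Omega> j u g"
  shows "loc_integrable \<Omega> u" "loc_integrable \<Omega> g"
  by (rule conjunct1[OF assms[unfolded weak_partial_def]],
      rule conjunct1[OF conjunct2[OF assms[unfolded weak_partial_def]]])

lemma weak_partial_eq:
  assumes "weak_partial \<Omega> j u g" "\<phi> \<in> Cc_inf \<Omega>"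
  shows "(LINT x|lebesgue_on \<Omega>. (partial_deriv j \<phi> x :: real) *\<^sub>R u x) =
    - (LINT x|lebesgue_on \<Omega>. \<phi> x *\<^sub>R g x)"
  by (rule bspec[OF conjunct2[OF conjunct2[OF assms(1)[unfolded weak_partial_def]]] assms(2)])

text \<open>By the fundamental lemma. Thus the representative chosen in
  \<^const>\<open>wpartial\<close> is determined up to a null set.\<close>

lemma weak_partial_unique:
  fixes u :: "real ^ 'n \<Rightarrow> 'b::euclidean_space"
  assumes "weak_partial \<Omega> j u g" "weak_partial \<Omega> j u h"
  shows "AE x in lebesgue_on \<Omega>. g x = h x"
proof -
  note l = weak_partial_loc_integrable(2)[OF assms(1)] weak_partial_loc_integrable(2)[OF assms(2)]
  have "AE x in lebesgue_on \<Omega>. g x - h x = 0"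
  proof (rule fundamental_lemma[OF open_dom loc_integrable_diff[OF l]])
    fix \<phi> :: "real ^ 'n \<Rightarrow> real" assume \<phi>: "\<phi> \<in> Cc_inf \<Omega>"
    have "(LINT x|lebesgue_on \<Omega>. \<phi> x *\<^sub>R g x) = (LINT x|lebesgue_on \<Omega>. \<phi> x *\<^sub>R h x)"
      using weak_partial_eq[OF assms(1) \<phi>] weak_partial_eq[OF assms(2) \<phi>] by simp
    then show "(LINT x|lebesgue_on \<Omega>. \<phi> x *\<^sub>R (g x - h x)) = 0"
      using loc_integrable_mult_Cc_inf[OF l(1) \<phi>] loc_integrable_mult_Cc_inf[OF l(2) \<phi>]
      by (simp add: scaleR_diff_right)
  qed
  then show ?thesis by simp
qed

lemma weak_partial_cong_AE:
  assumes "AE x in lebesgue_on \<Omega>. u x = u' x" "AE x in lebesgue_on \<Omega>. g x = g' x"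
  shows "weak_partial \<Omega> j u g = weak_partial \<Omega> j u' g'"
proof -
  have 1: "(LINT x|lebesgue_on \<Omega>. \<psi> x *\<^sub>R u x) = (LINT x|lebesgue_on \<Omega>. \<psi> x *\<^sub>R u' x)" for \<psi> :: "real ^ 'n \<Rightarrow> real"
  proof (rule integral_AE_cong_lebesgue_on[OF sets_dom])
    show "AE x in lebesgue_on \<Omega>. \<psi> x *\<^sub>R u x = \<psi> x *\<^sub>R u' x"
      using assms(1) by eventually_elim simp
  qed
  have 2: "(LINT x|lebesgue_on \<Omega>. \<psi> x *\<^sub>R g x) = (LINT x|lebesgue_on \<Omega>. \<psi> x *\<^sub>R g' x)" for \<psi> :: "real ^ 'n \<Rightarrow> real"
  proof (rule integral_AE_cong_lebesgue_on[OF sets_dom])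
    show "AE x in lebesgue_on \<Omega>. \<psi> x *\<^sub>R g x = \<psi> x *\<^sub>R g' x"
      using assms(2) by eventually_elim simp
  qed
  show ?thesis
    unfolding weak_partial_def loc_integrable_cong_AE[OF assms(1)] loc_integrable_cong_AE[OF assms(2)]
    by (intro conj_cong ball_cong refl) (simp only: 1 2)
qed

text \<open>Functions that agree almost everywhere have the same weak derivatives, hence the choice
  operator in \<^const>\<open>wpartial\<close> picks the same function for both.\<close>

lemma wpartial_cong_AE:
  assumes "AE x in lebesgue_on \<Omega>. u x = u' x"
  shows "wpartial \<Omega> j u = wpartial \<Omega> j u'"
proof -
  have "weak_partial \<Omega> j u = weak_partial \<Omega> j u'"
    by (rule ext, rule weak_partial_cong_AE[OF assms AE_I2[OF refl]])
  then show ?thesis unfolding wpartial_def by (rule arg_cong[where f=Eps])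
qed

lemma weak_partial_wpartial: "weak_partial \<Omega> j u g \<Longrightarrow> weak_partial \<Omega> j u (wpartial \<Omega> j u)"
  unfolding wpartial_def by (rule someI[of "weak_partial \<Omega> j u"])

lemma wpartial_AE_eq:
  fixes u :: "real ^ 'n \<Rightarrow> 'b::euclidean_space"
  assumes "weak_partial \<Omega> j u g"
  shows "AE x in lebesgue_on \<Omega>. wpartial \<Omega> j u x = g x"
  by (rule weak_partial_unique[OF weak_partial_wpartial[OF assms] assms])

lemma weak_partial_add:
  fixes u :: "real ^ 'n \<Rightarrow> 'b::euclidean_space"
  assumes "weak_partial \<Omega> j u g" "weak_partial \<Omega> j w h"
  shows "weak_partial \<Omega> j (\<lambda>x. u x + w x) (\<lambda>x. g x + h x)"
  unfolding weak_partial_def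
proof (intro conjI ballI)
  note l = weak_partial_loc_integrable[OF assms(1)] weak_partial_loc_integrable[OF assms(2)]
  show "loc_integrable \<Omega> (\<lambda>x. u x + w x)" by (rule loc_integrable_add[OF l(1,3)])
  show "loc_integrable \<Omega> (\<lambda>x. g x + h x)" by (rule loc_integrable_add[OF l(2,4)])
  fix \<phi> :: "real ^ 'n \<Rightarrow> real" assume \<phi>: "\<phi> \<in> Cc_inf \<Omega>"
  then show "(LINT x|lebesgue_on \<Omega>. partial_deriv j \<phi> x *\<^sub>R (u x + w x)) =
      - (LINT x|lebesgue_on \<Omega>. \<phi> x *\<^sub>R (g x + h x))"
    using l weak_partial_eq[OF assms(1) \<phi>] weak_partial_eq[OF assms(2) \<phi>]
    by (simp add: scaleR_add_right loc_integrable_mult_Cc_inf Cc_inf_partial)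
qed

lemma weak_partial_scaleR:
  fixes u :: "real ^ 'n \<Rightarrow> 'b::euclidean_space"
  assumes "weak_partial \<Omega> j u g"
  shows "weak_partial \<Omega> j (\<lambda>x. c *\<^sub>R u x) (\<lambda>x. c *\<^sub>R g x)"
  unfolding weak_partial_def
proof (intro conjI ballI)
  show "loc_integrable \<Omega> (\<lambda>x. c *\<^sub>R u x)" "loc_integrable \<Omega> (\<lambda>x. c *\<^sub>R g x)"
    by (intro loc_integrable_scaleR weak_partial_loc_integrable[OF assms])+
  fix \<phi> :: "real ^ 'n \<Rightarrow> real" assume \<phi>: "\<phi> \<in> Cc_inf \<Omega>"
  have "(LINT x|lebesgue_on \<Omega>. partial_deriv j \<phi> x *\<^sub>R c *\<^sub>R u x) = c *\<^sub>R (LINT x|lebesgue_on \<Omega>. partial_deriv j \<phi> x *\<^sub>R u x)"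
    by (subst integral_scaleR_right[symmetric]) (simp only: scaleR_left_commute)
  moreover have "(LINT x|lebesgue_on \<Omega>. \<phi> x *\<^sub>R c *\<^sub>R g x) = c *\<^sub>R (LINT x|lebesgue_on \<Omega>. \<phi> x *\<^sub>R g x)"
    by (subst integral_scaleR_right[symmetric]) (simp only: scaleR_left_commute)
  ultimately show "(LINT x|lebesgue_on \<Omega>. partial_deriv j \<phi> x *\<^sub>R c *\<^sub>R u x) =
      - (LINT x|lebesgue_on \<Omega>. \<phi> x *\<^sub>R c *\<^sub>R g x)"
    using weak_partial_eq[OF assms \<phi>] by simp
qed

lemma weak_partial_diff:
  fixes u :: "real ^ 'n \<Rightarrow> 'b::euclidean_space"
  assumes "weak_partial \<Omega> j u g" "weak_partial \<Omega> j w h"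
  shows "weak_partial \<Omega> j (\<lambda>x. u x - w x) (\<lambda>x. g x - h x)"
  using weak_partial_add[OF assms(1) weak_partial_scaleR[OF assms(2), of "-1"]] by simp

lemma weak_partial_smooth:
  fixes \<phi> :: "real ^ 'n \<Rightarrow> 'b::euclidean_space"
  assumes \<phi>: "\<phi> \<in> Cc_inf S"
  shows "weak_partial \<Omega> j \<phi> (partial_deriv j \<phi>)"
  unfolding weak_partial_def
proof (intro conjI ballI)
  show l: "loc_integrable \<Omega> \<phi>" "loc_integrable \<Omega> (partial_deriv j \<phi>)"
    using \<phi> by (auto intro: L2_loc_integrable Cc_inf_L2 Cc_inf_partial)
  fix \<psi> :: "real ^ 'n \<Rightarrow> real" assume \<psi>: "\<psi> \<in> Cc_inf \<Omega>"
  have F: "(\<lambda>x. \<psi> x *\<^sub>R \<phi> x) \<in> Cc_inf \<Omega>"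
    by (rule Cc_inf_bilinear[OF bounded_bilinear_scaleR \<psi> Cc_inf_smooth[OF \<phi>]])
  have "partial_deriv j (\<lambda>x. \<psi> x *\<^sub>R \<phi> x) x = partial_deriv j \<psi> x *\<^sub>R \<phi> x + \<psi> x *\<^sub>R partial_deriv j \<phi> x" for x
    by (rule partial_deriv_bilinear[OF bounded_bilinear_scaleR])
      (use \<phi> \<psi> in \<open>auto intro: smooth_fun_differentiable Cc_inf_smooth\<close>)
  then have "(LINT x|lebesgue_on \<Omega>. partial_deriv j \<psi> x *\<^sub>R \<phi> x + \<psi> x *\<^sub>R partial_deriv j \<phi> x) = 0"
    using partial_deriv_integral_zero[OF F, of j] Cc_inf_integral_dom[OF Cc_inf_partial[OF F], of j] by simp
  then show "(LINT x|lebesgue_on \<Omega>. partial_deriv j \<psi> x *\<^sub>R \<phi> x) = - (LINT x|lebesgue_on \<Omega>. \<psi> x *\<^sub>R partial_deriv j \<phi> x)"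
    using loc_integrable_mult_Cc_inf[OF l(1) Cc_inf_partial[OF \<psi>], of j] loc_integrable_mult_Cc_inf[OF l(2) \<psi>]
    by (simp add: eq_neg_iff_add_eq_0)
qed

lemma wpartial_smooth:
  fixes \<phi> :: "real ^ 'n \<Rightarrow> 'b::euclidean_space"
  assumes "\<phi> \<in> Cc_inf S"
  shows "AE x in lebesgue_on \<Omega>. wpartial \<Omega> j \<phi> x = partial_deriv j \<phi> x"
  by (rule wpartial_AE_eq[OF weak_partial_smooth[OF assms]])

section \<open>Sobolev functions of first order\<close>

lemma H1_L2: "u \<in> H1 \<Omega> \<Longrightarrow> u \<in> L2 \<Omega>"
  by (simp add: H1_def)

lemma H1_weak_partial:
  assumes "u \<in> H1 \<Omega>"
  shows "weak_partial \<Omega> j u (wpartial \<Omega> j u)"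
proof -
  obtain g where "weak_partial \<Omega> j u g" using assms unfolding H1_def by blast
  then show ?thesis by (rule weak_partial_wpartial)
qed

lemma H1_wpartial_L2:
  fixes u :: "real ^ 'n \<Rightarrow> 'b::euclidean_space"
  assumes "u \<in> H1 \<Omega>"
  shows "wpartial \<Omega> j u \<in> L2 \<Omega>"
proof -
  obtain g where g: "g \<in> L2 \<Omega>" "weak_partial \<Omega> j u g" using assms unfolding H1_def by blast
  have "AE x in lebesgue_on \<Omega>. g x = wpartial \<Omega> j u x"
    using wpartial_AE_eq[OF g(2)] by eventually_elim simp
  then show ?thesis using g(1) by (rule L2_cong_AE)
qed

lemma wpartial_diff:
  fixes u :: "real ^ 'n \<Rightarrow> 'b::euclidean_space"
  assumes "u \<in> H1 \<Omega>" "w \<in> H1 \<Omega>"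
  shows "AE x in lebesgue_on \<Omega>. wpartial \<Omega> j (\<lambda>x. u x - w x) x = wpartial \<Omega> j u x - wpartial \<Omega> j w x"
  by (rule wpartial_AE_eq[OF weak_partial_diff[OF H1_weak_partial[OF assms(1)] H1_weak_partial[OF assms(2)]]])

lemma H1_diff:
  fixes u :: "real ^ 'n \<Rightarrow> 'b::euclidean_space"
  assumes "u \<in> H1 \<Omega>" "w \<in> H1 \<Omega>"
  shows "(\<lambda>x. u x - w x) \<in> H1 \<Omega>"
  unfolding H1_def
proof (intro CollectI conjI allI)
  show "(\<lambda>x. u x - w x) \<in> L2 \<Omega>" using assms by (intro L2_diff H1_L2)
  show "\<exists>g\<in>L2 \<Omega>. weak_partial \<Omega> j (\<lambda>x. u x - w x) g" for j
    using weak_partial_diff[OF H1_weak_partial[OF assms(1)] H1_weak_partial[OF assms(2)], of j]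
      L2_diff[OF H1_wpartial_L2[OF assms(1)] H1_wpartial_L2[OF assms(2)], of j j] by blast
qed

lemma Cc_inf_H1:
  fixes \<phi> :: "real ^ 'n \<Rightarrow> 'b::euclidean_space"
  assumes "\<phi> \<in> Cc_inf S"
  shows "\<phi> \<in> H1 \<Omega>"
  unfolding H1_def
  using assms weak_partial_smooth[OF assms] Cc_inf_L2[OF assms] Cc_inf_L2[OF Cc_inf_partial[OF assms]] by blast

lemma L2_matrix:
  assumes "\<And>j. (\<lambda>x. A x j) \<in> L2 \<Omega>"
  shows "(\<lambda>x. \<chi> i j. A x j $ i :: real ^ 'n ^ 'n) \<in> L2 \<Omega>"
proof -
  have L: "bounded_linear (\<lambda>y :: real ^ 'n. \<chi> i k. if k = j then y $ i else 0 :: real ^ 'n ^ 'n)" for j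
    unfolding linear_conv_bounded_linear[symmetric]
    by (rule linearI) (auto simp: vec_eq_iff)
  have "(\<lambda>x. \<Sum>j\<in>UNIV. (\<chi> i k. if k = j then A x j $ i else 0 :: real ^ 'n ^ 'n)) \<in> L2 \<Omega>"
    by (intro L2_sum L2_bounded_linear[OF L] assms)
  moreover have "(\<Sum>j\<in>UNIV. (\<chi> i k. if k = j then A x j $ i else 0 :: real ^ 'n ^ 'n)) = (\<chi> i j. A x j $ i)" for x
    by (simp add: vec_eq_iff)
  ultimately show ?thesis by simp
qed

lemma norm_matrix_columns:
  "(norm (A :: real ^ 'm ^ 'm))\<^sup>2 = (\<Sum>j\<in>UNIV. (norm (column j A))\<^sup>2)"
proof -
  have "(norm A)\<^sup>2 = (\<Sum>i\<in>UNIV. \<Sum>j\<in>UNIV. (A $ i $ j)\<^sup>2)"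
    by (simp only: power2_norm_eq_inner inner_vec_def) (simp add: power2_eq_square)
  also have "\<dots> = (\<Sum>j\<in>UNIV. \<Sum>i\<in>UNIV. (A $ i $ j)\<^sup>2)" by (rule sum.swap)
  also have "\<dots> = (\<Sum>j\<in>UNIV. (norm (column j A))\<^sup>2)"
    by (simp only: power2_norm_eq_inner inner_vec_def) (simp add: power2_eq_square column_def)
  finally show ?thesis .
qed

lemma wgrad_L2: "u \<in> H1 \<Omega> \<Longrightarrow> wgrad \<Omega> u \<in> L2 \<Omega>"
  unfolding wgrad_def[abs_def] by (intro L2_matrix H1_wpartial_L2)

lemma wgrad_norm_sq:
  assumes "u \<in> H1 \<Omega>"
  shows "(L2_norm \<Omega> (wgrad \<Omega> u))\<^sup>2 = (\<Sum>j\<in>UNIV. (L2_norm \<Omega> (wpartial \<Omega> j u))\<^sup>2)"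
proof -
  have "column j (wgrad \<Omega> u x) = wpartial \<Omega> j u x" for j x
    by (simp add: column_def wgrad_def vec_eq_iff)
  then have "(norm (wgrad \<Omega> u x))\<^sup>2 = (\<Sum>j\<in>UNIV. (norm (wpartial \<Omega> j u x))\<^sup>2)" for x
    by (simp add: norm_matrix_columns)
  then show ?thesis
    using L2_integrable_sq[OF H1_wpartial_L2[OF assms]] by (simp add: L2_norm_sq)
qed

lemma H1_norm_sq:
  assumes "u \<in> H1 \<Omega>"
  shows "(H1_norm \<Omega> u)\<^sup>2 = (L2_norm \<Omega> u)\<^sup>2 + (L2_norm \<Omega> (wgrad \<Omega> u))\<^sup>2"
  by (simp add: H1_norm_def wgrad_norm_sq[OF assms] sum_nonneg)

lemma H1_norm_nonneg [simp]: "0 \<le> H1_norm \<Omega> u"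
  by (simp add: H1_norm_def sum_nonneg)

lemma H1_norm_bounds:
  assumes "u \<in> H1 \<Omega>"
  shows "L2_norm \<Omega> u \<le> H1_norm \<Omega> u" "L2_norm \<Omega> (wgrad \<Omega> u) \<le> H1_norm \<Omega> u"
proof -
  have "(L2_norm \<Omega> u)\<^sup>2 \<le> (H1_norm \<Omega> u)\<^sup>2" "(L2_norm \<Omega> (wgrad \<Omega> u))\<^sup>2 \<le> (H1_norm \<Omega> u)\<^sup>2"
    unfolding H1_norm_sq[OF assms] by simp_all
  then show "L2_norm \<Omega> u \<le> H1_norm \<Omega> u" "L2_norm \<Omega> (wgrad \<Omega> u) \<le> H1_norm \<Omega> u"
    by (auto dest: power2_le_imp_le)
qed

lemma AE_all_finite:
  fixes P :: "'i::finite \<Rightarrow> 'z \<Rightarrow> bool"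
  assumes "\<And>j. AE x in M. P j x"
  shows "AE x in M. \<forall>j. P j x"
proof -
  have "AE x in M. \<forall>j\<in>UNIV. P j x"
    by (subst AE_ball_countable) (auto simp: countable_finite assms)
  then show ?thesis by simp
qed

lemma wgrad_diff:
  assumes "u \<in> H1 \<Omega>" "w \<in> H1 \<Omega>"
  shows "AE x in lebesgue_on \<Omega>. wgrad \<Omega> (\<lambda>x. u x - w x) x = wgrad \<Omega> u x - wgrad \<Omega> w x"
proof -
  have "AE x in lebesgue_on \<Omega>. \<forall>j. wpartial \<Omega> j (\<lambda>x. u x - w x) x = wpartial \<Omega> j u x - wpartial \<Omega> j w x"
    by (rule AE_all_finite[OF wpartial_diff[OF assms]])
  then show ?thesis by eventually_elim (simp add: wgrad_def vec_eq_iff)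
qed

lemma wgrad_smooth:
  assumes "\<phi> \<in> Cc_inf S"
  shows "AE x in lebesgue_on \<Omega>. wgrad \<Omega> \<phi> x = grad \<phi> x"
proof -
  have "AE x in lebesgue_on \<Omega>. \<forall>j. wpartial \<Omega> j \<phi> x = partial_deriv j \<phi> x"
    by (rule AE_all_finite[OF wpartial_smooth[OF assms]])
  then show ?thesis by eventually_elim (simp add: wgrad_def grad_def)
qed

end


section \<open>The convective term\<close>

lemma grad_mult_vec: "grad \<phi> x *v a = (\<Sum>j\<in>UNIV. a $ j *\<^sub>R partial_deriv j \<phi> x)"
  by (simp add: vec_eq_iff matrix_vector_mult_def grad_def mult.commute)

lemma wgrad_mult_vec: "wgrad \<Omega> u x *v a = (\<Sum>j\<in>UNIV. a $ j *\<^sub>R wpartial \<Omega> j u x)"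
  by (simp add: vec_eq_iff matrix_vector_mult_def wgrad_def mult.commute)

lemma bounded_bilinear_matrix_vector:
  "bounded_bilinear (\<lambda>(A :: real ^ 'n ^ 'm) x. A *v x)"
  unfolding bilinear_conv_bounded_bilinear[symmetric] bilinear_def
  by (intro conjI allI linearI)
    (simp_all add: matrix_vector_mult_add_rdistrib matrix_vector_right_distrib
      vec_eq_iff matrix_vector_mult_def sum_distrib_left mult.assoc mult.left_commute
      distrib_left distrib_right sum.distrib)

lemma bounded_bilinear_vector_matrix:
  "bounded_bilinear (\<lambda>(x :: real ^ 'm) (A :: real ^ 'n ^ 'm). x v* A)"
  unfolding bilinear_conv_bounded_bilinear[symmetric] bilinear_def
  by (intro conjI allI linearI)
    (simp_all add: vec_eq_iff vector_matrix_mult_def sum_distrib_left mult.assoc mult.left_commute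
      distrib_left distrib_right sum.distrib)

lemma norm_outer: "norm (outer a b) = norm a * norm b"
proof -
  have "(norm (outer a b))\<^sup>2 = (\<Sum>i\<in>UNIV. \<Sum>j\<in>UNIV. (a $ i * b $ j) * (a $ i * b $ j))"
    by (simp only: power2_norm_eq_inner inner_vec_def) (simp add: outer_def)
  also have "\<dots> = (a \<bullet> a) * (b \<bullet> b)"
    by (simp add: inner_vec_def sum_product algebra_simps)
  also have "\<dots> = (norm a * norm b)\<^sup>2"
    by (simp add: power_mult_distrib power2_norm_eq_inner)
  finally show ?thesis by simp
qed

lemma inner_outer: "A \<bullet> outer w z = (A *v z) \<bullet> w"
  by (simp add: inner_vec_def outer_def matrix_vector_mult_def sum_distrib_right sum_distrib_left
      mult.assoc mult.commute mult.left_commute)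

lemma L2_norm_le_mult:
  assumes "p \<in> L2 \<Omega>" "u \<in> L2 \<Omega>" "AE x in lebesgue_on \<Omega>. norm (p x) \<le> B * norm (u x)" "0 \<le> B"
  shows "L2_norm \<Omega> p \<le> B * L2_norm \<Omega> u"
proof -
  have "(LINT x|lebesgue_on \<Omega>. (norm (p x))\<^sup>2) \<le> (LINT x|lebesgue_on \<Omega>. B\<^sup>2 * (norm (u x))\<^sup>2)"
  proof (rule integral_mono_AE)
    show "AE x in lebesgue_on \<Omega>. (norm (p x))\<^sup>2 \<le> B\<^sup>2 * (norm (u x))\<^sup>2"
      using assms(3)
    proof eventually_elim
      case (elim x)
      from power_mono[OF elim norm_ge_zero, of 2] show ?case by (simp add: power_mult_distrib)
    qed
  qed (use assms in \<open>simp_all add: L2_integrable_sq\<close>)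
  then have "(L2_norm \<Omega> p)\<^sup>2 \<le> (B * L2_norm \<Omega> u)\<^sup>2"
    by (simp add: L2_norm_sq power_mult_distrib)
  then show ?thesis by (rule power2_le_imp_le) (use assms(4) in simp)
qed

context bounded_open begin

text \<open>Weak derivatives are defined with scalar test functions; the components of
  \<open>F\<close> are such.\<close>

lemma weak_partial_vector:
  fixes F u :: "real ^ 'n \<Rightarrow> real ^ 'n"
  assumes F: "F \<in> Cc_inf \<Omega>" and u: "u \<in> H1 \<Omega>"
  shows "L2_inner \<Omega> (partial_deriv j F) u = - L2_inner \<Omega> F (wpartial \<Omega> j u)"
proof -
  have bl: "bounded_linear (\<lambda>y :: real ^ 'n. y $ i)" for i by (rule bounded_linear_vec_nth)
  have Fi: "(\<lambda>x. F x $ i) \<in> Cc_inf \<Omega>" for i by (rule Cc_inf_linear[OF bl F])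
  have dFi: "partial_deriv j (\<lambda>x. F x $ i) = (\<lambda>x. partial_deriv j F x $ i)" for i
    by (rule ext, rule partial_deriv_linear[OF bl smooth_fun_differentiable[OF Cc_inf_smooth[OF F]]])
  have dF: "(\<lambda>x. partial_deriv j F x $ i) \<in> Cc_inf \<Omega>" for i
    by (rule Cc_inf_linear[OF bl Cc_inf_partial[OF F]])
  have l: "loc_integrable \<Omega> u" "loc_integrable \<Omega> (wpartial \<Omega> j u)"
    using u by (auto intro: L2_loc_integrable H1_L2 H1_wpartial_L2)
  have comp: "integrable (lebesgue_on \<Omega>) (\<lambda>x. \<psi> x * w x $ i) \<and>
      (LINT x|lebesgue_on \<Omega>. \<psi> x * w x $ i) = (LINT x|lebesgue_on \<Omega>. \<psi> x *\<^sub>R w x) $ i"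
    if "\<psi> \<in> Cc_inf \<Omega>" "loc_integrable \<Omega> w" for \<psi> :: "real ^ 'n \<Rightarrow> real" and w :: "real ^ 'n \<Rightarrow> real ^ 'n" and i
    using integral_bounded_linear[OF bl loc_integrable_mult_Cc_inf[OF that(2,1)], of i]
      integrable_bounded_linear[OF bl loc_integrable_mult_Cc_inf[OF that(2,1)], of i] by simp
  have "L2_inner \<Omega> (partial_deriv j F) u = (\<Sum>i\<in>UNIV. LINT x|lebesgue_on \<Omega>. partial_deriv j F x $ i * u x $ i)"
    unfolding L2_inner_def inner_vec_def inner_real_def
    by (rule Bochner_Integration.integral_sum) (use comp[OF dF l(1)] in blast)
  also have "\<dots> = (\<Sum>i\<in>UNIV. - (LINT x|lebesgue_on \<Omega>. F x $ i * wpartial \<Omega> j u x $ i))"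
  proof (rule sum.cong[OF refl])
    fix i
    have "(LINT x|lebesgue_on \<Omega>. partial_deriv j F x $ i *\<^sub>R u x) = - (LINT x|lebesgue_on \<Omega>. F x $ i *\<^sub>R wpartial \<Omega> j u x)"
      using weak_partial_eq[OF H1_weak_partial[OF u, of j] Fi[of i]] unfolding dFi .
    then show "(LINT x|lebesgue_on \<Omega>. partial_deriv j F x $ i * u x $ i) = - (LINT x|lebesgue_on \<Omega>. F x $ i * wpartial \<Omega> j u x $ i)"
      using comp[OF dF l(1), of i i] comp[OF Fi l(2), of i i] by simp
  qed
  also have "\<dots> = - (\<Sum>i\<in>UNIV. LINT x|lebesgue_on \<Omega>. F x $ i * wpartial \<Omega> j u x $ i)"
    by (rule sum_negf)
  also have "(\<Sum>i\<in>UNIV. LINT x|lebesgue_on \<Omega>. F x $ i * wpartial \<Omega> j u x $ i) = L2_inner \<Omega> F (wpartial \<Omega> j u)"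
    unfolding L2_inner_def inner_vec_def inner_real_def
    by (rule Bochner_Integration.integral_sum[symmetric]) (use comp[OF Fi l(2)] in blast)
  finally show ?thesis .
qed

lemma L2_inner_sum_left:
  assumes "finite I" "\<And>i. i \<in> I \<Longrightarrow> y i \<in> L2 \<Omega>" "w \<in> L2 \<Omega>"
  shows "L2_inner \<Omega> (\<lambda>x. \<Sum>i\<in>I. y i x) w = (\<Sum>i\<in>I. L2_inner \<Omega> (y i) w)"
  using assms by (induct I rule: finite_induct) (simp_all add: L2_inner_add_left L2_sum)

text \<open>Moving the derivative from \<open>u\<close> to \<open>a\<^sub>j \<phi>\<close> produces,
  besides the right-hand side, a term with the divergence of \<open>a\<close>, which is zero.\<close>

lemma convective_smooth:
  fixes a \<phi> u :: "real ^ 'n \<Rightarrow> real ^ 'n"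
  assumes a: "a \<in> Cc_inf_sigma \<Omega>" and u: "u \<in> H1 \<Omega>" and \<phi>: "\<phi> \<in> Cc_inf \<Omega>"
  shows "L2_inner \<Omega> (\<lambda>x. wgrad \<Omega> u x *v a x) \<phi> = - L2_inner \<Omega> (\<lambda>x. grad \<phi> x *v a x) u"
proof -
  have ac: "a \<in> Cc_inf \<Omega>" by (rule Cc_inf_sigma_Cc_inf[OF a])
  have bl: "bounded_linear (\<lambda>y :: real ^ 'n. y $ i)" for i by (rule bounded_linear_vec_nth)
  have aj: "(\<lambda>x. a x $ j) \<in> Cc_inf \<Omega>" for j by (rule Cc_inf_linear[OF bl ac])
  have F: "(\<lambda>x. a x $ j *\<^sub>R \<phi> x) \<in> Cc_inf \<Omega>" for j
    by (rule Cc_inf_bilinear[OF bounded_bilinear_scaleR aj Cc_inf_smooth[OF \<phi>]])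
  have aw: "(\<lambda>x. a x $ j *\<^sub>R wpartial \<Omega> j u x) \<in> L2 \<Omega>" for j
  proof -
    obtain B where "\<And>x. norm (a x $ j) \<le> B" using Cc_inf_bounded[OF aj] by blast
    then show ?thesis
      by (intro L2_bounded_mult[OF bounded_bilinear_scaleR H1_wpartial_L2[OF u]
            smooth_measurable[OF Cc_inf_smooth[OF aj]], where B=B] AE_I2)
  qed
  have uL: "u \<in> L2 \<Omega>" by (rule H1_L2[OF u])
  have "L2_inner \<Omega> (\<lambda>x. wgrad \<Omega> u x *v a x) \<phi> = (\<Sum>j\<in>UNIV. L2_inner \<Omega> (\<lambda>x. a x $ j *\<^sub>R wpartial \<Omega> j u x) \<phi>)"
    unfolding wgrad_mult_vec by (rule L2_inner_sum_left) (use aw Cc_inf_L2[OF \<phi>] in auto)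
  also have "\<dots> = (\<Sum>j\<in>UNIV. - L2_inner \<Omega> (partial_deriv j (\<lambda>x. a x $ j *\<^sub>R \<phi> x)) u)"
  proof (rule sum.cong[OF refl])
    fix j
    have "L2_inner \<Omega> (\<lambda>x. a x $ j *\<^sub>R wpartial \<Omega> j u x) \<phi> = L2_inner \<Omega> (\<lambda>x. a x $ j *\<^sub>R \<phi> x) (wpartial \<Omega> j u)"
      unfolding L2_inner_def by (simp add: inner_commute)
    then show "L2_inner \<Omega> (\<lambda>x. a x $ j *\<^sub>R wpartial \<Omega> j u x) \<phi> = - L2_inner \<Omega> (partial_deriv j (\<lambda>x. a x $ j *\<^sub>R \<phi> x)) u"
      using weak_partial_vector[OF F[of j] u, of j] by simp
  qed
  also have "\<dots> = - L2_inner \<Omega> (\<lambda>x. \<Sum>j\<in>UNIV. partial_deriv j (\<lambda>x. a x $ j *\<^sub>R \<phi> x) x) u"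
    by (subst L2_inner_sum_left) (use Cc_inf_L2[OF Cc_inf_partial[OF F]] uL in \<open>auto simp: sum_negf\<close>)
  also have "(\<lambda>x. \<Sum>j\<in>UNIV. partial_deriv j (\<lambda>x. a x $ j *\<^sub>R \<phi> x) x) = (\<lambda>x. grad \<phi> x *v a x)"
  proof
    fix x
    have "partial_deriv j (\<lambda>x. a x $ j *\<^sub>R \<phi> x) x = partial_deriv j a x $ j *\<^sub>R \<phi> x + a x $ j *\<^sub>R partial_deriv j \<phi> x" for j
      using partial_deriv_bilinear[OF bounded_bilinear_scaleR smooth_fun_differentiable[OF Cc_inf_smooth[OF aj]]
          smooth_fun_differentiable[OF Cc_inf_smooth[OF \<phi>]], of j j x]
        partial_deriv_linear[OF bl smooth_fun_differentiable[OF Cc_inf_smooth[OF ac]], of j j x] by simp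
    then have "(\<Sum>j\<in>UNIV. partial_deriv j (\<lambda>x. a x $ j *\<^sub>R \<phi> x) x) =
        (\<Sum>j\<in>UNIV. partial_deriv j a x $ j) *\<^sub>R \<phi> x + (\<Sum>j\<in>UNIV. a x $ j *\<^sub>R partial_deriv j \<phi> x)"
      by (simp add: sum.distrib scaleR_sum_left)
    moreover have "(\<Sum>j\<in>UNIV. partial_deriv j a x $ j) = 0" using a by (simp add: Cc_inf_sigma_def)
    ultimately show "(\<Sum>j\<in>UNIV. partial_deriv j (\<lambda>x. a x $ j *\<^sub>R \<phi> x) x) = grad \<phi> x *v a x"
      by (simp add: grad_mult_vec)
  qed
  finally show ?thesis .
qed

lemma L2_sigma_L2: "u \<in> L2_sigma \<Omega> \<Longrightarrow> u \<in> L2 \<Omega>"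
  by (simp add: L2_sigma_def closure_in_def)

lemma L2_sigma_approx:
  assumes "u \<in> L2_sigma \<Omega>"
  obtains y :: "nat \<Rightarrow> real ^ 'n \<Rightarrow> real ^ 'n" where "\<And>k. y k \<in> Cc_inf_sigma \<Omega>"
    "(\<lambda>k. L2_norm \<Omega> (\<lambda>x. y k x - u x)) \<longlonglongrightarrow> 0"
proof -
  have "\<exists>\<phi>\<in>Cc_inf_sigma \<Omega>. L2_norm \<Omega> (\<lambda>x. u x - \<phi> x) < 1 / real (Suc k)" for k
    using assms by (simp add: L2_sigma_def closure_in_def)
  then obtain y where y: "\<And>k. y k \<in> Cc_inf_sigma \<Omega>" "\<And>k. L2_norm \<Omega> (\<lambda>x. u x - y k x) < 1 / real (Suc k)"
    by metis
  have "(\<lambda>k. L2_norm \<Omega> (\<lambda>x. y k x - u x)) \<longlonglongrightarrow> 0"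
  proof (rule Lim_null_comparison[OF always_eventually])
    show "\<forall>k. norm (L2_norm \<Omega> (\<lambda>x. y k x - u x)) \<le> 1 / real (Suc k)"
      using y(2) by (simp add: L2_norm_minus_commute[of \<Omega> _ u] less_imp_le)
    show "(\<lambda>k. 1 / real (Suc k)) \<longlonglongrightarrow> 0"
      using LIMSEQ_inverse_real_of_nat by (simp add: inverse_eq_divide)
  qed
  then show ?thesis using y(1) that by blast
qed

lemma L2_sigma_diff:
  assumes "u \<in> L2_sigma \<Omega>" "w \<in> L2_sigma \<Omega>"
  shows "(\<lambda>x. u x - w x) \<in> L2_sigma \<Omega>"
  unfolding L2_sigma_def closure_in_def
proof (intro CollectI conjI allI impI)
  note uw = L2_sigma_L2[OF assms(1)] L2_sigma_L2[OF assms(2)]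
  show "(\<lambda>x. u x - w x) \<in> L2 \<Omega>" using uw by (rule L2_diff)
  fix e :: real assume "e > 0"
  then have "e / 2 > 0" by simp
  then obtain \<phi> \<psi> where \<phi>: "\<phi> \<in> Cc_inf_sigma \<Omega>" "L2_norm \<Omega> (\<lambda>x. u x - \<phi> x) < e / 2"
    and \<psi>: "\<psi> \<in> Cc_inf_sigma \<Omega>" "L2_norm \<Omega> (\<lambda>x. w x - \<psi> x) < e / 2"
    using assms unfolding L2_sigma_def closure_in_def by blast
  have d: "(\<lambda>x. \<phi> x - \<psi> x) \<in> Cc_inf_sigma \<Omega>"
    using Cc_inf_sigma_add[OF \<phi>(1) Cc_inf_sigma_scaleR[OF \<psi>(1), of "-1"]] by simp
  have L: "(\<lambda>x. u x - \<phi> x) \<in> L2 \<Omega>" "(\<lambda>x. \<psi> x - w x) \<in> L2 \<Omega>"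
    using uw Cc_inf_L2[OF Cc_inf_sigma_Cc_inf[OF \<phi>(1)]] Cc_inf_L2[OF Cc_inf_sigma_Cc_inf[OF \<psi>(1)]]
    by (auto intro: L2_diff)
  have "(\<lambda>x. u x - w x - (\<phi> x - \<psi> x)) = (\<lambda>x. (u x - \<phi> x) + (\<psi> x - w x))" by auto
  then have "L2_norm \<Omega> (\<lambda>x. u x - w x - (\<phi> x - \<psi> x)) < e"
    using L2_norm_triangle[OF L] \<phi>(2) \<psi>(2) L2_norm_minus_commute[of \<Omega> \<psi> w] by simp
  then show "\<exists>\<phi>\<in>Cc_inf_sigma \<Omega>. L2_norm \<Omega> (\<lambda>x. u x - w x - \<phi> x) < e"
    by (rule bexI[of _ "\<lambda>x. \<phi> x - \<psi> x", OF _ d])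
qed

lemma Cc_inf_sigma_L2_sigma: "\<phi> \<in> Cc_inf_sigma \<Omega> \<Longrightarrow> \<phi> \<in> L2_sigma \<Omega>"
  unfolding L2_sigma_def closure_in_def
  by (auto intro!: Cc_inf_L2 Cc_inf_sigma_Cc_inf bexI[of _ \<phi>])

lemma grad_L2: "\<phi> \<in> Cc_inf S \<Longrightarrow> grad \<phi> \<in> L2 \<Omega>"
  unfolding grad_def[abs_def] by (intro L2_matrix Cc_inf_L2 Cc_inf_partial)

lemma norm_matrix_le_columns: "norm (\<chi> i j. A j $ i :: real ^ 'm ^ 'm) \<le> (\<Sum>j\<in>UNIV. norm (A j))"
proof -
  have "(\<chi> i j. A j $ i :: real ^ 'm ^ 'm) = (\<Sum>j\<in>UNIV. outer (A j) (axis j 1))"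
    by (simp add: vec_eq_iff outer_def axis_def if_distrib[of "(*) _"] cong: if_cong)
  then have "norm (\<chi> i j. A j $ i :: real ^ 'm ^ 'm) \<le> (\<Sum>j\<in>UNIV. norm (outer (A j) (axis j (1::real))))"
    by (metis norm_sum)
  then show ?thesis by (simp add: norm_outer)
qed

lemma grad_bounded:
  assumes "\<phi> \<in> Cc_inf S"
  obtains B where "B > 0" "\<And>x. norm (grad \<phi> x) \<le> B"
proof -
  have "\<exists>B>0. \<forall>x. norm (partial_deriv j \<phi> x) \<le> B" for j
    using Cc_inf_bounded[OF Cc_inf_partial[OF assms]] by metis
  then obtain B where B: "\<And>j. B j > 0" "\<And>j x. norm (partial_deriv j \<phi> x) \<le> B j" by metis
  have "norm (grad \<phi> x) \<le> (\<Sum>j\<in>UNIV. B j)" for x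
    unfolding grad_def by (rule order.trans[OF norm_matrix_le_columns sum_mono[OF B(2)]])
  moreover have "(\<Sum>j\<in>UNIV. B j) > 0" using B(1) by (simp add: sum_pos)
  ultimately show ?thesis using that by blast
qed

lemma grad_mult_L2:
  assumes "\<phi> \<in> Cc_inf S" "a \<in> L2 \<Omega>"
  shows "(\<lambda>x. grad \<phi> x *v a x) \<in> L2 \<Omega>" "(\<lambda>x. a x v* grad \<phi> x) \<in> L2 \<Omega>"
proof -
  obtain B where B: "\<And>x. norm (grad \<phi> x) \<le> B" using grad_bounded[OF assms(1)] by blast
  note m = L2_measurable[OF grad_L2[OF assms(1)]]
  show "(\<lambda>x. grad \<phi> x *v a x) \<in> L2 \<Omega>"
    by (rule L2_bounded_mult[OF bounded_bilinear_matrix_vector assms(2) m AE_I2[OF B]])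
  show "(\<lambda>x. a x v* grad \<phi> x) \<in> L2 \<Omega>"
    by (rule L2_bounded_mult[OF bounded_bilinear.flip[OF bounded_bilinear_vector_matrix] assms(2) m AE_I2[OF B]])
qed

text \<open>Solenoidal \<open>L\<^sup>2\<close> fields are limits of solenoidal test fields, and
  both sides depend continuously on \<open>a\<close> because \<open>\<phi>\<close> and its gradient
  are bounded.\<close>

lemma convective_antisym:
  assumes a: "a \<in> L2_sigma \<Omega>" and u: "u \<in> H1 \<Omega>" and \<phi>: "\<phi> \<in> Cc_inf \<Omega>"
  shows "L2_inner \<Omega> (\<lambda>x. wgrad \<Omega> u x *v a x) \<phi> = - L2_inner \<Omega> (\<lambda>x. grad \<phi> x *v a x) u"
proof -
  obtain y where y: "\<And>k. y k \<in> Cc_inf_sigma \<Omega>" "(\<lambda>k. L2_norm \<Omega> (\<lambda>x. y k x - a x)) \<longlonglongrightarrow> 0"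
    using L2_sigma_approx[OF a] by blast
  have yL: "\<forall>\<^sub>F k in sequentially. y k \<in> L2 \<Omega>"
    by (rule always_eventually, rule allI, rule Cc_inf_L2[OF Cc_inf_sigma_Cc_inf[OF y(1)]])
  have aL: "a \<in> L2 \<Omega>" by (rule L2_sigma_L2[OF a])
  have uL: "u \<in> L2 \<Omega>" by (rule H1_L2[OF u])
  \<comment> \<open>Transposing the matrices exhibits both sides as inner products of a with fixed square integrable fields.\<close>
  define P where "P x = \<phi> x v* wgrad \<Omega> u x" for x
  define Q where "Q x = u x v* grad \<phi> x" for x
  have P: "P \<in> L2 \<Omega>"
  proof -
    obtain B where B: "\<And>x. norm (\<phi> x) \<le> B" using Cc_inf_bounded[OF \<phi>] by blast
    show ?thesis unfolding P_def
      by (rule L2_bounded_mult[OF bounded_bilinear_vector_matrix wgrad_L2[OF u]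
            smooth_measurable[OF Cc_inf_smooth[OF \<phi>]] AE_I2[OF B]])
  qed
  have Q: "Q \<in> L2 \<Omega>" unfolding Q_def by (rule grad_mult_L2(2)[OF \<phi> uL])
  have eqP: "L2_inner \<Omega> (\<lambda>x. wgrad \<Omega> u x *v b x) \<phi> = L2_inner \<Omega> b P" for b
    unfolding L2_inner_def P_def by (simp add: inner_commute[of "b _"] dot_lmul_matrix inner_commute[of "_ *v _"])
  have eqQ: "L2_inner \<Omega> (\<lambda>x. grad \<phi> x *v b x) u = L2_inner \<Omega> b Q" for b
    unfolding L2_inner_def Q_def by (simp add: inner_commute[of "b _"] dot_lmul_matrix inner_commute[of "_ *v _"])
  have lim1: "(\<lambda>k. L2_inner \<Omega> (y k) P) \<longlonglongrightarrow> L2_inner \<Omega> a P"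
    by (rule L2_inner_tendsto_left[OF yL aL y(2) P])
  have lim2: "(\<lambda>k. L2_inner \<Omega> (y k) Q) \<longlonglongrightarrow> L2_inner \<Omega> a Q"
    by (rule L2_inner_tendsto_left[OF yL aL y(2) Q])
  have eq: "L2_inner \<Omega> (y k) P = - L2_inner \<Omega> (y k) Q" for k
    using convective_smooth[OF y(1) u \<phi>, of k] unfolding eqP eqQ .
  have "L2_inner \<Omega> a P = - L2_inner \<Omega> a Q"
    by (rule LIMSEQ_unique[OF lim1]) (simp only: eq tendsto_minus[OF lim2])
  then show ?thesis unfolding eqP eqQ .
qed

text \<open>Transport by a solenoidal field does no work on the transported field: take
  \<open>u = \<phi>\<close> in antisymmetry.\<close>

lemma convective_zero:
  assumes a: "a \<in> L2_sigma \<Omega>" and \<phi>: "\<phi> \<in> Cc_inf \<Omega>"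
  shows "L2_inner \<Omega> (\<lambda>x. grad \<phi> x *v a x) \<phi> = 0"
proof -
  have "AE x in lebesgue_on \<Omega>. wgrad \<Omega> \<phi> x *v a x = grad \<phi> x *v a x"
    using wgrad_smooth[OF \<phi>] by eventually_elim simp
  then have "L2_inner \<Omega> (\<lambda>x. wgrad \<Omega> \<phi> x *v a x) \<phi> = L2_inner \<Omega> (\<lambda>x. grad \<phi> x *v a x) \<phi>"
    by (rule L2_inner_cong_AE) simp
  with convective_antisym[OF a Cc_inf_H1[OF \<phi>] \<phi>] show ?thesis by simp
qed

section \<open>Essentially bounded functions and gradients\<close>

lemma Linf_norm_set:
  assumes "u \<in> Linf \<Omega>"
  shows "{C. 0 \<le> C \<and> (AE x in lebesgue_on \<Omega>. norm (u x) \<le> C)} \<noteq> {}"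
proof -
  obtain C where C: "AE x in lebesgue_on \<Omega>. norm (u x) \<le> C" using assms by (auto simp: Linf_def)
  then have "AE x in lebesgue_on \<Omega>. norm (u x) \<le> max C 0" by eventually_elim simp
  then show ?thesis by (auto intro!: exI[of _ "max C 0"])
qed

lemma Linf_norm_le:
  "AE x in lebesgue_on \<Omega>. norm (u x) \<le> C \<Longrightarrow> 0 \<le> C \<Longrightarrow> Linf_norm \<Omega> u \<le> C"
  unfolding Linf_norm_def by (rule cInf_lower) (auto intro: bdd_belowI[of _ 0])

lemma Linf_norm_nonneg: "u \<in> Linf \<Omega> \<Longrightarrow> 0 \<le> Linf_norm \<Omega> u"
  unfolding Linf_norm_def using Linf_norm_set by (intro cInf_greatest) auto

text \<open>The infimum that defines the norm is attained, since a countable union of null sets is a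
  null set.\<close>

lemma Linf_norm_AE:
  assumes "u \<in> Linf \<Omega>"
  shows "AE x in lebesgue_on \<Omega>. norm (u x) \<le> Linf_norm \<Omega> u"
proof -
  have "AE x in lebesgue_on \<Omega>. norm (u x) < Linf_norm \<Omega> u + 1 / real (Suc k)" for k
  proof -
    have "Linf_norm \<Omega> u < Linf_norm \<Omega> u + 1 / real (Suc k)" by simp
    then obtain C where "AE x in lebesgue_on \<Omega>. norm (u x) \<le> C" "C < Linf_norm \<Omega> u + 1 / real (Suc k)"
      using cInf_lessD[OF Linf_norm_set[OF assms]] unfolding Linf_norm_def by blast
    then show ?thesis by (auto elim: eventually_mono)
  qed
  then have "AE x in lebesgue_on \<Omega>. \<forall>k. norm (u x) < Linf_norm \<Omega> u + 1 / real (Suc k)"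
    by (simp add: AE_all_countable)
  then show ?thesis
  proof eventually_elim
    case (elim x)
    have "(\<lambda>k. Linf_norm \<Omega> u + 1 / real (Suc k)) \<longlonglongrightarrow> Linf_norm \<Omega> u + 0"
      using LIMSEQ_inverse_real_of_nat by (intro tendsto_add tendsto_const) (simp add: inverse_eq_divide)
    then show ?case
      using elim by (intro LIMSEQ_le_const[of _ _ "norm (u x)"]) (auto intro: less_imp_le)
  qed
qed

lemma Linf_norm_cong_AE:
  assumes "AE x in lebesgue_on \<Omega>. u x = w x"
  shows "Linf_norm \<Omega> u = Linf_norm \<Omega> w"
proof -
  have "(AE x in lebesgue_on \<Omega>. norm (u x) \<le> C) = (AE x in lebesgue_on \<Omega>. norm (w x) \<le> C)" for C
    by (rule AE_cong_simp[OF refl] eventually_cong)+ (use assms in \<open>auto elim: eventually_mono\<close>)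
  then show ?thesis by (simp add: Linf_norm_def)
qed

lemma Linf_norm_diff_le:
  assumes "u \<in> Linf \<Omega>" "w \<in> Linf \<Omega>" "AE x in lebesgue_on \<Omega>. norm (u x - w x) \<le> e" "0 \<le> e"
  shows "\<bar>Linf_norm \<Omega> u - Linf_norm \<Omega> w\<bar> \<le> e"
proof -
  have "Linf_norm \<Omega> u \<le> Linf_norm \<Omega> w + e"
  proof (rule Linf_norm_le)
    show "AE x in lebesgue_on \<Omega>. norm (u x) \<le> Linf_norm \<Omega> w + e"
      using assms(3) Linf_norm_AE[OF assms(2)]
    proof eventually_elim
      case (elim x)
      then show ?case using norm_triangle_ineq2[of "u x" "w x"] by linarith
    qed
  qed (use assms(4) Linf_norm_nonneg[OF assms(2)] in simp)
  moreover have "Linf_norm \<Omega> w \<le> Linf_norm \<Omega> u + e"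
  proof (rule Linf_norm_le)
    show "AE x in lebesgue_on \<Omega>. norm (w x) \<le> Linf_norm \<Omega> u + e"
      using assms(3) Linf_norm_AE[OF assms(1)]
    proof eventually_elim
      case (elim x)
      then show ?case using norm_triangle_ineq2[of "w x" "u x"] norm_minus_commute[of "u x" "w x"] by linarith
    qed
  qed (use assms(4) Linf_norm_nonneg[OF assms(1)] in simp)
  ultimately show ?thesis by linarith
qed

lemma Linf_norm_scaleR:
  fixes u :: "real ^ 'n \<Rightarrow> 'b::euclidean_space"
  assumes "u \<in> Linf \<Omega>"
  shows "Linf_norm \<Omega> (\<lambda>x. c *\<^sub>R u x) = \<bar>c\<bar> * Linf_norm \<Omega> u"
proof -
  have le: "Linf_norm \<Omega> (\<lambda>x. d *\<^sub>R w x) \<le> \<bar>d\<bar> * Linf_norm \<Omega> w"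
    if w: "w \<in> Linf \<Omega>" for d and w :: "real ^ 'n \<Rightarrow> 'b"
  proof (rule Linf_norm_le)
    show "AE x in lebesgue_on \<Omega>. norm (d *\<^sub>R w x) \<le> \<bar>d\<bar> * Linf_norm \<Omega> w"
      using Linf_norm_AE[OF w] by eventually_elim (simp add: mult_left_mono)
  qed (simp add: Linf_norm_nonneg[OF w])
  have cu: "(\<lambda>x. c *\<^sub>R u x) \<in> Linf \<Omega>"
  proof -
    have "AE x in lebesgue_on \<Omega>. norm (c *\<^sub>R u x) \<le> \<bar>c\<bar> * Linf_norm \<Omega> u"
      using Linf_norm_AE[OF assms] by eventually_elim (simp add: mult_left_mono)
    then show ?thesis using assms by (auto simp: Linf_def intro!: borel_measurable_const_scaleR)
  qed
  show ?thesis
  proof (cases "c = 0")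
    case True
    have "Linf_norm \<Omega> (\<lambda>x. c *\<^sub>R u x) = 0"
      using le[OF assms, of c] Linf_norm_nonneg[OF cu] True by simp
    then show ?thesis using True by simp
  next
    case False
    have "Linf_norm \<Omega> (\<lambda>x. (1 / c) *\<^sub>R (c *\<^sub>R u x)) \<le> \<bar>1 / c\<bar> * Linf_norm \<Omega> (\<lambda>x. c *\<^sub>R u x)"
      by (rule le[OF cu])
    then have "\<bar>c\<bar> * Linf_norm \<Omega> u \<le> Linf_norm \<Omega> (\<lambda>x. c *\<^sub>R u x)"
      using False by (simp add: field_simps)
    with le[OF assms, of c] show ?thesis by simp
  qed
qed

lemma Cc_inf_Linf:
  fixes \<phi> :: "real ^ 'n \<Rightarrow> 'b::euclidean_space"
  assumes "\<phi> \<in> Cc_inf S"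
  shows "\<phi> \<in> Linf \<Omega>"
proof -
  obtain B where "\<And>x. norm (\<phi> x) \<le> B" using Cc_inf_bounded[OF assms] by blast
  then show ?thesis using smooth_measurable[OF Cc_inf_smooth[OF assms]]
    by (auto simp: Linf_def intro!: exI[of _ B])
qed

lemma Linf_cong_AE:
  assumes "AE x in lebesgue_on \<Omega>. u x = w x" "u \<in> Linf \<Omega>"
  shows "w \<in> Linf \<Omega>"
proof -
  have "AE x in lebesgue_on \<Omega>. norm (w x) \<le> Linf_norm \<Omega> u"
    using assms(1) Linf_norm_AE[OF assms(2)] by eventually_elim simp
  then show ?thesis
    using assms measurable_AE_cong_lebesgue_on[OF sets_dom assms(1)] by (auto simp: Linf_def)
qed

lemma W1inf_Linf: "u \<in> W1inf \<Omega> \<Longrightarrow> u \<in> Linf \<Omega>"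
  by (simp add: W1inf_def)

lemma W1inf_wpartial_Linf:
  fixes u :: "real ^ 'n \<Rightarrow> 'b::euclidean_space"
  assumes "u \<in> W1inf \<Omega>"
  shows "wpartial \<Omega> j u \<in> Linf \<Omega>"
proof -
  obtain g where g: "g \<in> Linf \<Omega>" "weak_partial \<Omega> j u g" using assms unfolding W1inf_def by blast
  have "AE x in lebesgue_on \<Omega>. g x = wpartial \<Omega> j u x"
    using wpartial_AE_eq[OF g(2)] by eventually_elim simp
  then show ?thesis using g(1) by (rule Linf_cong_AE)
qed

lemma Cc_inf_W1inf:
  fixes \<phi> :: "real ^ 'n \<Rightarrow> 'b::euclidean_space"
  assumes "\<phi> \<in> Cc_inf S"
  shows "\<phi> \<in> W1inf \<Omega>"
  unfolding W1inf_def
  using Cc_inf_Linf[OF assms] Cc_inf_Linf[OF Cc_inf_partial[OF assms]] weak_partial_smooth[OF assms] by blast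

lemma W1inf_norm_smooth:
  fixes \<phi> :: "real ^ 'n \<Rightarrow> 'b::euclidean_space"
  assumes "\<phi> \<in> Cc_inf S"
  shows "W1inf_norm \<Omega> \<phi> = Linf_norm \<Omega> \<phi> + (\<Sum>j\<in>UNIV. Linf_norm \<Omega> (partial_deriv j \<phi>))"
  unfolding W1inf_norm_def using Linf_norm_cong_AE[OF wpartial_smooth[OF assms]] by simp

lemma W1inf_norm_scaleR:
  fixes \<phi> :: "real ^ 'n \<Rightarrow> 'b::euclidean_space"
  assumes "\<phi> \<in> Cc_inf S"
  shows "W1inf_norm \<Omega> (\<lambda>x. c *\<^sub>R \<phi> x) = \<bar>c\<bar> * W1inf_norm \<Omega> \<phi>"
proof -
  have "partial_deriv j (\<lambda>x. c *\<^sub>R \<phi> x) = (\<lambda>x. c *\<^sub>R partial_deriv j \<phi> x)" for j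
    by (rule ext, rule partial_deriv_scaleR[OF smooth_fun_differentiable[OF Cc_inf_smooth[OF assms]]])
  then show ?thesis
    using Linf_norm_scaleR[OF Cc_inf_Linf[OF assms], of c]
      Linf_norm_scaleR[OF Cc_inf_Linf[OF Cc_inf_partial[OF assms]], of c]
    by (simp add: W1inf_norm_smooth[OF assms] W1inf_norm_smooth[OF Cc_inf_scaleR_const[OF assms]]
        sum_distrib_left distrib_left)
qed

lemma W1inf_norm_nonneg:
  fixes u :: "real ^ 'n \<Rightarrow> 'b::euclidean_space"
  shows "u \<in> W1inf \<Omega> \<Longrightarrow> 0 \<le> W1inf_norm \<Omega> u"
  unfolding W1inf_norm_def
  by (intro add_nonneg_nonneg sum_nonneg Linf_norm_nonneg W1inf_Linf W1inf_wpartial_Linf)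

lemma W1inf_norm_cong_AE:
  assumes "AE x in lebesgue_on \<Omega>. u x = w x"
  shows "W1inf_norm \<Omega> u = W1inf_norm \<Omega> w"
  using Linf_norm_cong_AE[OF assms] wpartial_cong_AE[OF assms] by (simp add: W1inf_norm_def)

lemma W1inf_norm_AE:
  fixes u :: "real ^ 'n \<Rightarrow> real ^ 'n"
  assumes u: "u \<in> W1inf \<Omega>"
  shows "AE x in lebesgue_on \<Omega>. norm (u x) \<le> W1inf_norm \<Omega> u \<and> norm (wgrad \<Omega> u x) \<le> W1inf_norm \<Omega> u"
proof -
  have "AE x in lebesgue_on \<Omega>. \<forall>j. norm (wpartial \<Omega> j u x) \<le> Linf_norm \<Omega> (wpartial \<Omega> j u)"
    by (rule AE_all_finite[OF Linf_norm_AE[OF W1inf_wpartial_Linf[OF u]]])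
  with Linf_norm_AE[OF W1inf_Linf[OF u]] show ?thesis
  proof eventually_elim
    case (elim x)
    have s: "0 \<le> (\<Sum>j\<in>UNIV. Linf_norm \<Omega> (wpartial \<Omega> j u))"
      by (intro sum_nonneg Linf_norm_nonneg W1inf_wpartial_Linf u)
    have "norm (wgrad \<Omega> u x) \<le> (\<Sum>j\<in>UNIV. norm (wpartial \<Omega> j u x))"
      unfolding wgrad_def by (rule norm_matrix_le_columns)
    also have "\<dots> \<le> (\<Sum>j\<in>UNIV. Linf_norm \<Omega> (wpartial \<Omega> j u))"
      using elim(2) by (intro sum_mono) blast
    finally have "norm (wgrad \<Omega> u x) \<le> W1inf_norm \<Omega> u"
      unfolding W1inf_norm_def using Linf_norm_nonneg[OF W1inf_Linf[OF u]] by linarith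
    moreover have "norm (u x) \<le> W1inf_norm \<Omega> u"
      unfolding W1inf_norm_def using elim(1) s by linarith
    ultimately show ?case by blast
  qed
qed

end


section \<open>Measurability in time\<close>

text \<open>The source of all measurability in time: the composition is measurable for the
  approximating simple functions, which take finitely many values in \<open>X\<close>, and
  continuity of \<open>F t\<close> at \<open>u t\<close> passes this on to the limit.\<close>

lemma bochner_measurable_compose:
  assumes u: "bochner_measurable T X N u"
    and meas: "\<And>x. x \<in> X \<Longrightarrow> (\<lambda>t. F t x) \<in> borel_measurable (lebesgue_on {0<..<T})"
    and cont: "AE t in lebesgue_on {0<..<T}. \<forall>y :: nat \<Rightarrow> _. (\<forall>k. y k \<in> X) \<longrightarrow>
        (\<lambda>k. N (\<lambda>x. y k x - u t x)) \<longlonglongrightarrow> 0 \<longrightarrow> (\<lambda>k. F t (y k)) \<longlonglongrightarrow> (F t (u t) :: real)"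
  shows "(\<lambda>t. F t (u t)) \<in> borel_measurable (lebesgue_on {0<..<T})"
proof -
  obtain s where s: "\<And>k::nat. simple_function (lebesgue_on {0<..<T}) (s k)"
    "\<And>k t. t \<in> {0<..<T} \<Longrightarrow> s k t \<in> X"
    "AE t in lebesgue_on {0<..<T}. (\<lambda>k. N (\<lambda>x. s k t x - u t x)) \<longlonglongrightarrow> 0"
    using u unfolding bochner_measurable_def by blast
  have m: "(\<lambda>t. F t (s k t)) \<in> borel_measurable (lebesgue_on {0<..<T})" for k
  proof (rule measurable_compose_countable'[where I="s k ` {0<..<T}" and f="\<lambda>i t. F t i" and g="s k"])
    show "s k \<in> lebesgue_on {0<..<T} \<rightarrow>\<^sub>M count_space (s k ` {0<..<T})"
    proof (rule measurableI)
      fix A assume "A \<in> sets (count_space (s k ` {0<..<T}))"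
      show "s k -` A \<inter> space (lebesgue_on {0<..<T}) \<in> sets (lebesgue_on {0<..<T})"
        by (rule simple_functionD(2)[OF s(1)])
    qed simp
    show "countable (s k ` {0<..<T})"
      using simple_functionD(1)[OF s(1)[of k]] by (simp add: countable_finite)
    show "(\<lambda>t. F t i) \<in> borel_measurable (lebesgue_on {0<..<T})" if "i \<in> s k ` {0<..<T}" for i
      using that s(2) meas by blast
  qed
  show ?thesis
  proof (rule measurable_AE_limit_lebesgue_on[OF _ m])
    show "AE t in lebesgue_on {0<..<T}. (\<lambda>k. F t (s k t)) \<longlonglongrightarrow> F t (u t)"
      using s(3) cont AE_space
    proof eventually_elim
      case (elim t)
      then have "\<forall>k. s k t \<in> X" using s(2) by simp
      then show ?case
        using spec[OF elim(2), of "\<lambda>k. s k t"] elim(1) by (simp only: simp_thms)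
    qed
  qed simp
qed

lemma bochner_measurable_AE:
  "bochner_measurable T X N u \<Longrightarrow> AE t in lebesgue_on {0<..<T}. u t \<in> X"
  by (simp add: bochner_measurable_def)

text \<open>The simple functions that approximate \<open>u\<close> have together only countably many
  values. This separability lets a null set that depends on a test element be chosen independently
  of it.\<close>

lemma bochner_measurable_countable_approx:
  assumes u: "bochner_measurable T X N u"
  obtains D where "countable D" "D \<subseteq> X"
    "AE t in lebesgue_on {0<..<T}. \<exists>y :: nat \<Rightarrow> _. (\<forall>k. y k \<in> D) \<and> (\<lambda>k. N (\<lambda>x. y k x - u t x)) \<longlonglongrightarrow> 0"
proof -
  obtain s where s: "\<And>k::nat. simple_function (lebesgue_on {0<..<T}) (s k)"
    "\<And>k t. t \<in> {0<..<T} \<Longrightarrow> s k t \<in> X"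
    "AE t in lebesgue_on {0<..<T}. (\<lambda>k. N (\<lambda>x. s k t x - u t x)) \<longlonglongrightarrow> 0"
    using u unfolding bochner_measurable_def by blast
  define D where "D = (\<Union>k. s k ` {0<..<T})"
  have "countable (s k ` {0<..<T})" for k
    using simple_functionD(1)[OF s(1)[of k]] by (simp add: countable_finite)
  then have "countable D" unfolding D_def by simp
  moreover have "D \<subseteq> X" unfolding D_def using s(2) by blast
  moreover have "AE t in lebesgue_on {0<..<T}. \<exists>y :: nat \<Rightarrow> _. (\<forall>k. y k \<in> D) \<and> (\<lambda>k. N (\<lambda>x. y k x - u t x)) \<longlonglongrightarrow> 0"
    using s(3) AE_space
  proof eventually_elim
    case (elim t)
    then have "s k t \<in> D" for k
      unfolding D_def by (intro UN_I[of k] imageI) simp_all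
    then show ?case using elim(1) by (intro exI[of _ "\<lambda>k. s k t"]) simp
  qed
  ultimately show ?thesis by (rule that)
qed

lemma simple_function_floor:
  fixes c :: real
  assumes "c > 0"
  shows "simple_function (lebesgue_on {0<..<T}) (\<lambda>t. \<lfloor>c * t\<rfloor>)"
  unfolding simple_function_def
proof (intro conjI ballI)
  have "(\<lambda>t. \<lfloor>c * t\<rfloor>) ` space (lebesgue_on {0<..<T}) \<subseteq> {0..\<lfloor>c * T\<rfloor>}"
    using assms by (auto intro!: floor_mono)
  then show "finite ((\<lambda>t. \<lfloor>c * t\<rfloor>) ` space (lebesgue_on {0<..<T}))"
    by (rule finite_subset) simp
  fix n
  have "(\<lambda>t. \<lfloor>c * t\<rfloor>) \<in> measurable borel (count_space UNIV)"
    by (rule measurable_compose[OF _ measurable_real_floor]) simp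
  from measurable_sets[OF this, of "{n}"]
  have m: "(\<lambda>t. \<lfloor>c * t\<rfloor>) -` {n} \<in> sets lebesgue" by simp
  have "(\<lambda>t. \<lfloor>c * t\<rfloor>) -` {n} \<inter> {0<..<T} \<in> sets lebesgue"
    by (rule sets.Int[OF m]) simp
  then show "(\<lambda>t. \<lfloor>c * t\<rfloor>) -` {n} \<inter> space (lebesgue_on {0<..<T}) \<in> sets (lebesgue_on {0<..<T})"
    by (simp add: sets_restrict_space_iff)
qed

text \<open>A continuous curve is the limit of its step functions on uniform partitions of the time
  interval.\<close>

lemma bochner_measurable_continuous:
  assumes X: "\<And>t. t \<in> {0<..<T} \<Longrightarrow> u t \<in> X" and N0: "N (\<lambda>x. 0) = (0::real)"
    and lim: "\<And>t. t \<in> {0<..<T} \<Longrightarrow> ((\<lambda>\<tau>. N (\<lambda>x. u \<tau> x - u t x)) \<longlongrightarrow> 0) (at t within {0..T})"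
  shows "bochner_measurable T X N u"
proof -
  define c where "c k = real (Suc k) / T" for k
  \<comment> \<open>The midpoint of the cell of length T / (k + 1) that contains t; unlike a node, it never is 0 or T.\<close>
  define g where "g k t = (real_of_int \<lfloor>c k * t\<rfloor> + 1 / 2) / c k" for k t
  show ?thesis
    unfolding bochner_measurable_def
  proof (intro conjI exI[of _ "\<lambda>k t. u (g k t)"] allI ballI)
    show "AE t in lebesgue_on {0<..<T}. u t \<in> X" using X by (intro AE_I2) simp
    have g: "0 < g k t \<and> g k t < T \<and> \<bar>g k t - t\<bar> \<le> T / real (Suc k)" if t: "t \<in> {0<..<T}" for k t
    proof -
      have T: "T > 0" and c: "c k > 0" using t by (auto simp: c_def)
      have fl: "real_of_int \<lfloor>c k * t\<rfloor> \<le> c k * t" "c k * t < real_of_int \<lfloor>c k * t\<rfloor> + 1" by linarith+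
      have "0 \<le> c k * t" using c t by simp
      then have f0: "0 \<le> \<lfloor>c k * t\<rfloor>" by simp
      have "real (Suc k) * t < real (Suc k) * T" using t by (intro mult_strict_left_mono) auto
      then have "c k * t < real (Suc k)" using T by (simp only: c_def) (simp add: divide_less_eq)
      then have "\<lfloor>c k * t\<rfloor> < int (Suc k)" by (simp add: floor_less_iff)
      then have f1: "real_of_int \<lfloor>c k * t\<rfloor> + 1 \<le> real (Suc k)" by linarith
      have gc: "g k t * c k = real_of_int \<lfloor>c k * t\<rfloor> + 1 / 2" using c by (simp add: g_def)
      have "0 \<le> real_of_int \<lfloor>c k * t\<rfloor>" using f0 by (simp only: of_int_0_le_iff)
      then have "0 < g k t" unfolding g_def using c by (intro divide_pos_pos) linarith+
      moreover have "g k t < T"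
      proof -
        have "g k t * c k < T * c k" unfolding gc using f1 T by (simp add: c_def)
        then show ?thesis using c by simp
      qed
      moreover have "\<bar>g k t - t\<bar> \<le> T / real (Suc k)"
      proof -
        have "\<bar>g k t - t\<bar> * c k = \<bar>g k t * c k - c k * t\<bar>"
          using c by (simp add: abs_mult[symmetric] algebra_simps abs_mult_pos')
        also have "\<dots> \<le> 1" unfolding gc using fl by linarith
        finally show ?thesis using c T by (simp add: c_def field_simps)
      qed
      ultimately show ?thesis by blast
    qed
    show "u (g k t) \<in> X" if "t \<in> {0<..<T}" for k t using g[OF that, of k] X by simp
    show "simple_function (lebesgue_on {0<..<T}) (\<lambda>t. u (g k t))" for k
    proof (cases "T > 0")
      case True
      then have "c k > 0" by (simp add: c_def)
      from simple_function_compose1[OF simple_function_floor[OF this], where g="\<lambda>n. u ((real_of_int n + 1 / 2) / c k)"]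
      show ?thesis by (simp add: g_def)
    next
      case False
      then show ?thesis by (simp add: simple_function_def)
    qed
    show "AE t in lebesgue_on {0<..<T}. (\<lambda>k. N (\<lambda>x. u (g k t) x - u t x)) \<longlonglongrightarrow> 0"
    proof (rule AE_I2)
      fix t assume "t \<in> space (lebesgue_on {0<..<T})"
      then have t: "t \<in> {0<..<T}" by simp
      define n where "n \<tau> = N (\<lambda>x. u \<tau> x - u t x)" for \<tau>
      have nt: "n t = 0" by (simp add: n_def N0)
      have "continuous (at t within {0..T}) n"
        using lim[OF t] nt unfolding continuous_within n_def by simp
      moreover have "(\<lambda>k. g k t) \<longlonglongrightarrow> t"
      proof -
        have "(\<lambda>k. T * (1 / real (Suc k))) \<longlonglongrightarrow> T * 0"
          using LIMSEQ_inverse_real_of_nat by (intro tendsto_mult tendsto_const) (simp add: inverse_eq_divide)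
        then have l0: "(\<lambda>k. T / real (Suc k)) \<longlonglongrightarrow> 0" by simp
        have "(\<lambda>k. g k t - t) \<longlonglongrightarrow> 0"
          by (rule Lim_null_comparison[OF always_eventually l0]) (use g[OF t] in simp)
        then show ?thesis by (simp add: LIM_zero_iff)
      qed
      ultimately have "(\<lambda>k. n (g k t)) \<longlonglongrightarrow> n t"
        using t g[OF t] by (intro continuous_within_tendsto_compose'[of t "{0..T}" n "\<lambda>k. g k t"])
          (auto intro: less_imp_le)
      then have "(\<lambda>k. n (g k t)) \<longlonglongrightarrow> 0" unfolding nt .
      then show "(\<lambda>k. N (\<lambda>x. u (g k t) x - u t x)) \<longlonglongrightarrow> 0"
        by (simp only: n_def)
    qed
  qed
qed

lemma integrable_continuous_time:
  fixes g :: "real \<Rightarrow> real"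
  assumes "continuous_on {0..T} g"
  shows "integrable (lebesgue_on {0<..<T}) g"
proof -
  have "g integrable_on {0..T}" by (rule integrable_continuous_real[OF assms])
  have "compact (g ` {0..T})" using assms by (intro compact_continuous_image) auto
  then obtain B where B: "\<And>t. t \<in> {0..T} \<Longrightarrow> norm (g t) \<le> B"
    using compact_imp_bounded bounded_iff by (metis imageI)
  show ?thesis
  proof (rule finite_measure.integrable_const_bound[where B=B])
    show "finite_measure (lebesgue_on {0<..<T})"
      by (rule finite_measure_lebesgue_on) simp
    show "AE t in lebesgue_on {0<..<T}. norm (g t) \<le> B" using B by (intro AE_I2) simp
    show "g \<in> borel_measurable (lebesgue_on {0<..<T})"
      by (rule continuous_imp_measurable_on_sets_lebesgue[OF continuous_on_subset[OF assms]]) auto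
  qed
qed

lemma Lp_time_continuous:
  assumes X: "\<And>t. t \<in> {0..T} \<Longrightarrow> u t \<in> X" and N0: "N (\<lambda>x. 0) = (0::real)"
    and lim: "\<And>t. t \<in> {0..T} \<Longrightarrow> ((\<lambda>\<tau>. N (\<lambda>x. u \<tau> x - u t x)) \<longlongrightarrow> 0) (at t within {0..T})"
    and cont: "continuous_on {0..T} (\<lambda>t. N (u t))"
  shows "u \<in> Lp_time p T X N" "u \<in> Linf_time T X N"
proof -
  have b: "bochner_measurable T X N u"
  proof (rule bochner_measurable_continuous[where N=N])
    show "u t \<in> X" if "t \<in> {0<..<T}" for t using X that by simp
    show "((\<lambda>\<tau>. N (\<lambda>x. u \<tau> x - u t x)) \<longlongrightarrow> 0) (at t within {0..T})" if "t \<in> {0<..<T}" for t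
      using lim[of t] that by simp
  qed (rule N0)
  then show "u \<in> Lp_time p T X N"
    unfolding Lp_time_def using integrable_continuous_time[OF continuous_on_power[OF cont]] by blast
  have "compact ((\<lambda>t. N (u t)) ` {0..T})" using cont by (intro compact_continuous_image) auto
  then obtain B where B: "\<And>t. t \<in> {0..T} \<Longrightarrow> norm (N (u t)) \<le> B"
    using compact_imp_bounded bounded_iff by (metis (mono_tags, lifting) imageI)
  have "N (u t) \<le> B" if "t \<in> {0<..<T}" for t using B[of t] that by simp
  then have "AE t in lebesgue_on {0<..<T}. N (u t) \<le> B" by (intro AE_I2) simp
  then show "u \<in> Linf_time T X N"
    unfolding Linf_time_def using b by blast
qed

section \<open>Bounded functionals\<close>

text \<open>Rescale \<open>u\<close> to the unit ball. If \<open>N u = 0\<close> this is impossible,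
  but then \<open>F u = 0\<close> because \<open>F\<close> is bounded.\<close>

lemma dual_bound:
  assumes F: "F \<in> dual X N" and u: "u \<in> X"
    and N: "\<And>u. u \<in> X \<Longrightarrow> 0 \<le> N u"
    and scale: "\<And>c u. u \<in> X \<Longrightarrow> (\<lambda>x. c *\<^sub>R u x) \<in> X \<and> N (\<lambda>x. c *\<^sub>R u x) = \<bar>c\<bar> * N u"
  shows "\<bar>F u\<bar> \<le> dual_norm X N F * N u"
proof -
  obtain C where C: "\<And>u. u \<in> X \<Longrightarrow> \<bar>F u\<bar> \<le> C * N u" using F unfolding dual_def by blast
  show ?thesis
  proof (cases "N u = 0")
    case True
    then show ?thesis using C[OF u] by simp
  next
    case False
    then have pos: "N u > 0" using N[OF u] by simp
    let ?w = "\<lambda>x. (1 / N u) *\<^sub>R u x"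
    have w: "?w \<in> X" "N ?w \<le> 1" using scale[OF u, of "1 / N u"] pos by auto
    have "\<bar>F ?w\<bar> \<le> dual_norm X N F"
      unfolding dual_norm_def
    proof (rule cSup_upper)
      show "\<bar>F ?w\<bar> \<in> {\<bar>F u\<bar> |u. u \<in> X \<and> N u \<le> 1}" using w by blast
      show "bdd_above {\<bar>F u\<bar> |u. u \<in> X \<and> N u \<le> 1}"
      proof (rule bdd_aboveI[of _ "\<bar>C\<bar>"])
        fix a assume "a \<in> {\<bar>F u\<bar> |u. u \<in> X \<and> N u \<le> 1}"
        then obtain z where z: "a = \<bar>F z\<bar>" "z \<in> X" "N z \<le> 1" by blast
        have "a \<le> C * N z" using C z by simp
        also have "\<dots> \<le> \<bar>C\<bar> * N z" using N[OF z(2)] by (intro mult_right_mono) auto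
        also have "\<dots> \<le> \<bar>C\<bar> * 1" using z(3) by (intro mult_left_mono) auto
        finally show "a \<le> \<bar>C\<bar>" by simp
      qed
    qed
    moreover have "F ?w = (1 / N u) * F u" using F u unfolding dual_def by blast
    ultimately have "\<bar>F u\<bar> / N u \<le> dual_norm X N F" using pos by (simp add: abs_mult)
    then show ?thesis using pos by (simp add: field_simps)
  qed
qed

lemma dual_norm_cong:
  "(\<And>u. u \<in> X \<Longrightarrow> F u = G u) \<Longrightarrow> dual_norm X N F = dual_norm X N G"
  unfolding dual_norm_def by (rule arg_cong[where f=Sup]) (auto; metis)

lemma FTC_lebesgue:
  fixes F :: "real \<Rightarrow> real"
  assumes "a \<le> b" "\<And>t. t \<in> {a..b} \<Longrightarrow> (F has_vector_derivative f t) (at t within {a..b})"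
    and "continuous_on {a..b} f"
  shows "(LINT t|lebesgue_on {a..b}. f t) = F b - F a"
proof -
  have "f absolutely_integrable_on {a..b}"
    using assms(3) by (rule absolutely_integrable_continuous_real)
  then have "integrable (lebesgue_on {a..b}) f"
    by (simp add: set_integrable_def integrable_restrict_space)
  then have "(LINT t|lebesgue_on {a..b}. f t) = integral {a..b} f"
    by (intro lebesgue_integral_eq_integral) auto
  also have "\<dots> = F b - F a"
    by (rule integral_unique[OF fundamental_theorem_of_calculus[OF assms(1,2)]])
  finally show ?thesis .
qed

lemma LINT_interior:
  fixes f :: "real \<Rightarrow> real"
  shows "(LINT t|lebesgue_on {a..b}. f t) = (LINT t|lebesgue_on {a<..<b}. f t)"
    and "integrable (lebesgue_on {a..b}) f \<longleftrightarrow> integrable (lebesgue_on {a<..<b}) f"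
proof -
  have "{a, b} \<in> null_sets lebesgue" by (rule null_sets_completionI) (simp add: finite_imp_null_set_lborel)
  then have "AE t in lebesgue. t \<notin> {a, b}" by (rule AE_not_in)
  then have ae: "AE t in lebesgue_on UNIV. indicat_real {a..b} t *\<^sub>R f t = indicat_real {a<..<b} t *\<^sub>R f t"
    unfolding lebesgue_on_UNIV_eq by eventually_elim (auto simp: indicator_def)
  show "(LINT t|lebesgue_on {a..b}. f t) = (LINT t|lebesgue_on {a<..<b}. f t)"
    using integral_AE_cong_lebesgue_on[OF _ ae]
    by (simp add: integral_restrict_space lebesgue_on_UNIV_eq)
  show "integrable (lebesgue_on {a..b}) f \<longleftrightarrow> integrable (lebesgue_on {a<..<b}) f"
    using integrable_AE_cong_lebesgue_on[OF _ ae]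
    by (simp add: integrable_restrict_space lebesgue_on_UNIV_eq)
qed

context bounded_open begin

lemma L2_sigma_scaleR:
  assumes "u \<in> L2_sigma \<Omega>"
  shows "(\<lambda>x. c *\<^sub>R u x) \<in> L2_sigma \<Omega>"
  unfolding L2_sigma_def closure_in_def
proof (intro CollectI conjI allI impI)
  show "(\<lambda>x. c *\<^sub>R u x) \<in> L2 \<Omega>" by (rule L2_scaleR[OF L2_sigma_L2[OF assms]])
  fix e :: real assume "e > 0"
  then have "e / (\<bar>c\<bar> + 1) > 0" by simp
  then obtain \<phi> where \<phi>: "\<phi> \<in> Cc_inf_sigma \<Omega>" "L2_norm \<Omega> (\<lambda>x. u x - \<phi> x) < e / (\<bar>c\<bar> + 1)"
    using assms unfolding L2_sigma_def closure_in_def by blast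
  have "L2_norm \<Omega> (\<lambda>x. c *\<^sub>R u x - c *\<^sub>R \<phi> x) = \<bar>c\<bar> * L2_norm \<Omega> (\<lambda>x. u x - \<phi> x)"
    unfolding scaleR_diff_right[symmetric] by (rule L2_norm_scaleR)
  also have "\<dots> \<le> (\<bar>c\<bar> + 1) * L2_norm \<Omega> (\<lambda>x. u x - \<phi> x)" by (intro mult_right_mono) auto
  also have "\<dots> < e" using \<phi>(2) by (simp add: field_simps)
  finally show "\<exists>\<phi>\<in>Cc_inf_sigma \<Omega>. L2_norm \<Omega> (\<lambda>x. c *\<^sub>R u x - \<phi> x) < e"
    by (rule bexI[of _ "\<lambda>x. c *\<^sub>R \<phi> x", OF _ Cc_inf_sigma_scaleR[OF \<phi>(1)]])
qed

lemma dual_L2_sigma_bound: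
  "F \<in> dual (L2_sigma \<Omega>) (L2_norm \<Omega>) \<Longrightarrow> u \<in> L2_sigma \<Omega> \<Longrightarrow>
    \<bar>F u\<bar> \<le> dual_norm (L2_sigma \<Omega>) (L2_norm \<Omega>) F * L2_norm \<Omega> u"
  by (rule dual_bound) (auto simp: L2_norm_scaleR L2_sigma_scaleR)

lemma L2_inner_dual:
  assumes "u \<in> L2 \<Omega>"
  shows "L2_inner \<Omega> u \<in> dual (L2_sigma \<Omega>) (L2_norm \<Omega>)"
  unfolding dual_def
proof (intro CollectI conjI ballI allI exI[of _ "L2_norm \<Omega> u"])
  fix w z assume "w \<in> L2_sigma \<Omega>" "z \<in> L2_sigma \<Omega>"
  then show "L2_inner \<Omega> u (\<lambda>x. w x + z x) = L2_inner \<Omega> u w + L2_inner \<Omega> u z"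
    using L2_inner_add_right[OF L2_sigma_L2 L2_sigma_L2 assms] by blast
next
  fix w assume "w \<in> L2_sigma \<Omega>"
  then show "\<bar>L2_inner \<Omega> u w\<bar> \<le> L2_norm \<Omega> u * L2_norm \<Omega> w"
    by (rule L2_Cauchy_Schwarz[OF assms L2_sigma_L2])
qed simp

text \<open>The Riesz isometry: one inequality is Cauchy-Schwarz, the other comes from testing with
  \<open>u\<close>.\<close>

lemma dual_norm_L2_inner:
  assumes u: "u \<in> L2_sigma \<Omega>"
  shows "dual_norm (L2_sigma \<Omega>) (L2_norm \<Omega>) (L2_inner \<Omega> u) = L2_norm \<Omega> u"
proof (rule antisym)
  note uL = L2_sigma_L2[OF u]
  have z: "(\<lambda>x. 0) \<in> L2_sigma \<Omega>" using Cc_inf_sigma_L2_sigma[OF Cc_inf_sigma_zero] .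
  show "dual_norm (L2_sigma \<Omega>) (L2_norm \<Omega>) (L2_inner \<Omega> u) \<le> L2_norm \<Omega> u"
    unfolding dual_norm_def
  proof (rule cSup_least)
    have "\<bar>L2_inner \<Omega> u (\<lambda>x. 0)\<bar> \<in> {\<bar>L2_inner \<Omega> u w\<bar> |w. w \<in> L2_sigma \<Omega> \<and> L2_norm \<Omega> w \<le> 1}"
      using z by (intro CollectI exI[of _ "\<lambda>x. 0"]) simp
    then show "{\<bar>L2_inner \<Omega> u w\<bar> |w. w \<in> L2_sigma \<Omega> \<and> L2_norm \<Omega> w \<le> 1} \<noteq> {}" by blast
    fix a assume "a \<in> {\<bar>L2_inner \<Omega> u w\<bar> |w. w \<in> L2_sigma \<Omega> \<and> L2_norm \<Omega> w \<le> 1}"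
    then obtain w where w: "a = \<bar>L2_inner \<Omega> u w\<bar>" "w \<in> L2_sigma \<Omega>" "L2_norm \<Omega> w \<le> 1" by blast
    have "a \<le> L2_norm \<Omega> u * L2_norm \<Omega> w" using L2_Cauchy_Schwarz[OF uL L2_sigma_L2[OF w(2)]] w(1) by simp
    also have "\<dots> \<le> L2_norm \<Omega> u * 1" using w(3) by (intro mult_left_mono) auto
    finally show "a \<le> L2_norm \<Omega> u" by simp
  qed
  show "L2_norm \<Omega> u \<le> dual_norm (L2_sigma \<Omega>) (L2_norm \<Omega>) (L2_inner \<Omega> u)"
  proof (cases "L2_norm \<Omega> u = 0")
    case True
    have "\<bar>L2_inner \<Omega> u (\<lambda>x. 0)\<bar> \<le> dual_norm (L2_sigma \<Omega>) (L2_norm \<Omega>) (L2_inner \<Omega> u)"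
      unfolding dual_norm_def
    proof (rule cSup_upper)
      show "\<bar>L2_inner \<Omega> u (\<lambda>x. 0)\<bar> \<in> {\<bar>L2_inner \<Omega> u w\<bar> |w. w \<in> L2_sigma \<Omega> \<and> L2_norm \<Omega> w \<le> 1}"
        using z by (intro CollectI exI[of _ "\<lambda>x. 0"]) simp
      show "bdd_above {\<bar>L2_inner \<Omega> u w\<bar> |w. w \<in> L2_sigma \<Omega> \<and> L2_norm \<Omega> w \<le> 1}"
      proof (rule bdd_aboveI[of _ 0])
        fix a assume "a \<in> {\<bar>L2_inner \<Omega> u w\<bar> |w. w \<in> L2_sigma \<Omega> \<and> L2_norm \<Omega> w \<le> 1}"
        then obtain w where w: "a = \<bar>L2_inner \<Omega> u w\<bar>" "w \<in> L2_sigma \<Omega>" by blast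
        then show "a \<le> 0" using L2_Cauchy_Schwarz[OF uL L2_sigma_L2[OF w(2)]] True by simp
      qed
    qed
    then show ?thesis using True by simp
  next
    case False
    then have pos: "L2_norm \<Omega> u > 0" using L2_norm_nonneg[of \<Omega> u] by linarith
    have "(L2_norm \<Omega> u)\<^sup>2 \<le> dual_norm (L2_sigma \<Omega>) (L2_norm \<Omega>) (L2_inner \<Omega> u) * L2_norm \<Omega> u"
      using dual_L2_sigma_bound[OF L2_inner_dual[OF uL] u] by (simp add: L2_inner_self)
    then show ?thesis using pos by (simp add: power2_eq_square)
  qed
qed

section \<open>Sobolev norms of test functions\<close>

lemma H1_cong_AE:
  assumes "AE x in lebesgue_on \<Omega>. u x = w x" "u \<in> H1 \<Omega>"
  shows "w \<in> H1 \<Omega>"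
proof -
  have "weak_partial \<Omega> j u g = weak_partial \<Omega> j w g" for j g
    by (rule weak_partial_cong_AE[OF assms(1)]) simp
  then show ?thesis
    using assms(2) L2_cong_AE[OF assms(1)] unfolding H1_def by blast
qed

lemma H1_norm_cong_AE:
  assumes "AE x in lebesgue_on \<Omega>. u x = w x"
  shows "H1_norm \<Omega> u = H1_norm \<Omega> w"
  using L2_norm_cong_AE[OF assms] wpartial_cong_AE[OF assms] by (simp add: H1_norm_def)

lemma H1_norm_smooth:
  fixes \<phi> :: "real ^ 'n \<Rightarrow> 'b::euclidean_space"
  assumes "\<phi> \<in> Cc_inf S"
  shows "H1_norm \<Omega> \<phi> = sqrt ((L2_norm \<Omega> \<phi>)\<^sup>2 + (\<Sum>j\<in>UNIV. (L2_norm \<Omega> (partial_deriv j \<phi>))\<^sup>2))"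
  unfolding H1_norm_def using L2_norm_cong_AE[OF wpartial_smooth[OF assms]] by simp

lemma H2_norm_smooth:
  fixes \<phi> :: "real ^ 'n \<Rightarrow> 'b::euclidean_space"
  assumes "\<phi> \<in> Cc_inf S"
  shows "H2_norm \<Omega> \<phi> = sqrt ((L2_norm \<Omega> \<phi>)\<^sup>2 + (\<Sum>j\<in>UNIV. (H1_norm \<Omega> (partial_deriv j \<phi>))\<^sup>2))"
  unfolding H2_norm_def using H1_norm_cong_AE[OF wpartial_smooth[OF assms]] by simp

lemma Cc_inf_H2:
  fixes \<phi> :: "real ^ 'n \<Rightarrow> 'b::euclidean_space"
  assumes "\<phi> \<in> Cc_inf S"
  shows "\<phi> \<in> H2 \<Omega>"
  unfolding H2_def
proof (intro CollectI conjI allI)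
  show "\<phi> \<in> H1 \<Omega>" by (rule Cc_inf_H1[OF assms])
  fix j
  have "AE x in lebesgue_on \<Omega>. partial_deriv j \<phi> x = wpartial \<Omega> j \<phi> x"
    using wpartial_smooth[OF assms, of j] by eventually_elim simp
  then show "wpartial \<Omega> j \<phi> \<in> H1 \<Omega>"
    by (rule H1_cong_AE) (rule Cc_inf_H1[OF Cc_inf_partial[OF assms]])
qed

lemma H1_norm_zero [simp]: "H1_norm \<Omega> (\<lambda>x. 0 :: 'b::euclidean_space) = 0"
  using H1_norm_smooth[OF Cc_inf_zero] by simp

lemma H2_norm_zero [simp]: "H2_norm \<Omega> (\<lambda>x. 0 :: 'b::euclidean_space) = 0"
  using H2_norm_smooth[OF Cc_inf_zero] by simp

lemma W1inf_norm_zero [simp]: "W1inf_norm \<Omega> (\<lambda>x. 0 :: 'b::euclidean_space) = 0"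
  using W1inf_norm_scaleR[OF Cc_inf_zero, of 0] by simp

lemma Cc_inf_sigma_H10_sigma:
  assumes "\<phi> \<in> Cc_inf_sigma \<Omega>"
  shows "\<phi> \<in> H10_sigma \<Omega>"
  unfolding H10_sigma_def closure_in_def
  using assms by (auto intro!: Cc_inf_H1 Cc_inf_sigma_Cc_inf bexI[of _ \<phi>])

lemma H10_sigma_H1: "u \<in> H10_sigma \<Omega> \<Longrightarrow> u \<in> H1 \<Omega>"
  by (simp add: H10_sigma_def closure_in_def)

lemma H10_H1: "u \<in> H10 \<Omega> \<Longrightarrow> u \<in> H1 \<Omega>"
  by (simp add: H10_def closure_in_def)

lemma H10_sigma_H10: "u \<in> H10_sigma \<Omega> \<Longrightarrow> u \<in> H10 \<Omega>"
proof -
  assume u: "u \<in> H10_sigma \<Omega>"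
  show "u \<in> H10 \<Omega>"
    unfolding H10_def closure_in_def
  proof (intro CollectI conjI allI impI)
    show "u \<in> H1 \<Omega>" by (rule H10_sigma_H1[OF u])
    fix e :: real assume "e > 0"
    then obtain \<phi> where "\<phi> \<in> Cc_inf_sigma \<Omega>" "H1_norm \<Omega> (\<lambda>x. u x - \<phi> x) < e"
      using u unfolding H10_sigma_def closure_in_def by blast
    then show "\<exists>\<phi>\<in>Cc_inf \<Omega>. H1_norm \<Omega> (\<lambda>x. u x - \<phi> x) < e"
      by (intro bexI[of _ \<phi>] Cc_inf_sigma_Cc_inf)
  qed
qed

lemma H1_scaleR:
  fixes u :: "real ^ 'n \<Rightarrow> 'b::euclidean_space"
  assumes "u \<in> H1 \<Omega>"
  shows "(\<lambda>x. c *\<^sub>R u x) \<in> H1 \<Omega>" "H1_norm \<Omega> (\<lambda>x. c *\<^sub>R u x) = \<bar>c\<bar> * H1_norm \<Omega> u"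
proof -
  have wp: "weak_partial \<Omega> j (\<lambda>x. c *\<^sub>R u x) (\<lambda>x. c *\<^sub>R wpartial \<Omega> j u x)" for j
    by (rule weak_partial_scaleR[OF H1_weak_partial[OF assms]])
  show "(\<lambda>x. c *\<^sub>R u x) \<in> H1 \<Omega>"
    unfolding H1_def using wp L2_scaleR[OF H1_L2[OF assms]] L2_scaleR[OF H1_wpartial_L2[OF assms]] by blast
  have "L2_norm \<Omega> (wpartial \<Omega> j (\<lambda>x. c *\<^sub>R u x)) = \<bar>c\<bar> * L2_norm \<Omega> (wpartial \<Omega> j u)" for j
    using L2_norm_cong_AE[OF wpartial_AE_eq[OF wp]] by (simp add: L2_norm_scaleR)
  then have "H1_norm \<Omega> (\<lambda>x. c *\<^sub>R u x) = sqrt (c\<^sup>2 * ((L2_norm \<Omega> u)\<^sup>2 + (\<Sum>j\<in>UNIV. (L2_norm \<Omega> (wpartial \<Omega> j u))\<^sup>2)))"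
    unfolding H1_norm_def by (simp add: L2_norm_scaleR power_mult_distrib sum_distrib_left distrib_left)
  then show "H1_norm \<Omega> (\<lambda>x. c *\<^sub>R u x) = \<bar>c\<bar> * H1_norm \<Omega> u"
    by (simp add: H1_norm_def real_sqrt_mult)
qed

lemma H10_scaleR:
  assumes "u \<in> H10 \<Omega>"
  shows "(\<lambda>x. c *\<^sub>R u x) \<in> H10 \<Omega>"
  unfolding H10_def closure_in_def
proof (intro CollectI conjI allI impI)
  show "(\<lambda>x. c *\<^sub>R u x) \<in> H1 \<Omega>" by (rule H1_scaleR(1)[OF H10_H1[OF assms]])
  fix e :: real assume "e > 0"
  then have "e / (\<bar>c\<bar> + 1) > 0" by simp
  then obtain \<phi> where \<phi>: "\<phi> \<in> Cc_inf \<Omega>" "H1_norm \<Omega> (\<lambda>x. u x - \<phi> x) < e / (\<bar>c\<bar> + 1)"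
    using assms unfolding H10_def closure_in_def by blast
  have "H1_norm \<Omega> (\<lambda>x. c *\<^sub>R u x - c *\<^sub>R \<phi> x) = \<bar>c\<bar> * H1_norm \<Omega> (\<lambda>x. u x - \<phi> x)"
    unfolding scaleR_diff_right[symmetric]
    by (rule H1_scaleR(2)[OF H1_diff[OF H10_H1[OF assms] Cc_inf_H1[OF \<phi>(1)]]])
  also have "\<dots> \<le> (\<bar>c\<bar> + 1) * H1_norm \<Omega> (\<lambda>x. u x - \<phi> x)" by (intro mult_right_mono) auto
  also have "\<dots> < e" using \<phi>(2) by (simp add: field_simps)
  finally show "\<exists>\<phi>\<in>Cc_inf \<Omega>. H1_norm \<Omega> (\<lambda>x. c *\<^sub>R u x - \<phi> x) < e"
    by (rule bexI[of _ "\<lambda>x. c *\<^sub>R \<phi> x", OF _ Cc_inf_scaleR_const[OF \<phi>(1)]])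
qed

lemma dual_H10_bound:
  "F \<in> dual (H10 \<Omega>) (H1_norm \<Omega>) \<Longrightarrow> u \<in> H10 \<Omega> \<Longrightarrow>
    \<bar>F u\<bar> \<le> dual_norm (H10 \<Omega>) (H1_norm \<Omega>) F * H1_norm \<Omega> u"
  by (rule dual_bound) (simp_all add: H1_scaleR(2)[OF H10_H1] H10_scaleR)

end


section \<open>Curves of test functions\<close>

definition smooth_curve ::
  "real \<Rightarrow> (real ^ 'n) set \<Rightarrow> (real \<Rightarrow> real ^ 'n \<Rightarrow> 'b::euclidean_space) \<Rightarrow> bool" where
  "smooth_curve T \<Omega> \<Phi> \<longleftrightarrow> (\<forall>t\<in>{0..T}. \<Phi> t \<in> Cc_inf \<Omega> \<and>
     (\<forall>js. uniform_limit UNIV (\<lambda>\<tau>. iter_partial js (\<Phi> \<tau>)) (iter_partial js (\<Phi> t)) (at t within {0..T})))"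

text \<open>The derivative is a parameter, since it enters the relative energy inequality.\<close>

definition C1_curve ::
  "real \<Rightarrow> (real ^ 'n) set \<Rightarrow> (real \<Rightarrow> real ^ 'n \<Rightarrow> real ^ 'n) \<Rightarrow> (real \<Rightarrow> real ^ 'n \<Rightarrow> real ^ 'n) \<Rightarrow> bool" where
  "C1_curve T \<Omega> \<phi> \<phi>' \<longleftrightarrow> (\<forall>t\<in>{0..T}. \<phi> t \<in> Cc_inf_sigma \<Omega> \<and> \<phi>' t \<in> Cc_inf_sigma \<Omega> \<and> (\<forall>js.
        uniform_limit UNIV (\<lambda>\<tau>. iter_partial js (\<lambda>x. (1 / (\<tau> - t)) *\<^sub>R (\<phi> \<tau> x - \<phi> t x)))
          (iter_partial js (\<phi>' t)) (at t within {0..T}) \<and>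
        uniform_limit UNIV (\<lambda>\<tau>. iter_partial js (\<phi>' \<tau>)) (iter_partial js (\<phi>' t)) (at t within {0..T})))"

lemma eventually_in_time: "\<forall>\<^sub>F \<tau> in at t within S. \<tau> \<in> S"
  by (simp add: eventually_at_filter)

lemma smooth_curveD:
  assumes "smooth_curve T \<Omega> \<Phi>" "t \<in> {0..T}"
  shows "\<Phi> t \<in> Cc_inf \<Omega>"
    "uniform_limit UNIV (\<lambda>\<tau>. iter_partial js (\<Phi> \<tau>)) (iter_partial js (\<Phi> t)) (at t within {0..T})"
    "uniform_limit UNIV \<Phi> (\<Phi> t) (at t within {0..T})"
proof -
  have *: "\<Phi> t \<in> Cc_inf \<Omega> \<and>
     (\<forall>js. uniform_limit UNIV (\<lambda>\<tau>. iter_partial js (\<Phi> \<tau>)) (iter_partial js (\<Phi> t)) (at t within {0..T}))"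
    using assms unfolding smooth_curve_def by (rule bspec)
  then show "\<Phi> t \<in> Cc_inf \<Omega>" by (rule conjunct1)
  show u: "uniform_limit UNIV (\<lambda>\<tau>. iter_partial js (\<Phi> \<tau>)) (iter_partial js (\<Phi> t)) (at t within {0..T})" for js
    by (rule spec[OF conjunct2[OF *]])
  show "uniform_limit UNIV \<Phi> (\<Phi> t) (at t within {0..T})"
    using u[of "[]"] by simp
qed

lemma smooth_curve_partial:
  assumes "smooth_curve T \<Omega> \<Phi>"
  shows "smooth_curve T \<Omega> (\<lambda>t. partial_deriv j (\<Phi> t))"
  unfolding smooth_curve_def
proof (intro ballI conjI allI)
  fix t assume t: "t \<in> {0..T}"
  show "partial_deriv j (\<Phi> t) \<in> Cc_inf \<Omega>" by (rule Cc_inf_partial[OF smooth_curveD(1)[OF assms t]])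
  show "uniform_limit UNIV (\<lambda>\<tau>. iter_partial js (partial_deriv j (\<Phi> \<tau>))) (iter_partial js (partial_deriv j (\<Phi> t)))
      (at t within {0..T})" for js
    unfolding iter_partial_snoc[symmetric] by (rule smooth_curveD(2)[OF assms t])
qed

lemma C1_curve_of_C1:
  assumes "\<phi> \<in> C1_Cc_inf_sigma {0..T} \<Omega>"
  obtains \<phi>' where "C1_curve T \<Omega> \<phi> \<phi>'"
proof -
  obtain \<phi>' C where "compact C \<and> C \<subseteq> \<Omega> \<and>
     (\<forall>t\<in>{0..T}. \<phi> t \<in> Cc_inf_sigma \<Omega> \<and> \<phi>' t \<in> Cc_inf_sigma \<Omega> \<and> (\<forall>x. x \<notin> C \<longrightarrow> \<phi> t x = 0 \<and> \<phi>' t x = 0)) \<and>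
     (\<forall>t\<in>{0..T}. \<forall>js.
        uniform_limit UNIV (\<lambda>\<tau>. iter_partial js (\<lambda>x. (1 / (\<tau> - t)) *\<^sub>R (\<phi> \<tau> x - \<phi> t x)))
          (iter_partial js (\<phi>' t)) (at t within {0..T}) \<and>
        uniform_limit UNIV (\<lambda>\<tau>. iter_partial js (\<phi>' \<tau>)) (iter_partial js (\<phi>' t)) (at t within {0..T}))"
    using assms unfolding C1_Cc_inf_sigma_def mem_Collect_eq by (elim exE)
  then have "C1_curve T \<Omega> \<phi> \<phi>'" unfolding C1_curve_def by blast
  then show ?thesis by (rule that)
qed

lemma C1_curveD:
  assumes "C1_curve T \<Omega> \<phi> \<phi>'" "t \<in> {0..T}"
  shows "\<phi> t \<in> Cc_inf_sigma \<Omega>" "\<phi>' t \<in> Cc_inf_sigma \<Omega>"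
    "uniform_limit UNIV (\<lambda>\<tau>. iter_partial js (\<lambda>x. (1 / (\<tau> - t)) *\<^sub>R (\<phi> \<tau> x - \<phi> t x)))
          (iter_partial js (\<phi>' t)) (at t within {0..T})"
    "uniform_limit UNIV (\<lambda>\<tau>. iter_partial js (\<phi>' \<tau>)) (iter_partial js (\<phi>' t)) (at t within {0..T})"
proof -
  note * = bspec[OF assms(1)[unfolded C1_curve_def] assms(2)]
  show "\<phi> t \<in> Cc_inf_sigma \<Omega>" by (rule conjunct1[OF *])
  show "\<phi>' t \<in> Cc_inf_sigma \<Omega>" by (rule conjunct1[OF conjunct2[OF *]])
  note ** = spec[OF conjunct2[OF conjunct2[OF *]], of js]
  show "uniform_limit UNIV (\<lambda>\<tau>. iter_partial js (\<lambda>x. (1 / (\<tau> - t)) *\<^sub>R (\<phi> \<tau> x - \<phi> t x)))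
          (iter_partial js (\<phi>' t)) (at t within {0..T})" by (rule conjunct1[OF **])
  show "uniform_limit UNIV (\<lambda>\<tau>. iter_partial js (\<phi>' \<tau>)) (iter_partial js (\<phi>' t)) (at t within {0..T})"
    by (rule conjunct2[OF **])
qed

text \<open>The difference quotients of the space derivatives converge uniformly, so they stay
  bounded near \<open>t\<close>, and multiplication by \<open>\<tau> - t\<close> gives uniform
  convergence of the derivatives themselves.\<close>

lemma C1_curve_smooth_curve:
  assumes "C1_curve T \<Omega> \<phi> \<phi>'"
  shows "smooth_curve T \<Omega> \<phi>" "smooth_curve T \<Omega> \<phi>'"
proof -
  show "smooth_curve T \<Omega> \<phi>'"
    unfolding smooth_curve_def
    by (intro ballI conjI allI Cc_inf_sigma_Cc_inf C1_curveD[OF assms])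
  show "smooth_curve T \<Omega> \<phi>"
    unfolding smooth_curve_def
  proof (intro ballI conjI allI)
    fix t js assume t: "t \<in> {0..T}"
    show "\<phi> t \<in> Cc_inf \<Omega>" by (rule Cc_inf_sigma_Cc_inf[OF C1_curveD(1)[OF assms t]])
    define Q where "Q \<tau> = iter_partial js (\<lambda>x. (1 / (\<tau> - t)) *\<^sub>R (\<phi> \<tau> x - \<phi> t x))" for \<tau>
    have lim: "uniform_limit UNIV Q (iter_partial js (\<phi>' t)) (at t within {0..T})"
      unfolding Q_def by (rule C1_curveD(3)[OF assms t])
    obtain B where B: "B > 0" "\<And>x. norm (iter_partial js (\<phi>' t) x) \<le> B"
    proof -
      have "iter_partial js (\<phi>' t) \<in> Cc_inf \<Omega>"
        by (induct js) (auto intro: Cc_inf_partial Cc_inf_sigma_Cc_inf[OF C1_curveD(2)[OF assms t]])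
      then show ?thesis using that Cc_inf_bounded by blast
    qed
    show "uniform_limit UNIV (\<lambda>\<tau>. iter_partial js (\<phi> \<tau>)) (iter_partial js (\<phi> t)) (at t within {0..T})"
      unfolding uniform_limit_iff
    proof (intro allI impI)
      fix e :: real assume e: "e > 0"
      have 1: "\<forall>\<^sub>F \<tau> in at t within {0..T}. \<forall>x\<in>UNIV. dist (Q \<tau> x) (iter_partial js (\<phi>' t) x) < 1"
        using lim unfolding uniform_limit_iff by simp
      have "((\<lambda>\<tau>. \<tau> - t) \<longlongrightarrow> t - t) (at t within {0..T})" by (intro tendsto_intros)
      then have "((\<lambda>\<tau>. \<tau> - t) \<longlongrightarrow> 0) (at t within {0..T})" by simp
      then have 2: "\<forall>\<^sub>F \<tau> in at t within {0..T}. dist (\<tau> - t) 0 < e / (B + 1)"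
        using e B(1) by (intro tendstoD) auto
      have 3: "\<forall>\<^sub>F \<tau> in at t within {0..T}. \<tau> \<noteq> t" by (simp add: eventually_at_filter)
      show "\<forall>\<^sub>F \<tau> in at t within {0..T}. \<forall>x\<in>UNIV. dist (iter_partial js (\<phi> \<tau>) x) (iter_partial js (\<phi> t) x) < e"
        using 1 2 3 eventually_in_time
      proof eventually_elim
        case (elim \<tau>)
        have sm: "smooth_fun (\<phi> \<tau>)" "smooth_fun (\<phi> t)"
          using C1_curveD(1)[OF assms] elim(4) t by (auto intro: Cc_inf_smooth Cc_inf_sigma_Cc_inf)
        have Qeq: "Q \<tau> x = (1 / (\<tau> - t)) *\<^sub>R (iter_partial js (\<phi> \<tau>) x - iter_partial js (\<phi> t) x)" for x
          unfolding Q_def by (simp add: iter_partial_scaleR[OF smooth_fun_diff[OF sm]] iter_partial_diff[OF sm])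
        show ?case
        proof
          fix x
          have n1: "norm (Q \<tau> x - iter_partial js (\<phi>' t) x) < 1"
            using elim(1) by (simp add: dist_norm)
          have "norm (Q \<tau> x) \<le> norm (Q \<tau> x - iter_partial js (\<phi>' t) x) + norm (iter_partial js (\<phi>' t) x)"
            using norm_triangle_ineq[of "Q \<tau> x - iter_partial js (\<phi>' t) x" "iter_partial js (\<phi>' t) x"] by simp
          also have "\<dots> < B + 1" using n1 B(2)[of x] by linarith
          finally have q: "norm (Q \<tau> x) < B + 1" .
          have "dist (iter_partial js (\<phi> \<tau>) x) (iter_partial js (\<phi> t) x) = \<bar>\<tau> - t\<bar> * norm (Q \<tau> x)"
            using elim(3) by (simp add: Qeq dist_norm)
          also have "\<dots> \<le> \<bar>\<tau> - t\<bar> * (B + 1)" using q by (intro mult_left_mono) auto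
          also have "\<dots> < (e / (B + 1)) * (B + 1)"
            using elim(2) B(1) by (intro mult_strict_right_mono) (auto simp: dist_real_def)
          also have "\<dots> = e" using B(1) by simp
          finally show "dist (iter_partial js (\<phi> \<tau>) x) (iter_partial js (\<phi> t) x) < e" .
        qed
      qed
    qed
  qed
qed

context bounded_open begin

text \<open>Every quantity \<open>M\<close> that the maximum norm dominates on test functions is
  continuous along the curve. The domain has finite measure, so this applies to
  \<open>L\<^sup>2\<close> as well as to \<open>L\<^sup>\<infinity>\<close>.\<close>

lemma smooth_curve_seminorm:
  fixes \<Phi> :: "real \<Rightarrow> real ^ 'n \<Rightarrow> 'b::euclidean_space"
  assumes \<Phi>: "smooth_curve T \<Omega> \<Phi>" and t: "t \<in> {0..T}"
    and M: "\<And>w d. w \<in> Cc_inf \<Omega> \<Longrightarrow> (\<And>x. norm (w x) \<le> d) \<Longrightarrow> 0 \<le> d \<Longrightarrow> 0 \<le> M w \<and> M w \<le> d * K" and K: "0 \<le> K"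
  shows "((\<lambda>\<tau>. M (\<lambda>x. \<Phi> \<tau> x - \<Phi> t x)) \<longlongrightarrow> (0::real)) (at t within {0..T})"
proof (rule tendstoI)
  fix e :: real assume e: "e > 0"
  define d where "d = e / (K + 1)"
  have d: "d > 0" using e K by (simp add: d_def)
  have "\<forall>\<^sub>F \<tau> in at t within {0..T}. \<forall>x\<in>UNIV. dist (\<Phi> \<tau> x) (\<Phi> t x) < d"
    using smooth_curveD(3)[OF \<Phi> t] d unfolding uniform_limit_iff by blast
  then show "\<forall>\<^sub>F \<tau> in at t within {0..T}. dist (M (\<lambda>x. \<Phi> \<tau> x - \<Phi> t x)) 0 < e"
    using eventually_in_time
  proof eventually_elim
    case (elim \<tau>)
    have "(\<lambda>x. \<Phi> \<tau> x - \<Phi> t x) \<in> Cc_inf \<Omega>"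
      by (rule Cc_inf_diff[OF smooth_curveD(1)[OF \<Phi> elim(2)] smooth_curveD(1)[OF \<Phi> t]])
    moreover have "norm (\<Phi> \<tau> x - \<Phi> t x) \<le> d" for x using elim(1) by (simp add: dist_norm less_imp_le)
    ultimately have "0 \<le> M (\<lambda>x. \<Phi> \<tau> x - \<Phi> t x)" "M (\<lambda>x. \<Phi> \<tau> x - \<Phi> t x) \<le> d * K"
      using M d less_imp_le by blast+
    moreover have "d * K < e"
    proof -
      have "d * K < d * (K + 1)" using d by simp
      also have "\<dots> = e" using K by (simp add: d_def)
      finally show ?thesis .
    qed
    ultimately show ?case by simp
  qed
qed

lemma smooth_curve_L2:
  fixes \<Phi> :: "real \<Rightarrow> real ^ 'n \<Rightarrow> 'b::euclidean_space"
  assumes \<Phi>: "smooth_curve T \<Omega> \<Phi>" and t: "t \<in> {0..T}"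
  shows "((\<lambda>\<tau>. L2_norm \<Omega> (\<lambda>x. \<Phi> \<tau> x - \<Phi> t x)) \<longlongrightarrow> 0) (at t within {0..T})"
    and "((\<lambda>\<tau>. L2_norm \<Omega> (\<Phi> \<tau>)) \<longlongrightarrow> L2_norm \<Omega> (\<Phi> t)) (at t within {0..T})"
    and "\<forall>\<^sub>F \<tau> in at t within {0..T}. \<Phi> \<tau> \<in> L2 \<Omega>"
    and "\<Phi> t \<in> L2 \<Omega>"
proof -
  show 1: "((\<lambda>\<tau>. L2_norm \<Omega> (\<lambda>x. \<Phi> \<tau> x - \<Phi> t x)) \<longlongrightarrow> 0) (at t within {0..T})"
    by (rule smooth_curve_seminorm[OF \<Phi> t, where K="sqrt (measure lebesgue \<Omega>)"])
      (auto intro!: L2_norm_le_bound smooth_measurable Cc_inf_smooth)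
  show 2: "\<forall>\<^sub>F \<tau> in at t within {0..T}. \<Phi> \<tau> \<in> L2 \<Omega>"
    using eventually_in_time by eventually_elim (rule Cc_inf_L2[OF smooth_curveD(1)[OF \<Phi>]])
  show 3: "\<Phi> t \<in> L2 \<Omega>" by (rule Cc_inf_L2[OF smooth_curveD(1)[OF \<Phi> t]])
  show "((\<lambda>\<tau>. L2_norm \<Omega> (\<Phi> \<tau>)) \<longlongrightarrow> L2_norm \<Omega> (\<Phi> t)) (at t within {0..T})"
    by (rule L2_norm_tendsto[OF 2 3 1])
qed

lemma smooth_curve_Linf:
  fixes \<Phi> :: "real \<Rightarrow> real ^ 'n \<Rightarrow> 'b::euclidean_space"
  assumes \<Phi>: "smooth_curve T \<Omega> \<Phi>" and t: "t \<in> {0..T}"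
  shows "((\<lambda>\<tau>. Linf_norm \<Omega> (\<lambda>x. \<Phi> \<tau> x - \<Phi> t x)) \<longlongrightarrow> 0) (at t within {0..T})"
    and "((\<lambda>\<tau>. Linf_norm \<Omega> (\<Phi> \<tau>)) \<longlongrightarrow> Linf_norm \<Omega> (\<Phi> t)) (at t within {0..T})"
proof -
  show 1: "((\<lambda>\<tau>. Linf_norm \<Omega> (\<lambda>x. \<Phi> \<tau> x - \<Phi> t x)) \<longlongrightarrow> 0) (at t within {0..T})"
    by (rule smooth_curve_seminorm[OF \<Phi> t, where K=1])
      (auto intro!: Linf_norm_le Linf_norm_nonneg Cc_inf_Linf AE_I2)
  have "((\<lambda>\<tau>. Linf_norm \<Omega> (\<Phi> \<tau>) - Linf_norm \<Omega> (\<Phi> t)) \<longlongrightarrow> 0) (at t within {0..T})"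
  proof (rule Lim_null_comparison[OF _ 1])
    show "\<forall>\<^sub>F \<tau> in at t within {0..T}. norm (Linf_norm \<Omega> (\<Phi> \<tau>) - Linf_norm \<Omega> (\<Phi> t)) \<le> Linf_norm \<Omega> (\<lambda>x. \<Phi> \<tau> x - \<Phi> t x)"
      using eventually_in_time
    proof eventually_elim
      case (elim \<tau>)
      note c = smooth_curveD(1)[OF \<Phi> elim] smooth_curveD(1)[OF \<Phi> t]
      have d: "(\<lambda>x. \<Phi> \<tau> x - \<Phi> t x) \<in> Linf \<Omega>" by (rule Cc_inf_Linf[OF Cc_inf_diff[OF c]])
      show ?case
        using Linf_norm_diff_le[OF Cc_inf_Linf[OF c(1)] Cc_inf_Linf[OF c(2)] Linf_norm_AE[OF d] Linf_norm_nonneg[OF d]]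
        by simp
    qed
  qed
  then show "((\<lambda>\<tau>. Linf_norm \<Omega> (\<Phi> \<tau>)) \<longlongrightarrow> Linf_norm \<Omega> (\<Phi> t)) (at t within {0..T})"
    by (simp add: LIM_zero_iff)
qed

lemma smooth_curve_partial_diff:
  fixes \<Phi> :: "real \<Rightarrow> real ^ 'n \<Rightarrow> 'b::euclidean_space"
  assumes \<Phi>: "smooth_curve T \<Omega> \<Phi>" and t: "t \<in> {0..T}" and \<tau>: "\<tau> \<in> {0..T}"
  shows "partial_deriv j (\<lambda>x. \<Phi> \<tau> x - \<Phi> t x) = (\<lambda>x. partial_deriv j (\<Phi> \<tau>) x - partial_deriv j (\<Phi> t) x)"
    and "(\<lambda>x. \<Phi> \<tau> x - \<Phi> t x) \<in> Cc_inf \<Omega>"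
proof -
  note c = smooth_curveD(1)[OF \<Phi> \<tau>] smooth_curveD(1)[OF \<Phi> t]
  show "partial_deriv j (\<lambda>x. \<Phi> \<tau> x - \<Phi> t x) = (\<lambda>x. partial_deriv j (\<Phi> \<tau>) x - partial_deriv j (\<Phi> t) x)"
    by (rule ext, rule partial_deriv_diff[OF smooth_fun_differentiable[OF Cc_inf_smooth[OF c(1)]]
          smooth_fun_differentiable[OF Cc_inf_smooth[OF c(2)]]])
  show "(\<lambda>x. \<Phi> \<tau> x - \<Phi> t x) \<in> Cc_inf \<Omega>" by (rule Cc_inf_diff[OF c])
qed

text \<open>Continuity with respect to \<open>M\<close> of the partial derivatives, which are curves
  of the same kind, gives continuity with respect to a norm \<open>M'\<close> of one order more. Two
  steps lead from \<open>L\<^sup>2\<close> to \<open>H\<^sup>2\<close>.\<close>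

lemma smooth_curve_Sobolev_step:
  fixes \<Phi> :: "real \<Rightarrow> real ^ 'n \<Rightarrow> 'b::euclidean_space"
    and M M' :: "(real ^ 'n \<Rightarrow> 'b) \<Rightarrow> real"
  assumes M': "\<And>w. w \<in> Cc_inf \<Omega> \<Longrightarrow> M' w = sqrt ((L2_norm \<Omega> w)\<^sup>2 + (\<Sum>j\<in>UNIV. (M (partial_deriv j w))\<^sup>2))"
    and M: "\<And>\<Psi> :: real \<Rightarrow> real ^ 'n \<Rightarrow> 'b. \<And>t. smooth_curve T \<Omega> \<Psi> \<Longrightarrow> t \<in> {0..T} \<Longrightarrow>
      ((\<lambda>\<tau>. M (\<lambda>x. \<Psi> \<tau> x - \<Psi> t x)) \<longlongrightarrow> 0) (at t within {0..T}) \<and>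
      ((\<lambda>\<tau>. M (\<Psi> \<tau>)) \<longlongrightarrow> M (\<Psi> t)) (at t within {0..T})"
    and \<Phi>: "smooth_curve T \<Omega> \<Phi>" and t: "t \<in> {0..T}"
  shows "((\<lambda>\<tau>. M' (\<lambda>x. \<Phi> \<tau> x - \<Phi> t x)) \<longlongrightarrow> 0) (at t within {0..T}) \<and>
      ((\<lambda>\<tau>. M' (\<Phi> \<tau>)) \<longlongrightarrow> M' (\<Phi> t)) (at t within {0..T})"
proof
  have "((\<lambda>\<tau>. sqrt ((L2_norm \<Omega> (\<lambda>x. \<Phi> \<tau> x - \<Phi> t x))\<^sup>2 +
        (\<Sum>j\<in>UNIV. (M (\<lambda>x. partial_deriv j (\<Phi> \<tau>) x - partial_deriv j (\<Phi> t) x))\<^sup>2)))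
      \<longlongrightarrow> sqrt (0\<^sup>2 + (\<Sum>j\<in>(UNIV :: 'n set). 0\<^sup>2))) (at t within {0..T})"
    by (intro tendsto_real_sqrt tendsto_add tendsto_power tendsto_sum smooth_curve_L2(1)[OF \<Phi> t]
        conjunct1[OF M[OF smooth_curve_partial[OF \<Phi>] t]])
  then have "((\<lambda>\<tau>. sqrt ((L2_norm \<Omega> (\<lambda>x. \<Phi> \<tau> x - \<Phi> t x))\<^sup>2 +
        (\<Sum>j\<in>UNIV. (M (\<lambda>x. partial_deriv j (\<Phi> \<tau>) x - partial_deriv j (\<Phi> t) x))\<^sup>2)))
      \<longlongrightarrow> 0) (at t within {0..T})" by simp
  then show "((\<lambda>\<tau>. M' (\<lambda>x. \<Phi> \<tau> x - \<Phi> t x)) \<longlongrightarrow> 0) (at t within {0..T})"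
  proof (rule Lim_transform_eventually)
    show "\<forall>\<^sub>F \<tau> in at t within {0..T}. sqrt ((L2_norm \<Omega> (\<lambda>x. \<Phi> \<tau> x - \<Phi> t x))\<^sup>2 +
        (\<Sum>j\<in>UNIV. (M (\<lambda>x. partial_deriv j (\<Phi> \<tau>) x - partial_deriv j (\<Phi> t) x))\<^sup>2)) = M' (\<lambda>x. \<Phi> \<tau> x - \<Phi> t x)"
      using eventually_in_time
      by eventually_elim (simp only: M'[OF smooth_curve_partial_diff(2)[OF \<Phi> t]] smooth_curve_partial_diff(1)[OF \<Phi> t])
  qed
  have "((\<lambda>\<tau>. sqrt ((L2_norm \<Omega> (\<Phi> \<tau>))\<^sup>2 + (\<Sum>j\<in>UNIV. (M (partial_deriv j (\<Phi> \<tau>)))\<^sup>2)))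
      \<longlongrightarrow> sqrt ((L2_norm \<Omega> (\<Phi> t))\<^sup>2 + (\<Sum>j\<in>UNIV. (M (partial_deriv j (\<Phi> t)))\<^sup>2))) (at t within {0..T})"
    by (intro tendsto_real_sqrt tendsto_add tendsto_power tendsto_sum smooth_curve_L2(2)[OF \<Phi> t]
        conjunct2[OF M[OF smooth_curve_partial[OF \<Phi>] t]])
  then show "((\<lambda>\<tau>. M' (\<Phi> \<tau>)) \<longlongrightarrow> M' (\<Phi> t)) (at t within {0..T})"
    unfolding M'[OF smooth_curveD(1)[OF \<Phi> t], symmetric]
  proof (rule Lim_transform_eventually)
    show "\<forall>\<^sub>F \<tau> in at t within {0..T}. sqrt ((L2_norm \<Omega> (\<Phi> \<tau>))\<^sup>2 + (\<Sum>j\<in>UNIV. (M (partial_deriv j (\<Phi> \<tau>)))\<^sup>2)) = M' (\<Phi> \<tau>)"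
      using eventually_in_time by eventually_elim (rule M'[OF smooth_curveD(1)[OF \<Phi>], symmetric])
  qed
qed

lemma smooth_curve_H1:
  fixes \<Phi> :: "real \<Rightarrow> real ^ 'n \<Rightarrow> 'b::euclidean_space"
  assumes "smooth_curve T \<Omega> \<Phi>" "t \<in> {0..T}"
  shows "((\<lambda>\<tau>. H1_norm \<Omega> (\<lambda>x. \<Phi> \<tau> x - \<Phi> t x)) \<longlongrightarrow> 0) (at t within {0..T}) \<and>
      ((\<lambda>\<tau>. H1_norm \<Omega> (\<Phi> \<tau>)) \<longlongrightarrow> H1_norm \<Omega> (\<Phi> t)) (at t within {0..T})"
  by (rule smooth_curve_Sobolev_step[where M="L2_norm \<Omega>", OF H1_norm_smooth conjI[OF smooth_curve_L2(1,2)] assms])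

lemma smooth_curve_H2:
  fixes \<Phi> :: "real \<Rightarrow> real ^ 'n \<Rightarrow> 'b::euclidean_space"
  assumes "smooth_curve T \<Omega> \<Phi>" "t \<in> {0..T}"
  shows "((\<lambda>\<tau>. H2_norm \<Omega> (\<lambda>x. \<Phi> \<tau> x - \<Phi> t x)) \<longlongrightarrow> 0) (at t within {0..T}) \<and>
      ((\<lambda>\<tau>. H2_norm \<Omega> (\<Phi> \<tau>)) \<longlongrightarrow> H2_norm \<Omega> (\<Phi> t)) (at t within {0..T})"
  by (rule smooth_curve_Sobolev_step[where M="H1_norm \<Omega>", OF H2_norm_smooth smooth_curve_H1 assms])

lemma smooth_curve_W1inf:
  fixes \<Phi> :: "real \<Rightarrow> real ^ 'n \<Rightarrow> 'b::euclidean_space"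
  assumes \<Phi>: "smooth_curve T \<Omega> \<Phi>" and t: "t \<in> {0..T}"
  shows "((\<lambda>\<tau>. W1inf_norm \<Omega> (\<lambda>x. \<Phi> \<tau> x - \<Phi> t x)) \<longlongrightarrow> 0) (at t within {0..T})"
    and "((\<lambda>\<tau>. W1inf_norm \<Omega> (\<Phi> \<tau>)) \<longlongrightarrow> W1inf_norm \<Omega> (\<Phi> t)) (at t within {0..T})"
proof -
  have "((\<lambda>\<tau>. Linf_norm \<Omega> (\<lambda>x. \<Phi> \<tau> x - \<Phi> t x) +
        (\<Sum>j\<in>UNIV. Linf_norm \<Omega> (\<lambda>x. partial_deriv j (\<Phi> \<tau>) x - partial_deriv j (\<Phi> t) x)))
      \<longlongrightarrow> 0 + (\<Sum>j\<in>(UNIV :: 'n set). 0)) (at t within {0..T})"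
    by (intro tendsto_add tendsto_sum smooth_curve_Linf(1)[OF \<Phi> t]
        smooth_curve_Linf(1)[OF smooth_curve_partial[OF \<Phi>] t])
  then have "((\<lambda>\<tau>. Linf_norm \<Omega> (\<lambda>x. \<Phi> \<tau> x - \<Phi> t x) +
        (\<Sum>j\<in>UNIV. Linf_norm \<Omega> (\<lambda>x. partial_deriv j (\<Phi> \<tau>) x - partial_deriv j (\<Phi> t) x)))
      \<longlongrightarrow> 0) (at t within {0..T})" by simp
  then show "((\<lambda>\<tau>. W1inf_norm \<Omega> (\<lambda>x. \<Phi> \<tau> x - \<Phi> t x)) \<longlongrightarrow> 0) (at t within {0..T})"
  proof (rule Lim_transform_eventually)
    show "\<forall>\<^sub>F \<tau> in at t within {0..T}. Linf_norm \<Omega> (\<lambda>x. \<Phi> \<tau> x - \<Phi> t x) +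
        (\<Sum>j\<in>UNIV. Linf_norm \<Omega> (\<lambda>x. partial_deriv j (\<Phi> \<tau>) x - partial_deriv j (\<Phi> t) x)) = W1inf_norm \<Omega> (\<lambda>x. \<Phi> \<tau> x - \<Phi> t x)"
      using eventually_in_time
      by eventually_elim (simp only: W1inf_norm_smooth[OF smooth_curve_partial_diff(2)[OF \<Phi> t]] smooth_curve_partial_diff(1)[OF \<Phi> t])
  qed
  have "((\<lambda>\<tau>. Linf_norm \<Omega> (\<Phi> \<tau>) + (\<Sum>j\<in>UNIV. Linf_norm \<Omega> (partial_deriv j (\<Phi> \<tau>))))
      \<longlongrightarrow> Linf_norm \<Omega> (\<Phi> t) + (\<Sum>j\<in>UNIV. Linf_norm \<Omega> (partial_deriv j (\<Phi> t)))) (at t within {0..T})"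
    by (intro tendsto_add tendsto_sum smooth_curve_Linf(2)[OF \<Phi> t]
        smooth_curve_Linf(2)[OF smooth_curve_partial[OF \<Phi>] t])
  then show "((\<lambda>\<tau>. W1inf_norm \<Omega> (\<Phi> \<tau>)) \<longlongrightarrow> W1inf_norm \<Omega> (\<Phi> t)) (at t within {0..T})"
    unfolding W1inf_norm_smooth[OF smooth_curveD(1)[OF \<Phi> t], symmetric]
  proof (rule Lim_transform_eventually)
    show "\<forall>\<^sub>F \<tau> in at t within {0..T}. Linf_norm \<Omega> (\<Phi> \<tau>) + (\<Sum>j\<in>UNIV. Linf_norm \<Omega> (partial_deriv j (\<Phi> \<tau>))) = W1inf_norm \<Omega> (\<Phi> \<tau>)"
      using eventually_in_time by eventually_elim (rule W1inf_norm_smooth[OF smooth_curveD(1)[OF \<Phi>], symmetric])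
  qed
qed

lemma continuous_on_timeI:
  "(\<And>t. t \<in> {0..T} \<Longrightarrow> (g \<longlongrightarrow> g t) (at t within {0..T})) \<Longrightarrow> continuous_on {0..T} (g :: real \<Rightarrow> real)"
  by (simp add: continuous_on_def)

end


section \<open>Uniqueness of weak time derivatives\<close>

lemma dual_add:
  assumes "F \<in> dual X N" "u \<in> X" "w \<in> X"
  shows "F (\<lambda>x. u x + w x) = F u + F w"
  using assms(1) unfolding dual_def mem_Collect_eq by (elim conjE) (rule bspec[OF bspec[OF _ assms(2)] assms(3)])

lemma dual_scaleR:
  assumes "F \<in> dual X N" "u \<in> X"
  shows "F (\<lambda>x. c *\<^sub>R u x) = c * F u"
  using assms unfolding dual_def mem_Collect_eq by blast

lemma dual_diff_eq:
  assumes F: "F \<in> dual X N" and u: "u \<in> X" and w: "w \<in> X" and sc: "(\<lambda>x. (-1) *\<^sub>R w x) \<in> X"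
  shows "F (\<lambda>x. u x - w x) = F u - F w"
proof -
  have "F (\<lambda>x. u x + (-1) *\<^sub>R w x) = F u + F (\<lambda>x. (-1) *\<^sub>R w x)"
    by (rule dual_add[OF F u sc])
  moreover have "F (\<lambda>x. (-1) *\<^sub>R w x) = -1 * F w" by (rule dual_scaleR[OF F w])
  ultimately show ?thesis by simp
qed

lemma dual_diff:
  assumes F: "F \<in> dual X N" and G: "G \<in> dual X N"
  shows "(\<lambda>u. F u - G u) \<in> dual X N"
proof -
  obtain C where C: "\<And>u. u \<in> X \<Longrightarrow> \<bar>F u\<bar> \<le> C * N u" using F unfolding dual_def by blast
  obtain D where D: "\<And>u. u \<in> X \<Longrightarrow> \<bar>G u\<bar> \<le> D * N u" using G unfolding dual_def by blast
  have "\<bar>F u - G u\<bar> \<le> (C + D) * N u" if "u \<in> X" for u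
    using C[OF that] D[OF that] by (simp add: distrib_right abs_le_iff)
  moreover have "F (\<lambda>x. u x + w x) = F u + F w" "G (\<lambda>x. u x + w x) = G u + G w" if "u \<in> X" "w \<in> X" for u w
    by (rule dual_add[OF F that], rule dual_add[OF G that])
  moreover have "F (\<lambda>x. c *\<^sub>R u x) = c * F u" "G (\<lambda>x. c *\<^sub>R u x) = c * G u" if "u \<in> X" for u c
    by (rule dual_scaleR[OF F that], rule dual_scaleR[OF G that])
  ultimately show ?thesis
    unfolding dual_def mem_Collect_eq
    by (intro conjI ballI allI exI[of _ "C + D"]) (simp_all add: right_diff_distrib)
qed

text \<open>The space is given by a carrier, because the norms are only seminorms on
  representatives.\<close>

locale seminormed_space =
  fixes X :: "('p \<Rightarrow> 'b::real_normed_vector) set" and N :: "('p \<Rightarrow> 'b) \<Rightarrow> real"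
  assumes nonneg: "u \<in> X \<Longrightarrow> 0 \<le> N u"
    and scale: "u \<in> X \<Longrightarrow> (\<lambda>x. c *\<^sub>R u x) \<in> X" "u \<in> X \<Longrightarrow> N (\<lambda>x. c *\<^sub>R u x) = \<bar>c\<bar> * N u"
    and diff: "u \<in> X \<Longrightarrow> w \<in> X \<Longrightarrow> (\<lambda>x. u x - w x) \<in> X"
begin

lemma bound: "F \<in> dual X N \<Longrightarrow> u \<in> X \<Longrightarrow> \<bar>F u\<bar> \<le> dual_norm X N F * N u"
  by (rule dual_bound) (simp_all add: nonneg scale)

lemma functional_diff: "F \<in> dual X N \<Longrightarrow> u \<in> X \<Longrightarrow> w \<in> X \<Longrightarrow> F (\<lambda>x. u x - w x) = F u - F w"
  by (rule dual_diff_eq[OF _ _ _ scale(1)])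

lemma functional_tendsto:
  assumes F: "F \<in> dual X N" and y: "\<And>k. y k \<in> X" and u: "u \<in> X"
    and lim: "(\<lambda>k. N (\<lambda>x. y k x - u x)) \<longlonglongrightarrow> 0"
  shows "(\<lambda>k. F (y k)) \<longlonglongrightarrow> F u"
proof -
  have "(\<lambda>k. F (y k) - F u) \<longlonglongrightarrow> 0"
  proof (rule Lim_null_comparison[OF always_eventually])
    show "\<forall>k. norm (F (y k) - F u) \<le> dual_norm X N F * N (\<lambda>x. y k x - u x)"
      using bound[OF F diff[OF y u]] functional_diff[OF F y u] by simp
    show "(\<lambda>k. dual_norm X N F * N (\<lambda>x. y k x - u x)) \<longlonglongrightarrow> 0"
      using tendsto_mult[OF tendsto_const lim] by simp
  qed
  then show ?thesis by (simp add: LIM_zero_iff)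
qed

lemma evaluation_tendsto:
  assumes G: "\<And>k. G k \<in> dual X N" and F: "F \<in> dual X N" and u: "u \<in> X"
    and lim: "(\<lambda>k. dual_norm X N (\<lambda>w. G k w - F w)) \<longlonglongrightarrow> 0"
  shows "(\<lambda>k. G k u) \<longlonglongrightarrow> F u"
proof -
  have "(\<lambda>k. G k u - F u) \<longlonglongrightarrow> 0"
  proof (rule Lim_null_comparison[OF always_eventually])
    show "\<forall>k. norm (G k u - F u) \<le> dual_norm X N (\<lambda>w. G k w - F w) * N u"
      using bound[OF dual_diff[OF G F] u] by simp
    show "(\<lambda>k. dual_norm X N (\<lambda>w. G k w - F w) * N u) \<longlonglongrightarrow> 0"
      using tendsto_mult[OF lim tendsto_const, of "N u"] by simp
  qed
  then show ?thesis by (simp add: LIM_zero_iff)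
qed

lemma dual_evaluation_measurable:
  assumes G: "bochner_measurable T (dual X N) (dual_norm X N) G" and w: "w \<in> X"
  shows "(\<lambda>t. G t w) \<in> borel_measurable (lebesgue_on {0<..<T})"
proof (rule bochner_measurable_compose[OF G, where F="\<lambda>t x. x w"])
  show "AE t in lebesgue_on {0<..<T}. \<forall>y :: nat \<Rightarrow> _. (\<forall>k. y k \<in> dual X N) \<longrightarrow>
      (\<lambda>k. dual_norm X N (\<lambda>x. y k x - G t x)) \<longlonglongrightarrow> 0 \<longrightarrow> (\<lambda>k. y k w) \<longlonglongrightarrow> G t w"
    using bochner_measurable_AE[OF G]
  proof eventually_elim
    case (elim t)
    show ?case by (intro allI impI) (rule evaluation_tendsto[OF _ elim w], auto)
  qed
qed simp

lemma dual_pairing_measurable: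
  assumes G: "bochner_measurable T (dual X N) (dual_norm X N) G" and u: "bochner_measurable T Y N u" and Y: "Y \<subseteq> X"
  shows "(\<lambda>t. G t (u t)) \<in> borel_measurable (lebesgue_on {0<..<T})"
proof (rule bochner_measurable_compose[OF u, where F=G])
  show "(\<lambda>t. G t x) \<in> borel_measurable (lebesgue_on {0<..<T})" if "x \<in> Y" for x
    using dual_evaluation_measurable[OF G] that Y by blast
  show "AE t in lebesgue_on {0<..<T}. \<forall>y :: nat \<Rightarrow> _. (\<forall>k. y k \<in> Y) \<longrightarrow>
      (\<lambda>k. N (\<lambda>x. y k x - u t x)) \<longlonglongrightarrow> 0 \<longrightarrow> (\<lambda>k. G t (y k)) \<longlonglongrightarrow> G t (u t)"
    using bochner_measurable_AE[OF G] bochner_measurable_AE[OF u]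
  proof eventually_elim
    case (elim t)
    show ?case
    proof (intro allI impI)
      fix y :: "nat \<Rightarrow> _"
      assume y: "\<forall>k. y k \<in> Y" and lim: "(\<lambda>k. N (\<lambda>x. y k x - u t x)) \<longlonglongrightarrow> 0"
      have "y k \<in> X" for k using y Y by blast
      moreover have "u t \<in> X" using elim(2) Y by blast
      ultimately show "(\<lambda>k. G t (y k)) \<longlonglongrightarrow> G t (u t)" using lim by (rule functional_tendsto[OF elim(1)])
    qed
  qed
qed

lemma dual_evaluation_integrable:
  assumes G: "G \<in> Lp_time 2 T (dual X N) (dual_norm X N)" and w: "w \<in> X"
  shows "integrable (lebesgue_on {0<..<T}) (\<lambda>t. G t w)"
proof (rule Bochner_Integration.integrable_bound)
  have b: "bochner_measurable T (dual X N) (dual_norm X N) G"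
    and i: "integrable (lebesgue_on {0<..<T}) (\<lambda>t. (dual_norm X N (G t))\<^sup>2)"
    using G by (simp_all add: Lp_time_def)
  have "finite_measure (lebesgue_on {0<..<T})" by (rule finite_measure_lebesgue_on) simp
  then have "integrable (lebesgue_on {0<..<T}) (\<lambda>t. 1 :: real)" by (rule finite_measure.integrable_const)
  with i show "integrable (lebesgue_on {0<..<T}) (\<lambda>t. ((dual_norm X N (G t))\<^sup>2 + 1) * N w)" by simp
  show "(\<lambda>t. G t w) \<in> borel_measurable (lebesgue_on {0<..<T})" by (rule dual_evaluation_measurable[OF b w])
  show "AE t in lebesgue_on {0<..<T}. norm (G t w) \<le> norm (((dual_norm X N (G t))\<^sup>2 + 1) * N w)"
    using bochner_measurable_AE[OF b]
  proof eventually_elim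
    case (elim t)
    have "dual_norm X N (G t) \<le> (dual_norm X N (G t))\<^sup>2 + 1"
      using sum_squares_bound[of 1 "dual_norm X N (G t)"] zero_le_power2[of "dual_norm X N (G t)"]
      by (simp only: power_one mult_1_right)
    then have "\<bar>G t w\<bar> \<le> ((dual_norm X N (G t))\<^sup>2 + 1) * N w"
      using bound[OF elim w] nonneg[OF w] by (meson mult_right_mono order.trans)
    then show ?case by simp
  qed
qed

text \<open>For a fixed \<open>w\<close> the fundamental lemma in time gives
  \<open>G t w = H t w\<close> for almost every \<open>t\<close>. As \<open>u\<close> has
  essentially separable range, countably many \<open>w\<close> determine the values at
  \<open>u t\<close>, so that one null set suffices.\<close>

lemma weak_time_deriv_unique:
  assumes G: "G \<in> Lp_time 2 T (dual X N) (dual_norm X N)" "weak_time_deriv T X U G"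
    and H: "H \<in> Lp_time 2 T (dual X N) (dual_norm X N)" "weak_time_deriv T X U H"
    and u: "bochner_measurable T X N u"
  shows "AE t in lebesgue_on {0<..<T}. G t (u t) = H t (u t)"
proof -
  have pointwise: "AE t in lebesgue_on {0<..<T}. G t w = H t w" if w: "w \<in> X" for w
  proof -
    note iG = dual_evaluation_integrable[OF G(1) w] and iH = dual_evaluation_integrable[OF H(1) w]
    have "AE t in lebesgue_on {0<..<T}. G t w - H t w = 0"
    proof (rule fundamental_lemma_time)
      show "integrable (lebesgue_on {0<..<T}) (\<lambda>t. G t w - H t w)" using iG iH by simp
      fix \<psi> assume \<psi>: "\<psi> \<in> test_time T"
      then have "smooth1 \<psi>" by (simp add: test_time_def smooth1_def)
      then have cont: "continuous_on S \<psi>" for S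
        by (intro continuous_at_imp_continuous_on ballI DERIV_isCont[OF smooth1_has_derivative])
      have "compact (\<psi> ` {0..T})" by (intro compact_continuous_image cont) simp
      then obtain B where B: "\<And>t. t \<in> {0..T} \<Longrightarrow> norm (\<psi> t) \<le> B"
        using compact_imp_bounded bounded_iff by (metis imageI)
      have mult: "integrable (lebesgue_on {0<..<T}) (\<lambda>t. \<psi> t * k t)" if k: "integrable (lebesgue_on {0<..<T}) k" for k :: "real \<Rightarrow> real"
      proof (rule Bochner_Integration.integrable_bound)
        show "integrable (lebesgue_on {0<..<T}) (\<lambda>t. B * k t)" using k by simp
        show "(\<lambda>t. \<psi> t * k t) \<in> borel_measurable (lebesgue_on {0<..<T})"
          by (intro borel_measurable_times borel_measurable_integrable[OF k] continuous_imp_measurable_on_sets_lebesgue cont) simp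
        have "norm (\<psi> t * k t) \<le> norm (B * k t)" if "t \<in> {0<..<T}" for t
        proof -
          have "\<bar>\<psi> t\<bar> \<le> \<bar>B\<bar>" using B[of t] that by simp
          then show ?thesis by (simp add: abs_mult mult_right_mono)
        qed
        then show "AE t in lebesgue_on {0<..<T}. norm (\<psi> t * k t) \<le> norm (B * k t)" by (intro AE_I2) simp
      qed
      have "(LINT t|lebesgue_on {0<..<T}. \<psi> t * G t w) = (LINT t|lebesgue_on {0<..<T}. \<psi> t * H t w)"
        using bspec[OF bspec[OF G(2)[unfolded weak_time_deriv_def] \<psi>] w]
          bspec[OF bspec[OF H(2)[unfolded weak_time_deriv_def] \<psi>] w] by linarith
      then show "(LINT t|lebesgue_on {0<..<T}. \<psi> t * (G t w - H t w)) = 0"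
        using mult[OF iG] mult[OF iH] by (simp add: right_diff_distrib)
    qed
    then show ?thesis by eventually_elim simp
  qed
  obtain D where D: "countable D" "D \<subseteq> X"
    "AE t in lebesgue_on {0<..<T}. \<exists>y :: nat \<Rightarrow> _. (\<forall>k. y k \<in> D) \<and> (\<lambda>k. N (\<lambda>x. y k x - u t x)) \<longlonglongrightarrow> 0"
    using bochner_measurable_countable_approx[OF u] by blast
  have "AE t in lebesgue_on {0<..<T}. \<forall>w\<in>D. G t w = H t w"
    using pointwise D(2) by (subst AE_ball_countable[OF D(1)]) blast
  moreover have "AE t in lebesgue_on {0<..<T}. G t \<in> dual X N" "AE t in lebesgue_on {0<..<T}. H t \<in> dual X N"
    using G(1) H(1) by (simp_all add: Lp_time_def bochner_measurable_def)
  ultimately show ?thesis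
    using D(3) bochner_measurable_AE[OF u]
  proof eventually_elim
    case (elim t)
    obtain y where y: "\<And>k::nat. y k \<in> D" "(\<lambda>k. N (\<lambda>x. y k x - u t x)) \<longlonglongrightarrow> 0" using elim(4) by blast
    have yX: "y k \<in> X" for k using y(1) D(2) by blast
    have lG: "(\<lambda>k. G t (y k)) \<longlonglongrightarrow> G t (u t)" by (rule functional_tendsto[OF elim(2) yX elim(5) y(2)])
    have lH: "(\<lambda>k. H t (y k)) \<longlonglongrightarrow> H t (u t)" by (rule functional_tendsto[OF elim(3) yX elim(5) y(2)])
    have "G t (y k) = H t (y k)" for k using elim(1) y(1) by blast
    then have "(\<lambda>k. G t (y k)) = (\<lambda>k. H t (y k))" by (rule ext)
    then show ?case using lG lH LIMSEQ_unique by metis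
  qed
qed

end

context bounded_open begin

sublocale L2_sigma: seminormed_space "L2_sigma \<Omega>" "L2_norm \<Omega>"
  by unfold_locales (simp_all add: L2_sigma_scaleR L2_norm_scaleR L2_sigma_diff)

lemma H1_norm_triangle:
  fixes u :: "real ^ 'n \<Rightarrow> real ^ 'n"
  assumes "u \<in> H1 \<Omega>" "w \<in> H1 \<Omega>"
  shows "H1_norm \<Omega> (\<lambda>x. u x - w x) \<le> 2 * (H1_norm \<Omega> u + H1_norm \<Omega> w)"
proof -
  have tri: "L2_norm \<Omega> (\<lambda>x. p x - q x) \<le> L2_norm \<Omega> p + L2_norm \<Omega> q"
    if "p \<in> L2 \<Omega>" "q \<in> L2 \<Omega>" for p q :: "real ^ 'n \<Rightarrow> 'z::euclidean_space"
    using L2_norm_triangle[OF that(1) L2_scaleR[OF that(2), of "-1"]] L2_norm_scaleR[of \<Omega> "-1" q] by simp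
  let ?d = "\<lambda>x. u x - w x"
  have arith: "h \<le> 2 * (p + q)"
    if "h \<le> a + b" "a \<le> a1 + a2" "b \<le> b1 + b2" "a1 \<le> p" "b1 \<le> p" "a2 \<le> q" "b2 \<le> q"
    for h a b a1 a2 b1 b2 p q :: real
    using order.trans[OF that(1) add_mono[OF order.trans[OF that(2) add_mono[OF that(4,6)]]
          order.trans[OF that(3) add_mono[OF that(5,7)]]]]
    by (simp only: mult_2)
  show ?thesis
  proof (rule arith)
    show "L2_norm \<Omega> ?d \<le> L2_norm \<Omega> u + L2_norm \<Omega> w" by (rule tri[OF H1_L2 H1_L2]) fact+
    show "L2_norm \<Omega> (wgrad \<Omega> ?d) \<le> L2_norm \<Omega> (wgrad \<Omega> u) + L2_norm \<Omega> (wgrad \<Omega> w)"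
      unfolding L2_norm_cong_AE[OF wgrad_diff[OF assms]] by (rule tri[OF wgrad_L2 wgrad_L2]) fact+
    show "H1_norm \<Omega> ?d \<le> L2_norm \<Omega> ?d + L2_norm \<Omega> (wgrad \<Omega> ?d)"
    proof (rule power2_le_imp_le)
      show "(H1_norm \<Omega> ?d)\<^sup>2 \<le> (L2_norm \<Omega> ?d + L2_norm \<Omega> (wgrad \<Omega> ?d))\<^sup>2"
        unfolding H1_norm_sq[OF H1_diff[OF assms]] by (simp add: power2_sum)
    qed simp
  qed (rule H1_norm_bounds assms)+
qed

lemma H10_diff:
  assumes "u \<in> H10 \<Omega>" "w \<in> H10 \<Omega>"
  shows "(\<lambda>x. u x - w x :: real ^ 'n) \<in> H10 \<Omega>"
  unfolding H10_def closure_in_def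
proof (intro CollectI conjI allI impI)
  note uw = H10_H1[OF assms(1)] H10_H1[OF assms(2)]
  show "(\<lambda>x. u x - w x) \<in> H1 \<Omega>" by (rule H1_diff[OF uw])
  fix e :: real assume "e > 0"
  then have "e / 4 > 0" by simp
  then obtain \<phi> \<psi> where \<phi>: "\<phi> \<in> Cc_inf \<Omega>" "H1_norm \<Omega> (\<lambda>x. u x - \<phi> x) < e / 4"
    and \<psi>: "\<psi> \<in> Cc_inf \<Omega>" "H1_norm \<Omega> (\<lambda>x. w x - \<psi> x) < e / 4"
    using assms unfolding H10_def closure_in_def by blast
  have "H1_norm \<Omega> (\<lambda>x. (u x - \<phi> x) - (w x - \<psi> x)) \<le> 2 * (H1_norm \<Omega> (\<lambda>x. u x - \<phi> x) + H1_norm \<Omega> (\<lambda>x. w x - \<psi> x))"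
    by (rule H1_norm_triangle[OF H1_diff[OF uw(1) Cc_inf_H1[OF \<phi>(1)]] H1_diff[OF uw(2) Cc_inf_H1[OF \<psi>(1)]]])
  moreover have "(\<lambda>x. (u x - \<phi> x) - (w x - \<psi> x)) = (\<lambda>x. u x - w x - (\<phi> x - \<psi> x))" by (simp add: algebra_simps)
  ultimately have "H1_norm \<Omega> (\<lambda>x. u x - w x - (\<phi> x - \<psi> x)) < e" using \<phi>(2) \<psi>(2) by simp
  then show "\<exists>\<phi>\<in>Cc_inf \<Omega>. H1_norm \<Omega> (\<lambda>x. u x - w x - \<phi> x) < e"
    by (rule bexI[of _ "\<lambda>x. \<phi> x - \<psi> x", OF _ Cc_inf_diff[OF \<phi>(1) \<psi>(1)]])
qed

sublocale H10: seminormed_space "H10 \<Omega> :: (real ^ 'n \<Rightarrow> real ^ 'n) set" "H1_norm \<Omega>"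
  by unfold_locales (simp_all add: H10_scaleR H1_scaleR(2)[OF H10_H1] H10_diff)

section \<open>Differentiable curves of test fields\<close>

lemma C1_curve_quotient_L2:
  assumes \<phi>: "C1_curve T \<Omega> \<phi> \<phi>'" and t: "t \<in> {0..T}"
  shows "((\<lambda>\<tau>. L2_norm \<Omega> (\<lambda>x. (1 / (\<tau> - t)) *\<^sub>R (\<phi> \<tau> x - \<phi> t x) - \<phi>' t x)) \<longlongrightarrow> 0) (at t within {0..T})"
    and "\<forall>\<^sub>F \<tau> in at t within {0..T}. (\<lambda>x. (1 / (\<tau> - t)) *\<^sub>R (\<phi> \<tau> x - \<phi> t x)) \<in> L2 \<Omega>"
proof -
  have Cc: "(\<lambda>x. (1 / (\<tau> - t)) *\<^sub>R (\<phi> \<tau> x - \<phi> t x)) \<in> Cc_inf \<Omega>" if "\<tau> \<in> {0..T}" for \<tau>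
    by (intro Cc_inf_scaleR_const Cc_inf_diff Cc_inf_sigma_Cc_inf C1_curveD(1)[OF \<phi>] that t)
  show "\<forall>\<^sub>F \<tau> in at t within {0..T}. (\<lambda>x. (1 / (\<tau> - t)) *\<^sub>R (\<phi> \<tau> x - \<phi> t x)) \<in> L2 \<Omega>"
    using eventually_in_time by eventually_elim (rule Cc_inf_L2[OF Cc])
  have u: "uniform_limit UNIV (\<lambda>\<tau> x. (1 / (\<tau> - t)) *\<^sub>R (\<phi> \<tau> x - \<phi> t x)) (\<phi>' t) (at t within {0..T})"
    using C1_curveD(3)[OF \<phi> t, of "[]"] by simp
  show "((\<lambda>\<tau>. L2_norm \<Omega> (\<lambda>x. (1 / (\<tau> - t)) *\<^sub>R (\<phi> \<tau> x - \<phi> t x) - \<phi>' t x)) \<longlongrightarrow> 0) (at t within {0..T})"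
  proof (rule tendstoI)
    fix e :: real assume e: "e > 0"
    define K where "K = sqrt (measure lebesgue \<Omega>)"
    have K: "0 \<le> K" by (simp add: K_def)
    define d where "d = e / (K + 1)"
    have d: "d > 0" using e K by (simp add: d_def)
    have "\<forall>\<^sub>F \<tau> in at t within {0..T}. \<forall>x\<in>UNIV. dist ((1 / (\<tau> - t)) *\<^sub>R (\<phi> \<tau> x - \<phi> t x)) (\<phi>' t x) < d"
      using u d unfolding uniform_limit_iff by blast
    then show "\<forall>\<^sub>F \<tau> in at t within {0..T}. dist (L2_norm \<Omega> (\<lambda>x. (1 / (\<tau> - t)) *\<^sub>R (\<phi> \<tau> x - \<phi> t x) - \<phi>' t x)) 0 < e"
      using eventually_in_time
    proof eventually_elim
      case (elim \<tau>)
      have "L2_norm \<Omega> (\<lambda>x. (1 / (\<tau> - t)) *\<^sub>R (\<phi> \<tau> x - \<phi> t x) - \<phi>' t x) \<le> d * K"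
        unfolding K_def
      proof (rule L2_norm_le_bound)
        show "norm ((1 / (\<tau> - t)) *\<^sub>R (\<phi> \<tau> x - \<phi> t x) - \<phi>' t x) \<le> d" for x
          using elim(1) by (simp add: dist_norm less_imp_le)
        show "(\<lambda>x. (1 / (\<tau> - t)) *\<^sub>R (\<phi> \<tau> x - \<phi> t x) - \<phi>' t x) \<in> borel_measurable (lebesgue_on \<Omega>)"
          by (rule smooth_measurable[OF Cc_inf_smooth[OF Cc_inf_diff[OF Cc[OF elim(2)] Cc_inf_sigma_Cc_inf[OF C1_curveD(2)[OF \<phi> t]]]]])
      qed (use d in simp)
      also have "\<dots> < d * (K + 1)" using d by simp
      also have "\<dots> = e" using K by (simp add: d_def)
      finally show ?case by simp
    qed
  qed
qed

lemma C1_curve_L2: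
  assumes \<phi>: "C1_curve T \<Omega> \<phi> \<phi>'" and t: "t \<in> {0..T}"
  shows "\<phi> t \<in> L2 \<Omega>" "\<phi>' t \<in> L2 \<Omega>"
  using smooth_curve_L2(4)[OF C1_curve_smooth_curve(1)[OF \<phi>] t]
    smooth_curve_L2(4)[OF C1_curve_smooth_curve(2)[OF \<phi>] t] .

lemma C1_curve_pairing_deriv:
  assumes \<phi>: "C1_curve T \<Omega> \<phi> \<phi>'" and t: "t \<in> {0..T}" and w: "w \<in> L2 \<Omega>"
  shows "((\<lambda>\<tau>. L2_inner \<Omega> (\<phi> \<tau>) w) has_vector_derivative L2_inner \<Omega> (\<phi>' t) w) (at t within {0..T})"
  unfolding has_vector_derivative_iff_quotient
proof (rule Lim_transform_eventually)
  show "((\<lambda>\<tau>. L2_inner \<Omega> (\<lambda>x. (1 / (\<tau> - t)) *\<^sub>R (\<phi> \<tau> x - \<phi> t x)) w) \<longlongrightarrow> L2_inner \<Omega> (\<phi>' t) w) (at t within {0..T})"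
    by (rule L2_inner_tendsto_left[OF C1_curve_quotient_L2(2)[OF \<phi> t] C1_curve_L2(2)[OF \<phi> t]
          C1_curve_quotient_L2(1)[OF \<phi> t] w])
  show "\<forall>\<^sub>F \<tau> in at t within {0..T}. L2_inner \<Omega> (\<lambda>x. (1 / (\<tau> - t)) *\<^sub>R (\<phi> \<tau> x - \<phi> t x)) w =
      (1 / (\<tau> - t)) *\<^sub>R (L2_inner \<Omega> (\<phi> \<tau>) w - L2_inner \<Omega> (\<phi> t) w)"
    using eventually_in_time
  proof eventually_elim
    case (elim \<tau>)
    show ?case
      by (simp only: L2_inner_scaleR_left L2_inner_diff_left[OF C1_curve_L2(1)[OF \<phi> elim] C1_curve_L2(1)[OF \<phi> t] w] real_scaleR_def)
  qed
qed

lemma smooth_curve_inner_continuous: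
  fixes \<Phi> \<Psi> :: "real \<Rightarrow> real ^ 'n \<Rightarrow> 'b::euclidean_space"
  assumes "smooth_curve T \<Omega> \<Phi>" "smooth_curve T \<Omega> \<Psi>"
  shows "continuous_on {0..T} (\<lambda>t. L2_inner \<Omega> (\<Phi> t) (\<Psi> t))"
proof (rule continuous_on_timeI)
  fix t assume t: "t \<in> {0..T}"
  show "((\<lambda>\<tau>. L2_inner \<Omega> (\<Phi> \<tau>) (\<Psi> \<tau>)) \<longlongrightarrow> L2_inner \<Omega> (\<Phi> t) (\<Psi> t)) (at t within {0..T})"
    by (rule L2_inner_tendsto) (fact smooth_curve_L2[OF assms(1) t] smooth_curve_L2[OF assms(2) t])+
qed

lemma smooth_curve_inner_const_continuous:
  fixes \<Phi> :: "real \<Rightarrow> real ^ 'n \<Rightarrow> 'b::euclidean_space"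
  assumes "smooth_curve T \<Omega> \<Phi>" "w \<in> L2 \<Omega>"
  shows "continuous_on {0..T} (\<lambda>t. L2_inner \<Omega> (\<Phi> t) w)"
proof (rule continuous_on_timeI)
  fix t assume t: "t \<in> {0..T}"
  show "((\<lambda>\<tau>. L2_inner \<Omega> (\<Phi> \<tau>) w) \<longlongrightarrow> L2_inner \<Omega> (\<Phi> t) w) (at t within {0..T})"
    by (rule L2_inner_tendsto_left[OF smooth_curve_L2(3)[OF assms(1) t] smooth_curve_L2(4)[OF assms(1) t]
        smooth_curve_L2(1)[OF assms(1) t] assms(2)])
qed

text \<open>The difference of the squares is the inner product of
  \<open>\<phi> \<tau> - \<phi> t\<close> and \<open>\<phi> \<tau> + \<phi> t\<close>.\<close>

lemma C1_curve_energy_deriv: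
  assumes \<phi>: "C1_curve T \<Omega> \<phi> \<phi>'" and t: "t \<in> {0..T}"
  shows "((\<lambda>\<tau>. 1 / 2 * (L2_norm \<Omega> (\<phi> \<tau>))\<^sup>2) has_vector_derivative L2_inner \<Omega> (\<phi>' t) (\<phi> t)) (at t within {0..T})"
  unfolding has_vector_derivative_iff_quotient
proof (rule Lim_transform_eventually)
  note sc = C1_curve_smooth_curve(1)[OF \<phi>]
  let ?Q = "\<lambda>\<tau> x. (1 / (\<tau> - t)) *\<^sub>R (\<phi> \<tau> x - \<phi> t x)"
  note L2t = C1_curve_L2[OF \<phi> t]
  note q = C1_curve_quotient_L2(2)[OF \<phi> t] L2t(2) C1_curve_quotient_L2(1)[OF \<phi> t]
  have 1: "((\<lambda>\<tau>. L2_inner \<Omega> (?Q \<tau>) (\<phi> \<tau>)) \<longlongrightarrow> L2_inner \<Omega> (\<phi>' t) (\<phi> t)) (at t within {0..T})"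
    by (rule L2_inner_tendsto[OF q smooth_curve_L2(3)[OF sc t] L2t(1) smooth_curve_L2(1)[OF sc t]])
  have 2: "((\<lambda>\<tau>. L2_inner \<Omega> (?Q \<tau>) (\<phi> t)) \<longlongrightarrow> L2_inner \<Omega> (\<phi>' t) (\<phi> t)) (at t within {0..T})"
    by (rule L2_inner_tendsto_left[OF q L2t(1)])
  have "((\<lambda>\<tau>. 1 / 2 * (L2_inner \<Omega> (?Q \<tau>) (\<phi> \<tau>) + L2_inner \<Omega> (?Q \<tau>) (\<phi> t)))
      \<longlongrightarrow> 1 / 2 * (L2_inner \<Omega> (\<phi>' t) (\<phi> t) + L2_inner \<Omega> (\<phi>' t) (\<phi> t))) (at t within {0..T})"
    by (intro tendsto_mult tendsto_const tendsto_add 1 2)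
  then show "((\<lambda>\<tau>. 1 / 2 * (L2_inner \<Omega> (?Q \<tau>) (\<phi> \<tau>) + L2_inner \<Omega> (?Q \<tau>) (\<phi> t)))
      \<longlongrightarrow> L2_inner \<Omega> (\<phi>' t) (\<phi> t)) (at t within {0..T})" by simp
  show "\<forall>\<^sub>F \<tau> in at t within {0..T}. 1 / 2 * (L2_inner \<Omega> (?Q \<tau>) (\<phi> \<tau>) + L2_inner \<Omega> (?Q \<tau>) (\<phi> t)) =
      (1 / (\<tau> - t)) *\<^sub>R (1 / 2 * (L2_norm \<Omega> (\<phi> \<tau>))\<^sup>2 - 1 / 2 * (L2_norm \<Omega> (\<phi> t))\<^sup>2)"
    using eventually_in_time
  proof eventually_elim
    case (elim \<tau>)
    note L2\<tau> = C1_curve_L2(1)[OF \<phi> elim]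
    have c: "L2_inner \<Omega> (\<phi> t) (\<phi> \<tau>) = L2_inner \<Omega> (\<phi> \<tau>) (\<phi> t)" by (rule L2_inner_commute)
    show ?case
      unfolding L2_inner_scaleR_left L2_inner_diff_left[OF L2\<tau> L2t(1) L2\<tau>] L2_inner_diff_left[OF L2\<tau> L2t(1) L2t(1)]
        L2_inner_self c by (simp add: algebra_simps)
  qed
qed

lemma C1_curve_energy_balance:
  assumes \<phi>: "C1_curve T \<Omega> \<phi> \<phi>'" and "0 \<le> q" "q \<le> r" "r \<le> T"
  shows "(LINT \<tau>|lebesgue_on {q..r}. L2_inner \<Omega> (\<phi>' \<tau>) (\<phi> \<tau>)) = 1 / 2 * (L2_norm \<Omega> (\<phi> r))\<^sup>2 - 1 / 2 * (L2_norm \<Omega> (\<phi> q))\<^sup>2"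
proof (rule FTC_lebesgue[OF assms(3)])
  have sub: "{q..r} \<subseteq> {0..T}" using assms by auto
  show "((\<lambda>\<tau>. 1 / 2 * (L2_norm \<Omega> (\<phi> \<tau>))\<^sup>2) has_vector_derivative L2_inner \<Omega> (\<phi>' t) (\<phi> t)) (at t within {q..r})"
    if "t \<in> {q..r}" for t
    by (rule has_vector_derivative_within_subset[OF C1_curve_energy_deriv[OF \<phi>] sub]) (use that sub in blast)
  show "continuous_on {q..r} (\<lambda>\<tau>. L2_inner \<Omega> (\<phi>' \<tau>) (\<phi> \<tau>))"
    by (rule continuous_on_subset[OF smooth_curve_inner_continuous[OF C1_curve_smooth_curve(2,1)[OF \<phi>]] sub])
qed

text \<open>Integration by parts for the scalar function that pairs \<open>\<phi> t\<close> with
  \<open>w\<close>.\<close>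

lemma C1_curve_weak_time_deriv:
  assumes \<phi>: "C1_curve T \<Omega> \<phi> \<phi>'" and T: "0 < T"
  shows "weak_time_deriv T (L2_sigma \<Omega>) (\<lambda>t. L2_inner \<Omega> (\<phi> t)) (\<lambda>t. L2_inner \<Omega> (\<phi>' t))"
  unfolding weak_time_deriv_def
proof (intro ballI)
  fix \<psi> w assume \<psi>: "\<psi> \<in> test_time T" and w: "w \<in> L2_sigma \<Omega>"
  note wL = L2_sigma_L2[OF w]
  have sm: "smooth1 \<psi>" using \<psi> by (simp add: test_time_def smooth1_def)
  have cont: "continuous_on S \<psi>" "continuous_on S (deriv \<psi>)" for S
    by (intro continuous_at_imp_continuous_on ballI DERIV_isCont[OF smooth1_has_derivative[OF sm]]
        DERIV_isCont[OF smooth1_has_derivative[OF smooth1_deriv[OF sm]]])+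
  have \<psi>0: "\<psi> t = 0" if "t \<notin> {0<..<T}" for t
    using \<psi> closure_subset[of "{t. \<psi> t \<noteq> 0}"] that unfolding test_time_def by blast
  let ?m = "\<lambda>t. L2_inner \<Omega> (\<phi> t) w" and ?m' = "\<lambda>t. L2_inner \<Omega> (\<phi>' t) w"
  have cm: "continuous_on {0..T} ?m" "continuous_on {0..T} ?m'"
    by (intro smooth_curve_inner_const_continuous C1_curve_smooth_curve[OF \<phi>] wL)+
  have "(LINT t|lebesgue_on {0..T}. deriv \<psi> t * ?m t + \<psi> t * ?m' t) = \<psi> T * ?m T - \<psi> 0 * ?m 0"
  proof (rule FTC_lebesgue)
    show "((\<lambda>t. \<psi> t * ?m t) has_vector_derivative deriv \<psi> t * ?m t + \<psi> t * ?m' t) (at t within {0..T})"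
      if "t \<in> {0..T}" for t
    proof -
      have "(?m has_real_derivative ?m' t) (at t within {0..T})"
        using C1_curve_pairing_deriv[OF \<phi> that wL] by (simp add: has_real_derivative_iff_has_vector_derivative)
      from DERIV_mult'[OF has_field_derivative_at_within[OF smooth1_has_derivative[OF sm, of t]] this]
      show ?thesis by (simp add: has_real_derivative_iff_has_vector_derivative add.commute)
    qed
    show "continuous_on {0..T} (\<lambda>t. deriv \<psi> t * ?m t + \<psi> t * ?m' t)"
      by (intro continuous_intros cont cm)
  qed (use T in simp)
  also have "\<dots> = 0" using \<psi>0 by simp
  finally have "(LINT t|lebesgue_on {0<..<T}. deriv \<psi> t * ?m t + \<psi> t * ?m' t) = 0"
    by (simp only: LINT_interior(1))
  moreover have "integrable (lebesgue_on {0<..<T}) (\<lambda>t. deriv \<psi> t * ?m t)" "integrable (lebesgue_on {0<..<T}) (\<lambda>t. \<psi> t * ?m' t)"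
    by (intro integrable_continuous_time continuous_intros cont cm)+
  ultimately show "(LINT t|lebesgue_on {0<..<T}. deriv \<psi> t * ?m t) = - (LINT t|lebesgue_on {0<..<T}. \<psi> t * ?m' t)"
    by simp
qed

lemma smooth_curve_dual:
  assumes \<Phi>: "smooth_curve T \<Omega> \<Phi>" and s: "\<And>t. t \<in> {0..T} \<Longrightarrow> \<Phi> t \<in> Cc_inf_sigma \<Omega>"
  shows "(\<lambda>t. L2_inner \<Omega> (\<Phi> t)) \<in> Lp_time p T (dual (L2_sigma \<Omega>) (L2_norm \<Omega>)) (dual_norm (L2_sigma \<Omega>) (L2_norm \<Omega>))"
proof (rule Lp_time_continuous(1))
  have ss: "\<Phi> t \<in> L2_sigma \<Omega>" if "t \<in> {0..T}" for t by (rule Cc_inf_sigma_L2_sigma[OF s[OF that]])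
  show "L2_inner \<Omega> (\<Phi> t) \<in> dual (L2_sigma \<Omega>) (L2_norm \<Omega>)" if "t \<in> {0..T}" for t
    by (rule L2_inner_dual[OF L2_sigma_L2[OF ss[OF that]]])
  show "dual_norm (L2_sigma \<Omega>) (L2_norm \<Omega>) (\<lambda>x. 0) = 0"
  proof -
    have "dual_norm (L2_sigma \<Omega>) (L2_norm \<Omega>) (\<lambda>x. 0) = dual_norm (L2_sigma \<Omega>) (L2_norm \<Omega>) (L2_inner \<Omega> (\<lambda>x. 0))"
      by (rule dual_norm_cong) simp
    then show ?thesis by (simp add: dual_norm_L2_inner[OF Cc_inf_sigma_L2_sigma[OF Cc_inf_sigma_zero]])
  qed
  fix t assume t: "t \<in> {0..T}"
  show "((\<lambda>\<tau>. dual_norm (L2_sigma \<Omega>) (L2_norm \<Omega>) (\<lambda>x. L2_inner \<Omega> (\<Phi> \<tau>) x - L2_inner \<Omega> (\<Phi> t) x)) \<longlongrightarrow> 0) (at t within {0..T})"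
  proof (rule Lim_transform_eventually[OF smooth_curve_L2(1)[OF \<Phi> t]])
    show "\<forall>\<^sub>F \<tau> in at t within {0..T}. L2_norm \<Omega> (\<lambda>x. \<Phi> \<tau> x - \<Phi> t x) =
       dual_norm (L2_sigma \<Omega>) (L2_norm \<Omega>) (\<lambda>x. L2_inner \<Omega> (\<Phi> \<tau>) x - L2_inner \<Omega> (\<Phi> t) x)"
      using eventually_in_time
    proof eventually_elim
      case (elim \<tau>)
      have "dual_norm (L2_sigma \<Omega>) (L2_norm \<Omega>) (\<lambda>x. L2_inner \<Omega> (\<Phi> \<tau>) x - L2_inner \<Omega> (\<Phi> t) x)
         = dual_norm (L2_sigma \<Omega>) (L2_norm \<Omega>) (L2_inner \<Omega> (\<lambda>x. \<Phi> \<tau> x - \<Phi> t x))"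
        by (rule dual_norm_cong)
          (rule L2_inner_diff_left[symmetric, OF L2_sigma_L2[OF ss[OF elim]] L2_sigma_L2[OF ss[OF t]] L2_sigma_L2])
      then show ?case by (simp add: dual_norm_L2_inner[OF L2_sigma_diff[OF ss[OF elim] ss[OF t]]])
    qed
  qed
next
  have ss: "\<Phi> t \<in> L2_sigma \<Omega>" if "t \<in> {0..T}" for t by (rule Cc_inf_sigma_L2_sigma[OF s[OF that]])
  have "continuous_on {0..T} (\<lambda>t. L2_norm \<Omega> (\<Phi> t))"
    by (rule continuous_on_timeI[OF smooth_curve_L2(2)[OF \<Phi>]])
  then show "continuous_on {0..T} (\<lambda>t. dual_norm (L2_sigma \<Omega>) (L2_norm \<Omega>) (L2_inner \<Omega> (\<Phi> t)))"
    by (rule continuous_on_eq) (rule dual_norm_L2_inner[OF ss, symmetric])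
qed

lemma C1_curve_H1_time:
  assumes \<phi>: "C1_curve T \<Omega> \<phi> \<phi>'" and T: "0 < T"
  shows "(\<lambda>t. L2_inner \<Omega> (\<phi> t)) \<in> H1_time_dual T (L2_sigma \<Omega>) (L2_norm \<Omega>)"
  unfolding H1_time_dual_def
  using smooth_curve_dual[OF C1_curve_smooth_curve(1)[OF \<phi>] C1_curveD(1)[OF \<phi>]]
    smooth_curve_dual[OF C1_curve_smooth_curve(2)[OF \<phi>] C1_curveD(2)[OF \<phi>]]
    C1_curve_weak_time_deriv[OF \<phi> T] by blast

text \<open>The operator \<^const>\<open>dt\<close> is a choice among weak time derivatives. The
  classical derivative is one of them, and uniqueness identifies their values along any measurable
  \<open>u\<close>. Its values are functionals in the dual, hence linear on differences such as
  \<open>u t - \<phi> t\<close>.\<close>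

lemma C1_curve_dt:
  assumes \<phi>: "C1_curve T \<Omega> \<phi> \<phi>'" and T: "0 < T" and u: "bochner_measurable T (L2_sigma \<Omega>) (L2_norm \<Omega>) u"
  shows "AE t in lebesgue_on {0<..<T}. dt T \<Omega> \<phi> t (u t) = L2_inner \<Omega> (\<phi>' t) (u t)"
    and "AE t in lebesgue_on {0<..<T}. dt T \<Omega> \<phi> t \<in> dual (L2_sigma \<Omega>) (L2_norm \<Omega>)"
proof -
  let ?P = "\<lambda>G. G \<in> Lp_time 2 T (dual (L2_sigma \<Omega>) (L2_norm \<Omega>)) (dual_norm (L2_sigma \<Omega>) (L2_norm \<Omega>)) \<and>
                       weak_time_deriv T (L2_sigma \<Omega>) (\<lambda>t. L2_inner \<Omega> (\<phi> t)) G"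
  have P: "?P (\<lambda>t. L2_inner \<Omega> (\<phi>' t))"
    using smooth_curve_dual[OF C1_curve_smooth_curve(2)[OF \<phi>] C1_curveD(2)[OF \<phi>]]
      C1_curve_weak_time_deriv[OF \<phi> T] by blast
  have Q: "?P (dt T \<Omega> \<phi>)" unfolding dt_def by (rule someI[of ?P, OF P])
  show "AE t in lebesgue_on {0<..<T}. dt T \<Omega> \<phi> t (u t) = L2_inner \<Omega> (\<phi>' t) (u t)"
    by (rule L2_sigma.weak_time_deriv_unique[OF conjunct1[OF Q] conjunct2[OF Q] conjunct1[OF P] conjunct2[OF P] u])
  show "AE t in lebesgue_on {0<..<T}. dt T \<Omega> \<phi> t \<in> dual (L2_sigma \<Omega>) (L2_norm \<Omega>)"
    using conjunct1[OF Q] by (simp add: Lp_time_def bochner_measurable_def)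
qed

lemma C1_curve_Lp:
  assumes \<phi>: "C1_curve T \<Omega> \<phi> \<phi>'"
  shows "\<phi> \<in> Linf_time T (L2_sigma \<Omega>) (L2_norm \<Omega>)" "\<phi> \<in> Lp_time p T (H10_sigma \<Omega>) (H1_norm \<Omega>)"
    "\<phi> \<in> Lp_time p T (H2 \<Omega>) (H2_norm \<Omega>)" "\<phi> \<in> Lp_time p T (W1inf \<Omega>) (W1inf_norm \<Omega>)"
    "\<phi>' \<in> Linf_time T (L2_sigma \<Omega>) (L2_norm \<Omega>)"
proof -
  note sc = C1_curve_smooth_curve(1)[OF \<phi>] and sc' = C1_curve_smooth_curve(2)[OF \<phi>]
  note s = C1_curveD(1)[OF \<phi>] and Cc = Cc_inf_sigma_Cc_inf[OF C1_curveD(1)[OF \<phi>]]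
  show "\<phi> \<in> Linf_time T (L2_sigma \<Omega>) (L2_norm \<Omega>)"
    by (rule Lp_time_continuous(2)[OF Cc_inf_sigma_L2_sigma[OF s] L2_norm_zero smooth_curve_L2(1)[OF sc]
          continuous_on_timeI[OF smooth_curve_L2(2)[OF sc]]])
  show "\<phi>' \<in> Linf_time T (L2_sigma \<Omega>) (L2_norm \<Omega>)"
    by (rule Lp_time_continuous(2)[OF Cc_inf_sigma_L2_sigma[OF C1_curveD(2)[OF \<phi>]] L2_norm_zero smooth_curve_L2(1)[OF sc']
          continuous_on_timeI[OF smooth_curve_L2(2)[OF sc']]])
  show "\<phi> \<in> Lp_time p T (H10_sigma \<Omega>) (H1_norm \<Omega>)"
    by (rule Lp_time_continuous(1)[OF Cc_inf_sigma_H10_sigma[OF s] H1_norm_zero conjunct1[OF smooth_curve_H1[OF sc]]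
          continuous_on_timeI[OF conjunct2[OF smooth_curve_H1[OF sc]]]])
  show "\<phi> \<in> Lp_time p T (H2 \<Omega>) (H2_norm \<Omega>)"
    by (rule Lp_time_continuous(1)[OF Cc_inf_H2[OF Cc] H2_norm_zero conjunct1[OF smooth_curve_H2[OF sc]]
          continuous_on_timeI[OF conjunct2[OF smooth_curve_H2[OF sc]]]])
  show "\<phi> \<in> Lp_time p T (W1inf \<Omega>) (W1inf_norm \<Omega>)"
    by (rule Lp_time_continuous(1)[OF Cc_inf_W1inf[OF Cc] W1inf_norm_zero smooth_curve_W1inf(1)[OF sc]
          continuous_on_timeI[OF smooth_curve_W1inf(2)[OF sc]]])
qed

lemma C1_curve_XX:
  assumes \<phi>: "C1_curve T \<Omega> \<phi> \<phi>'"
  shows "\<phi> \<in> XX \<nu> T \<Omega>"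
  unfolding XX_def using C1_curve_Lp(1,2)[OF \<phi>] by simp

lemma C1_curve_YY:
  assumes \<phi>: "C1_curve T \<Omega> \<phi> \<phi>'" and T: "0 < T"
  shows "\<phi> \<in> YY \<nu> T \<Omega>"
  unfolding YY_def using C1_curve_XX[OF \<phi>] C1_curve_Lp(3,4)[OF \<phi>] C1_curve_H1_time[OF \<phi> T] by simp

lemma C1_curve_L2_sigma_continuous:
  assumes \<phi>: "C1_curve T \<Omega> \<phi> \<phi>'"
  shows "L2_sigma_continuous T \<Omega> \<phi>"
  unfolding L2_sigma_continuous_def
  using Cc_inf_sigma_L2_sigma[OF C1_curveD(1)[OF \<phi>]] smooth_curve_L2(1)[OF C1_curve_smooth_curve(1)[OF \<phi>]] by blast

lemma XX_bochner: "u \<in> XX \<nu> T \<Omega> \<Longrightarrow> bochner_measurable T (L2_sigma \<Omega>) (L2_norm \<Omega>) u"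
  by (simp add: XX_def Linf_time_def split: if_splits)

end


section \<open>An admissible weight\<close>

text \<open>Truncate \<open>k\<close> at a large height \<open>m\<close> and clip a sequence of
  continuous functions that converges to \<open>k\<close> almost everywhere to the range from 0 to
  \<open>m\<close>; both steps are dominated.\<close>

lemma continuous_dense_L1:
  fixes k :: "real \<Rightarrow> real"
  assumes k: "integrable (lebesgue_on {0<..<T}) k" and k0: "\<And>t. t \<in> {0<..<T} \<Longrightarrow> 0 \<le> k t" and e: "0 < e"
  obtains g where "continuous_on UNIV g" "(LINT t|lebesgue_on {0<..<T}. \<bar>g t - k t\<bar>) < e"
proof -
  let ?M = "lebesgue_on {0<..<T}"
  have km: "k \<in> borel_measurable ?M" using k by (rule borel_measurable_integrable)
  have fin: "finite_measure ?M" by (rule finite_measure_lebesgue_on) simp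
  have "k measurable_on {0<..<T}" using km by (simp add: measurable_on_iff_borel_measurable)
  then obtain N g where N: "negligible N" and g: "\<And>n. continuous_on UNIV (g n)"
    "\<And>x. x \<notin> N \<Longrightarrow> (\<lambda>n. g n x) \<longlonglongrightarrow> (if x \<in> {0<..<T} then k x else 0)"
    unfolding measurable_on_def by blast
  have AEN: "AE t in ?M. t \<notin> N"
  proof -
    have "AE t in lebesgue. t \<notin> N" by (rule AE_not_in) (use N in \<open>simp add: negligible_iff_null_sets\<close>)
    then show ?thesis by (simp add: AE_lebesgue_on_iff) (auto elim: eventually_mono)
  qed
  have "(\<lambda>m. LINT t|?M. \<bar>min (k t) (real m) - k t\<bar>) \<longlonglongrightarrow> (LINT t|?M. 0)"
  proof (rule integral_dominated_convergence[where w=k])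
    show "(\<lambda>t. \<bar>min (k t) (real m) - k t\<bar>) \<in> borel_measurable ?M" for m using km by measurable
    show "AE t in ?M. (\<lambda>m. \<bar>min (k t) (real m) - k t\<bar>) \<longlonglongrightarrow> 0"
    proof (rule AE_I2)
      fix t
      have "\<forall>\<^sub>F m in sequentially. k t \<le> real m"
        using filterlim_real_sequentially by (auto simp: filterlim_at_top)
      then have "\<forall>\<^sub>F m in sequentially. \<bar>min (k t) (real m) - k t\<bar> = 0"
        by eventually_elim simp
      then show "(\<lambda>m. \<bar>min (k t) (real m) - k t\<bar>) \<longlonglongrightarrow> 0" by (rule tendsto_eventually)
    qed
    have "\<bar>min (k t) (real m) - k t\<bar> \<le> k t" if "t \<in> {0<..<T}" for m t using k0[OF that] by (simp add: min_def)
    then show "AE t in ?M. norm \<bar>min (k t) (real m) - k t\<bar> \<le> k t" for m by (intro AE_I2) simp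
  qed (use k in simp_all)
  then have "\<forall>\<^sub>F m in sequentially. (LINT t|?M. \<bar>min (k t) (real m) - k t\<bar>) < e / 2"
    by (rule order_tendstoD(2)) (use e in simp)
  then obtain m where m: "(LINT t|?M. \<bar>min (k t) (real m) - k t\<bar>) < e / 2"
    by (auto simp: eventually_sequentially)
  define G where "G n t = min (max (g n t) 0) (real m)" for n t
  have Gc: "continuous_on UNIV (G n)" for n unfolding G_def by (intro continuous_intros g)
  have Gb: "0 \<le> G n t" "G n t \<le> real m" for n t by (simp_all add: G_def)
  have Gm: "G n \<in> borel_measurable ?M" for n
    by (rule continuous_imp_measurable_on_sets_lebesgue[OF continuous_on_subset[OF Gc]]) simp_all
  have "(\<lambda>n. LINT t|?M. \<bar>G n t - min (k t) (real m)\<bar>) \<longlonglongrightarrow> (LINT t|?M. 0)"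
  proof (rule integral_dominated_convergence[where w="\<lambda>t. real m"])
    show "(\<lambda>t. \<bar>G n t - min (k t) (real m)\<bar>) \<in> borel_measurable ?M" for n using km Gm by measurable
    show "integrable ?M (\<lambda>t. real m)" by (rule finite_measure.integrable_const[OF fin])
    show "AE t in ?M. (\<lambda>n. \<bar>G n t - min (k t) (real m)\<bar>) \<longlonglongrightarrow> 0"
      using AEN AE_space
    proof eventually_elim
      case (elim t)
      then have "(\<lambda>n. g n t) \<longlonglongrightarrow> k t" using g(2)[of t] by simp
      then have "(\<lambda>n. \<bar>G n t - min (k t) (real m)\<bar>) \<longlonglongrightarrow> \<bar>min (max (k t) 0) (real m) - min (k t) (real m)\<bar>"
        unfolding G_def by (intro tendsto_intros)
      moreover have "max (k t) 0 = k t" using k0[of t] elim(2) by simp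
      ultimately show ?case by simp
    qed
    have "\<bar>G n t - min (k t) (real m)\<bar> \<le> real m" if "t \<in> {0<..<T}" for n t
      using k0[OF that] Gb[of n t] by (simp add: abs_le_iff min_def)
    then show "AE t in ?M. norm \<bar>G n t - min (k t) (real m)\<bar> \<le> real m" for n by (intro AE_I2) simp
  qed simp_all
  then have "\<forall>\<^sub>F n in sequentially. (LINT t|?M. \<bar>G n t - min (k t) (real m)\<bar>) < e / 2"
    by (rule order_tendstoD(2)) (use e in simp)
  then obtain n where n: "(LINT t|?M. \<bar>G n t - min (k t) (real m)\<bar>) < e / 2"
    by (auto simp: eventually_sequentially)
  have Gi: "integrable ?M (G n)"
    by (rule finite_measure.integrable_const_bound[OF fin, where B="real m"]) (use Gb Gm in \<open>auto intro: AE_I2\<close>)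
  have mi: "integrable ?M (\<lambda>t. min (k t) (real m))"
    using k finite_measure.integrable_const[OF fin] by (intro integrable_min)
  have "(LINT t|?M. \<bar>G n t - k t\<bar>) \<le> (LINT t|?M. \<bar>G n t - min (k t) (real m)\<bar> + \<bar>min (k t) (real m) - k t\<bar>)"
    by (rule integral_mono) (use Gi mi k in auto)
  also have "\<dots> = (LINT t|?M. \<bar>G n t - min (k t) (real m)\<bar>) + (LINT t|?M. \<bar>min (k t) (real m) - k t\<bar>)"
    by (rule Bochner_Integration.integral_add) (use Gi mi k in auto)
  also have "\<dots> < e" using m n by simp
  finally show ?thesis using that[OF Gc] by blast
qed

text \<open>The weight below is absolutely homogeneous, so the weight of the field
  \<open>h t *\<^sub>R w\<close> is \<open>\<bar>h t\<bar>\<close> times that of \<open>w\<close>,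
  and these are the functions to approximate with. As \<open>k\<close> is nonnegative, replacing
  \<open>h\<close> by its modulus only decreases the distance to \<open>k\<close>.\<close>

lemma polynomial_modulus_dense_L1:
  fixes k :: "real \<Rightarrow> real"
  assumes k: "integrable (lebesgue_on {0<..<T}) k" and k0: "\<And>t. t \<in> {0<..<T} \<Longrightarrow> 0 \<le> k t" and e: "0 < e"
    and A: "0 < A"
  obtains h where "real_polynomial_function h" "(LINT t|lebesgue_on {0<..<T}. \<bar>A * \<bar>h t\<bar> - k t\<bar>) < e"
proof -
  let ?M = "lebesgue_on {0<..<T}"
  have fin: "finite_measure ?M" by (rule finite_measure_lebesgue_on) simp
  have "e / 2 > 0" using e by simp
  then obtain g where g: "continuous_on UNIV g" "(LINT t|?M. \<bar>g t - k t\<bar>) < e / 2"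
    using continuous_dense_L1[OF k k0] by blast
  have gc: "continuous_on {0..T} g" by (rule continuous_on_subset[OF g(1)]) simp
  define m where "m = measure ?M (space ?M)"
  define \<delta> where "\<delta> = e / (2 * (m + 1))"
  have m: "0 \<le> m" by (simp add: m_def)
  have \<delta>: "0 < \<delta>" "m * \<delta> \<le> e / 2" using e m by (auto simp: \<delta>_def field_simps)
  obtain h where h: "real_polynomial_function h" "\<And>t. t \<in> {0..T} \<Longrightarrow> \<bar>g t - h t\<bar> < \<delta>"
    using Stone_Weierstrass_real_polynomial_function[OF compact_Icc gc \<delta>(1)] by blast
  have hc: "continuous_on {0..T} h"
    using continuous_real_polymonial_function[OF h(1)] by (simp add: continuous_at_imp_continuous_on)
  have gi: "integrable ?M g" and hi: "integrable ?M h" by (rule integrable_continuous_time[OF gc], rule integrable_continuous_time[OF hc])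
  have c: "integrable ?M (\<lambda>t. \<delta>)" by (rule finite_measure.integrable_const[OF fin])
  have "\<bar>\<bar>h t\<bar> - k t\<bar> \<le> \<delta> + \<bar>g t - k t\<bar>" if "t \<in> {0<..<T}" for t
    using h(2)[of t] k0[OF that] that by simp
  then have "(LINT t|?M. \<bar>\<bar>h t\<bar> - k t\<bar>) \<le> (LINT t|?M. \<delta> + \<bar>g t - k t\<bar>)"
    using gi hi k c by (intro integral_mono) auto
  also have "\<dots> = (LINT t|?M. \<delta>) + (LINT t|?M. \<bar>g t - k t\<bar>)"
    by (rule Bochner_Integration.integral_add) (use gi k c in auto)
  also have "\<dots> < e" using g(2) \<delta>(2) by (simp add: m_def)
  finally have "(LINT t|?M. \<bar>A * \<bar>(1 / A) * h t\<bar> - k t\<bar>) < e" using A by (simp add: abs_mult)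
  then show ?thesis
    by (intro that[of "\<lambda>t. (1 / A) * h t"] real_polynomial_function.intros(2,4) h(1))
qed

lemma uniform_limit_scaleR_const:
  assumes "(a \<longlongrightarrow> a0) F" "\<And>x. norm (f x) \<le> B"
  shows "uniform_limit UNIV (\<lambda>\<tau> x. a \<tau> *\<^sub>R f x) (\<lambda>x. (a0 :: real) *\<^sub>R f x) F"
  unfolding uniform_limit_iff
proof (intro allI impI)
  fix e :: real assume e: "e > 0"
  have B: "0 \<le> B" using norm_ge_zero order.trans assms(2) by blast
  then have "e / (B + 1) > 0" using e by simp
  from tendstoD[OF assms(1) this] show "\<forall>\<^sub>F \<tau> in F. \<forall>x\<in>UNIV. dist (a \<tau> *\<^sub>R f x) (a0 *\<^sub>R f x) < e"
  proof eventually_elim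
    case (elim \<tau>)
    show ?case
    proof
      fix x
      have "dist (a \<tau> *\<^sub>R f x) (a0 *\<^sub>R f x) = \<bar>a \<tau> - a0\<bar> * norm (f x)"
        by (simp add: dist_norm scaleR_diff_left[symmetric])
      also have "\<dots> \<le> \<bar>a \<tau> - a0\<bar> * (B + 1)"
        using assms(2)[of x] by (intro mult_left_mono) auto
      also have "\<dots> < (e / (B + 1)) * (B + 1)"
        using elim B by (intro mult_strict_right_mono) (auto simp: dist_real_def)
      also have "\<dots> = e" using B by simp
      finally show "dist (a \<tau> *\<^sub>R f x) (a0 *\<^sub>R f x) < e" .
    qed
  qed
qed

lemma C1_separated:
  assumes w: "w \<in> Cc_inf_sigma \<Omega>" and h: "\<And>t. (h has_real_derivative h' t) (at t)" "continuous_on UNIV h'"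
  shows "(\<lambda>t x. h t *\<^sub>R w x) \<in> C1_Cc_inf_sigma I \<Omega>"
proof -
  have wc: "w \<in> Cc_inf \<Omega>" by (rule Cc_inf_sigma_Cc_inf[OF w])
  obtain C where C: "compact C" "C \<subseteq> \<Omega>" "\<And>x. x \<notin> C \<Longrightarrow> w x = 0" using Cc_infE[OF wc] by metis
  have sw: "smooth_fun w" by (rule Cc_inf_smooth[OF wc])
  have iter: "iter_partial js w \<in> Cc_inf \<Omega>" for js by (induct js) (simp_all add: wc Cc_inf_partial)
  show ?thesis
    unfolding C1_Cc_inf_sigma_def mem_Collect_eq
  proof (intro exI[of _ "\<lambda>t x. h' t *\<^sub>R w x"] exI[of _ C] conjI ballI allI impI)
    show "compact C" "C \<subseteq> \<Omega>" by (fact C)+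
    show "(\<lambda>x. h t *\<^sub>R w x) \<in> Cc_inf_sigma \<Omega>" "(\<lambda>x. h' t *\<^sub>R w x) \<in> Cc_inf_sigma \<Omega>" for t
      by (rule Cc_inf_sigma_scaleR[OF w])+
    show "h t *\<^sub>R w x = 0" "h' t *\<^sub>R w x = 0" if "x \<notin> C" for t x using C(3)[OF that] by simp_all
    fix t js
    obtain B where B: "\<And>x. norm (iter_partial js w x) \<le> B" using Cc_inf_bounded[OF iter] by blast
    have "((\<lambda>\<tau>. (1 / (\<tau> - t)) *\<^sub>R (h \<tau> - h t)) \<longlongrightarrow> h' t) (at t within I)"
      using has_field_derivative_at_within[OF h(1)]
      by (simp only: has_real_derivative_iff_has_vector_derivative has_vector_derivative_iff_quotient)
    from uniform_limit_scaleR_const[OF this B]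
    show "uniform_limit UNIV (\<lambda>\<tau>. iter_partial js (\<lambda>x. (1 / (\<tau> - t)) *\<^sub>R (h \<tau> *\<^sub>R w x - h t *\<^sub>R w x)))
          (iter_partial js (\<lambda>x. h' t *\<^sub>R w x)) (at t within I)"
      by (simp only: scaleR_diff_left[symmetric] scaleR_scaleR iter_partial_scaleR[OF sw] real_scaleR_def)
    have "(h' \<longlongrightarrow> h' t) (at t within I)"
      using continuous_on_subset[OF h(2), of "insert t I"] by (auto simp: continuous_on_def intro: tendsto_within_subset)
    from uniform_limit_scaleR_const[OF this B]
    show "uniform_limit UNIV (\<lambda>\<tau>. iter_partial js (\<lambda>x. h' \<tau> *\<^sub>R w x)) (iter_partial js (\<lambda>x. h' t *\<^sub>R w x)) (at t within I)"
      by (simp only: iter_partial_scaleR[OF sw])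
  qed
qed

lemma norm_matrix_vector_le: "norm (A *v z) \<le> norm (A :: real ^ 'n ^ 'n) * norm z"
proof (cases "A *v z = 0")
  case False
  have "norm (A *v z) * norm (A *v z) = A \<bullet> outer (A *v z) z"
    by (simp add: inner_outer power2_norm_eq_inner[symmetric] power2_eq_square)
  also have "\<dots> \<le> norm A * norm (outer (A *v z) z)" by (rule norm_cauchy_schwarz)
  also have "\<dots> = (norm A * norm z) * norm (A *v z)" by (simp add: norm_outer)
  finally show ?thesis using False by simp
qed simp

lemma inner_sym_part: "z \<bullet> (sym_part A *v z) = z \<bullet> (A *v z)"
proof -
  have "z \<bullet> (transpose A *v z) = z \<bullet> (A *v z)"
    by (simp add: transpose_matrix_vector dot_lmul_matrix[symmetric] inner_commute)
  then show ?thesis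
    by (simp add: sym_part_def scaleR_matrix_vector_assoc[symmetric] matrix_vector_mult_add_rdistrib inner_add_right)
qed

text \<open>Fields of finite weight are test fields up to null sets, so that the relative form can
  be evaluated with classical derivatives. The factor 2 compensates the factor \<open>1 / 2\<close>
  in the relative energy.\<close>

definition smooth_weight :: "(real ^ 'n) set \<Rightarrow> (real ^ 'n \<Rightarrow> real ^ 'n) \<Rightarrow> ennreal" where
  "smooth_weight \<Omega> u =
    (if \<exists>w\<in>Cc_inf_sigma \<Omega>. AE x in lebesgue_on \<Omega>. u x = w x then ennreal (2 * W1inf_norm \<Omega> u) else \<infinity>)"

context bounded_open begin

lemma grad_norm_bounds:
  assumes "w \<in> Cc_inf \<Omega>"
  shows "L2_norm \<Omega> (grad w) \<le> H1_norm \<Omega> w" "AE x in lebesgue_on \<Omega>. norm (grad w x) \<le> W1inf_norm \<Omega> w"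
proof -
  show "L2_norm \<Omega> (grad w) \<le> H1_norm \<Omega> w"
    using H1_norm_bounds(2)[OF Cc_inf_H1[OF assms]] L2_norm_cong_AE[OF wgrad_smooth[OF assms]] by simp
  show "AE x in lebesgue_on \<Omega>. norm (grad w x) \<le> W1inf_norm \<Omega> w"
    using W1inf_norm_AE[OF Cc_inf_W1inf[OF assms]] wgrad_smooth[OF assms] by eventually_elim simp
qed

lemma grad_mult_norm:
  assumes w: "w \<in> Cc_inf \<Omega>" and u: "u \<in> L2 \<Omega>"
  shows "L2_norm \<Omega> (\<lambda>x. grad w x *v u x) \<le> W1inf_norm \<Omega> w * L2_norm \<Omega> u"
proof (rule L2_norm_le_mult[OF grad_mult_L2(1)[OF w u] u])
  show "AE x in lebesgue_on \<Omega>. norm (grad w x *v u x) \<le> W1inf_norm \<Omega> w * norm (u x)"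
    using grad_norm_bounds(2)[OF w]
  proof eventually_elim
    case (elim x)
    show ?case
      using norm_matrix_vector_le[of "grad w x" "u x"] mult_right_mono[OF elim norm_ge_zero[of "u x"]] by linarith
  qed
qed (rule W1inf_norm_nonneg[OF Cc_inf_W1inf[OF w]])

text \<open>Of the quadratic terms in the relative form, this one has no sign; the weight is chosen
  to absorb it.\<close>

lemma stretching_bound:
  assumes w: "w \<in> Cc_inf \<Omega>" and u: "u \<in> L2 \<Omega>"
  shows "\<bar>L2_inner \<Omega> (\<lambda>x. grad w x *v u x) u\<bar> \<le> W1inf_norm \<Omega> w * (L2_norm \<Omega> u)\<^sup>2"
proof -
  have "\<bar>L2_inner \<Omega> (\<lambda>x. grad w x *v u x) u\<bar> \<le> L2_norm \<Omega> (\<lambda>x. grad w x *v u x) * L2_norm \<Omega> u"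
    by (rule L2_Cauchy_Schwarz[OF grad_mult_L2(1)[OF w u] u])
  also have "\<dots> \<le> W1inf_norm \<Omega> w * L2_norm \<Omega> u * L2_norm \<Omega> u"
    by (rule mult_right_mono[OF grad_mult_norm[OF w u]]) simp
  finally show ?thesis by (simp add: power2_eq_square mult.assoc)
qed

text \<open>For test fields \<open>w\<close> the two cases of \<^const>\<open>rel_form\<close> have
  a common expression: if \<open>\<nu> > 0\<close>, antisymmetry of the convective term turns
  \<open>- ((z \<cdot> \<nabla>) z, w)\<close> into \<open>((z \<cdot> \<nabla>) w, z)\<close>, and
  if \<open>\<nu> = 0\<close>, the quadratic form of a matrix sees only its symmetric part.\<close>

lemma rel_form_smooth:
  assumes \<nu>: "0 \<le> \<nu>" and u: "u \<in> L2_sigma \<Omega>" "0 < \<nu> \<Longrightarrow> u \<in> H1 \<Omega>" and w: "w \<in> Cc_inf_sigma \<Omega>"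
  defines "z \<equiv> (\<lambda>x. u x - w x)"
  shows "rel_form \<nu> \<Omega> K u w = \<nu> * (L2_norm \<Omega> (\<lambda>x. wgrad \<Omega> u x - wgrad \<Omega> w x))\<^sup>2
      + L2_inner \<Omega> (\<lambda>x. grad w x *v z x) z + enn2real (K w) * rel_energy \<Omega> u w"
proof (cases "0 < \<nu>")
  case True
  note wc = Cc_inf_sigma_Cc_inf[OF w]
  have zs: "z \<in> L2_sigma \<Omega>" unfolding z_def by (rule L2_sigma_diff[OF u(1) Cc_inf_sigma_L2_sigma[OF w]])
  have zH: "z \<in> H1 \<Omega>" unfolding z_def by (rule H1_diff[OF u(2)[OF True] Cc_inf_H1[OF wc]])
  have "L2_inner \<Omega> (conv \<Omega> z z) w = - L2_inner \<Omega> (\<lambda>x. grad w x *v z x) z"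
    using convective_antisym[OF zs zH wc] by (simp add: conv_def[abs_def])
  then show ?thesis using True by (simp add: rel_form_def z_def)
next
  case False
  have "L2_inner \<Omega> z (\<lambda>x. sym_part (wgrad \<Omega> w x) *v z x) = L2_inner \<Omega> z (\<lambda>x. wgrad \<Omega> w x *v z x)"
    unfolding L2_inner_def inner_sym_part ..
  also have "\<dots> = L2_inner \<Omega> z (\<lambda>x. grad w x *v z x)"
  proof (rule L2_inner_cong_AE)
    show "AE x in lebesgue_on \<Omega>. wgrad \<Omega> w x *v z x = grad w x *v z x"
      using wgrad_smooth[OF Cc_inf_sigma_Cc_inf[OF w]] by eventually_elim simp
  qed simp
  also have "\<dots> = L2_inner \<Omega> (\<lambda>x. grad w x *v z x) z" by (rule L2_inner_commute)
  finally show ?thesis using False \<nu> by (simp add: rel_form_def z_def)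
qed

lemma rel_form_cong_AE:
  assumes ae: "AE x in lebesgue_on \<Omega>. w x = w' x" and K: "K w = K w'"
  shows "rel_form \<nu> \<Omega> K u w = rel_form \<nu> \<Omega> K u w'"
proof -
  have d: "AE x in lebesgue_on \<Omega>. u x - w x = u x - w' x" using ae by eventually_elim simp
  have g: "wgrad \<Omega> w = wgrad \<Omega> w'" "wgrad \<Omega> (\<lambda>x. u x - w x) = wgrad \<Omega> (\<lambda>x. u x - w' x)"
    by (rule ext, simp only: wgrad_def wpartial_cong_AE[OF ae], rule ext, simp only: wgrad_def wpartial_cong_AE[OF d])
  have "L2_inner \<Omega> (conv \<Omega> (\<lambda>x. u x - w x) (\<lambda>x. u x - w x)) w = L2_inner \<Omega> (conv \<Omega> (\<lambda>x. u x - w' x) (\<lambda>x. u x - w' x)) w'"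
    by (rule L2_inner_cong_AE[OF _ ae]) (use d in \<open>eventually_elim, simp add: conv_def g\<close>)
  moreover have "L2_inner \<Omega> (\<lambda>x. u x - w x) (\<lambda>x. sym_part (wgrad \<Omega> w x) *v (u x - w x))
      = L2_inner \<Omega> (\<lambda>x. u x - w' x) (\<lambda>x. sym_part (wgrad \<Omega> w' x) *v (u x - w' x))"
    by (rule L2_inner_cong_AE[OF d]) (use d in \<open>eventually_elim, simp add: g\<close>)
  ultimately show ?thesis
    by (simp add: rel_form_def rel_energy_def g K L2_norm_cong_AE[OF d])
qed

lemma smooth_weight_smooth:
  "w \<in> Cc_inf_sigma \<Omega> \<Longrightarrow> smooth_weight \<Omega> w = ennreal (2 * W1inf_norm \<Omega> w)"
  unfolding smooth_weight_def by (auto intro: bexI[of _ w])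

lemma smooth_weight_cong_AE:
  assumes "AE x in lebesgue_on \<Omega>. u x = w x"
  shows "smooth_weight \<Omega> u = smooth_weight \<Omega> w"
proof -
  have "(AE x in lebesgue_on \<Omega>. u x = z x) = (AE x in lebesgue_on \<Omega>. w x = z x)" for z
  proof
    assume "AE x in lebesgue_on \<Omega>. u x = z x"
    with assms show "AE x in lebesgue_on \<Omega>. w x = z x" by eventually_elim simp
  next
    assume "AE x in lebesgue_on \<Omega>. w x = z x"
    with assms show "AE x in lebesgue_on \<Omega>. u x = z x" by eventually_elim simp
  qed
  then show ?thesis by (simp add: smooth_weight_def W1inf_norm_cong_AE[OF assms])
qed

lemma smooth_weight_finite:
  assumes "smooth_weight \<Omega> u \<noteq> \<infinity>"
  obtains w where "w \<in> Cc_inf_sigma \<Omega>" "AE x in lebesgue_on \<Omega>. u x = w x"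
  using assms unfolding smooth_weight_def by (metis (mono_tags))

lemma XX_H10_sigma:
  assumes v: "v \<in> XX \<nu> T \<Omega>"
  shows "AE t in lebesgue_on {0<..<T}. 0 < \<nu> \<longrightarrow> v t \<in> H10_sigma \<Omega>"
proof (cases "0 < \<nu>")
  case True
  then have "bochner_measurable T (H10_sigma \<Omega>) (H1_norm \<Omega>) v" using v by (simp add: XX_def Lp_time_def)
  from bochner_measurable_AE[OF this] show ?thesis by eventually_elim simp
qed simp

lemma DK_integrable:
  assumes "u \<in> DK \<nu> T \<Omega> K"
  shows "integrable (lebesgue_on {0<..<T}) (\<lambda>t. enn2real (K (u t)))"
    and "AE t in lebesgue_on {0<..<T}. K (u t) \<noteq> \<infinity>"
proof -
  let ?M = "lebesgue_on {0<..<T}"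
  have m: "(\<lambda>t. K (u t)) \<in> borel_measurable ?M" and f: "(\<integral>\<^sup>+ t. K (u t) \<partial>?M) < \<infinity>"
    using assms by (simp_all add: DK_def)
  then show ae: "AE t in ?M. K (u t) \<noteq> \<infinity>" by (intro nn_integral_PInf_AE) auto
  show "integrable ?M (\<lambda>t. enn2real (K (u t)))"
  proof (rule integrableI_bounded)
    show "(\<lambda>t. enn2real (K (u t))) \<in> borel_measurable ?M" using m by measurable
    have "(\<integral>\<^sup>+ t. ennreal (norm (enn2real (K (u t)))) \<partial>?M) = (\<integral>\<^sup>+ t. K (u t) \<partial>?M)"
    proof (rule nn_integral_cong_AE)
      show "AE t in ?M. ennreal (norm (enn2real (K (u t)))) = K (u t)"
        using ae by eventually_elim (simp add: less_top)
    qed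
    then show "(\<integral>\<^sup>+ t. ennreal (norm (enn2real (K (u t)))) \<partial>?M) < \<infinity>" using f by simp
  qed
qed

lemma C1_curve_DK:
  assumes \<phi>: "C1_curve T \<Omega> \<phi> \<phi>'"
  shows "\<phi> \<in> DK \<nu> T \<Omega> (smooth_weight \<Omega>)"
proof -
  let ?M = "lebesgue_on {0<..<T}"
  define g where "g t = 2 * W1inf_norm \<Omega> (\<phi> t)" for t
  have "continuous_on {0..T} (\<lambda>t. W1inf_norm \<Omega> (\<phi> t))"
    by (rule continuous_on_timeI[OF smooth_curve_W1inf(2)[OF C1_curve_smooth_curve(1)[OF \<phi>]]])
  then have gc: "continuous_on {0..T} g" unfolding g_def by (intro continuous_intros)
  have eq: "smooth_weight \<Omega> (\<phi> t) = ennreal (g t)" if "t \<in> {0<..<T}" for t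
    unfolding g_def by (rule smooth_weight_smooth[OF C1_curveD(1)[OF \<phi>]]) (use that in simp)
  have gi: "integrable ?M g" by (rule integrable_continuous_time[OF gc])
  have "(\<lambda>t. ennreal (g t)) \<in> borel_measurable ?M" using borel_measurable_integrable[OF gi] by measurable
  then have 1: "(\<lambda>t. smooth_weight \<Omega> (\<phi> t)) \<in> borel_measurable ?M"
    by (subst measurable_cong[where g="\<lambda>t. ennreal (g t)"]) (simp_all add: eq)
  have "(\<integral>\<^sup>+ t. smooth_weight \<Omega> (\<phi> t) \<partial>?M) \<le> (\<integral>\<^sup>+ t. ennreal (norm (g t)) \<partial>?M)"
    by (rule nn_integral_mono) (simp add: eq ennreal_leI)
  also have "\<dots> < \<infinity>" using gi by (simp add: integrable_iff_bounded)
  finally show ?thesis using 1 C1_curve_XX[OF \<phi>] by (simp add: DK_def)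
qed

text \<open>The topology is that of the pseudometric \<open>d u w\<close>, the
  \<open>L\<^sup>1\<close> distance of the weights of \<open>u\<close> and \<open>w\<close>, for
  which \<open>K\<close> is continuous by construction. Since it sees nothing of a field but its
  weight as a function of time, density follows from the approximation of nonnegative integrable
  functions by the weights of separated fields \<open>h t *\<^sub>R w\<close>.\<close>

lemma weight_form_smooth_weight: "weight_form \<nu> T \<Omega> (smooth_weight \<Omega>)"
proof -
  let ?K = "smooth_weight \<Omega>"
  let ?M = "lebesgue_on {0<..<T}"
  let ?D = "DK \<nu> T \<Omega> ?K"
  let ?S = "C1_Cc_inf_sigma {0..T} \<Omega>"
  define d where "d u w = (LINT t|?M. \<bar>enn2real (?K (w t)) - enn2real (?K (u t))\<bar>)" for u w :: "real \<Rightarrow> real ^ 'n \<Rightarrow> real ^ 'n"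
  have tri: "d u z \<le> d u w + d w z" if "u \<in> ?D" "w \<in> ?D" "z \<in> ?D" for u w z
  proof -
    note i = DK_integrable(1)[OF that(1)] DK_integrable(1)[OF that(2)] DK_integrable(1)[OF that(3)]
    have "d u z \<le> (LINT t|?M. \<bar>enn2real (?K (w t)) - enn2real (?K (u t))\<bar> + \<bar>enn2real (?K (z t)) - enn2real (?K (w t))\<bar>)"
      unfolding d_def by (rule integral_mono) (use i in auto)
    also have "\<dots> = d u w + d w z"
      unfolding d_def by (rule Bochner_Integration.integral_add) (use i in auto)
    finally show ?thesis .
  qed
  define op where "op V \<longleftrightarrow> V \<subseteq> ?D \<and> (\<forall>u\<in>V. \<exists>e>0. \<forall>w\<in>?D. d u w < e \<longrightarrow> w \<in> V)" for V
  have "istopology op"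
    unfolding istopology_def
  proof (intro conjI allI impI)
    fix S R assume "op S" "op R"
    show "op (S \<inter> R)"
      unfolding op_def
    proof (intro conjI ballI)
      show "S \<inter> R \<subseteq> ?D" using \<open>op S\<close> unfolding op_def by blast
      fix u assume u: "u \<in> S \<inter> R"
      obtain e1 where e1: "e1 > 0" "\<forall>w\<in>?D. d u w < e1 \<longrightarrow> w \<in> S" using \<open>op S\<close> u unfolding op_def by blast
      obtain e2 where e2: "e2 > 0" "\<forall>w\<in>?D. d u w < e2 \<longrightarrow> w \<in> R" using \<open>op R\<close> u unfolding op_def by blast
      show "\<exists>e>0. \<forall>w\<in>?D. d u w < e \<longrightarrow> w \<in> S \<inter> R"
        using e1 e2 by (intro exI[of _ "min e1 e2"]) simp
    qed
  next
    fix \<K> assume K: "\<forall>S\<in>\<K>. op S"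
    show "op (\<Union>\<K>)"
      unfolding op_def
    proof (intro conjI ballI)
      show "\<Union>\<K> \<subseteq> ?D" using K unfolding op_def by blast
      fix u assume "u \<in> \<Union>\<K>"
      then obtain S where S: "S \<in> \<K>" "u \<in> S" by blast
      then obtain e where "e > 0" "\<forall>w\<in>?D. d u w < e \<longrightarrow> w \<in> S" using K unfolding op_def by blast
      then show "\<exists>e>0. \<forall>w\<in>?D. d u w < e \<longrightarrow> w \<in> \<Union>\<K>" using S(1) by blast
    qed
  qed
  then have op: "openin (topology op) V \<longleftrightarrow> op V" for V by simp
  have "op ?D" unfolding op_def by (auto intro: exI[of _ 1])
  then have ts: "topspace (topology op) = ?D"
    unfolding topspace_def op using op_def by (intro equalityI) blast+
  have sub: "?S \<subseteq> ?D"
  proof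
    fix \<phi> assume "\<phi> \<in> ?S"
    then obtain \<phi>' where "C1_curve T \<Omega> \<phi> \<phi>'" by (rule C1_curve_of_C1)
    then show "\<phi> \<in> ?D" by (rule C1_curve_DK)
  qed
  have dense: "\<exists>\<phi>\<in>?S. d u \<phi> < e" if u: "u \<in> ?D" and e: "e > 0" for u e
  proof (cases "\<exists>w\<in>Cc_inf_sigma \<Omega>. W1inf_norm \<Omega> w \<noteq> 0")
    case True
    then obtain w where w: "w \<in> Cc_inf_sigma \<Omega>" "W1inf_norm \<Omega> w \<noteq> 0" by blast
    note wc = Cc_inf_sigma_Cc_inf[OF w(1)]
    have "0 < W1inf_norm \<Omega> w" using w(2) W1inf_norm_nonneg[OF Cc_inf_W1inf[OF wc]] by linarith
    then have A: "0 < 2 * W1inf_norm \<Omega> w" (is "0 < ?A") by simp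
    obtain h where h: "real_polynomial_function h"
      "(LINT t|?M. \<bar>?A * \<bar>h t\<bar> - enn2real (?K (u t))\<bar>) < e"
      using polynomial_modulus_dense_L1[OF DK_integrable(1)[OF u] enn2real_nonneg e A] by blast
    obtain h' where h': "real_polynomial_function h'" "\<And>x. (h has_real_derivative h' x) (at x)"
      using has_real_derivative_polynomial_function[OF h(1)] by blast
    have "continuous_on UNIV h'"
      using continuous_real_polymonial_function[OF h'(1)] by (simp add: continuous_at_imp_continuous_on)
    then have S: "(\<lambda>t x. h t *\<^sub>R w x) \<in> ?S" by (rule C1_separated[OF w(1) h'(2)])
    have "enn2real (?K (\<lambda>x. h t *\<^sub>R w x)) = ?A * \<bar>h t\<bar>" for t
    proof -
      have "?K (\<lambda>x. h t *\<^sub>R w x) = ennreal (2 * (\<bar>h t\<bar> * W1inf_norm \<Omega> w))"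
        by (simp only: smooth_weight_smooth[OF Cc_inf_sigma_scaleR[OF w(1)]] W1inf_norm_scaleR[OF wc])
      then show ?thesis using \<open>0 < W1inf_norm \<Omega> w\<close> by simp
    qed
    then have "d u (\<lambda>t x. h t *\<^sub>R w x) < e" unfolding d_def using h(2) by simp
    then show ?thesis using S by (rule bexI[where x="\<lambda>t x. h t *\<^sub>R w x"])
  next
    \<comment> \<open>All test fields have weight zero here, so the zero curve is at distance zero from u.\<close>
    case False
    have z: "(\<lambda>t x. 0) \<in> ?S"
      using C1_separated[OF Cc_inf_sigma_zero, of "\<lambda>t. 0" "\<lambda>t. 0"] by simp
    have "AE t in ?M. \<bar>enn2real (?K (\<lambda>x. 0)) - enn2real (?K (u t))\<bar> = 0"
      using DK_integrable(2)[OF u]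
    proof eventually_elim
      case (elim t)
      obtain w where w: "w \<in> Cc_inf_sigma \<Omega>" "AE x in lebesgue_on \<Omega>. u t x = w x"
        by (rule smooth_weight_finite[OF elim])
      then have "?K (u t) = 0" using False by (simp add: smooth_weight_cong_AE[OF w(2)] smooth_weight_smooth)
      moreover have "?K (\<lambda>x. 0) = 0" using smooth_weight_smooth[OF Cc_inf_sigma_zero] by simp
      ultimately show ?case by simp
    qed
    then have "d u (\<lambda>t x. 0) = (LINT t|?M. 0)" unfolding d_def by (intro integral_AE_cong_lebesgue_on) simp_all
    then have "d u (\<lambda>t x. 0) < e" using e by simp
    then show ?thesis using z by (rule bexI[where x="\<lambda>t x. 0"])
  qed
  show ?thesis
    unfolding weight_form_def
  proof (intro conjI ballI impI exI[of _ "topology op"] allI)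
    show "?K u = ?K w" if "AE x in lebesgue_on \<Omega>. u x = w x" for u w by (rule smooth_weight_cong_AE[OF that])
    show "?K (\<lambda>x. 0) = 0" using smooth_weight_smooth[OF Cc_inf_sigma_zero] by simp
    show "topspace (topology op) = ?D" by (rule ts)
    show "?S \<subseteq> topspace (topology op)" unfolding ts by (rule sub)
    show "(topology op) closure_of ?S = topspace (topology op)"
      unfolding ts
    proof (intro equalityI subsetI)
      fix u assume "u \<in> (topology op) closure_of ?S"
      then show "u \<in> ?D" using closure_of_subset_topspace[of "topology op" ?S] unfolding ts by blast
    next
      fix u assume u: "u \<in> ?D"
      show "u \<in> (topology op) closure_of ?S"
        unfolding in_closure_of ts
      proof (rule conjI[OF u], intro allI impI, elim conjE)
        fix V assume "u \<in> V" "openin (topology op) V"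
        then obtain e where e: "e > 0" "\<forall>w\<in>?D. d u w < e \<longrightarrow> w \<in> V" unfolding op op_def by blast
        from dense[OF u e(1)] obtain \<phi> where "\<phi> \<in> ?S" "d u \<phi> < e" by blast
        then show "\<exists>y. y \<in> ?S \<and> y \<in> V" using e(2) sub by blast
      qed
    qed
    fix u and e :: real assume "u \<in> topspace (topology op)" and e: "e > 0"
    then have u: "u \<in> ?D" unfolding ts by blast
    define V where "V = {w \<in> ?D. d u w < e}"
    have "op V"
      unfolding op_def
    proof (intro conjI ballI)
      show "V \<subseteq> ?D" unfolding V_def by blast
      fix w assume "w \<in> V"
      then have w: "w \<in> ?D" "d u w < e" unfolding V_def by blast+
      have "z \<in> V" if "z \<in> ?D" "d w z < e - d u w" for z
        using tri[OF u w(1) that(1)] that unfolding V_def by simp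
      then show "\<exists>e>0. \<forall>z\<in>?D. d w z < e \<longrightarrow> z \<in> V" using w(2) by (intro exI[of _ "e - d u w"]) simp
    qed
    moreover have "u \<in> V" unfolding V_def using u e by (simp add: d_def)
    moreover have "(LINT t|?M. \<bar>enn2real (?K (w t)) - enn2real (?K (u t))\<bar>) < e" if "w \<in> V" for w
      using that unfolding V_def d_def by blast
    ultimately show "\<exists>V. openin (topology op) V \<and> u \<in> V \<and>
           (\<forall>w\<in>V. (LINT t|?M. \<bar>enn2real (?K (w t)) - enn2real (?K (u t))\<bar>) < e)"
      unfolding op by blast
  qed
qed

lemma rel_form_nonneg:
  assumes \<nu>: "0 \<le> \<nu>" and u: "u \<in> L2_sigma \<Omega>" "0 < \<nu> \<Longrightarrow> u \<in> H1 \<Omega>" and fin: "smooth_weight \<Omega> w \<noteq> \<infinity>"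
  shows "0 \<le> rel_form \<nu> \<Omega> (smooth_weight \<Omega>) u w"
proof -
  obtain w' where w': "w' \<in> Cc_inf_sigma \<Omega>" and ae: "AE x in lebesgue_on \<Omega>. w x = w' x"
    by (rule smooth_weight_finite[OF fin])
  note wc = Cc_inf_sigma_Cc_inf[OF w']
  define z where "z = (\<lambda>x. u x - w' x)"
  have z: "z \<in> L2 \<Omega>"
    unfolding z_def by (rule L2_diff[OF L2_sigma_L2[OF u(1)] L2_sigma_L2[OF Cc_inf_sigma_L2_sigma[OF w']]])
  have K: "enn2real (smooth_weight \<Omega> w') * rel_energy \<Omega> u w' = W1inf_norm \<Omega> w' * (L2_norm \<Omega> z)\<^sup>2"
    using W1inf_norm_nonneg[OF Cc_inf_W1inf[OF wc]]
    by (simp add: smooth_weight_smooth[OF w'] rel_energy_def z_def)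
  have "rel_form \<nu> \<Omega> (smooth_weight \<Omega>) u w' = \<nu> * (L2_norm \<Omega> (\<lambda>x. wgrad \<Omega> u x - wgrad \<Omega> w' x))\<^sup>2
      + L2_inner \<Omega> (\<lambda>x. grad w' x *v z x) z + W1inf_norm \<Omega> w' * (L2_norm \<Omega> z)\<^sup>2"
    using rel_form_smooth[OF \<nu> u w', of "smooth_weight \<Omega>"] unfolding K z_def .
  moreover have "0 \<le> \<nu> * (L2_norm \<Omega> (\<lambda>x. wgrad \<Omega> u x - wgrad \<Omega> w' x))\<^sup>2" using \<nu> by simp
  ultimately have "0 \<le> rel_form \<nu> \<Omega> (smooth_weight \<Omega>) u w'" using stretching_bound[OF wc z] by linarith
  then show ?thesis unfolding rel_form_cong_AE[OF ae smooth_weight_cong_AE[OF ae]] .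
qed

lemma smooth_weight_admissible:
  assumes \<nu>: "0 \<le> \<nu>"
  shows "admissible \<nu> T \<Omega> (smooth_weight \<Omega>)"
  unfolding admissible_def
proof (intro conjI ballI)
  show "weight_form \<nu> T \<Omega> (smooth_weight \<Omega>)" by (rule weight_form_smooth_weight)
  fix v vt assume v: "v \<in> XX \<nu> T \<Omega>" and vt: "vt \<in> YY \<nu> T \<Omega> \<inter> DK \<nu> T \<Omega> (smooth_weight \<Omega>)"
  have fin: "AE t in lebesgue_on {0<..<T}. smooth_weight \<Omega> (vt t) \<noteq> \<infinity>"
    using vt by (intro DK_integrable(2)[of vt \<nu>]) blast
  show "AE t in lebesgue_on {0<..<T}. 0 \<le> rel_form \<nu> \<Omega> (smooth_weight \<Omega>) (v t) (vt t)"
    using fin bochner_measurable_AE[OF XX_bochner[OF v]] XX_H10_sigma[OF v]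
  proof eventually_elim
    case (elim t)
    show ?case by (rule rel_form_nonneg[OF \<nu> elim(2) _ elim(1)]) (use elim(3) H10_sigma_H1 in blast)
  qed
qed

end


section \<open>Essential one-sided limits\<close>

lemma AE_lebesgueE:
  assumes "AE x in lebesgue. P x"
  obtains Z where "Z \<in> null_sets lebesgue" "\<And>x. x \<notin> Z \<Longrightarrow> P x"
proof -
  obtain N where "N \<in> null_sets lebesgue" "{x \<in> space lebesgue. \<not> P x} \<subseteq> N"
    using assms unfolding eventually_ae_filter by blast
  then show ?thesis by (intro that[of N]) auto
qed

text \<open>A nonempty open set is not a null set.\<close>

lemma islimpt_minus_null:
  fixes J :: "real set"
  assumes J: "open J" and t: "t islimpt J" and N: "N \<in> null_sets lebesgue"
  shows "t islimpt (J - N)"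
  unfolding islimpt_def
proof (intro allI impI)
  fix U assume U: "t \<in> U" "open U"
  define W where "W = (U \<inter> J) - {t}"
  have oW: "open W" unfolding W_def using U(2) J by (intro open_Diff open_Int) auto
  obtain y where "y \<in> J" "y \<in> U" "y \<noteq> t" using t U unfolding islimpt_def by blast
  then have neW: "W \<noteq> {}" unfolding W_def by blast
  have "\<not> W \<subseteq> N"
  proof
    assume "W \<subseteq> N"
    moreover have "negligible N" using N by (simp add: negligible_iff_null_sets)
    ultimately have "negligible W" by (rule negligible_subset[rotated])
    then show False using open_not_negligible[OF oW neW] by blast
  qed
  then show "\<exists>y\<in>J - N. y \<in> U \<and> y \<noteq> t" unfolding W_def by blast
qed

text \<open>Bounds pass to an essential limit if they hold almost everywhere near the point, since
  removing a null set from an open set leaves its accumulation points.\<close>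

lemma ess_limit_bound:
  fixes g :: "real \<Rightarrow> real"
  assumes lim: "(g \<longlongrightarrow> l) (at t within (I - N'))" and N': "N' \<in> null_sets lebesgue"
    and J: "open J" "t islimpt J" "J \<subseteq> I" and N: "N \<in> null_sets lebesgue"
    and b: "\<And>\<sigma>. \<sigma> \<in> J - N \<Longrightarrow> \<bar>g \<sigma> - c\<bar> \<le> e"
  shows "\<bar>l - c\<bar> \<le> (e :: real)"
proof (rule tendsto_upperbound)
  let ?S = "J - (N \<union> N')"
  have "(g \<longlongrightarrow> l) (at t within ?S)" by (rule tendsto_within_subset[OF lim]) (use J(3) in blast)
  then show "((\<lambda>\<sigma>. \<bar>g \<sigma> - c\<bar>) \<longlongrightarrow> \<bar>l - c\<bar>) (at t within ?S)" by (intro tendsto_intros)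
  show "\<forall>\<^sub>F \<sigma> in at t within ?S. \<bar>g \<sigma> - c\<bar> \<le> e"
    using eventually_in_time[of ?S t] by eventually_elim (use b in blast)
  have "N \<union> N' \<in> null_sets lebesgue" using N N' by (rule null_sets.Un)
  from islimpt_minus_null[OF J(1,2) this] show "at t within ?S \<noteq> bot"
    by (simp add: trivial_limit_within)
qed

lemma islimpt_interval: "a < b \<Longrightarrow> a islimpt {a<..<b}" "a < b \<Longrightarrow> b islimpt {a<..<(b::real)}"
  by (simp_all add: islimpt_greaterThanLessThan1 islimpt_greaterThanLessThan2)

lemma right_lim_bound:
  assumes "right_lim T g t l" "t < b" "b \<le> T" "N \<in> null_sets lebesgue"
    and "\<And>\<sigma>. \<sigma> \<in> {t<..<b} - N \<Longrightarrow> \<bar>g \<sigma> - c\<bar> \<le> e"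
  shows "\<bar>l - c\<bar> \<le> e"
proof -
  have "ess_tendsto_on {t<..<T} g t l" using assms(1-3) by (simp add: right_lim_def)
  then obtain N' where N': "N' \<in> null_sets lebesgue" "(g \<longlongrightarrow> l) (at t within ({t<..<T} - N'))"
    unfolding ess_tendsto_on_def by blast
  show ?thesis
    by (rule ess_limit_bound[OF N'(2,1) _ islimpt_interval(1)[OF assms(2)] _ assms(4,5)]) (use assms(3) in auto)
qed

lemma left_lim_bound:
  assumes "left_lim T g t l" "a < t" "0 \<le> a" "N \<in> null_sets lebesgue"
    and "\<And>\<sigma>. \<sigma> \<in> {a<..<t} - N \<Longrightarrow> \<bar>g \<sigma> - c\<bar> \<le> e"
  shows "\<bar>l - c\<bar> \<le> e"
proof -
  have "ess_tendsto_on {0<..<t} g t l" using assms(1-3) by (simp add: left_lim_def)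
  then obtain N' where N': "N' \<in> null_sets lebesgue" "(g \<longlongrightarrow> l) (at t within ({0<..<t} - N'))"
    unfolding ess_tendsto_on_def by blast
  show ?thesis
    by (rule ess_limit_bound[OF N'(2,1) _ islimpt_interval(2)[OF assms(2)] _ assms(4,5)]) (use assms(3) in auto)
qed

lemma right_limD:
  assumes "right_lim T g t l" "t < T" "0 < e"
  obtains d N where "0 < d" "N \<in> null_sets lebesgue" "\<And>\<sigma>. \<sigma> \<in> {t<..<T} - N \<Longrightarrow> \<sigma> < t + d \<Longrightarrow> \<bar>g \<sigma> - l\<bar> < e"
proof -
  obtain N where N: "N \<in> null_sets lebesgue" "(g \<longlongrightarrow> l) (at t within ({t<..<T} - N))"
    using assms(1,2) unfolding right_lim_def ess_tendsto_on_def by auto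
  obtain d where d: "d > 0" "\<forall>x\<in>{t<..<T} - N. x \<noteq> t \<and> dist x t < d \<longrightarrow> dist (g x) l < e"
    using tendstoD[OF N(2) assms(3)] unfolding eventually_at by blast
  have "\<bar>g \<sigma> - l\<bar> < e" if "\<sigma> \<in> {t<..<T} - N" "\<sigma> < t + d" for \<sigma>
    using bspec[OF d(2) that(1)] that by (simp add: dist_real_def)
  with d(1) N(1) show ?thesis by (rule that)
qed

lemma left_limD:
  assumes "left_lim T g t l" "0 < t" "0 < e"
  obtains d N where "0 < d" "N \<in> null_sets lebesgue" "\<And>\<sigma>. \<sigma> \<in> {0<..<t} - N \<Longrightarrow> t - d < \<sigma> \<Longrightarrow> \<bar>g \<sigma> - l\<bar> < e"
proof -
  obtain N where N: "N \<in> null_sets lebesgue" "(g \<longlongrightarrow> l) (at t within ({0<..<t} - N))"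
    using assms(1,2) unfolding left_lim_def ess_tendsto_on_def by auto
  obtain d where d: "d > 0" "\<forall>x\<in>{0<..<t} - N. x \<noteq> t \<and> dist x t < d \<longrightarrow> dist (g x) l < e"
    using tendstoD[OF N(2) assms(3)] unfolding eventually_at by blast
  have "\<bar>g \<sigma> - l\<bar> < e" if "\<sigma> \<in> {0<..<t} - N" "t - d < \<sigma>" for \<sigma>
    using bspec[OF d(2) that(1)] that by (simp add: dist_real_def)
  with d(1) N(1) show ?thesis by (rule that)
qed

text \<open>Fix \<open>e > 0\<close>. Around every \<open>t\<close> there is an interval such that
  \<open>g\<close> is essentially \<open>e\<close>-close to \<open>gp t\<close> on its right half
  and to \<open>gm t\<close> on its left half. By Lindelof countably many of these intervals cover.
  Up to a null set every \<open>\<tau>\<close> lies strictly inside one of the halves, where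
  \<open>g \<tau>\<close> and both one-sided limits at \<open>\<tau>\<close> are
  \<open>e\<close>-close to the same number.\<close>

lemma one_sided_limits_AE:
  assumes lims: "\<And>t. t \<in> {0<..<T} \<Longrightarrow> right_lim T g t (gp t)" "\<And>t. t \<in> {0<..<T} \<Longrightarrow> left_lim T g t (gm t)"
  shows "AE t in lebesgue_on {0<..<T}. gp t = g t \<and> gm t = g t"
proof -
  have approx: "AE t in lebesgue. t \<in> {0<..<T} \<longrightarrow> \<bar>gp t - g t\<bar> \<le> 2 * e \<and> \<bar>gm t - g t\<bar> \<le> 2 * e" if e: "0 < e" for e
  proof -
    define P where "P t d N \<longleftrightarrow> 0 < d \<and> N \<in> null_sets lebesgue \<and>
        (\<forall>\<sigma>\<in>{t<..<T} - N. \<sigma> < t + d \<longrightarrow> \<bar>g \<sigma> - gp t\<bar> < e) \<and> (\<forall>\<sigma>\<in>{0<..<t} - N. t - d < \<sigma> \<longrightarrow> \<bar>g \<sigma> - gm t\<bar> < e)"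
      for t d N
    have "\<exists>d N. P t d N"
      if t: "t \<in> {0<..<T}" for t
    proof -
      obtain d1 N1 where 1: "0 < d1" "N1 \<in> null_sets lebesgue" "\<And>\<sigma>. \<sigma> \<in> {t<..<T} - N1 \<Longrightarrow> \<sigma> < t + d1 \<Longrightarrow> \<bar>g \<sigma> - gp t\<bar> < e"
        using right_limD[OF lims(1)[OF t] _ e] t by auto
      obtain d2 N2 where 2: "0 < d2" "N2 \<in> null_sets lebesgue" "\<And>\<sigma>. \<sigma> \<in> {0<..<t} - N2 \<Longrightarrow> t - d2 < \<sigma> \<Longrightarrow> \<bar>g \<sigma> - gm t\<bar> < e"
        using left_limD[OF lims(2)[OF t] _ e] t by auto
      show ?thesis
        unfolding P_def
      proof (intro exI[of _ "min d1 d2"] exI[of _ "N1 \<union> N2"] conjI ballI impI)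
        show "N1 \<union> N2 \<in> null_sets lebesgue" using 1(2) 2(2) by (rule null_sets.Un)
      qed (use 1 2 in auto)
    qed
    then have "\<forall>t\<in>{0<..<T}. \<exists>d N. P t d N" by blast
    from bchoice[OF this] obtain d where "\<forall>t\<in>{0<..<T}. \<exists>N. P t (d t) N" by (elim exE)
    from bchoice[OF this] obtain N where PN: "\<forall>t\<in>{0<..<T}. P t (d t) (N t)" by (elim exE)
    have dN: "0 < d t" "N t \<in> null_sets lebesgue"
      "\<And>\<sigma>. \<sigma> \<in> {t<..<T} - N t \<Longrightarrow> \<sigma> < t + d t \<Longrightarrow> \<bar>g \<sigma> - gp t\<bar> < e"
      "\<And>\<sigma>. \<sigma> \<in> {0<..<t} - N t \<Longrightarrow> t - d t < \<sigma> \<Longrightarrow> \<bar>g \<sigma> - gm t\<bar> < e"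
      if "t \<in> {0<..<T}" for t
      using bspec[OF PN that] unfolding P_def by blast+
    define \<F> where "\<F> = (\<lambda>t. {t - d t<..<t + d t}) ` {0<..<T}"
    have op: "open S" if "S \<in> \<F>" for S using that unfolding \<F>_def by auto
    obtain \<F>' where F': "\<F>' \<subseteq> \<F>" "countable \<F>'" "\<Union>\<F>' = \<Union>\<F>" by (rule Lindelof[of \<F>, OF op])
    obtain Q where Q: "countable Q" "Q \<subseteq> {0<..<T}" "\<F>' = (\<lambda>t. {t - d t<..<t + d t}) ` Q"
      using iffD1[OF countable_subset_image conjI[OF F'(2) F'(1)[unfolded \<F>_def]]] by (elim exE conjE)
    define Z where "Z = Q \<union> (\<Union>t\<in>Q. N t)"
    have "Q \<in> null_sets lebesgue" using Q(1) by (intro null_sets_completionI countable_imp_null_set_lborel)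
    moreover have "(\<Union>t\<in>Q. N t) \<in> null_sets lebesgue" using Q dN(2) by (intro null_sets_UN') auto
    ultimately have "Z \<in> null_sets lebesgue" unfolding Z_def by (rule null_sets.Un)
    then have "AE t in lebesgue. t \<notin> Z" by (rule AE_not_in)
    then show ?thesis
    proof eventually_elim
      case (elim \<tau>)
      show ?case
      proof
        assume \<tau>: "\<tau> \<in> {0<..<T}"
        have core: "\<bar>gp \<tau> - g \<tau>\<bar> \<le> 2 * e \<and> \<bar>gm \<tau> - g \<tau>\<bar> \<le> 2 * e"
          if "M \<in> null_sets lebesgue" "\<tau> \<notin> M" "a < \<tau>" "\<tau> < b" "0 \<le> a" "b \<le> T"
            "\<And>\<sigma>. \<sigma> \<in> {a<..<b} - M \<Longrightarrow> \<bar>g \<sigma> - c\<bar> < e" for M a b c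
        proof -
          have "\<bar>g \<tau> - c\<bar> < e" using that by simp
          moreover have "\<bar>gp \<tau> - c\<bar> \<le> e"
            by (rule right_lim_bound[OF lims(1)[OF \<tau>] that(4,6,1)], rule less_imp_le, rule that(7)) (use that(3) in auto)
          moreover have "\<bar>gm \<tau> - c\<bar> \<le> e"
            by (rule left_lim_bound[OF lims(2)[OF \<tau>] that(3,5,1)], rule less_imp_le, rule that(7)) (use that(4) in auto)
          ultimately show ?thesis by linarith
        qed
        have "\<tau> \<in> \<Union>\<F>" unfolding \<F>_def using \<tau> dN(1)[OF \<tau>] by (intro UN_I[of \<tau>]) auto
        then obtain t where t: "t \<in> Q" "\<tau> \<in> {t - d t<..<t + d t}"
          unfolding F'(3)[symmetric] Q(3) by blast
        have tT: "t \<in> {0<..<T}" using t(1) Q(2) by blast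
        have nt: "\<tau> \<noteq> t" "\<tau> \<notin> N t" using elim t(1) unfolding Z_def by blast+
        show "\<bar>gp \<tau> - g \<tau>\<bar> \<le> 2 * e \<and> \<bar>gm \<tau> - g \<tau>\<bar> \<le> 2 * e"
        proof (cases "t < \<tau>")
          case True
          show ?thesis
            by (rule core[OF dN(2)[OF tT] nt(2), of t "min T (t + d t)" "gp t"])
              (use True \<tau> t(2) tT dN(3)[OF tT] in auto)
        next
          case False
          show ?thesis
            by (rule core[OF dN(2)[OF tT] nt(2), of "max 0 (t - d t)" t "gm t"])
              (use False nt(1) \<tau> t(2) tT dN(4)[OF tT] in auto)
        qed
      qed
    qed
  qed
  have "AE t in lebesgue. \<forall>n. t \<in> {0<..<T} \<longrightarrow> \<bar>gp t - g t\<bar> \<le> 2 * (1 / real (Suc n)) \<and> \<bar>gm t - g t\<bar> \<le> 2 * (1 / real (Suc n))"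
    using approx[of "1 / real (Suc n)" for n] by (subst AE_all_countable) simp
  then have "AE t in lebesgue. t \<in> {0<..<T} \<longrightarrow> gp t = g t \<and> gm t = g t"
  proof eventually_elim
    case (elim t)
    show ?case
    proof
      assume t: "t \<in> {0<..<T}"
      have "(\<lambda>n. 1 / real (Suc n)) \<longlonglongrightarrow> 0" using LIMSEQ_inverse_real_of_nat by (simp add: inverse_eq_divide)
      then have z: "(\<lambda>n. 2 * (1 / real (Suc n))) \<longlonglongrightarrow> 2 * 0" by (intro tendsto_mult tendsto_const)
      have "\<bar>gp t - g t\<bar> \<le> 2 * 0" by (rule LIMSEQ_le_const[OF z]) (use elim t in blast)
      moreover have "\<bar>gm t - g t\<bar> \<le> 2 * 0" by (rule LIMSEQ_le_const[OF z]) (use elim t in blast)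
      ultimately show "gp t = g t \<and> gm t = g t" by simp
    qed
  qed
  moreover have "{0<..<T} \<in> sets lebesgue" by simp
  ultimately show ?thesis by (simp only: AE_lebesgue_on_iff)
qed

context bounded_open begin

text \<open>Let \<open>D\<close> be countable such that almost all values of \<open>v\<close> are
  limits of elements of \<open>D\<close>. Off one null set the scalar limits show that
  \<open>z = v t - vp t\<close> is orthogonal to \<open>D\<close>, hence to almost all values of
  \<open>v\<close>, and hence to the weak limit \<open>vp t\<close> of such values. So
  \<open>z\<close> is orthogonal to itself.\<close>

lemma weak_limits_AE:
  assumes v: "bochner_measurable T (L2_sigma \<Omega>) (L2_norm \<Omega>) v"
    and vp: "\<And>t. t \<in> {0<..<T} \<Longrightarrow> weak_right_lim T \<Omega> v t (vp t)"
    and vm: "\<And>t. t \<in> {0<..<T} \<Longrightarrow> weak_left_lim T \<Omega> v t (vm t)"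
  shows "AE t in lebesgue_on {0<..<T}. L2_norm \<Omega> (vp t) = L2_norm \<Omega> (v t) \<and> L2_norm \<Omega> (vm t) = L2_norm \<Omega> (v t)"
proof -
  have mI: "{0<..<T} \<in> sets lebesgue" by simp
  obtain D where D: "countable D" "D \<subseteq> L2_sigma \<Omega>"
    "AE t in lebesgue_on {0<..<T}. \<exists>y :: nat \<Rightarrow> _. (\<forall>k. y k \<in> D) \<and> (\<lambda>k. L2_norm \<Omega> (\<lambda>x. y k x - v t x)) \<longlonglongrightarrow> 0"
    using bochner_measurable_countable_approx[OF v] by blast
  have lims: "right_lim T (\<lambda>\<tau>. L2_inner \<Omega> (v \<tau>) \<phi>) t (L2_inner \<Omega> (vp t) \<phi>)"
    "left_lim T (\<lambda>\<tau>. L2_inner \<Omega> (v \<tau>) \<phi>) t (L2_inner \<Omega> (vm t) \<phi>)"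
    if "\<phi> \<in> L2_sigma \<Omega>" "t \<in> {0<..<T}" for \<phi> t
    using vp[OF that(2)] vm[OF that(2)] that(1) unfolding weak_right_lim_def weak_left_lim_def by blast+
  have s: "vp t \<in> L2_sigma \<Omega>" "vm t \<in> L2_sigma \<Omega>" if "t \<in> {0<..<T}" for t
    using vp[OF that] vm[OF that] unfolding weak_right_lim_def weak_left_lim_def by blast+
  have "AE t in lebesgue_on {0<..<T}. L2_inner \<Omega> (vp t) \<phi> = L2_inner \<Omega> (v t) \<phi> \<and> L2_inner \<Omega> (vm t) \<phi> = L2_inner \<Omega> (v t) \<phi>"
    if "\<phi> \<in> D" for \<phi>
    by (rule one_sided_limits_AE) (use lims that D(2) in blast)+
  then have "AE t in lebesgue_on {0<..<T}. \<forall>\<phi>\<in>D. L2_inner \<Omega> (vp t) \<phi> = L2_inner \<Omega> (v t) \<phi> \<and> L2_inner \<Omega> (vm t) \<phi> = L2_inner \<Omega> (v t) \<phi>"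
    by (subst AE_ball_countable[OF D(1)]) blast
  note AE_D = this
  define G where "G t \<longleftrightarrow> (\<forall>\<phi>\<in>D. L2_inner \<Omega> (vp t) \<phi> = L2_inner \<Omega> (v t) \<phi> \<and> L2_inner \<Omega> (vm t) \<phi> = L2_inner \<Omega> (v t) \<phi>) \<and>
     v t \<in> L2_sigma \<Omega> \<and> (\<exists>y :: nat \<Rightarrow> _. (\<forall>k. y k \<in> D) \<and> (\<lambda>k. L2_norm \<Omega> (\<lambda>x. y k x - v t x)) \<longlonglongrightarrow> 0)" for t
  have "AE t in lebesgue_on {0<..<T}. G t"
    using AE_D D(3) bochner_measurable_AE[OF v] unfolding G_def by eventually_elim blast
  then have "AE t in lebesgue. t \<in> {0<..<T} \<longrightarrow> G t"
    by (simp only: AE_lebesgue_on_iff[OF mI])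
  then obtain Z where Z0: "Z \<in> null_sets lebesgue" "\<And>t. t \<notin> Z \<Longrightarrow> t \<in> {0<..<T} \<longrightarrow> G t"
    using AE_lebesgueE by blast
  have Z: "Z \<in> null_sets lebesgue" "\<And>t. t \<in> {0<..<T} - Z \<Longrightarrow>
     (\<forall>\<phi>\<in>D. L2_inner \<Omega> (vp t) \<phi> = L2_inner \<Omega> (v t) \<phi> \<and> L2_inner \<Omega> (vm t) \<phi> = L2_inner \<Omega> (v t) \<phi>) \<and>
     v t \<in> L2_sigma \<Omega> \<and> (\<exists>y :: nat \<Rightarrow> _. (\<forall>k. y k \<in> D) \<and> (\<lambda>k. L2_norm \<Omega> (\<lambda>x. y k x - v t x)) \<longlonglongrightarrow> 0)"
    using Z0 unfolding G_def by blast+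
  have vs: "v t \<in> L2_sigma \<Omega>" if "t \<in> {0<..<T} - Z" for t using Z(2)[OF that] by blast
  have orth: "L2_inner \<Omega> (v \<sigma>) z = 0"
    if \<sigma>: "\<sigma> \<in> {0<..<T} - Z" and z: "z \<in> L2 \<Omega>" "\<And>\<phi>. \<phi> \<in> D \<Longrightarrow> L2_inner \<Omega> \<phi> z = 0" for \<sigma> z
  proof -
    obtain y where y: "\<And>k::nat. y k \<in> D" "(\<lambda>k. L2_norm \<Omega> (\<lambda>x. y k x - v \<sigma> x)) \<longlonglongrightarrow> 0" using Z(2)[OF \<sigma>] by blast
    have yL: "\<forall>\<^sub>F k in sequentially. y k \<in> L2 \<Omega>"
      by (rule always_eventually) (use y(1) D(2) L2_sigma_L2 in blast)
    from L2_inner_tendsto_left[OF yL L2_sigma_L2[OF vs[OF \<sigma>]] y(2) z(1)]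
    have "(\<lambda>k. 0) \<longlonglongrightarrow> L2_inner \<Omega> (v \<sigma>) z" using z(2)[OF y(1)] by simp
    then show ?thesis by (simp add: LIMSEQ_const_iff)
  qed
  have key: "L2_norm \<Omega> w = L2_norm \<Omega> (v t)"
    if t: "t \<in> {0<..<T} - Z" and w: "w \<in> L2_sigma \<Omega>"
      and eq: "\<And>\<phi>. \<phi> \<in> D \<Longrightarrow> L2_inner \<Omega> w \<phi> = L2_inner \<Omega> (v t) \<phi>"
      and lim: "\<And>z. z \<in> L2_sigma \<Omega> \<Longrightarrow> (\<And>\<sigma>. \<sigma> \<in> {0<..<T} - Z \<Longrightarrow> L2_inner \<Omega> (v \<sigma>) z = 0) \<Longrightarrow> L2_inner \<Omega> w z = 0" for t w
  proof -
    define z where "z = (\<lambda>x. v t x - w x)"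
    have zs: "z \<in> L2_sigma \<Omega>" unfolding z_def by (rule L2_sigma_diff[OF vs[OF t] w])
    note zL = L2_sigma_L2[OF zs] and vL = L2_sigma_L2[OF vs[OF t]] and wL = L2_sigma_L2[OF w]
    have zD: "L2_inner \<Omega> \<phi> z = 0" if "\<phi> \<in> D" for \<phi>
    proof -
      have "\<phi> \<in> L2 \<Omega>" using that D(2) L2_sigma_L2 by blast
      from L2_inner_diff_left[OF vL wL this] eq[OF that] show ?thesis
        unfolding z_def L2_inner_commute[of \<Omega> \<phi>] by simp
    qed
    have o: "L2_inner \<Omega> (v \<sigma>) z = 0" if "\<sigma> \<in> {0<..<T} - Z" for \<sigma> by (rule orth[OF that zL zD])
    have "L2_inner \<Omega> w z = 0" by (rule lim[OF zs o])
    moreover have "L2_inner \<Omega> z z = L2_inner \<Omega> (v t) z - L2_inner \<Omega> w z"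
      using L2_inner_diff_left[OF vL wL zL] by (simp add: z_def)
    ultimately have "(L2_norm \<Omega> z)\<^sup>2 = 0" using o[OF t] by (simp add: L2_inner_self)
    then have "L2_norm \<Omega> (\<lambda>x. v t x - w x) = 0" by (simp add: z_def)
    then show ?thesis using L2_norm_triangle_diff[OF vL wL] by simp
  qed
  have "L2_norm \<Omega> (vp t) = L2_norm \<Omega> (v t) \<and> L2_norm \<Omega> (vm t) = L2_norm \<Omega> (v t)" if t: "t \<in> {0<..<T} - Z" for t
  proof
    have tT: "t \<in> {0<..<T}" using t by blast
    show "L2_norm \<Omega> (vp t) = L2_norm \<Omega> (v t)"
    proof (rule key[OF t s(1)[OF tT]])
      show "L2_inner \<Omega> (vp t) \<phi> = L2_inner \<Omega> (v t) \<phi>" if "\<phi> \<in> D" for \<phi> using Z(2)[OF t] that by blast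
      fix z assume z: "z \<in> L2_sigma \<Omega>" "\<And>\<sigma>. \<sigma> \<in> {0<..<T} - Z \<Longrightarrow> L2_inner \<Omega> (v \<sigma>) z = 0"
      have "\<bar>L2_inner \<Omega> (vp t) z - 0\<bar> \<le> 0"
        by (rule right_lim_bound[OF lims(1)[OF z(1) tT] _ order.refl Z(1)]) (use tT z(2) in auto)
      then show "L2_inner \<Omega> (vp t) z = 0" by simp
    qed
    show "L2_norm \<Omega> (vm t) = L2_norm \<Omega> (v t)"
    proof (rule key[OF t s(2)[OF tT]])
      show "L2_inner \<Omega> (vm t) \<phi> = L2_inner \<Omega> (v t) \<phi>" if "\<phi> \<in> D" for \<phi> using Z(2)[OF t] that by blast
      fix z assume z: "z \<in> L2_sigma \<Omega>" "\<And>\<sigma>. \<sigma> \<in> {0<..<T} - Z \<Longrightarrow> L2_inner \<Omega> (v \<sigma>) z = 0"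
      have "\<bar>L2_inner \<Omega> (vm t) z - 0\<bar> \<le> 0"
        by (rule left_lim_bound[OF lims(2)[OF z(1) tT] _ order.refl Z(1)]) (use tT z(2) in auto)
      then show "L2_inner \<Omega> (vm t) z = 0" by simp
    qed
  qed
  then have "AE t in lebesgue. t \<in> {0<..<T} \<longrightarrow> L2_norm \<Omega> (vp t) = L2_norm \<Omega> (v t) \<and> L2_norm \<Omega> (vm t) = L2_norm \<Omega> (v t)"
    using AE_not_in[OF Z(1)] by (auto elim!: eventually_mono)
  then show ?thesis by (simp only: AE_lebesgue_on_iff[OF mI])
qed

end


section \<open>Scaling and extending curves\<close>

lemma C1_curve_scaleR:
  assumes "C1_curve T \<Omega> \<phi> \<phi>'"
  shows "C1_curve T \<Omega> (\<lambda>t x. c *\<^sub>R \<phi> t x) (\<lambda>t x. c *\<^sub>R \<phi>' t x)"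
  unfolding C1_curve_def
proof (intro ballI conjI allI)
  fix t js assume t: "t \<in> {0..T}"
  show "(\<lambda>x. c *\<^sub>R \<phi> t x) \<in> Cc_inf_sigma \<Omega>" "(\<lambda>x. c *\<^sub>R \<phi>' t x) \<in> Cc_inf_sigma \<Omega>"
    by (rule Cc_inf_sigma_scaleR[OF C1_curveD(1)[OF assms t]], rule Cc_inf_sigma_scaleR[OF C1_curveD(2)[OF assms t]])
  have sm: "smooth_fun (\<phi> \<tau>)" "smooth_fun (\<phi>' \<tau>)" if "\<tau> \<in> {0..T}" for \<tau>
    by (rule Cc_inf_smooth[OF Cc_inf_sigma_Cc_inf[OF C1_curveD(1)[OF assms that]]],
        rule Cc_inf_smooth[OF Cc_inf_sigma_Cc_inf[OF C1_curveD(2)[OF assms that]]])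
  have scale: "uniform_limit UNIV (\<lambda>\<tau> x. c *\<^sub>R G \<tau> x) (\<lambda>x. c *\<^sub>R H x) F"
    if "uniform_limit UNIV G H F" for G :: "real \<Rightarrow> real ^ 'a \<Rightarrow> real ^ 'a" and H F
    by (rule bounded_linear.uniform_limit[OF bounded_linear_scaleR_right that])
  show "uniform_limit UNIV (\<lambda>\<tau>. iter_partial js (\<lambda>x. (1 / (\<tau> - t)) *\<^sub>R (c *\<^sub>R \<phi> \<tau> x - c *\<^sub>R \<phi> t x)))
          (iter_partial js (\<lambda>x. c *\<^sub>R \<phi>' t x)) (at t within {0..T})"
    unfolding iter_partial_scaleR[OF sm(2)[OF t]]
  proof (rule uniform_limit_cong[THEN iffD1, OF _ _ scale[OF C1_curveD(3)[OF assms t, of js]]])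
    show "\<forall>\<^sub>F \<tau> in at t within {0..T}. \<forall>x\<in>UNIV. c *\<^sub>R iter_partial js (\<lambda>x. (1 / (\<tau> - t)) *\<^sub>R (\<phi> \<tau> x - \<phi> t x)) x
        = iter_partial js (\<lambda>x. (1 / (\<tau> - t)) *\<^sub>R (c *\<^sub>R \<phi> \<tau> x - c *\<^sub>R \<phi> t x)) x"
      using eventually_in_time
    proof eventually_elim
      case (elim \<tau>)
      have "(\<lambda>x. (1 / (\<tau> - t)) *\<^sub>R (c *\<^sub>R \<phi> \<tau> x - c *\<^sub>R \<phi> t x)) = (\<lambda>x. c *\<^sub>R ((1 / (\<tau> - t)) *\<^sub>R (\<phi> \<tau> x - \<phi> t x)))"
        by (simp add: scaleR_diff_right mult.commute)
      then show ?case
        by (simp only: iter_partial_scaleR[OF smooth_fun_scaleR_const[OF smooth_fun_diff[OF sm(1)[OF elim] sm(1)[OF t]]]]) simp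
    qed
  qed simp
  show "uniform_limit UNIV (\<lambda>\<tau>. iter_partial js (\<lambda>x. c *\<^sub>R \<phi>' \<tau> x)) (iter_partial js (\<lambda>x. c *\<^sub>R \<phi>' t x)) (at t within {0..T})"
    unfolding iter_partial_scaleR[OF sm(2)[OF t]]
  proof (rule uniform_limit_cong[THEN iffD1, OF _ _ scale[OF C1_curveD(4)[OF assms t, of js]]])
    show "\<forall>\<^sub>F \<tau> in at t within {0..T}. \<forall>x\<in>UNIV. c *\<^sub>R iter_partial js (\<phi>' \<tau>) x = iter_partial js (\<lambda>x. c *\<^sub>R \<phi>' \<tau> x) x"
      using eventually_in_time by eventually_elim (simp add: iter_partial_scaleR[OF sm(2)])
  qed simp
qed

text \<open>The curve vanishes near the ends of the interval from \<open>s\<close> to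
  \<open>t\<close>, so its extension by zero agrees near every time either with
  \<open>\<phi>\<close> or with zero.\<close>

lemma C1_curve_extend:
  assumes \<phi>: "\<phi> \<in> C1_Cc_inf_sigma {s<..<t} \<Omega>" and st: "0 < s" "t < T"
    and ab: "s < a" "b < t" "\<And>\<tau>. \<tau> \<in> {s<..<t} - {a..b} \<Longrightarrow> \<phi> \<tau> = (\<lambda>x. 0)"
  obtains \<phi>' where "C1_curve T \<Omega> (\<lambda>\<tau>. if \<tau> \<in> {s<..<t} then \<phi> \<tau> else (\<lambda>x. 0)) \<phi>'"
    "\<And>\<tau>. \<tau> \<in> {s<..<t} \<Longrightarrow> time_deriv \<phi> \<tau> = \<phi>' \<tau>"
    "\<And>\<tau>. \<tau> \<notin> {a..b} \<Longrightarrow> \<phi>' \<tau> = (\<lambda>x. 0)"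
proof -
  obtain \<psi> C where "compact C \<and> C \<subseteq> \<Omega> \<and>
     (\<forall>\<tau>\<in>{s<..<t}. \<phi> \<tau> \<in> Cc_inf_sigma \<Omega> \<and> \<psi> \<tau> \<in> Cc_inf_sigma \<Omega> \<and> (\<forall>x. x \<notin> C \<longrightarrow> \<phi> \<tau> x = 0 \<and> \<psi> \<tau> x = 0)) \<and>
     (\<forall>\<tau>\<in>{s<..<t}. \<forall>js.
        uniform_limit UNIV (\<lambda>\<sigma>. iter_partial js (\<lambda>x. (1 / (\<sigma> - \<tau>)) *\<^sub>R (\<phi> \<sigma> x - \<phi> \<tau> x)))
          (iter_partial js (\<psi> \<tau>)) (at \<tau> within {s<..<t}) \<and>
        uniform_limit UNIV (\<lambda>\<sigma>. iter_partial js (\<psi> \<sigma>)) (iter_partial js (\<psi> \<tau>)) (at \<tau> within {s<..<t}))"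
    using \<phi> unfolding C1_Cc_inf_sigma_def mem_Collect_eq by (elim exE)
  then have mem: "\<phi> \<tau> \<in> Cc_inf_sigma \<Omega>" "\<psi> \<tau> \<in> Cc_inf_sigma \<Omega>"
    and lim1: "uniform_limit UNIV (\<lambda>\<sigma>. iter_partial js (\<lambda>x. (1 / (\<sigma> - \<tau>)) *\<^sub>R (\<phi> \<sigma> x - \<phi> \<tau> x)))
          (iter_partial js (\<psi> \<tau>)) (at \<tau> within {s<..<t})"
    and lim2: "uniform_limit UNIV (\<lambda>\<sigma>. iter_partial js (\<psi> \<sigma>)) (iter_partial js (\<psi> \<tau>)) (at \<tau> within {s<..<t})"
    if "\<tau> \<in> {s<..<t}" for \<tau> js using that by blast+
  have at_eq: "at \<tau> within {s<..<t} = at \<tau>" if "\<tau> \<in> {s<..<t}" for \<tau>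
    by (rule at_within_open[OF that]) simp
  have at_eq': "at \<tau> within {0..T} = at \<tau>" if "\<tau> \<in> {s<..<t}" for \<tau>
    by (rule at_within_interior) (use that st in \<open>simp add: interior_atLeastAtMost_real\<close>)
  have near: "\<forall>\<^sub>F \<sigma> in at \<tau>. \<sigma> \<in> {s<..<t}" if "\<tau> \<in> {s<..<t}" for \<tau>
    by (rule eventually_at_in_open'[OF open_greaterThanLessThan that])
  have vd: "((\<lambda>\<sigma>. \<phi> \<sigma> x) has_vector_derivative \<psi> \<tau> x) (at \<tau>)" if \<tau>: "\<tau> \<in> {s<..<t}" for \<tau> x
    unfolding has_vector_derivative_iff_quotient
    using tendsto_uniform_limitI[OF lim1[OF \<tau>, of "[]"], of x] by (simp add: at_eq[OF \<tau>])
  have td: "time_deriv \<phi> \<tau> = \<psi> \<tau>" if "\<tau> \<in> {s<..<t}" for \<tau>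
    by (rule ext) (simp add: time_deriv_def vector_derivative_at[OF vd[OF that]])
  have \<psi>0: "\<psi> \<tau> = (\<lambda>x. 0)" if \<tau>: "\<tau> \<in> {s<..<t} - {a..b}" for \<tau>
  proof
    fix x
    have o: "open ({s<..<t} - {a..b})" by (intro open_Diff) auto
    have "((\<lambda>\<sigma>. 0) has_vector_derivative 0) (at \<tau>)" by simp
    then have "((\<lambda>\<sigma>. \<phi> \<sigma> x) has_vector_derivative 0) (at \<tau>)"
      by (rule has_vector_derivative_transform_within_open[OF _ o \<tau>]) (use ab(3) in simp)
    moreover have "((\<lambda>\<sigma>. \<phi> \<sigma> x) has_vector_derivative \<psi> \<tau> x) (at \<tau>)" using vd \<tau> by blast
    ultimately show "\<psi> \<tau> x = 0" by (metis vector_derivative_at)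
  qed
  define \<Phi> where "\<Phi> \<tau> = (if \<tau> \<in> {s<..<t} then \<phi> \<tau> else (\<lambda>x. 0))" for \<tau>
  define \<Psi> where "\<Psi> \<tau> = (if \<tau> \<in> {s<..<t} then \<psi> \<tau> else (\<lambda>x. 0))" for \<tau>
  have off: "\<Phi> \<tau> = (\<lambda>x. 0)" "\<Psi> \<tau> = (\<lambda>x. 0)" if "\<tau> \<notin> {a..b}" for \<tau>
    using that ab(3)[of \<tau>] \<psi>0[of \<tau>] unfolding \<Phi>_def \<Psi>_def by auto
  have "C1_curve T \<Omega> \<Phi> \<Psi>"
    unfolding C1_curve_def
  proof (intro ballI conjI allI)
    fix \<tau> js assume \<tau>: "\<tau> \<in> {0..T}"
    show "\<Phi> \<tau> \<in> Cc_inf_sigma \<Omega>" "\<Psi> \<tau> \<in> Cc_inf_sigma \<Omega>"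
      unfolding \<Phi>_def \<Psi>_def using mem by simp_all
    let ?L1 = "uniform_limit UNIV (\<lambda>\<sigma>. iter_partial js (\<lambda>x. (1 / (\<sigma> - \<tau>)) *\<^sub>R (\<Phi> \<sigma> x - \<Phi> \<tau> x)))
          (iter_partial js (\<Psi> \<tau>)) (at \<tau> within {0..T})"
    let ?L2 = "uniform_limit UNIV (\<lambda>\<sigma>. iter_partial js (\<Psi> \<sigma>)) (iter_partial js (\<Psi> \<tau>)) (at \<tau> within {0..T})"
    have "?L1 \<and> ?L2"
    proof (cases "\<tau> \<in> {a..b}")
      case True
      then have in_st: "\<tau> \<in> {s<..<t}" using ab by auto
      have P: "\<Psi> \<tau> = \<psi> \<tau>" "\<Phi> \<tau> = \<phi> \<tau>" using in_st by (simp_all add: \<Psi>_def \<Phi>_def)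
      have "?L1"
        unfolding at_eq'[OF in_st] P
      proof (rule uniform_limit_cong[THEN iffD1, OF _ _ lim1[OF in_st, of js, unfolded at_eq[OF in_st]]])
        show "\<forall>\<^sub>F \<sigma> in at \<tau>. \<forall>x\<in>UNIV. iter_partial js (\<lambda>x. (1 / (\<sigma> - \<tau>)) *\<^sub>R (\<phi> \<sigma> x - \<phi> \<tau> x)) x
            = iter_partial js (\<lambda>x. (1 / (\<sigma> - \<tau>)) *\<^sub>R (\<Phi> \<sigma> x - \<phi> \<tau> x)) x"
          using near[OF in_st] by eventually_elim (simp add: \<Phi>_def)
      qed simp
      moreover have "?L2"
        unfolding at_eq'[OF in_st] P
      proof (rule uniform_limit_cong[THEN iffD1, OF _ _ lim2[OF in_st, of js, unfolded at_eq[OF in_st]]])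
        show "\<forall>\<^sub>F \<sigma> in at \<tau>. \<forall>x\<in>UNIV. iter_partial js (\<psi> \<sigma>) x = iter_partial js (\<Psi> \<sigma>) x"
          using near[OF in_st] by eventually_elim (simp add: \<Psi>_def)
      qed simp
      ultimately show ?thesis ..
    next
      case False
      have ev: "\<forall>\<^sub>F \<sigma> in at \<tau> within {0..T}. \<sigma> \<in> - {a..b}"
        unfolding eventually_at_topological by (rule exI[of _ "- {a..b}"]) (use False in auto)
      have L: "uniform_limit UNIV (\<lambda>(\<sigma>::real) x. 0 :: real ^ 'a) (\<lambda>x. 0) (at \<tau> within {0..T})"
        by (rule uniform_limit_const)
      have "?L1"
        unfolding off[OF False] iter_partial_zero
      proof (rule uniform_limit_cong[THEN iffD1, OF _ _ L])
        show "\<forall>\<^sub>F \<sigma> in at \<tau> within {0..T}. \<forall>x\<in>UNIV. 0 = iter_partial js (\<lambda>x. (1 / (\<sigma> - \<tau>)) *\<^sub>R (\<Phi> \<sigma> x - 0)) x"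
          using ev by eventually_elim (simp add: off)
      qed simp
      moreover have "?L2"
        unfolding off[OF False] iter_partial_zero
      proof (rule uniform_limit_cong[THEN iffD1, OF _ _ L])
        show "\<forall>\<^sub>F \<sigma> in at \<tau> within {0..T}. \<forall>x\<in>UNIV. 0 = iter_partial js (\<Psi> \<sigma>) x"
          using ev by eventually_elim (simp add: off)
      qed simp
      ultimately show ?thesis ..
    qed
    then show "?L1" "?L2" by blast+
  qed
  moreover have "time_deriv \<phi> \<tau> = \<Psi> \<tau>" if "\<tau> \<in> {s<..<t}" for \<tau>
    using td[OF that] that by (simp add: \<Psi>_def)
  ultimately show ?thesis
    using that off(2) unfolding \<Phi>_def by blast
qed

context bounded_open begin

section \<open>The integrand of the relative energy inequality\<close>

text \<open>The momentum flux \<open>u \<otimes> u - \<nu> \<nabla>u\<close>, tested with the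
  gradient of \<open>w\<close>.\<close>

definition flux :: "real \<Rightarrow> (real ^ 'n \<Rightarrow> real ^ 'n) \<Rightarrow> (real ^ 'n \<Rightarrow> real ^ 'n) \<Rightarrow> real" where
  "flux \<nu> u w = L2_inner \<Omega> (\<lambda>x. outer (u x) (u x)) (grad w) - \<nu> * L2_inner \<Omega> (wgrad \<Omega> u) (grad w)"

lemma flux_outer: "L2_inner \<Omega> (\<lambda>x. outer (u x) (u x)) (grad w) = L2_inner \<Omega> (\<lambda>x. grad w x *v u x) u"
proof -
  have "L2_inner \<Omega> (\<lambda>x. outer (u x) (u x)) (grad w) = L2_inner \<Omega> (grad w) (\<lambda>x. outer (u x) (u x))"
    by (rule L2_inner_commute)
  also have "\<dots> = L2_inner \<Omega> (\<lambda>x. grad w x *v u x) u"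
    unfolding L2_inner_def inner_outer ..
  finally show ?thesis .
qed

text \<open>By bilinearity the left-hand side is \<open>((u \<cdot> \<nabla>) w, u - w)\<close>, and
  \<open>u\<close> does no work on \<open>w\<close>.\<close>

lemma convective_expansion:
  assumes u: "u \<in> L2_sigma \<Omega>" and w: "w \<in> Cc_inf_sigma \<Omega>"
  defines "z \<equiv> (\<lambda>x. u x - w x)"
  shows "L2_inner \<Omega> (\<lambda>x. grad w x *v z x) z + L2_inner \<Omega> (conv \<Omega> w w) z = L2_inner \<Omega> (\<lambda>x. grad w x *v u x) u"
proof -
  note wc = Cc_inf_sigma_Cc_inf[OF w] and ws = Cc_inf_sigma_L2_sigma[OF w]
  note L = L2_sigma_L2[OF u] L2_sigma_L2[OF ws]
  have zs: "z \<in> L2_sigma \<Omega>" unfolding z_def by (rule L2_sigma_diff[OF u ws])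
  note zL = L2_sigma_L2[OF zs]
  have gL: "(\<lambda>x. grad w x *v b x) \<in> L2 \<Omega>" if "b \<in> L2 \<Omega>" for b by (rule grad_mult_L2(1)[OF wc that])
  have "L2_inner \<Omega> (conv \<Omega> w w) z = L2_inner \<Omega> (\<lambda>x. grad w x *v w x) z"
  proof (rule L2_inner_cong_AE)
    show "AE x in lebesgue_on \<Omega>. conv \<Omega> w w x = grad w x *v w x"
      using wgrad_smooth[OF wc] by eventually_elim (simp add: conv_def)
  qed simp
  then have "L2_inner \<Omega> (\<lambda>x. grad w x *v z x) z + L2_inner \<Omega> (conv \<Omega> w w) z
      = L2_inner \<Omega> (\<lambda>x. grad w x *v z x + grad w x *v w x) z"
    by (simp add: L2_inner_add_left[OF gL[OF zL] gL[OF L(2)] zL])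
  also have "(\<lambda>x. grad w x *v z x + grad w x *v w x) = (\<lambda>x. grad w x *v u x)"
    by (simp add: matrix_vector_right_distrib[symmetric] z_def)
  also have "L2_inner \<Omega> (\<lambda>x. grad w x *v u x) z = L2_inner \<Omega> (\<lambda>x. grad w x *v u x) u - L2_inner \<Omega> (\<lambda>x. grad w x *v u x) w"
    unfolding z_def by (rule L2_inner_diff_right[OF L gL[OF L(1)]])
  also have "L2_inner \<Omega> (\<lambda>x. grad w x *v u x) w = 0" by (rule convective_zero[OF u wc])
  finally show ?thesis by simp
qed

text \<open>Everything quadratic in \<open>w\<close> cancels, and so does the weight: what remains
  is affine in \<open>w\<close>, with the energy dissipation as constant term. This is the algebraic
  core of the theorem.\<close>

lemma integrand_identity:
  assumes \<nu>: "0 \<le> \<nu>" and u: "u \<in> L2_sigma \<Omega>" "0 < \<nu> \<Longrightarrow> u \<in> H1 \<Omega>" and w: "w \<in> Cc_inf_sigma \<Omega>"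
  shows "rel_form \<nu> \<Omega> K u w - enn2real (K w) * rel_energy \<Omega> u w
      + L2_inner \<Omega> (conv \<Omega> w w) (\<lambda>x. u x - w x) + \<nu> * L2_inner \<Omega> (wgrad \<Omega> w) (wgrad \<Omega> (\<lambda>x. u x - w x))
     = \<nu> * (L2_norm \<Omega> (wgrad \<Omega> u))\<^sup>2 + flux \<nu> u w"
proof -
  note wc = Cc_inf_sigma_Cc_inf[OF w]
  have visc: "\<nu> * (L2_norm \<Omega> (\<lambda>x. wgrad \<Omega> u x - wgrad \<Omega> w x))\<^sup>2 + \<nu> * L2_inner \<Omega> (wgrad \<Omega> w) (wgrad \<Omega> (\<lambda>x. u x - w x))
      = \<nu> * (L2_norm \<Omega> (wgrad \<Omega> u))\<^sup>2 - \<nu> * L2_inner \<Omega> (wgrad \<Omega> u) (grad w)"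
  proof (cases "0 < \<nu>")
    case True
    have uH: "u \<in> H1 \<Omega>" by (rule u(2)[OF True])
    have wH: "w \<in> H1 \<Omega>" by (rule Cc_inf_H1[OF wc])
    have g: "wgrad \<Omega> u \<in> L2 \<Omega>" "wgrad \<Omega> w \<in> L2 \<Omega>" by (rule wgrad_L2[OF uH], rule wgrad_L2[OF wH])
    have "L2_inner \<Omega> (wgrad \<Omega> w) (wgrad \<Omega> (\<lambda>x. u x - w x)) = L2_inner \<Omega> (wgrad \<Omega> w) (\<lambda>x. wgrad \<Omega> u x - wgrad \<Omega> w x)"
      by (rule L2_inner_cong_AE[OF AE_I2[OF refl] wgrad_diff[OF uH wH]])
    also have "\<dots> = L2_inner \<Omega> (wgrad \<Omega> u) (wgrad \<Omega> w) - (L2_norm \<Omega> (wgrad \<Omega> w))\<^sup>2"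
      by (simp add: L2_inner_diff_right[OF g g(2)] L2_inner_self L2_inner_commute[of \<Omega> "wgrad \<Omega> w" "wgrad \<Omega> u"])
    finally have g1: "L2_inner \<Omega> (wgrad \<Omega> w) (wgrad \<Omega> (\<lambda>x. u x - w x)) = L2_inner \<Omega> (wgrad \<Omega> u) (wgrad \<Omega> w) - (L2_norm \<Omega> (wgrad \<Omega> w))\<^sup>2" .
    have g2: "L2_inner \<Omega> (wgrad \<Omega> u) (wgrad \<Omega> w) = L2_inner \<Omega> (wgrad \<Omega> u) (grad w)"
      by (rule L2_inner_cong_AE[OF AE_I2[OF refl] wgrad_smooth[OF wc]])
    show ?thesis unfolding g1 L2_norm_diff_sq[OF g] g2 by (simp add: algebra_simps)
  qed (use \<nu> in simp)
  have "rel_form \<nu> \<Omega> K u w = \<nu> * (L2_norm \<Omega> (\<lambda>x. wgrad \<Omega> u x - wgrad \<Omega> w x))\<^sup>2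
      + L2_inner \<Omega> (\<lambda>x. grad w x *v (u x - w x)) (\<lambda>x. u x - w x) + enn2real (K w) * rel_energy \<Omega> u w"
    by (rule rel_form_smooth[OF \<nu> u(1) _ w]) (rule u(2))
  then show ?thesis
    using visc convective_expansion[OF u(1) w] unfolding flux_def flux_outer by linarith
qed

lemma flux_scaleR:
  assumes "w \<in> Cc_inf \<Omega>"
  shows "flux \<nu> u (\<lambda>x. c *\<^sub>R w x) = c * flux \<nu> u w"
proof -
  have "grad (\<lambda>x. c *\<^sub>R w x) = (\<lambda>x. c *\<^sub>R grad w x)"
    by (rule ext) (simp add: grad_def vec_eq_iff partial_deriv_scaleR[OF smooth_fun_differentiable[OF Cc_inf_smooth[OF assms]]])
  then show ?thesis by (simp add: flux_def algebra_simps)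
qed

lemma grad_zero [simp]: "grad (\<lambda>x. 0) = (\<lambda>x. 0 :: real ^ 'n ^ 'n)"
  by (rule ext) (simp add: grad_def vec_eq_iff)

lemma flux_zero [simp]: "flux \<nu> u (\<lambda>x. 0) = 0"
  by (simp add: flux_def)

section \<open>Integrability in time\<close>

text \<open>Apply composition twice: first in \<open>g\<close> for a fixed second argument, then in
  \<open>u\<close>.\<close>

lemma inner_time_measurable:
  assumes u: "bochner_measurable T (L2_sigma \<Omega>) (L2_norm \<Omega>) u"
    and g: "bochner_measurable T Y (L2_norm \<Omega>) g" and Y: "Y \<subseteq> L2 \<Omega>"
  shows "(\<lambda>t. L2_inner \<Omega> (g t) (u t)) \<in> borel_measurable (lebesgue_on {0<..<T})"
proof (rule bochner_measurable_compose[OF u])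
  fix x assume x: "x \<in> L2_sigma \<Omega>"
  show "(\<lambda>t. L2_inner \<Omega> (g t) x) \<in> borel_measurable (lebesgue_on {0<..<T})"
  proof (rule bochner_measurable_compose[OF g, where F="\<lambda>t y. L2_inner \<Omega> y x"])
    show "AE t in lebesgue_on {0<..<T}. \<forall>y :: nat \<Rightarrow> _. (\<forall>k. y k \<in> Y) \<longrightarrow>
        (\<lambda>k. L2_norm \<Omega> (\<lambda>x. y k x - g t x)) \<longlonglongrightarrow> 0 \<longrightarrow> (\<lambda>k. L2_inner \<Omega> (y k) x) \<longlonglongrightarrow> L2_inner \<Omega> (g t) x"
      using bochner_measurable_AE[OF g]
    proof eventually_elim
      case (elim t)
      show ?case
      proof (intro allI impI)
        fix y :: "nat \<Rightarrow> _" assume y: "\<forall>k. y k \<in> Y" "(\<lambda>k. L2_norm \<Omega> (\<lambda>x. y k x - g t x)) \<longlonglongrightarrow> 0"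
        have "\<forall>\<^sub>F k in sequentially. y k \<in> L2 \<Omega>" by (rule always_eventually) (use y(1) Y in blast)
        moreover have "g t \<in> L2 \<Omega>" using elim Y by blast
        ultimately show "(\<lambda>k. L2_inner \<Omega> (y k) x) \<longlonglongrightarrow> L2_inner \<Omega> (g t) x"
          using y(2) L2_sigma_L2[OF x] by (rule L2_inner_tendsto_left)
      qed
    qed
  qed simp
next
  show "AE t in lebesgue_on {0<..<T}. \<forall>y :: nat \<Rightarrow> _. (\<forall>k. y k \<in> L2_sigma \<Omega>) \<longrightarrow>
      (\<lambda>k. L2_norm \<Omega> (\<lambda>x. y k x - u t x)) \<longlonglongrightarrow> 0 \<longrightarrow> (\<lambda>k. L2_inner \<Omega> (g t) (y k)) \<longlonglongrightarrow> L2_inner \<Omega> (g t) (u t)"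
    using bochner_measurable_AE[OF g] bochner_measurable_AE[OF u]
  proof eventually_elim
    case (elim t)
    show ?case
    proof (intro allI impI)
      fix y :: "nat \<Rightarrow> _" assume y: "\<forall>k. y k \<in> L2_sigma \<Omega>" "(\<lambda>k. L2_norm \<Omega> (\<lambda>x. y k x - u t x)) \<longlonglongrightarrow> 0"
      have ev: "\<forall>\<^sub>F k in sequentially. y k \<in> L2 \<Omega>" by (rule always_eventually) (use y(1) L2_sigma_L2 in blast)
      have gL: "g t \<in> L2 \<Omega>" using elim Y by blast
      show "(\<lambda>k. L2_inner \<Omega> (g t) (y k)) \<longlonglongrightarrow> L2_inner \<Omega> (g t) (u t)"
        using L2_inner_tendsto_left[OF ev L2_sigma_L2[OF elim(2)] y(2) gL]
        by (simp only: L2_inner_commute[of \<Omega> "g t"])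
    qed
  qed
qed

lemma XX_bounded:
  assumes "u \<in> XX \<nu> T \<Omega>"
  obtains C where "0 \<le> C" "AE t in lebesgue_on {0<..<T}. L2_norm \<Omega> (u t) \<le> C"
proof -
  obtain C where C: "AE t in lebesgue_on {0<..<T}. L2_norm \<Omega> (u t) \<le> C"
    using assms by (auto simp: XX_def Linf_time_def split: if_splits)
  then have "AE t in lebesgue_on {0<..<T}. L2_norm \<Omega> (u t) \<le> max C 0" by eventually_elim simp
  then show ?thesis using that[of "max C 0"] by simp
qed

lemma finite_measure_time: "finite_measure (lebesgue_on {0<..<T :: real})"
  by (rule finite_measure_lebesgue_on) simp

lemma pairing_integrable:
  assumes u: "u \<in> XX \<nu> T \<Omega>" and g: "g \<in> Lp_time 1 T (L2 \<Omega>) (L2_norm \<Omega>)"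
  shows "integrable (lebesgue_on {0<..<T}) (\<lambda>t. L2_inner \<Omega> (g t) (u t))"
proof -
  let ?M = "lebesgue_on {0<..<T}"
  note ub = XX_bochner[OF u]
  obtain C where C: "0 \<le> C" "AE t in ?M. L2_norm \<Omega> (u t) \<le> C" using XX_bounded[OF u] by blast
  have gb: "bochner_measurable T (L2 \<Omega>) (L2_norm \<Omega>) g" and gi: "integrable ?M (\<lambda>t. L2_norm \<Omega> (g t))"
    using g by (simp_all add: Lp_time_def)
  show ?thesis
  proof (rule Bochner_Integration.integrable_bound)
    show "integrable ?M (\<lambda>t. L2_norm \<Omega> (g t) * C)" using gi by simp
    show "(\<lambda>t. L2_inner \<Omega> (g t) (u t)) \<in> borel_measurable ?M" by (rule inner_time_measurable[OF ub gb order.refl])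
    show "AE t in ?M. norm (L2_inner \<Omega> (g t) (u t)) \<le> norm (L2_norm \<Omega> (g t) * C)"
      using bochner_measurable_AE[OF gb] bochner_measurable_AE[OF ub] C(2)
    proof eventually_elim
      case (elim t)
      have "\<bar>L2_inner \<Omega> (g t) (u t)\<bar> \<le> L2_norm \<Omega> (g t) * L2_norm \<Omega> (u t)"
        by (rule L2_Cauchy_Schwarz[OF elim(1) L2_sigma_L2[OF elim(2)]])
      also have "\<dots> \<le> L2_norm \<Omega> (g t) * C" using elim(3) by (intro mult_left_mono) simp_all
      finally show ?case using C(1) by simp
    qed
  qed
qed

lemma smooth_curve_pairing_integrable:
  assumes u: "u \<in> XX \<nu> T \<Omega>" and \<Phi>: "smooth_curve T \<Omega> \<Phi>"
  shows "integrable (lebesgue_on {0<..<T}) (\<lambda>t. L2_inner \<Omega> (\<Phi> t) (u t))"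
proof (rule pairing_integrable[OF u Lp_time_continuous(1)])
  show "continuous_on {0..T} (\<lambda>t. L2_norm \<Omega> (\<Phi> t))" by (rule continuous_on_timeI[OF smooth_curve_L2(2)[OF \<Phi>]])
qed (use smooth_curve_L2(1,4)[OF \<Phi>] in simp_all)

lemma force_integrable:
  assumes f: "f \<in> ZZ \<nu> T \<Omega>" and u: "u \<in> XX \<nu> T \<Omega>"
  shows "integrable (lebesgue_on {0<..<T}) (\<lambda>t. f t (u t))"
proof -
  let ?M = "lebesgue_on {0<..<T}"
  have mI: "{0<..<T} \<in> sets lebesgue" by simp
  note part = pairing_integrable[OF u]
  show ?thesis
  proof (cases "0 < \<nu>")
    case True
    obtain h g where h: "h \<in> Lp_time 2 T (dual (H10 \<Omega>) (H1_norm \<Omega>)) (dual_norm (H10 \<Omega>) (H1_norm \<Omega>))"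
      and g: "g \<in> Lp_time 1 T (L2 \<Omega>) (L2_norm \<Omega>)"
      and fe: "AE t in ?M. \<forall>w\<in>H10 \<Omega>. f t w = h t w + L2_inner \<Omega> (g t) w"
      using f True by (auto simp: ZZ_def)
    have uH: "bochner_measurable T (H10_sigma \<Omega>) (H1_norm \<Omega>) u" and ui: "integrable ?M (\<lambda>t. (H1_norm \<Omega> (u t))\<^sup>2)"
      using u True by (simp_all add: XX_def Lp_time_def)
    have hb: "bochner_measurable T (dual (H10 \<Omega>) (H1_norm \<Omega>)) (dual_norm (H10 \<Omega>) (H1_norm \<Omega>)) h"
      and hi: "integrable ?M (\<lambda>t. (dual_norm (H10 \<Omega>) (H1_norm \<Omega>) (h t))\<^sup>2)"
      using h by (simp_all add: Lp_time_def)
    have "integrable ?M (\<lambda>t. h t (u t))"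
    proof (rule Bochner_Integration.integrable_bound)
      show "integrable ?M (\<lambda>t. (dual_norm (H10 \<Omega>) (H1_norm \<Omega>) (h t))\<^sup>2 + (H1_norm \<Omega> (u t))\<^sup>2)" using hi ui by simp
      show "(\<lambda>t. h t (u t)) \<in> borel_measurable ?M"
        by (rule H10.dual_pairing_measurable[OF hb uH]) (use H10_sigma_H10 in blast)
      show "AE t in ?M. norm (h t (u t)) \<le> norm ((dual_norm (H10 \<Omega>) (H1_norm \<Omega>) (h t))\<^sup>2 + (H1_norm \<Omega> (u t))\<^sup>2)"
        using bochner_measurable_AE[OF hb] bochner_measurable_AE[OF uH]
      proof eventually_elim
        case (elim t)
        define A B where "A = dual_norm (H10 \<Omega>) (H1_norm \<Omega>) (h t)" and "B = H1_norm \<Omega> (u t)"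
        have "\<bar>h t (u t)\<bar> \<le> A * B" unfolding A_def B_def by (rule dual_H10_bound[OF elim(1) H10_sigma_H10[OF elim(2)]])
        also have "\<dots> \<le> \<bar>A * B\<bar>" by simp
        also have "\<dots> \<le> A\<^sup>2 + B\<^sup>2"
        proof -
          have "2 * (A * B) \<le> A\<^sup>2 + B\<^sup>2" "- (2 * (A * B)) \<le> A\<^sup>2 + B\<^sup>2"
            using sum_squares_bound[of A B] sum_squares_bound[of "- A" B] by (simp_all add: mult.assoc)
          moreover have "0 \<le> A\<^sup>2 + B\<^sup>2" by simp
          ultimately show ?thesis by linarith
        qed
        finally show ?case by (simp add: A_def B_def)
      qed
    qed
    then have i: "integrable ?M (\<lambda>t. h t (u t) + L2_inner \<Omega> (g t) (u t))" using part[OF g] by simp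
    have "AE t in ?M. h t (u t) + L2_inner \<Omega> (g t) (u t) = f t (u t)"
      using fe bochner_measurable_AE[OF uH]
    proof eventually_elim
      case (elim t)
      then show ?case using H10_sigma_H10 by simp
    qed
    from integrable_AE_cong_lebesgue_on[OF mI this] i show ?thesis by blast
  next
    case False
    obtain g where g: "g \<in> Lp_time 1 T (L2 \<Omega>) (L2_norm \<Omega>)"
      and fe: "AE t in ?M. \<forall>w\<in>L2 \<Omega>. f t w = L2_inner \<Omega> (g t) w"
      using f False by (auto simp: ZZ_def)
    have "AE t in ?M. L2_inner \<Omega> (g t) (u t) = f t (u t)"
      using fe bochner_measurable_AE[OF XX_bochner[OF u]]
    proof eventually_elim
      case (elim t)
      then show ?case using L2_sigma_L2 by simp
    qed
    from integrable_AE_cong_lebesgue_on[OF mI this] part[OF g] show ?thesis by blast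
  qed
qed

text \<open>The force acts as a linear functional only for almost every \<open>t\<close>. The null
  set is independent of the arguments, because these will be time-dependent.\<close>

lemma force_linear:
  assumes f: "f \<in> ZZ \<nu> T \<Omega>"
  shows "AE t in lebesgue_on {0<..<T}. \<forall>u w c. u \<in> L2_sigma \<Omega> \<longrightarrow> (0 < \<nu> \<longrightarrow> u \<in> H10_sigma \<Omega>) \<longrightarrow> w \<in> Cc_inf_sigma \<Omega> \<longrightarrow>
      f t (\<lambda>x. u x - w x) = f t u - f t w \<and> f t (\<lambda>x. c *\<^sub>R w x) = c * f t w"
proof (cases "0 < \<nu>")
  case True
  obtain h g where h: "h \<in> Lp_time 2 T (dual (H10 \<Omega>) (H1_norm \<Omega>)) (dual_norm (H10 \<Omega>) (H1_norm \<Omega>))"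
    and g: "g \<in> Lp_time 1 T (L2 \<Omega>) (L2_norm \<Omega>)"
    and fe: "AE t in lebesgue_on {0<..<T}. \<forall>w\<in>H10 \<Omega>. f t w = h t w + L2_inner \<Omega> (g t) w"
    using f True by (auto simp: ZZ_def)
  have "AE t in lebesgue_on {0<..<T}. h t \<in> dual (H10 \<Omega>) (H1_norm \<Omega>)" "AE t in lebesgue_on {0<..<T}. g t \<in> L2 \<Omega>"
    using h g by (simp_all add: Lp_time_def bochner_measurable_def)
  with fe show ?thesis
  proof eventually_elim
    case (elim t)
    show ?case
    proof (intro allI impI)
      fix u w c assume u: "u \<in> L2_sigma \<Omega>" "0 < \<nu> \<longrightarrow> u \<in> H10_sigma \<Omega>" and w: "w \<in> Cc_inf_sigma \<Omega>"
      have uH: "u \<in> H10 \<Omega>" using u(2) True H10_sigma_H10 by blast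
      have wH: "w \<in> H10 \<Omega>" by (rule H10_sigma_H10[OF Cc_inf_sigma_H10_sigma[OF w]])
      have dH: "(\<lambda>x. u x - w x) \<in> H10 \<Omega>" by (rule H10_diff[OF uH wH])
      have cH: "(\<lambda>x. c *\<^sub>R w x) \<in> H10 \<Omega>" by (rule H10_scaleR[OF wH])
      show "f t (\<lambda>x. u x - w x) = f t u - f t w \<and> f t (\<lambda>x. c *\<^sub>R w x) = c * f t w"
        unfolding bspec[OF elim(1) uH] bspec[OF elim(1) wH] bspec[OF elim(1) dH] bspec[OF elim(1) cH]
          H10.functional_diff[OF elim(2) uH wH] dual_scaleR[OF elim(2) wH] L2_inner_scaleR_right
          L2_inner_diff_right[OF H1_L2[OF H10_H1[OF uH]] H1_L2[OF H10_H1[OF wH]] elim(3)]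
        by (simp add: algebra_simps)
    qed
  qed
next
  case False
  obtain g where g: "g \<in> Lp_time 1 T (L2 \<Omega>) (L2_norm \<Omega>)"
    and fe: "AE t in lebesgue_on {0<..<T}. \<forall>w\<in>L2 \<Omega>. f t w = L2_inner \<Omega> (g t) w"
    using f False by (auto simp: ZZ_def)
  have "AE t in lebesgue_on {0<..<T}. g t \<in> L2 \<Omega>"
    using g by (simp add: Lp_time_def bochner_measurable_def)
  with fe show ?thesis
  proof eventually_elim
    case (elim t)
    show ?case
    proof (intro allI impI)
      fix u w c assume u: "u \<in> L2_sigma \<Omega>" and w: "w \<in> Cc_inf_sigma \<Omega>"
      note uL = L2_sigma_L2[OF u] and wL = L2_sigma_L2[OF Cc_inf_sigma_L2_sigma[OF w]]
      show "f t (\<lambda>x. u x - w x) = f t u - f t w \<and> f t (\<lambda>x. c *\<^sub>R w x) = c * f t w"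
        unfolding bspec[OF elim(1) uL] bspec[OF elim(1) wL] bspec[OF elim(1) L2_diff[OF uL wL]] bspec[OF elim(1) L2_scaleR[OF wL]]
          L2_inner_diff_right[OF uL wL elim(2)] L2_inner_scaleR_right by simp
    qed
  qed
qed

lemma bounded_time_integrable:
  fixes T :: real
  assumes m: "k \<in> borel_measurable (lebesgue_on {0<..<T})" and b: "AE t in lebesgue_on {0<..<T}. \<bar>k t\<bar> \<le> (B :: real)"
  shows "integrable (lebesgue_on {0<..<T}) k"
proof (rule finite_measure.integrable_const_bound)
  show "finite_measure (lebesgue_on {0<..<T})" by (rule finite_measure_time)
  show "AE t in lebesgue_on {0<..<T}. norm (k t) \<le> B" using b by simp
qed (rule m)

lemma dissipation_integrable:
  assumes u: "u \<in> XX \<nu> T \<Omega>" and \<nu>: "0 \<le> \<nu>"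
  shows "integrable (lebesgue_on {0<..<T}) (\<lambda>t. \<nu> * (L2_norm \<Omega> (wgrad \<Omega> (u t)))\<^sup>2)"
proof (cases "0 < \<nu>")
  case False
  then show ?thesis using \<nu> by simp
next
  case True
  let ?M = "lebesgue_on {0<..<T}"
  have mI: "{0<..<T} \<in> sets lebesgue" by simp
  note ub = XX_bochner[OF u]
  have uH: "bochner_measurable T (H10_sigma \<Omega>) (H1_norm \<Omega>) u" and ui: "integrable ?M (\<lambda>t. (H1_norm \<Omega> (u t))\<^sup>2)"
    using u True by (simp_all add: XX_def Lp_time_def)
  obtain C where C: "0 \<le> C" "AE t in ?M. L2_norm \<Omega> (u t) \<le> C" using XX_bounded[OF u] by blast
  have "integrable ?M (\<lambda>t. L2_inner \<Omega> (u t) (u t))"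
  proof (rule bounded_time_integrable[where B="C\<^sup>2"])
    show "(\<lambda>t. L2_inner \<Omega> (u t) (u t)) \<in> borel_measurable ?M"
      by (rule inner_time_measurable[OF ub ub]) (use L2_sigma_L2 in blast)
    show "AE t in ?M. \<bar>L2_inner \<Omega> (u t) (u t)\<bar> \<le> C\<^sup>2"
      using C(2) by eventually_elim (simp add: L2_inner_self power_mono)
  qed
  with ui have i: "integrable ?M (\<lambda>t. \<nu> * ((H1_norm \<Omega> (u t))\<^sup>2 - L2_inner \<Omega> (u t) (u t)))" by simp
  have "AE t in ?M. \<nu> * ((H1_norm \<Omega> (u t))\<^sup>2 - L2_inner \<Omega> (u t) (u t)) = \<nu> * (L2_norm \<Omega> (wgrad \<Omega> (u t)))\<^sup>2"
    using bochner_measurable_AE[OF uH]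
    by eventually_elim (simp add: H1_norm_sq[OF H10_sigma_H1] L2_inner_self)
  from integrable_AE_cong_lebesgue_on[OF mI this] i show ?thesis by blast
qed

lemma grad_diff:
  assumes "u \<in> Cc_inf S" "w \<in> Cc_inf S"
  shows "grad (\<lambda>x. u x - w x) x = grad u x - grad w x"
  by (simp add: grad_def vec_eq_iff partial_deriv_diff[OF smooth_fun_differentiable[OF Cc_inf_smooth[OF assms(1)]]
        smooth_fun_differentiable[OF Cc_inf_smooth[OF assms(2)]]])

text \<open>Integration by parts shifts the derivatives of \<open>u\<close> onto the test field,
  which reduces the viscous term to pairings of \<open>u\<close> with smooth curves.\<close>

lemma wgrad_inner_grad:
  assumes u: "u \<in> H1 \<Omega>" and w: "w \<in> Cc_inf \<Omega>"
  shows "L2_inner \<Omega> (wgrad \<Omega> u) (grad w) = - (\<Sum>j\<in>UNIV. L2_inner \<Omega> (partial_deriv j (partial_deriv j w)) u)"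
proof -
  have "wgrad \<Omega> u x \<bullet> grad w x = (\<Sum>j\<in>UNIV. wpartial \<Omega> j u x \<bullet> partial_deriv j w x)" for x
    unfolding inner_vec_def wgrad_def grad_def by (subst sum.swap) simp
  then have "L2_inner \<Omega> (wgrad \<Omega> u) (grad w) = (\<Sum>j\<in>UNIV. L2_inner \<Omega> (wpartial \<Omega> j u) (partial_deriv j w))"
    unfolding L2_inner_def
    by (simp add: Bochner_Integration.integral_sum L2_inner_integrable H1_wpartial_L2[OF u] Cc_inf_L2[OF Cc_inf_partial[OF w]])
  also have "\<dots> = (\<Sum>j\<in>UNIV. - L2_inner \<Omega> (partial_deriv j (partial_deriv j w)) u)"
    using weak_partial_vector[OF Cc_inf_partial[OF w] u] by (simp add: L2_inner_commute[of \<Omega> "wpartial \<Omega> _ u"])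
  finally show ?thesis by (simp add: sum_negf)
qed

lemma viscous_integrable:
  assumes u: "u \<in> XX \<nu> T \<Omega>" and \<nu>: "0 < \<nu>" and \<phi>: "C1_curve T \<Omega> \<phi> \<phi>'"
  shows "integrable (lebesgue_on {0<..<T}) (\<lambda>t. L2_inner \<Omega> (wgrad \<Omega> (u t)) (grad (\<phi> t)))"
proof -
  let ?M = "lebesgue_on {0<..<T}"
  have mI: "{0<..<T} \<in> sets lebesgue" by simp
  note sc = C1_curve_smooth_curve(1)[OF \<phi>]
  have i: "integrable ?M (\<lambda>t. - (\<Sum>j\<in>UNIV. L2_inner \<Omega> (partial_deriv j (partial_deriv j (\<phi> t))) (u t)))"
    by (intro Bochner_Integration.integrable_minus Bochner_Integration.integrable_sum
        smooth_curve_pairing_integrable[OF u] smooth_curve_partial sc)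
  have "AE t in ?M. - (\<Sum>j\<in>UNIV. L2_inner \<Omega> (partial_deriv j (partial_deriv j (\<phi> t))) (u t)) = L2_inner \<Omega> (wgrad \<Omega> (u t)) (grad (\<phi> t))"
    using XX_H10_sigma[OF u] AE_space
  proof eventually_elim
    case (elim t)
    have "u t \<in> H1 \<Omega>" using elim(1) \<nu> H10_sigma_H1 by blast
    moreover have "\<phi> t \<in> Cc_inf \<Omega>" by (rule smooth_curveD(1)[OF sc]) (use elim(2) in simp)
    ultimately show ?case by (rule wgrad_inner_grad[symmetric])
  qed
  from integrable_AE_cong_lebesgue_on[OF mI this] i show ?thesis by blast
qed

lemma convection_integrable:
  assumes u: "u \<in> XX \<nu> T \<Omega>" and \<phi>: "C1_curve T \<Omega> \<phi> \<phi>'"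
  shows "integrable (lebesgue_on {0<..<T}) (\<lambda>t. L2_inner \<Omega> (\<lambda>x. outer (u t x) (u t x)) (grad (\<phi> t)))"
proof -
  let ?M = "lebesgue_on {0<..<T}"
  note ub = XX_bochner[OF u]
  obtain C where C: "0 \<le> C" "AE t in ?M. L2_norm \<Omega> (u t) \<le> C" using XX_bounded[OF u] by blast
  note sc = C1_curve_smooth_curve(1)[OF \<phi>]
  have Cc: "\<phi> t \<in> Cc_inf \<Omega>" if "t \<in> {0..T}" for t by (rule smooth_curveD(1)[OF sc that])
  have W0: "0 \<le> W1inf_norm \<Omega> w" if "w \<in> Cc_inf \<Omega>" for w :: "real ^ 'n \<Rightarrow> real ^ 'n"
    by (rule W1inf_norm_nonneg[OF Cc_inf_W1inf[OF that]])
  define F where "F t x = L2_inner \<Omega> (\<lambda>y. grad (\<phi> t) y *v x y) x" for t x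
  have cont: "continuous_on {0..T} (\<lambda>t. W1inf_norm \<Omega> (\<phi> t))"
    by (rule continuous_on_timeI[OF smooth_curve_W1inf(2)[OF sc]])
  note gb = stretching_bound
  have "integrable ?M (\<lambda>t. F t (u t))"
  proof (rule Bochner_Integration.integrable_bound)
    show "integrable ?M (\<lambda>t. W1inf_norm \<Omega> (\<phi> t) * C\<^sup>2)"
      by (rule integrable_continuous_time) (intro continuous_intros cont)
    show "AE t in ?M. norm (F t (u t)) \<le> norm (W1inf_norm \<Omega> (\<phi> t) * C\<^sup>2)"
      using bochner_measurable_AE[OF ub] C(2) AE_space
    proof eventually_elim
      case (elim t)
      have c: "\<phi> t \<in> Cc_inf \<Omega>" using elim(3) by (intro Cc) simp
      have "\<bar>F t (u t)\<bar> \<le> W1inf_norm \<Omega> (\<phi> t) * (L2_norm \<Omega> (u t) * L2_norm \<Omega> (u t))"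
        using gb[OF c L2_sigma_L2[OF elim(1)]] by (simp add: F_def power2_eq_square)
      also have "\<dots> \<le> W1inf_norm \<Omega> (\<phi> t) * (C * C)"
        by (intro mult_left_mono mult_mono elim(2) W0[OF c] C(1) L2_norm_nonneg)
      finally show ?case by (simp add: power2_eq_square)
    qed
    show "(\<lambda>t. F t (u t)) \<in> borel_measurable ?M"
    proof (rule bochner_measurable_compose[OF ub, where F=F])
      fix x assume "x \<in> L2_sigma \<Omega>"
      then have x: "x \<in> L2 \<Omega>" by (rule L2_sigma_L2)
      have "continuous_on {0..T} (\<lambda>t. F t x)"
      proof (rule continuous_on_timeI)
        fix t assume t: "t \<in> {0..T}"
        have "((\<lambda>\<tau>. F \<tau> x - F t x) \<longlongrightarrow> 0) (at t within {0..T})"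
        proof (rule Lim_null_comparison)
          show "\<forall>\<^sub>F \<tau> in at t within {0..T}. norm (F \<tau> x - F t x) \<le> W1inf_norm \<Omega> (\<lambda>x. \<phi> \<tau> x - \<phi> t x) * (L2_norm \<Omega> x)\<^sup>2"
            using eventually_in_time
          proof eventually_elim
            case (elim \<tau>)
            note c = Cc[OF elim] Cc[OF t]
            have "F \<tau> x - F t x = L2_inner \<Omega> (\<lambda>y. grad (\<phi> \<tau>) y *v x y - grad (\<phi> t) y *v x y) x"
              unfolding F_def by (rule L2_inner_diff_left[OF grad_mult_L2(1)[OF c(1) x] grad_mult_L2(1)[OF c(2) x] x, symmetric])
            also have "\<dots> = L2_inner \<Omega> (\<lambda>y. grad (\<lambda>x. \<phi> \<tau> x - \<phi> t x) y *v x y) x"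
              by (simp add: grad_diff[OF c] matrix_vector_mult_diff_rdistrib)
            finally show ?case using gb[OF Cc_inf_diff[OF c] x] by simp
          qed
          have "((\<lambda>\<tau>. W1inf_norm \<Omega> (\<lambda>x. \<phi> \<tau> x - \<phi> t x) * (L2_norm \<Omega> x)\<^sup>2) \<longlongrightarrow> 0 * (L2_norm \<Omega> x)\<^sup>2) (at t within {0..T})"
            by (intro tendsto_mult tendsto_const smooth_curve_W1inf(1)[OF sc t])
          then show "((\<lambda>\<tau>. W1inf_norm \<Omega> (\<lambda>x. \<phi> \<tau> x - \<phi> t x) * (L2_norm \<Omega> x)\<^sup>2) \<longlongrightarrow> 0) (at t within {0..T})"
            by simp
        qed
        then show "((\<lambda>t. F t x) \<longlongrightarrow> F t x) (at t within {0..T})" by (simp add: LIM_zero_iff)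
      qed
      then show "(\<lambda>t. F t x) \<in> borel_measurable ?M"
        by (rule borel_measurable_integrable[OF integrable_continuous_time])
    next
      show "AE t in ?M. \<forall>y :: nat \<Rightarrow> _. (\<forall>k. y k \<in> L2_sigma \<Omega>) \<longrightarrow>
          (\<lambda>k. L2_norm \<Omega> (\<lambda>x. y k x - u t x)) \<longlonglongrightarrow> 0 \<longrightarrow> (\<lambda>k. F t (y k)) \<longlonglongrightarrow> F t (u t)"
        using bochner_measurable_AE[OF ub] AE_space
      proof eventually_elim
        case (elim t)
        have c: "\<phi> t \<in> Cc_inf \<Omega>" using elim(2) by (intro Cc) simp
        note uL = L2_sigma_L2[OF elim(1)]
        show ?case
        proof (intro allI impI)
          fix y :: "nat \<Rightarrow> _" assume y: "\<forall>k. y k \<in> L2_sigma \<Omega>" "(\<lambda>k. L2_norm \<Omega> (\<lambda>x. y k x - u t x)) \<longlonglongrightarrow> 0"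
          have yL: "y k \<in> L2 \<Omega>" for k using y(1) L2_sigma_L2 by blast
          show "(\<lambda>k. F t (y k)) \<longlonglongrightarrow> F t (u t)"
            unfolding F_def
          proof (rule L2_inner_tendsto[OF always_eventually grad_mult_L2(1)[OF c uL] _ always_eventually uL y(2)])
            show "\<forall>k. y k \<in> L2 \<Omega>" using yL by blast
            show "\<forall>k. (\<lambda>x. grad (\<phi> t) x *v y k x) \<in> L2 \<Omega>" using grad_mult_L2(1)[OF c yL] by blast
            show "(\<lambda>k. L2_norm \<Omega> (\<lambda>x. grad (\<phi> t) x *v y k x - grad (\<phi> t) x *v u t x)) \<longlonglongrightarrow> 0"
            proof (rule Lim_null_comparison[OF always_eventually], rule allI)
              fix k
              show "norm (L2_norm \<Omega> (\<lambda>x. grad (\<phi> t) x *v y k x - grad (\<phi> t) x *v u t x)) \<le> W1inf_norm \<Omega> (\<phi> t) * L2_norm \<Omega> (\<lambda>x. y k x - u t x)"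
                using grad_mult_norm[OF c L2_diff[OF yL uL], of k] by (simp add: matrix_vector_mult_diff_distrib)
              show "(\<lambda>k. W1inf_norm \<Omega> (\<phi> t) * L2_norm \<Omega> (\<lambda>x. y k x - u t x)) \<longlonglongrightarrow> 0"
                using tendsto_mult[OF tendsto_const y(2), of "W1inf_norm \<Omega> (\<phi> t)"] by simp
            qed
          qed
        qed
      qed
    qed
  qed
  then show ?thesis by (simp add: F_def flux_outer)
qed

lemma flux_integrable:
  assumes u: "u \<in> XX \<nu> T \<Omega>" and \<nu>: "0 \<le> \<nu>" and \<phi>: "C1_curve T \<Omega> \<phi> \<phi>'"
  shows "integrable (lebesgue_on {0<..<T}) (\<lambda>t. flux \<nu> (u t) (\<phi> t))"
  unfolding flux_def
proof (rule Bochner_Integration.integrable_diff[OF convection_integrable[OF u \<phi>]])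
  show "integrable (lebesgue_on {0<..<T}) (\<lambda>t. \<nu> * L2_inner \<Omega> (wgrad \<Omega> (u t)) (grad (\<phi> t)))"
    using viscous_integrable[OF u _ \<phi>] \<nu> by (cases "0 < \<nu>") auto
qed

end

context bounded_open begin

section \<open>Solutions with vanishing defect\<close>

definition energy_rate ::
  "real \<Rightarrow> (real \<Rightarrow> (real ^ 'n \<Rightarrow> real ^ 'n) \<Rightarrow> real) \<Rightarrow> (real \<Rightarrow> real ^ 'n \<Rightarrow> real ^ 'n) \<Rightarrow> real \<Rightarrow> real" where
  "energy_rate \<nu> f u \<tau> = \<nu> * (L2_norm \<Omega> (wgrad \<Omega> (u \<tau>)))\<^sup>2 - f \<tau> (u \<tau>)"

text \<open>The negative of the integrand of the weak formulation, tested with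
  \<open>\<phi>\<close>, whose time derivative is \<open>\<phi>'\<close>.\<close>

definition weak_residual ::
  "real \<Rightarrow> (real \<Rightarrow> (real ^ 'n \<Rightarrow> real ^ 'n) \<Rightarrow> real) \<Rightarrow> (real \<Rightarrow> real ^ 'n \<Rightarrow> real ^ 'n) \<Rightarrow>
     (real \<Rightarrow> real ^ 'n \<Rightarrow> real ^ 'n) \<Rightarrow> (real \<Rightarrow> real ^ 'n \<Rightarrow> real ^ 'n) \<Rightarrow> real \<Rightarrow> real" where
  "weak_residual \<nu> f u \<phi> \<phi>' \<tau> = flux \<nu> (u \<tau>) (\<phi> \<tau>) + L2_inner \<Omega> (\<phi>' \<tau>) (u \<tau>) + f \<tau> (\<phi> \<tau>)"

text \<open>The left-hand side is the integrand of the relative energy inequality for vanishing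
  defect. For any weight \<open>K\<close> it is affine in \<open>\<phi>\<close>, except for the last
  term, whose time integral is the change of the kinetic energy of \<open>\<phi>\<close>.\<close>

lemma energy_integrand_AE:
  assumes T: "0 < T" and \<nu>: "0 \<le> \<nu>" and f: "f \<in> ZZ \<nu> T \<Omega>" and v: "v \<in> XX \<nu> T \<Omega>" and \<phi>: "C1_curve T \<Omega> \<phi> \<phi>'"
  shows "AE \<tau> in lebesgue_on {0<..<T}.
     rel_form \<nu> \<Omega> K (v \<tau>) (\<phi> \<tau>) + system_op \<nu> T \<Omega> f \<phi> \<tau> (\<lambda>x. v \<tau> x - \<phi> \<tau> x)
       - enn2real (K (\<phi> \<tau>)) * rel_energy \<Omega> (v \<tau>) (\<phi> \<tau>)
     = energy_rate \<nu> f v \<tau> + weak_residual \<nu> f v \<phi> \<phi>' \<tau> - L2_inner \<Omega> (\<phi>' \<tau>) (\<phi> \<tau>)"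
proof -
  let ?M = "lebesgue_on {0<..<T}"
  note vb = XX_bochner[OF v]
  show ?thesis
    using bochner_measurable_AE[OF vb] XX_H10_sigma[OF v] C1_curve_dt(1)[OF \<phi> T vb] C1_curve_dt(1)[OF \<phi> T XX_bochner[OF C1_curve_XX[OF \<phi>]]]
      C1_curve_dt(2)[OF \<phi> T vb] force_linear[OF f] AE_space
  proof eventually_elim
    case (elim \<tau>)
    have t: "\<tau> \<in> {0..T}" using elim(7) by simp
    have w: "\<phi> \<tau> \<in> Cc_inf_sigma \<Omega>" by (rule C1_curveD(1)[OF \<phi> t])
    have H1: "v \<tau> \<in> H1 \<Omega>" if "0 < \<nu>" using elim(2) that H10_sigma_H1 by blast
    have fd: "f \<tau> (\<lambda>x. v \<tau> x - \<phi> \<tau> x) = f \<tau> (v \<tau>) - f \<tau> (\<phi> \<tau>)"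
      using elim(6)[rule_format, OF elim(1) _ w] elim(2) by blast
    have dd: "dt T \<Omega> \<phi> \<tau> (\<lambda>x. v \<tau> x - \<phi> \<tau> x) = L2_inner \<Omega> (\<phi>' \<tau>) (v \<tau>) - L2_inner \<Omega> (\<phi>' \<tau>) (\<phi> \<tau>)"
      unfolding L2_sigma.functional_diff[OF elim(5,1) Cc_inf_sigma_L2_sigma[OF w]] elim(3,4) ..
    show ?case
      using integrand_identity[OF \<nu> elim(1) H1 w, of K]
      unfolding system_op_def fd dd energy_rate_def weak_residual_def by linarith
  qed
qed

lemma energy_rate_integrable:
  assumes "f \<in> ZZ \<nu> T \<Omega>" "v \<in> XX \<nu> T \<Omega>" "0 \<le> \<nu>"
  shows "integrable (lebesgue_on {0<..<T}) (energy_rate \<nu> f v)"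
  unfolding energy_rate_def[abs_def]
  by (rule Bochner_Integration.integrable_diff[OF dissipation_integrable[OF assms(2,3)] force_integrable[OF assms(1,2)]])

lemma weak_residual_integrable:
  assumes "f \<in> ZZ \<nu> T \<Omega>" "v \<in> XX \<nu> T \<Omega>" "0 \<le> \<nu>" and \<phi>: "C1_curve T \<Omega> \<phi> \<phi>'"
  shows "integrable (lebesgue_on {0<..<T}) (weak_residual \<nu> f v \<phi> \<phi>')"
  unfolding weak_residual_def[abs_def]
  by (intro Bochner_Integration.integrable_add flux_integrable[OF assms(2,3) \<phi>] smooth_curve_pairing_integrable[OF assms(2) C1_curve_smooth_curve(2)[OF \<phi>]]
      force_integrable[OF assms(1) C1_curve_XX[OF \<phi>]])

lemma weak_residual_scaleR:
  assumes f: "f \<in> ZZ \<nu> T \<Omega>" and \<phi>: "C1_curve T \<Omega> \<phi> \<phi>'"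
  shows "AE \<tau> in lebesgue_on {0<..<T}.
    weak_residual \<nu> f v (\<lambda>\<tau> x. c *\<^sub>R \<phi> \<tau> x) (\<lambda>\<tau> x. c *\<^sub>R \<phi>' \<tau> x) \<tau> = c * weak_residual \<nu> f v \<phi> \<phi>' \<tau>"
  using force_linear[OF f] AE_space
proof eventually_elim
  case (elim \<tau>)
  have t: "\<tau> \<in> {0..T}" using elim(2) by simp
  have w: "\<phi> \<tau> \<in> Cc_inf_sigma \<Omega>" by (rule C1_curveD(1)[OF \<phi> t])
  have "f \<tau> (\<lambda>x. c *\<^sub>R \<phi> \<tau> x) = c * f \<tau> (\<phi> \<tau>)"
    using elim(1)[rule_format, OF Cc_inf_sigma_L2_sigma[OF w] Cc_inf_sigma_H10_sigma[OF w] w] by blast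
  then show ?case
    by (simp add: weak_residual_def flux_scaleR[OF Cc_inf_sigma_Cc_inf[OF w]] distrib_left)
qed

text \<open>The one-sided limits of \<open>\<xi>\<close> inside the interval from \<open>s\<close>
  to \<open>t\<close> vanish together with \<open>\<xi>\<close>, so that no trace of the defect and
  of the weight is left.\<close>

lemma zero_defect_inequality:
  assumes T: "0 < T" and \<nu>: "0 \<le> \<nu>" and f: "f \<in> ZZ \<nu> T \<Omega>"
    and sol: "energy_variational_solution \<nu> T \<Omega> v0 f v \<xi>"
    and st: "0 < s" "s < t" "t < T" and \<xi>: "AE \<tau> in lebesgue_on {s<..<t}. \<xi> \<tau> = 0"
  obtains vp vm where "\<And>r. r \<in> {0<..<T} \<Longrightarrow> weak_right_lim T \<Omega> v r (vp r)" "\<And>r. r \<in> {0<..<T} \<Longrightarrow> weak_left_lim T \<Omega> v r (vm r)"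
    "\<And>\<phi> \<phi>' q r. C1_curve T \<Omega> \<phi> \<phi>' \<Longrightarrow> s < q \<Longrightarrow> q \<le> r \<Longrightarrow> r < t \<Longrightarrow>
       rel_energy \<Omega> (vp r) (\<phi> r) + (LINT \<tau>|lebesgue_on {q..r}. energy_rate \<nu> f v \<tau>)
         + (LINT \<tau>|lebesgue_on {q..r}. weak_residual \<nu> f v \<phi> \<phi>' \<tau>) - (1 / 2 * (L2_norm \<Omega> (\<phi> r))\<^sup>2 - 1 / 2 * (L2_norm \<Omega> (\<phi> q))\<^sup>2)
       \<le> rel_energy \<Omega> (vm q) (\<phi> q)"
proof -
  let ?K = "smooth_weight \<Omega>"
  have v: "v \<in> XX \<nu> T \<Omega>" using sol unfolding energy_variational_solution_def by (rule conjunct1)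
  obtain vp vm \<xi>p \<xi>m where lims: "\<forall>t\<in>{0..T}. weak_right_lim T \<Omega> v t (vp t) \<and> weak_left_lim T \<Omega> v t (vm t) \<and>
                    right_lim T \<xi> t (\<xi>p t) \<and> left_lim T \<xi> t (\<xi>m t)"
    and all_K: "\<forall>K. admissible \<nu> T \<Omega> K \<longrightarrow>
          (\<forall>vt \<in> YY \<nu> T \<Omega> \<inter> DK \<nu> T \<Omega> K. L2_sigma_continuous T \<Omega> vt \<longrightarrow>
            (\<forall>s t. 0 \<le> s \<and> s \<le> t \<and> t \<le> T \<longrightarrow>
               rel_energy \<Omega> (vp t) (vt t) + \<xi>p t
               + (LINT \<tau>|lebesgue_on {s..t}.
                    rel_form \<nu> \<Omega> K (v \<tau>) (vt \<tau>)
                    + system_op \<nu> T \<Omega> f vt \<tau> (\<lambda>x. v \<tau> x - vt \<tau> x)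
                    - enn2real (K (vt \<tau>)) * (rel_energy \<Omega> (v \<tau>) (vt \<tau>) + \<xi> \<tau>))
               \<le> rel_energy \<Omega> (vm s) (vt s) + \<xi>m s))"
    using sol unfolding energy_variational_solution_def by (elim exE conjE)
  have mst: "{s<..<t} \<in> sets lebesgue" and mT: "{0<..<T} \<in> sets lebesgue" by simp_all
  obtain Z where Z: "Z \<in> null_sets lebesgue" "\<And>\<tau>. \<tau> \<notin> Z \<Longrightarrow> \<tau> \<in> {s<..<t} \<longrightarrow> \<xi> \<tau> = 0"
    by (rule AE_lebesgueE[OF \<xi>[unfolded AE_lebesgue_on_iff[OF mst]]]) (rule that)
  have \<xi>0: "\<xi>p r = 0" "\<xi>m r = 0" if r: "r \<in> {s<..<t}" for r
  proof -
    have r': "r \<in> {0..T}" using r st by simp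
    have lim: "right_lim T \<xi> r (\<xi>p r)" "left_lim T \<xi> r (\<xi>m r)" using bspec[OF lims r'] by blast+
    have "\<bar>\<xi>p r - 0\<bar> \<le> 0"
      by (rule right_lim_bound[OF lim(1) _ _ Z(1), where b=t]) (use r st Z(2) in auto)
    then show "\<xi>p r = 0" by simp
    have "\<bar>\<xi>m r - 0\<bar> \<le> 0"
      by (rule left_lim_bound[OF lim(2) _ _ Z(1), where a=s]) (use r st Z(2) in auto)
    then show "\<xi>m r = 0" by simp
  qed
  show ?thesis
  proof (rule that)
    show "weak_right_lim T \<Omega> v r (vp r)" "weak_left_lim T \<Omega> v r (vm r)" if "r \<in> {0<..<T}" for r
      using bspec[OF lims, of r] that by simp_all
    fix \<phi> \<phi>' and q r :: real
    assume \<phi>: "C1_curve T \<Omega> \<phi> \<phi>'" and qr: "s < q" "q \<le> r" "r < t"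
    let ?G = "\<lambda>\<tau>. rel_form \<nu> \<Omega> ?K (v \<tau>) (\<phi> \<tau>) + system_op \<nu> T \<Omega> f \<phi> \<tau> (\<lambda>x. v \<tau> x - \<phi> \<tau> x)
      - enn2real (?K (\<phi> \<tau>)) * (rel_energy \<Omega> (v \<tau>) (\<phi> \<tau>) + \<xi> \<tau>)"
    let ?H = "\<lambda>\<tau>. energy_rate \<nu> f v \<tau> + weak_residual \<nu> f v \<phi> \<phi>' \<tau> - L2_inner \<Omega> (\<phi>' \<tau>) (\<phi> \<tau>)"
    have mem: "\<phi> \<in> YY \<nu> T \<Omega> \<inter> DK \<nu> T \<Omega> ?K"
      by (rule IntI[OF C1_curve_YY[OF \<phi> T] C1_curve_DK[OF \<phi>]])
    have "0 \<le> q \<and> q \<le> r \<and> r \<le> T" using qr st by simp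
    note ineq = all_K[rule_format, OF smooth_weight_admissible[OF \<nu>] mem C1_curve_L2_sigma_continuous[OF \<phi>] this]
    have mqr: "{q..r} \<in> sets lebesgue" by simp
    have sub: "{q..r} \<subseteq> {0<..<T}" "{q..r} \<subseteq> {s<..<t}" using qr st by auto
    have "AE \<tau> in lebesgue_on {q..r}. ?G \<tau> = ?H \<tau>"
      using AE_lebesgue_on_subset[OF energy_integrand_AE[OF T \<nu> f v \<phi>, of ?K] sub(1) mT mqr]
        AE_lebesgue_on_subset[OF \<xi> sub(2) mst mqr]
      by eventually_elim simp
    note int_eq = integral_AE_cong_lebesgue_on[OF mqr this]
    note res = integrable_lebesgue_on_subset[OF _ mT mqr sub(1)]
    have i: "integrable (lebesgue_on {q..r}) (energy_rate \<nu> f v)" "integrable (lebesgue_on {q..r}) (weak_residual \<nu> f v \<phi> \<phi>')"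
      "integrable (lebesgue_on {q..r}) (\<lambda>\<tau>. L2_inner \<Omega> (\<phi>' \<tau>) (\<phi> \<tau>))"
      by (rule res[OF energy_rate_integrable[OF f v \<nu>]], rule res[OF weak_residual_integrable[OF f v \<nu> \<phi>]],
          rule res[OF smooth_curve_pairing_integrable[OF C1_curve_XX[OF \<phi>, of \<nu>] C1_curve_smooth_curve(2)[OF \<phi>]]])
    have "(LINT \<tau>|lebesgue_on {q..r}. ?H \<tau>) = (LINT \<tau>|lebesgue_on {q..r}. energy_rate \<nu> f v \<tau>)
        + (LINT \<tau>|lebesgue_on {q..r}. weak_residual \<nu> f v \<phi> \<phi>' \<tau>) - (LINT \<tau>|lebesgue_on {q..r}. L2_inner \<Omega> (\<phi>' \<tau>) (\<phi> \<tau>))"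
      unfolding Bochner_Integration.integral_diff[OF Bochner_Integration.integrable_add[OF i(1,2)] i(3)]
        Bochner_Integration.integral_add[OF i(1,2)] ..
    moreover have "(LINT \<tau>|lebesgue_on {q..r}. L2_inner \<Omega> (\<phi>' \<tau>) (\<phi> \<tau>)) = 1 / 2 * (L2_norm \<Omega> (\<phi> r))\<^sup>2 - 1 / 2 * (L2_norm \<Omega> (\<phi> q))\<^sup>2"
      by (rule C1_curve_energy_balance[OF \<phi>]) (use qr st in auto)
    moreover have "\<xi>p r = 0" "\<xi>m q = 0" using qr by (auto intro!: \<xi>0)
    ultimately show "rel_energy \<Omega> (vp r) (\<phi> r) + (LINT \<tau>|lebesgue_on {q..r}. energy_rate \<nu> f v \<tau>)
         + (LINT \<tau>|lebesgue_on {q..r}. weak_residual \<nu> f v \<phi> \<phi>' \<tau>) - (1 / 2 * (L2_norm \<Omega> (\<phi> r))\<^sup>2 - 1 / 2 * (L2_norm \<Omega> (\<phi> q))\<^sup>2)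
       \<le> rel_energy \<Omega> (vm q) (\<phi> q)"
      using ineq[unfolded int_eq] by linarith
  qed
qed

lemma C1_curve_zero: "C1_curve T \<Omega> (\<lambda>\<tau> x. 0) (\<lambda>\<tau> x. 0)"
  unfolding C1_curve_def by (auto simp: iter_partial_zero intro!: uniform_limit_const)

text \<open>Test with the zero curve. The energies of the one-sided limits \<open>vp r\<close> and
  \<open>vm q\<close> are those of \<open>v r\<close> and \<open>v q\<close> for almost all
  \<open>q\<close> and \<open>r\<close>.\<close>

lemma zero_defect_energy_inequality:
  assumes T: "0 < T" and \<nu>: "0 \<le> \<nu>" and f: "f \<in> ZZ \<nu> T \<Omega>"
    and sol: "energy_variational_solution \<nu> T \<Omega> v0 f v \<xi>"
    and st: "0 < s" "s < t" "t < T" and \<xi>: "AE \<tau> in lebesgue_on {s<..<t}. \<xi> \<tau> = 0"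
  obtains N where "N \<in> null_sets lebesgue"
    "\<And>q r. q \<in> {s<..<t} - N \<Longrightarrow> r \<in> {s<..<t} - N \<Longrightarrow> q < r \<Longrightarrow>
      1 / 2 * (L2_norm \<Omega> (v r))\<^sup>2 - 1 / 2 * (L2_norm \<Omega> (v q))\<^sup>2 + (LINT \<tau>|lebesgue_on {q..r}. energy_rate \<nu> f v \<tau>) \<le> 0"
proof -
  have v: "v \<in> XX \<nu> T \<Omega>" using sol unfolding energy_variational_solution_def by (rule conjunct1)
  obtain vp vm where vp: "\<And>r. r \<in> {0<..<T} \<Longrightarrow> weak_right_lim T \<Omega> v r (vp r)" and vm: "\<And>r. r \<in> {0<..<T} \<Longrightarrow> weak_left_lim T \<Omega> v r (vm r)"
    and ineq: "\<And>\<phi> \<phi>' q r. C1_curve T \<Omega> \<phi> \<phi>' \<Longrightarrow> s < q \<Longrightarrow> q \<le> r \<Longrightarrow> r < t \<Longrightarrow>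
       rel_energy \<Omega> (vp r) (\<phi> r) + (LINT \<tau>|lebesgue_on {q..r}. energy_rate \<nu> f v \<tau>)
         + (LINT \<tau>|lebesgue_on {q..r}. weak_residual \<nu> f v \<phi> \<phi>' \<tau>) - (1 / 2 * (L2_norm \<Omega> (\<phi> r))\<^sup>2 - 1 / 2 * (L2_norm \<Omega> (\<phi> q))\<^sup>2)
       \<le> rel_energy \<Omega> (vm q) (\<phi> q)"
    by (rule zero_defect_inequality[OF T \<nu> f sol st \<xi>]) (rule that)
  have mT: "{0<..<T} \<in> sets lebesgue" by simp
  have ae: "AE t in lebesgue_on {0<..<T}. L2_norm \<Omega> (vp t) = L2_norm \<Omega> (v t) \<and> L2_norm \<Omega> (vm t) = L2_norm \<Omega> (v t)"
    by (rule weak_limits_AE[OF XX_bochner[OF v] vp vm])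
  obtain N where N: "N \<in> null_sets lebesgue"
    "\<And>q. q \<notin> N \<Longrightarrow> q \<in> {0<..<T} \<longrightarrow> L2_norm \<Omega> (vp q) = L2_norm \<Omega> (v q) \<and> L2_norm \<Omega> (vm q) = L2_norm \<Omega> (v q)"
    by (rule AE_lebesgueE[OF ae[unfolded AE_lebesgue_on_iff[OF mT]]]) (rule that)
  show ?thesis
  proof (rule that[OF N(1)])
    fix q r assume q: "q \<in> {s<..<t} - N" and r: "r \<in> {s<..<t} - N" and qr: "q < r"
    have n: "L2_norm \<Omega> (vp r) = L2_norm \<Omega> (v r)" "L2_norm \<Omega> (vm q) = L2_norm \<Omega> (v q)"
      using N(2)[of q] N(2)[of r] q r st by auto
    have mqr: "{q..r} \<in> sets lebesgue" by simp
    have sub: "{q..r} \<subseteq> {0<..<T}" using q r st by auto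
    \<comment> \<open>Homogeneity with the factor 0 is what yields f \<tau> 0 = 0.\<close>
    have "AE \<tau> in lebesgue_on {q..r}. weak_residual \<nu> f v (\<lambda>\<tau> x. 0) (\<lambda>\<tau> x. 0) \<tau> = 0"
      using AE_lebesgue_on_subset[OF weak_residual_scaleR[OF f C1_curve_zero, of v 0] sub mT mqr]
      by eventually_elim simp
    from integral_AE_cong_lebesgue_on[OF mqr this]
    have z: "(LINT \<tau>|lebesgue_on {q..r}. weak_residual \<nu> f v (\<lambda>\<tau> x. 0) (\<lambda>\<tau> x. 0) \<tau>) = 0" by simp
    have qrs: "s < q" "q \<le> r" "r < t" using q r qr by auto
    from ineq[OF C1_curve_zero qrs]
    show "1 / 2 * (L2_norm \<Omega> (v r))\<^sup>2 - 1 / 2 * (L2_norm \<Omega> (v q))\<^sup>2 + (LINT \<tau>|lebesgue_on {q..r}. energy_rate \<nu> f v \<tau>) \<le> 0"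
      unfolding z by (simp add: rel_energy_def n)
  qed
qed

lemma affine_nonpos_slope_zero:
  fixes E L :: real
  assumes "\<And>\<alpha>. E + \<alpha> * L \<le> 0"
  shows "L = 0"
proof (rule ccontr)
  assume "L \<noteq> 0"
  then have "E + ((1 - E) / L) * L = 1" by simp
  with assms[of "(1 - E) / L"] show False by simp
qed

text \<open>Before and after its time support a test curve \<open>\<phi>\<close> is zero, so for all
  its multiples \<open>\<alpha> *\<^sub>R \<phi>\<close> the inequality reads
  \<open>E + \<alpha> L \<le> 0\<close>, where \<open>L\<close> is the time integral of the residual
  of \<open>\<phi>\<close> and \<open>E\<close> does not depend on \<open>\<alpha>\<close>. This
  forces \<open>L = 0\<close>.\<close>

lemma zero_defect_weak_solution:
  assumes T: "0 < T" and \<nu>: "0 \<le> \<nu>" and f: "f \<in> ZZ \<nu> T \<Omega>"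
    and sol: "energy_variational_solution \<nu> T \<Omega> v0 f v \<xi>"
    and st: "0 < s" "s < t" "t < T" and \<xi>: "AE \<tau> in lebesgue_on {s<..<t}. \<xi> \<tau> = 0"
    and vt: "vt \<in> C1c_Cc_inf_sigma s t \<Omega>"
  shows "(LINT \<tau>|lebesgue_on {s..t}.
               \<nu> * L2_inner \<Omega> (wgrad \<Omega> (v \<tau>)) (grad (vt \<tau>))
               - L2_inner \<Omega> (\<lambda>x. outer (v \<tau> x) (v \<tau> x)) (grad (vt \<tau>))
               - L2_inner \<Omega> (v \<tau>) (time_deriv vt \<tau>)
               - f \<tau> (vt \<tau>)) = 0"
proof -
  have v: "v \<in> XX \<nu> T \<Omega>" using sol unfolding energy_variational_solution_def by (rule conjunct1)
  have vt1: "vt \<in> C1_Cc_inf_sigma {s<..<t} \<Omega>" using vt by (simp add: C1c_Cc_inf_sigma_def)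
  obtain a0 b0 where ab0: "s < a0" "b0 < t" "\<And>\<tau>. \<tau> \<in> {s<..<t} - {a0..b0} \<Longrightarrow> vt \<tau> = (\<lambda>x. 0)"
    using vt unfolding C1c_Cc_inf_sigma_def by blast
  \<comment> \<open>Enlarging the support such that it contains the midpoint ensures that it is nonempty.\<close>
  define a b where "a = min a0 ((s + t) / 2)" and "b = max b0 ((s + t) / 2)"
  have ab: "s < a" "a \<le> b" "b < t" using ab0(1,2) st(2) by (auto simp: a_def b_def)
  have off0: "vt \<tau> = (\<lambda>x. 0)" if "\<tau> \<in> {s<..<t} - {a..b}" for \<tau>
    by (rule ab0(3)) (use that in \<open>auto simp: a_def b_def\<close>)
  define \<phi> where "\<phi> = (\<lambda>\<tau>. if \<tau> \<in> {s<..<t} then vt \<tau> else (\<lambda>x. 0))"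
  obtain \<phi>' where \<phi>: "C1_curve T \<Omega> \<phi> \<phi>'"
    and td: "\<And>\<tau>. \<tau> \<in> {s<..<t} \<Longrightarrow> time_deriv vt \<tau> = \<phi>' \<tau>"
    and off': "\<And>\<tau>. \<tau> \<notin> {a..b} \<Longrightarrow> \<phi>' \<tau> = (\<lambda>x. 0)"
    by (rule C1_curve_extend[OF vt1 st(1,3) ab(1,3)], erule off0) (rule that[unfolded \<phi>_def])
  have off: "\<phi> \<tau> = (\<lambda>x. 0)" if "\<tau> \<notin> {a..b}" for \<tau>
    using off0[of \<tau>] that by (simp add: \<phi>_def)
  \<comment> \<open>Here the test curve has the value zero already, and hence no kinetic energy.\<close>
  define q r where "q = (s + a) / 2" and "r = (b + t) / 2"
  have qr: "s < q" "q < a" "b < r" "r < t" "q \<le> r" using ab by (simp_all add: q_def r_def)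
  have "q \<notin> {a..b}" "r \<notin> {a..b}" using qr by auto
  note \<phi>0 = off[OF this(1)] off[OF this(2)]
  obtain vp vm
    where ineq: "\<And>\<phi> \<phi>' q r. C1_curve T \<Omega> \<phi> \<phi>' \<Longrightarrow> s < q \<Longrightarrow> q \<le> r \<Longrightarrow> r < t \<Longrightarrow>
       rel_energy \<Omega> (vp r) (\<phi> r) + (LINT \<tau>|lebesgue_on {q..r}. energy_rate \<nu> f v \<tau>)
         + (LINT \<tau>|lebesgue_on {q..r}. weak_residual \<nu> f v \<phi> \<phi>' \<tau>) - (1 / 2 * (L2_norm \<Omega> (\<phi> r))\<^sup>2 - 1 / 2 * (L2_norm \<Omega> (\<phi> q))\<^sup>2)
       \<le> rel_energy \<Omega> (vm q) (\<phi> q)"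
    by (rule zero_defect_inequality[OF T \<nu> f sol st \<xi>]) (rule that)
  have mT: "{0<..<T} \<in> sets lebesgue" and mst: "{s<..<t} \<in> sets lebesgue" and mqr: "{q..r} \<in> sets lebesgue" by simp_all
  have sub: "{q..r} \<subseteq> {0<..<T}" "{q..r} \<subseteq> {s<..<t}" "{s<..<t} \<subseteq> {0<..<T}" using qr st by auto
  let ?w = "weak_residual \<nu> f v \<phi> \<phi>'"
  define E where "E = rel_energy \<Omega> (vp r) (\<lambda>x. 0) + (LINT \<tau>|lebesgue_on {q..r}. energy_rate \<nu> f v \<tau>) - rel_energy \<Omega> (vm q) (\<lambda>x. 0)"
  have L: "(LINT \<tau>|lebesgue_on {q..r}. ?w \<tau>) = 0"
  proof (rule affine_nonpos_slope_zero)
    fix \<alpha> :: real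
    have "(LINT \<tau>|lebesgue_on {q..r}. weak_residual \<nu> f v (\<lambda>\<tau> x. \<alpha> *\<^sub>R \<phi> \<tau> x) (\<lambda>\<tau> x. \<alpha> *\<^sub>R \<phi>' \<tau> x) \<tau>)
        = (LINT \<tau>|lebesgue_on {q..r}. \<alpha> * ?w \<tau>)"
      by (rule integral_AE_cong_lebesgue_on[OF mqr AE_lebesgue_on_subset[OF weak_residual_scaleR[OF f \<phi>] sub(1) mT mqr]])
    also have "\<dots> = \<alpha> * (LINT \<tau>|lebesgue_on {q..r}. ?w \<tau>)" by simp
    finally show "E + \<alpha> * (LINT \<tau>|lebesgue_on {q..r}. ?w \<tau>) \<le> 0"
      using ineq[OF C1_curve_scaleR[OF \<phi>, of \<alpha>] qr(1,5,4)] by (simp add: \<phi>0 E_def)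
  qed
  have outside: "AE \<tau> in lebesgue_on {s<..<t}.
      \<nu> * L2_inner \<Omega> (wgrad \<Omega> (v \<tau>)) (grad (vt \<tau>)) - L2_inner \<Omega> (\<lambda>x. outer (v \<tau> x) (v \<tau> x)) (grad (vt \<tau>))
       - L2_inner \<Omega> (v \<tau>) (time_deriv vt \<tau>) - f \<tau> (vt \<tau>)
      = (if \<tau> \<in> {q..r} then - ?w \<tau> else 0)"
    using AE_lebesgue_on_subset[OF weak_residual_scaleR[OF f C1_curve_zero, of v 0] sub(3) mT mst] AE_space
  proof eventually_elim
    case (elim \<tau>)
    have \<tau>: "\<tau> \<in> {s<..<t}" using elim(2) by simp
    then have p: "vt \<tau> = \<phi> \<tau>" by (simp add: \<phi>_def)
    have eq: "\<nu> * L2_inner \<Omega> (wgrad \<Omega> (v \<tau>)) (grad (vt \<tau>)) - L2_inner \<Omega> (\<lambda>x. outer (v \<tau> x) (v \<tau> x)) (grad (vt \<tau>))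
       - L2_inner \<Omega> (v \<tau>) (time_deriv vt \<tau>) - f \<tau> (vt \<tau>) = - ?w \<tau>"
      unfolding p td[OF \<tau>] weak_residual_def flux_def L2_inner_commute[of \<Omega> "v \<tau>"] by simp
    have "?w \<tau> = 0" if "\<tau> \<notin> {q..r}"
    proof -
      have n: "\<tau> \<notin> {a..b}" using that qr by auto
      show ?thesis using elim(1) unfolding weak_residual_def off[OF n] off'[OF n] by simp
    qed
    then show ?case unfolding eq by simp
  qed
  have "(LINT \<tau>|lebesgue_on {s<..<t}. (if \<tau> \<in> {q..r} then - ?w \<tau> else 0)) = (LINT \<tau>|lebesgue_on {q..r}. (if \<tau> \<in> {q..r} then - ?w \<tau> else 0))"
    by (rule lebesgue_on_supp(2)[OF mst mqr sub(2)]) auto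
  also have "\<dots> = (LINT \<tau>|lebesgue_on {q..r}. - ?w \<tau>)"
    by (rule Bochner_Integration.integral_cong) simp_all
  also have "\<dots> = 0" using L by simp
  finally show ?thesis
    unfolding LINT_interior(1) integral_AE_cong_lebesgue_on[OF mst outside] .
qed

end

theorem proposition2p13:
  fixes \<Omega> :: "(real ^ 'n) set"
    and T \<nu> s t :: real
    and v0 :: "real ^ 'n \<Rightarrow> real ^ 'n"
    and f :: "real \<Rightarrow> (real ^ 'n \<Rightarrow> real ^ 'n) \<Rightarrow> real"
    and v :: "real \<Rightarrow> real ^ 'n \<Rightarrow> real ^ 'n"
    and \<xi> :: "real \<Rightarrow> real"
  assumes "CARD('n) \<ge> 2"
    and "bounded_lipschitz_domain \<Omega>"
    and "T > 0" and "\<nu> \<ge> 0"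
    and "v0 \<in> L2_sigma \<Omega>" and "f \<in> ZZ \<nu> T \<Omega>"
    and "energy_variational_solution \<nu> T \<Omega> v0 f v \<xi>"
    and "0 < s" and "s < t" and "t < T"
    and "AE \<tau> in lebesgue_on {s<..<t}. \<xi> \<tau> = 0"
  shows "(\<exists>N\<in>null_sets lebesgue. \<forall>q\<in>{s<..<t} - N. \<forall>r\<in>{s<..<t} - N. q < r \<longrightarrow>
            (1 / 2 * (L2_norm \<Omega> (v r))\<^sup>2 - 1 / 2 * (L2_norm \<Omega> (v q))\<^sup>2)
            + (LINT \<tau>|lebesgue_on {q..r}. \<nu> * (L2_norm \<Omega> (wgrad \<Omega> (v \<tau>)))\<^sup>2 - f \<tau> (v \<tau>)) \<le> 0) \<and>
         (\<forall>vt\<in>C1c_Cc_inf_sigma s t \<Omega>.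
            (LINT \<tau>|lebesgue_on {s..t}.
               \<nu> * L2_inner \<Omega> (wgrad \<Omega> (v \<tau>)) (grad (vt \<tau>))
               - L2_inner \<Omega> (\<lambda>x. outer (v \<tau> x) (v \<tau> x)) (grad (vt \<tau>))
               - L2_inner \<Omega> (v \<tau>) (time_deriv vt \<tau>)
               - f \<tau> (vt \<tau>)) = 0)"
proof -
  interpret bounded_open \<Omega>
    by unfold_locales (use assms(2) in \<open>simp_all add: bounded_lipschitz_domain_def\<close>)
  obtain N where N: "N \<in> null_sets lebesgue"
    "\<And>q r. q \<in> {s<..<t} - N \<Longrightarrow> r \<in> {s<..<t} - N \<Longrightarrow> q < r \<Longrightarrow>
      1 / 2 * (L2_norm \<Omega> (v r))\<^sup>2 - 1 / 2 * (L2_norm \<Omega> (v q))\<^sup>2 + (LINT \<tau>|lebesgue_on {q..r}. energy_rate \<nu> f v \<tau>) \<le> 0"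
    by (rule zero_defect_energy_inequality[OF assms(3,4,6-11)]) (rule that)
  show ?thesis
  proof (intro conjI ballI)
    show "\<exists>N\<in>null_sets lebesgue. \<forall>q\<in>{s<..<t} - N. \<forall>r\<in>{s<..<t} - N. q < r \<longrightarrow>
            (1 / 2 * (L2_norm \<Omega> (v r))\<^sup>2 - 1 / 2 * (L2_norm \<Omega> (v q))\<^sup>2)
            + (LINT \<tau>|lebesgue_on {q..r}. \<nu> * (L2_norm \<Omega> (wgrad \<Omega> (v \<tau>)))\<^sup>2 - f \<tau> (v \<tau>)) \<le> 0"
    proof (rule bexI[OF _ N(1)], intro ballI impI)
      fix q r assume "q \<in> {s<..<t} - N" "r \<in> {s<..<t} - N" "q < r"
      from N(2)[OF this]
      show "(1 / 2 * (L2_norm \<Omega> (v r))\<^sup>2 - 1 / 2 * (L2_norm \<Omega> (v q))\<^sup>2)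
            + (LINT \<tau>|lebesgue_on {q..r}. \<nu> * (L2_norm \<Omega> (wgrad \<Omega> (v \<tau>)))\<^sup>2 - f \<tau> (v \<tau>)) \<le> 0"
        unfolding energy_rate_def .
    qed
  qed (rule zero_defect_weak_solution[OF assms(3,4,6-11)])
qed

end
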